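(* Let $n\geq 1$. The singular locus of the Peterson variety $\mathrm{Pet}_n$ is $$\mathrm{Sing}(\mathrm{Pet}_n)=\coprod_{w_P}\mathcal{J}_{w_P,\mathrm{Pet}_n},$$ where the union is over all $w_P$ satisfying any of the following conditions (I)--(III), which are equivalent: (I) $w_PB$ is a singular point of $\mathrm{Pet}_n$; (II) $w_P$ is not one of the following permutations (in one-line notation): $n\ \ n-1\ \ n-2\ \cdots\ 3\ 2\ 1$ (the longest element $w_0\in S_n$); $1\ \ n\ \ n-1\ \cdots\ 3\ 2$; $n-1\ \ n-2\ \cdots\ 1\ \ n$. (III) $w_P$ contains at least one of the patterns $123$ or $2143$.
   Context: Work over $\mathbb{C}$. Let $B\subset GL_n$ be the group of invertible upper triangular matrices. Identify $\mathrm{Flags}(\mathbb{C}^n)\cong GL_n/B$: the coset $gB$ corresponds to the complete flag $F_\bullet$ with $F_i$ the span of the first $i$ columns of $g$. Let $N$ be the standard regular nilpotent $n\times n$ matrix (1's on the main superdiagonal, 0's elsewhere). The Peterson variety is the (reduced) closed subvariety $\mathrm{Pet}_n=\{F_\bullet\in \mathrm{Flags}(\mathbb{C}^n): N\cdot F_i\subset F_{i+1}\text{ for all } i\}$ (with $F_n=\mathbb{C}^n$). A permutation $w\in S_n$ is identified with the permutation matrix having 1 in row $w(j)$ and column $j$. For each composition $(i_1,\dots,i_k)$ of $n$ (positive parts, $i_1+\cdots+i_k=n$), let $W_P\cong S_{i_1}\times\cdots\times S_{i_k}$ be the corresponding parabolic (Young) subgroup of $S_n$ (permuting consecutive blocks),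 and let $w_P$ be its element of maximal Coxeter length; its permutation matrix is block diagonal with reverse identity blocks of sizes $i_1,\dots,i_k$. Let $U_P$ be the $(n-k)$-dimensional group of block diagonal matrices $B^{(1)}\oplus\cdots\oplus B^{(k)}$ where the block $B^{(j)}$ ranges over all $i_j\times i_j$ unipotent upper triangular matrices with equal entries along each superdiagonal. Define $\mathcal{J}_{w_P,\mathrm{Pet}_n}=U_P\cdot w_PB\subset GL_n/B$. (It is known that $\mathrm{Pet}_n=\coprod_{w_P}\mathcal{J}_{w_P,\mathrm{Pet}_n}$ and $\mathcal{J}_{w_P,\mathrm{Pet}_n}=\mathrm{Pet}_n\cap(Bw_PB/B)\cong\mathbb{C}^{n-k}$.) A permutation $w\in S_N$ contains the pattern $v\in S_m$ ($m\le N$) if there are indices $1\le\phi_1<\cdots<\phi_m\le N$ such that $w(\phi_1),\dots,w(\phi_m)$ are in the same relative order as $v(1),\dots,v(m)$. *)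

theory Defs
  imports
    Complex_Main
    "HOL-Library.Extended_Nat"
    "HOL-Library.Disjoint_Sets"
    "HOL-Library.Function_Algebras"
    "HOL-Combinatorics.Permutations"
    "Jordan_Normal_Form.VS_Connect"
begin

section \<open>Affine varieties: Zariski topology, tangent space, local dimension\<close>

text \<open>
  For a finite index set \<open>I\<close>, the affine space \<open>\<A>\<^sup>I\<close> consists of the functions that vanish outside \<open>I\<close>.
  As the field of complex numbers is infinite, polynomials are represented by polynomial functions.
\<close>

definition affine_space :: "'i set \<Rightarrow> ('i \<Rightarrow> complex) set" where
  "affine_space I = {p. \<forall>i. i \<notin> I \<longrightarrow> p i = 0}"

inductive_set poly_funs :: "'i set \<Rightarrow> (('i \<Rightarrow> complex) \<Rightarrow> complex) set" for I :: "'i set" where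
  const: "(\<lambda>p. c) \<in> poly_funs I"
| coord: "i \<in> I \<Longrightarrow> (\<lambda>p. p i) \<in> poly_funs I"
| add: "f \<in> poly_funs I \<Longrightarrow> g \<in> poly_funs I \<Longrightarrow> (\<lambda>p. f p + g p) \<in> poly_funs I"
| mult: "f \<in> poly_funs I \<Longrightarrow> g \<in> poly_funs I \<Longrightarrow> (\<lambda>p. f p * g p) \<in> poly_funs I"

definition zariski_closed :: "'i set \<Rightarrow> ('i \<Rightarrow> complex) set \<Rightarrow> bool" where
  "zariski_closed I Z \<longleftrightarrow>
     (\<exists>F \<subseteq> poly_funs I. Z = {p \<in> affine_space I. \<forall>f \<in> F. f p = 0})"

definition zariski_irreducible :: "'i set \<Rightarrow> ('i \<Rightarrow> complex) set \<Rightarrow> bool" where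
  "zariski_irreducible I Z \<longleftrightarrow> Z \<noteq> {} \<and>
     (\<forall>Z1 Z2. zariski_closed I Z1 \<longrightarrow> zariski_closed I Z2 \<longrightarrow> Z = Z1 \<union> Z2 \<longrightarrow> Z = Z1 \<or> Z = Z2)"

text \<open>
  The dimension of the local ring of \<open>Y\<close> at \<open>p\<close>, as the supremum of the lengths of chains of
  irreducible closed subsets of \<open>Y\<close> through \<open>p\<close> (these correspond to the primes of the local ring).
\<close>

definition local_dim :: "'i set \<Rightarrow> ('i \<Rightarrow> complex) set \<Rightarrow> ('i \<Rightarrow> complex) \<Rightarrow> enat" where
  "local_dim I Y p = Sup {enat k | k. \<exists>Z :: nat \<Rightarrow> ('i \<Rightarrow> complex) set.
     p \<in> Z 0 \<and> Z k \<subseteq> Y \<and>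
     (\<forall>j\<le>k. zariski_closed I (Z j) \<and> zariski_irreducible I (Z j)) \<and>
     (\<forall>j<k. Z j \<subset> Z (Suc j))}"

definition vanishing_ideal :: "'i set \<Rightarrow> ('i \<Rightarrow> complex) set \<Rightarrow> (('i \<Rightarrow> complex) \<Rightarrow> complex) set" where
  "vanishing_ideal I Y = {f \<in> poly_funs I. \<forall>p \<in> Y. f p = 0}"

text \<open>
  The Zariski tangent space of the reduced variety \<open>Y\<close> at \<open>p\<close>: the vectors killed by the differentials
  at \<open>p\<close> of all elements of the full vanishing ideal. The derivative in \<open>t\<close> is
  \<open>\<Sum>i\<in>I. (\<partial>f/\<partial>x\<^sub>i)(p) \<cdot> v i\<close>.
\<close>

definition tangent_space :: "'i set \<Rightarrow> ('i \<Rightarrow> complex) set \<Rightarrow> ('i \<Rightarrow> complex) \<Rightarrow> ('i \<Rightarrow> complex) set" where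
  "tangent_space I Y p = {v \<in> affine_space I. \<forall>f \<in> vanishing_ideal I Y.
     ((\<lambda>t::complex. f (\<lambda>i. p i + t * v i)) has_field_derivative 0) (at 0)}"

interpretation cfun: vector_space "\<lambda>(c::complex) (f :: 'i \<Rightarrow> complex) i. c * f i"
  by unfold_locales (auto simp: fun_eq_iff algebra_simps)

definition regular_point :: "'i set \<Rightarrow> ('i \<Rightarrow> complex) set \<Rightarrow> ('i \<Rightarrow> complex) \<Rightarrow> bool" where
  "regular_point I Y p \<longleftrightarrow> p \<in> Y \<and> enat (cfun.dim (tangent_space I Y p)) = local_dim I Y p"

section \<open>The flag variety \<open>GL\<^sub>n/B\<close>\<close>

definition GL :: "nat \<Rightarrow> complex mat set" where
  "GL n = {g \<in> carrier_mat n n. invertible_mat g}"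

definition borel_subgroup :: "nat \<Rightarrow> complex mat set" where
  "borel_subgroup n = {b \<in> GL n. upper_triangular b}"

definition coset :: "nat \<Rightarrow> complex mat \<Rightarrow> complex mat set" where
  "coset n g = (\<lambda>b. g * b) ` borel_subgroup n"

text \<open>The \<open>i\<close>-th space \<open>F\<^sub>i\<close> of the flag corresponding to the coset of \<open>g\<close>; matrix indices start at \<open>0\<close>.\<close>

definition flag_space :: "nat \<Rightarrow> complex mat \<Rightarrow> nat \<Rightarrow> complex vec set" where
  "flag_space n g i = LinearCombinations.module.span class_ring (module_vec TYPE(complex) n)
     (set (take i (cols g)))"

text \<open>
  The map \<open>u \<mapsto> g u B\<close> from the lower unitriangular matrices is an open immersion onto the affine
  neighbourhood \<open>g U\<^sup>- B/B\<close> of \<open>g B\<close> (the translate by \<open>g\<close> of the opposite big cell), with the origin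
  mapping to \<open>g B\<close>. The set \<open>patch n g X\<close> is \<open>X\<close> in these coordinates.
\<close>

definition patch_index :: "nat \<Rightarrow> (nat \<times> nat) set" where
  "patch_index n = {(i, j). j < i \<and> i < n}"

definition lower_unitriangular :: "nat \<Rightarrow> (nat \<times> nat \<Rightarrow> complex) \<Rightarrow> complex mat" where
  "lower_unitriangular n p = mat n n (\<lambda>(i, j). if i = j then 1 else if j < i then p (i, j) else 0)"

definition patch :: "nat \<Rightarrow> complex mat \<Rightarrow> complex mat set set \<Rightarrow> (nat \<times> nat \<Rightarrow> complex) set" where
  "patch n g X = {p \<in> affine_space (patch_index n). coset n (g * lower_unitriangular n p) \<in> X}"

text \<open>
  Singular points of a closed subset \<open>X\<close> of \<open>GL\<^sub>n/B\<close> with its reduced structure. Regularity is a property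
  of the local ring, so it does not depend on the representative \<open>g\<close> chosen for the point.
\<close>

definition regular_in_flags :: "nat \<Rightarrow> complex mat set set \<Rightarrow> complex mat set \<Rightarrow> bool" where
  "regular_in_flags n X x \<longleftrightarrow>
     (\<exists>g \<in> GL n. x = coset n g \<and> regular_point (patch_index n) (patch n g X) (\<lambda>_. 0))"

definition singular_locus :: "nat \<Rightarrow> complex mat set set \<Rightarrow> complex mat set set" where
  "singular_locus n X = {x \<in> X. \<not> regular_in_flags n X x}"

section \<open>The Peterson variety\<close>

definition regular_nilpotent :: "nat \<Rightarrow> complex mat" where
  "regular_nilpotent n = mat n n (\<lambda>(i, j). if j = Suc i then 1 else 0)"

definition Peterson :: "nat \<Rightarrow> complex mat set set" where
  "Peterson n = {coset n g | g. g \<in> GL n \<and>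
     (\<forall>i<n. (\<lambda>v. regular_nilpotent n *\<^sub>v v) ` flag_space n g i \<subseteq> flag_space n g (Suc i))}"

section \<open>Permutations\<close>

text \<open>Elements of \<open>S\<^sub>n\<close> are the \<open>w :: nat \<Rightarrow> nat\<close> with \<open>w permutes {1..n}\<close>.\<close>

definition perm_mat :: "nat \<Rightarrow> (nat \<Rightarrow> nat) \<Rightarrow> complex mat" where
  "perm_mat n w = mat n n (\<lambda>(i, j). if w (Suc j) = Suc i then 1 else 0)"

definition one_line :: "nat \<Rightarrow> (nat \<Rightarrow> nat) \<Rightarrow> nat list" where
  "one_line n w = map w [1..<Suc n]"

definition coxeter_length :: "nat \<Rightarrow> (nat \<Rightarrow> nat) \<Rightarrow> nat" where
  "coxeter_length n w = (LEAST l. \<exists>is. length is = l \<and> set is \<subseteq> {1..<n} \<and>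
     w = foldr (\<lambda>i u. transpose i (Suc i) \<circ> u) is id)"

text \<open>Pattern containment for permutations in one-line notation.\<close>

definition contains_pattern :: "nat list \<Rightarrow> nat list \<Rightarrow> bool" where
  "contains_pattern w v \<longleftrightarrow> (\<exists>\<phi> :: nat \<Rightarrow> nat.
     strict_mono_on {..<length v} \<phi> \<and> \<phi> ` {..<length v} \<subseteq> {..<length w} \<and>
     (\<forall>a<length v. \<forall>b<length v. w ! \<phi> a < w ! \<phi> b \<longleftrightarrow> v ! a < v ! b))"

definition compositions :: "nat \<Rightarrow> nat list set" where
  "compositions n = {c. sum_list c = n \<and> (\<forall>i \<in> set c. 0 < i)}"

definition block :: "nat list \<Rightarrow> nat \<Rightarrow> nat set" where
  "block c j = {sum_list (take j c) <.. sum_list (take (Suc j) c)}"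

definition young_subgroup :: "nat list \<Rightarrow> (nat \<Rightarrow> nat) set" where
  "young_subgroup c = {w. w permutes {1..sum_list c} \<and> (\<forall>j<length c. w ` block c j = block c j)}"

definition w_P :: "nat list \<Rightarrow> (nat \<Rightarrow> nat)" where
  "w_P c = arg_max (coxeter_length (sum_list c)) (\<lambda>w. w \<in> young_subgroup c)"

section \<open>The strata\<close>

definition unipotent_toeplitz :: "nat \<Rightarrow> complex mat set" where
  "unipotent_toeplitz m = {A \<in> carrier_mat m m. upper_triangular A \<and> (\<forall>i<m. A $$ (i, i) = 1) \<and>
     (\<forall>i j. Suc i < m \<longrightarrow> Suc j < m \<longrightarrow> A $$ (Suc i, Suc j) = A $$ (i, j))}"

definition U_P :: "nat list \<Rightarrow> complex mat set" where
  "U_P c = {diag_block_mat Bs | Bs. length Bs = length c \<and>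
     (\<forall>j<length c. Bs ! j \<in> unipotent_toeplitz (c ! j))}"

definition stratum :: "nat list \<Rightarrow> complex mat set set" where
  "stratum c = (let n = sum_list c in {coset n (u * perm_mat n (w_P c)) | u. u \<in> U_P c})"

section \<open>The three conditions on \<open>w\<^sub>P\<close>\<close>

definition cond_I :: "nat \<Rightarrow> (nat \<Rightarrow> nat) \<Rightarrow> bool" where
  "cond_I n w \<longleftrightarrow> coset n (perm_mat n w) \<in> singular_locus n (Peterson n)"

definition cond_II :: "nat \<Rightarrow> (nat \<Rightarrow> nat) \<Rightarrow> bool" where
  "cond_II n w \<longleftrightarrow>
     one_line n w \<notin> {rev [1..<Suc n], 1 # rev [2..<Suc n], rev [1..<n] @ [n]}"

definition cond_III :: "nat \<Rightarrow> (nat \<Rightarrow> nat) \<Rightarrow> bool" where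
  "cond_III n w \<longleftrightarrow>
     contains_pattern (one_line n w) [1, 2, 3] \<or> contains_pattern (one_line n w) [2, 1, 4, 3]"

end

theory Submission
  imports
    Defs
    "HOL-Computational_Algebra.Fundamental_Theorem_Algebra"
    "HOL-Computational_Algebra.Formal_Power_Series"
begin

text \<open>
Write a point of the Peterson variety as \<open>gB\<close>; the condition on the flag says \<open>N g = g A\<close> with \<open>A\<close>
upper Hessenberg (\<open>PM\<close>). A break of \<open>g\<close> is an \<open>s\<close> with \<open>F\<^sub>s\<close> = the span of the first \<open>s\<close> basis vectors.
Comparing leading terms of powers of \<open>A\<close> shows that an entry of the subdiagonal of \<open>A\<close> vanishes only at a
break (\<open>break_of_subdiag_zero\<close>); between two breaks the flag is therefore generated by one vector under
\<open>N\<close>, and \<open>gB\<close> has a normal form, a block matrix of Hankel blocks (\<open>strata_normal_form\<close>).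
These normal forms are the elements of \<open>U\<^sub>P w\<^sub>P\<close> for the composition with the breaks as partial sums
(\<open>block_mult_w_P\<close>), because \<open>w\<^sub>P\<close> reverses each block: it has the most inversions in the Young subgroup.
So the strata are the level sets of the break set, and everything reduces to this claim:
\<open>gB\<close> is singular iff its break set \<open>S\<close> is two-sided, that is, \<open>S\<close> has two elements or an element between
\<open>2\<close> and \<open>n - 2\<close> (\<open>singular_iff\<close>). Conditions II and III are two ways to read this off the reversed blocks.

Regular points. If \<open>S\<close> is contained in \<open>{n - 1}\<close>, then nearby flags are \<open>v, N v, ..., N^(n-2) v\<close>, so
the \<open>n - 1\<close> affine coordinates of the line spanned by \<open>v\<close> form a chart (\<open>krylov_chart\<close>). Passing to
dual flags exchanges breaks \<open>s\<close> and \<open>n - s\<close>, which settles \<open>S = {1}\<close> (\<open>flip_chart\<close>). A chart with \<open>n - 1\<close>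
parameters gives tangent space dimension \<open>n - 1\<close> and local dimension at least \<open>n - 1\<close> (\<open>rational_chart\<close>).

Singular points. The local dimension never exceeds \<open>n - 1\<close>: a strict chain of \<open>k\<close> steps between
irreducible sets yields \<open>k\<close> algebraically independent functions, while the normal forms cover the variety
by finitely many rational images of \<open>(n - 1)\<close>-space; counting monomials bounds \<open>k\<close>. It remains to
find \<open>n\<close> independent tangent vectors. It is convenient to do this upstairs, for the set of all \<open>g\<close> with
\<open>PM n g\<close>, where the upper triangular directions \<open>g X\<close> are always tangent and only add
a constant to the dimension (\<open>hat_dim_ge\<close>, \<open>dim_patch_ge\<close>).

Identify vectors with polynomials modulo \<open>z^n\<close>, so that \<open>N\<close> is multiplication by \<open>z\<close>. For a break
\<open>2 \<le> s \<le> n - 2\<close> a point that is generic among those with this break is the flag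
\<open>z^b p (b < s), z^(b-s) r\<close> with \<open>p = z^(n-s)\<close> and \<open>r\<close> a unit. Besides \<open>n - 2\<close> evident directions,
factorisations \<open>z^n + \<epsilon> r = p\<^sub>1 p\<close> give curves through this point: \<open>N\<close> maps \<open>z^(s-1) p\<close> into the
span of the earlier columns and \<open>r\<close>. In the limit the rescaled roots of \<open>p\<close> are any \<open>n - s\<close> of the roots of
\<open>x^n + r(0)\<close>, and comparing different choices of them shows that the first and second order coefficients
of \<open>p\<close> are both tangent directions (\<open>tangent_second_order\<close>). The dimension bound then passes
to every point with this break by semicontinuity (\<open>break_dim\<close>). The remaining break set \<open>{1, n - 1}\<close>
has an explicit base point with two explicit extra curves (\<open>ebase_dim\<close>).
\<close>

section \<open>Linear algebra of coordinate vectors\<close>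

lemma more_unknowns_than_equations:
 fixes A :: "'e => 'k => complex"
 assumes "finite E" "finite K" "card E < card K"
 shows "\<exists>x. (\<forall>k. k \<notin> K --> x k = 0) & (\<exists>k\<in>K. x k ~= 0) & (\<forall>e\<in>E. (\<Sum>k\<in>K. A e k * x k) = 0)"
 using assms
proof (induction "card E" arbitrary: E K A)
 case 0
 have "K ~= {}" using 0 by auto
 then obtain k where "k \<in> K" by auto
 moreover have "E = {}" using 0 by simp
 ultimately show ?case by (intro exI[of _ "%j. if j = k then 1 else 0"]) auto
next
 case (Suc m)
 have "E ~= {}" using Suc.hyps(2) by auto
 then obtain e where e: "e \<in> E" by auto
 have cE: "card (E - {e}) = m" using Suc.hyps(2) Suc.prems(1) e by simp
 show ?case
 proof (cases "\<forall>k\<in>K. A e k = 0")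
  case True
  have "finite (E - {e})" "card (E - {e}) < card K" using Suc.prems Suc.hyps(2) cE by auto
  from Suc.hyps(1)[OF cE[symmetric] this(1) Suc.prems(2) this(2), of A] obtain x
   where x: "\<forall>k. k \<notin> K --> x k = 0" "\<exists>k\<in>K. x k ~= 0" "\<forall>e\<in>E - {e}. (\<Sum>k\<in>K. A e k * x k) = 0"
   by blast
  moreover have "(\<Sum>k\<in>K. A e k * x k) = 0" using True by (simp add: sum.neutral)
  ultimately show ?thesis by (intro exI[of _ x]) auto
 next
  case False
  then obtain p where p: "p \<in> K" "A e p ~= 0" by auto
  define B where "B f k = A f k - A f p * A e k / A e p" for f k
  have "card (E - {e}) < card (K - {p})" using Suc.hyps(2) Suc.prems p cE by simp
  from Suc.hyps(1)[OF cE[symmetric] _ _ this, of B] Suc.prems(1,2) obtain x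
   where x: "\<forall>k. k \<notin> K - {p} --> x k = 0" "\<exists>k\<in>K - {p}. x k ~= 0"
    "\<forall>f\<in>E - {e}. (\<Sum>k\<in>K - {p}. B f k * x k) = 0" by blast
  define y where "y = x(p := - (\<Sum>k\<in>K - {p}. A e k * x k) / A e p)"
  have s: "(\<Sum>k\<in>K. A f k * y k) = A f p * y p + (\<Sum>k\<in>K - {p}. A f k * x k)" for f
   using p Suc.prems by (subst sum.remove[of K p]) (auto simp: y_def intro!: sum.cong)
  have "(\<Sum>k\<in>K. A f k * y k) = (\<Sum>k\<in>K - {p}. B f k * x k)" for f
   unfolding s B_def using p by (simp add: y_def left_diff_distrib right_diff_distrib sum_subtractf sum_distrib_left sum_divide_distrib mult_ac)
  moreover have "(\<Sum>k\<in>K. A e k * y k) = 0"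
   unfolding s using p by (simp add: y_def)
  ultimately have "\<forall>f\<in>E. (\<Sum>k\<in>K. A f k * y k) = 0" using x(3) by (metis DiffI singletonD)
  moreover have "\<exists>k\<in>K. y k ~= 0" using x(2) by (auto simp: y_def)
  moreover have "\<forall>k. k \<notin> K --> y k = 0" using x(1) p by (auto simp: y_def)
  ultimately show ?thesis by blast
 qed
qed

lemma cfun_sum: "(\<Sum>i\<in>A. (%x. c i * f i x)) x = (\<Sum>i\<in>A. c i * f i x)" for f :: "'b => 'i => complex"
 by (induction A rule: infinite_finite_induct) auto

lemma affine_space_in_span_units:
 fixes v :: "'i => complex"
 assumes "finite I" "v \<in> affine_space I"
 shows "v \<in> cfun.span ((%i j. if j = i then 1 else 0) ` I)"
proof -
 have "v = (\<Sum>i\<in>I. (%x. v i * (if x = i then 1 else 0)))"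
 proof
  fix x show "v x = (\<Sum>i\<in>I. (%x. v i * (if x = i then 1 else 0))) x"
   using assms by (subst cfun_sum) (auto simp: affine_space_def if_distrib[of "%z. _ * z"] cong: if_cong)
 qed
 also have "... \<in> cfun.span ((%i j. if j = i then 1 else 0) ` I)"
  by (intro cfun.span_sum cfun.span_scale cfun.span_base) auto
 finally show ?thesis .
qed

lemma independent_in_affine_space_finite:
 assumes "finite I" "cfun.independent B" "B \<subseteq> affine_space I"
 shows "finite B"
 using cfun.independent_span_bound[of "(%i j. if j = i then 1 else 0) ` I" B] assms
  affine_space_in_span_units[OF assms(1)] by auto

lemma dim_le_card_functionals:
 fixes L :: "'j => 'i => complex"
 assumes I: "finite I" and J: "finite J" and V: "cfun.subspace V" "V \<subseteq> affine_space I"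
  and inj: "!!v. v \<in> V ==> (!!j. j \<in> J ==> (\<Sum>i\<in>I. L j i * v i) = 0) ==> v = 0"
 shows "cfun.dim V <= card J"
proof (rule ccontr)
 assume nle: "~ ?thesis"
 obtain B where B: "B \<subseteq> V" "cfun.independent B" "V \<subseteq> cfun.span B" "card B = cfun.dim V"
  by (rule cfun.basis_exists)
 have fB: "finite B" using independent_in_affine_space_finite[OF I B(2)] B V by auto
 have "card J < card B" using nle B by simp
 from more_unknowns_than_equations[OF J fB this, of "%j b. \<Sum>i\<in>I. L j i * b i"] obtain x
  where x: "\<exists>b\<in>B. x b ~= 0" "\<forall>j\<in>J. (\<Sum>b\<in>B. (\<Sum>i\<in>I. L j i * b i) * x b) = 0" by blast
 define v where "v = (\<Sum>b\<in>B. (%i. x b * b i))"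
 have "v \<in> V" unfolding v_def using B V by (intro cfun.subspace_sum cfun.subspace_scale) auto
 moreover have "(\<Sum>i\<in>I. L j i * v i) = 0" if "j \<in> J" for j
 proof -
  have "(\<Sum>i\<in>I. L j i * v i) = (\<Sum>i\<in>I. \<Sum>b\<in>B. L j i * b i * x b)"
   unfolding v_def cfun_sum sum_distrib_left by (simp add: mult_ac)
  also have "... = (\<Sum>b\<in>B. (\<Sum>i\<in>I. L j i * b i) * x b)"
   by (subst sum.swap) (simp add: sum_distrib_right)
  finally show ?thesis using x that by simp
 qed
 ultimately have "v = 0" using inj by blast
 hence "\<forall>b\<in>B. x b = 0"
  unfolding v_def using cfun.independentD[OF B(2) fB subset_refl, of x] by blast
 with x show False by auto
qed

lemma dim_le_card_coords:
 assumes I: "finite I" and J: "J \<subseteq> I" and V: "cfun.subspace V" "V \<subseteq> affine_space I"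
  and inj: "!!v. v \<in> V ==> (!!j. j \<in> J ==> v j = 0) ==> v = 0"
 shows "cfun.dim V <= card J"
proof (rule dim_le_card_functionals[OF I _ V, where L = "%j i. if i = j then 1 else 0"])
 show "finite J" using I J finite_subset by blast
 fix v assume v: "v \<in> V" and z: "!!j. j \<in> J ==> (\<Sum>i\<in>I. (if i = j then 1 else 0) * v i) = 0"
 have "v j = 0" if "j \<in> J" for j
 proof -
  have "(\<Sum>i\<in>I. (if i = j then 1 else 0) * v i) = (\<Sum>i\<in>I. if i = j then v i else 0)"
   by (rule sum.cong) auto
  also have "... = v j" using I J that by auto
  finally show ?thesis using z[OF that] by simp
 qed
 thus "v = 0" using inj[OF v] by blast
qed

lemma card_le_dim:
 fixes u :: "'k => 'i => complex"
 assumes I: "finite I" and V: "V \<subseteq> affine_space I" and K: "finite K"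
  and u: "!!k. k \<in> K ==> u k \<in> V"
  and ind: "!!x. (!!i. (\<Sum>k\<in>K. x k * u k i) = 0) ==> \<forall>k\<in>K. x k = 0"
 shows "card K <= cfun.dim V"
proof -
 obtain B where B: "B \<subseteq> V" "cfun.independent B" "V \<subseteq> cfun.span B" "card B = cfun.dim V"
  by (rule cfun.basis_exists)
 have fB: "finite B" using independent_in_affine_space_finite[OF I B(2)] B V by auto
 have inj: "inj_on u K"
 proof
  fix k l assume kl: "k \<in> K" "l \<in> K" "u k = u l"
  show "k = l"
  proof (rule ccontr)
   assume ne: "k ~= l"
   define x where "x = (%m. if m = k then 1 else if m = l then -1 else (0::complex))"
   have "(\<Sum>m\<in>K. x m * u m i) = 0" for i
   proof -
    have "(\<Sum>m\<in>K. x m * u m i) = (\<Sum>m\<in>{k,l}. x m * u m i)"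
     using kl(1,2) K by (intro sum.mono_neutral_right) (auto simp: x_def)
    also have "... = 0" using kl(3) ne by (simp add: x_def)
    finally show ?thesis .
   qed
   from ind[OF this] kl(1) have "x k = 0" by blast
   thus False by (simp add: x_def)
  qed
 qed
 have "cfun.independent (u ` K)"
 proof (rule cfun.independent_if_scalars_zero)
  show "finite (u ` K)" using K by simp
  fix f x assume s: "(\<Sum>x\<in>u ` K. (%i. f x * x i)) = 0" and x: "x \<in> u ` K"
  have "(\<Sum>k\<in>K. f (u k) * u k i) = 0" for i
  proof -
   have "(\<Sum>k\<in>K. f (u k) * u k i) = (\<Sum>x\<in>u ` K. f x * x i)"
    using inj by (simp add: sum.reindex)
   also have "... = 0" using fun_cong[OF s, of i] by (simp add: cfun_sum)
   finally show ?thesis .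
  qed
  from ind[of "%k. f (u k)", OF this] x show "f x = 0" by auto
 qed
 moreover have "u ` K \<subseteq> cfun.span B" using u B by blast
 ultimately have "card (u ` K) <= card B" using cfun.independent_span_bound[OF fB] by blast
 thus ?thesis using B inj by (simp add: card_image)
qed

text \<open>
A minimal set of coordinates that separates the vectors of \<open>V\<close>: by minimality each of its elements \<open>j\<close> has a vector in \<open>V\<close> supported on the set only at \<open>j\<close>.
\<close>

lemma pivot_set_exists:
 assumes I: "finite I" and V: "cfun.subspace V" "V \<subseteq> affine_space I"
 shows "\<exists>J\<subseteq>I. card J <= cfun.dim V & (\<forall>v\<in>V. (\<forall>j\<in>J. v j = 0) --> v = 0)"
proof -
 define P where "P J \<longleftrightarrow> J \<subseteq> I & (\<forall>v\<in>V. (\<forall>j\<in>J. v j = 0) --> v = 0)" for J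
 have "P I" using V by (auto simp: P_def affine_space_def fun_eq_iff)
 then obtain J where J: "P J" "!!J'. P J' ==> card J <= card J'"
  using ex_has_least_nat[of P I card] by auto
 have fJ: "finite J" using J(1) I finite_subset unfolding P_def by blast
 have "\<exists>v\<in>V. (\<forall>i\<in>J - {j}. v i = 0) & v j ~= 0" if j: "j \<in> J" for j
 proof -
  have "~ P (J - {j})" using J(2)[of "J - {j}"] fJ j
   by (metis card_Diff1_less linorder_not_less)
  then obtain v where v: "v \<in> V" "\<forall>i\<in>J - {j}. v i = 0" "v ~= 0" using J(1) by (auto simp: P_def)
  with J(1) have "v j ~= 0" by (auto simp: P_def)
  with v show ?thesis by auto
 qed
 then obtain u where u: "!!j. j \<in> J ==> u j \<in> V" "!!j i. j \<in> J ==> i \<in> J ==> i ~= j ==> u j i = 0"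
  "!!j. j \<in> J ==> u j j ~= 0" by (metis Diff_iff singletonD)
 have "card J <= cfun.dim V"
 proof (rule card_le_dim[OF I V(2) fJ u(1)])
  fix x assume z: "!!i. (\<Sum>k\<in>J. x k * u k i) = 0"
  show "\<forall>k\<in>J. x k = 0"
  proof
   fix k assume k: "k \<in> J"
   have "(\<Sum>m\<in>J. x m * u m k) = (\<Sum>m\<in>{k}. x m * u m k)"
    using k fJ u(2) by (intro sum.mono_neutral_right) auto
   hence "x k * u k k = 0" using z[of k] by simp
   thus "x k = 0" using u(3)[OF k] by simp
  qed
 qed
 with J(1) show ?thesis unfolding P_def by blast
qed

lemma bounded_family_convergent_subsequence:
 fixes x :: "nat => 'i => complex"
 assumes "finite I" "\<forall>i\<in>I. \<exists>B. \<forall>m. cmod (x m i) <= B"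
 shows "\<exists>r l. strict_mono (r :: nat => nat) & (\<forall>i\<in>I. (%m. x (r m) i) \<longlonglongrightarrow> l i)"
 using assms
proof (induction I rule: finite_induct)
 case empty
 show ?case by (rule exI[of _ id]) (auto simp: strict_mono_def)
next
 case (insert i I)
 then obtain r l where r: "strict_mono r" "\<forall>i\<in>I. (%m. x (r m) i) \<longlonglongrightarrow> l i" by blast
 obtain B where B: "!!m. cmod (x m i) <= B" using insert.prems by blast
 obtain s1 where s1: "strict_mono s1" "monoseq (%m. Re (x (r (s1 m)) i))"
  using seq_monosub[of "%m. Re (x (r m) i)"] by (auto simp: comp_def)
 have "Bseq (%m. Re (x (r (s1 m)) i))"
  by (rule BseqI'[of _ B]) (metis B abs_Re_le_cmod order_trans real_norm_def)
 hence "convergent (%m. Re (x (r (s1 m)) i))" using Bseq_monoseq_convergent s1 by blast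
 then obtain a where a: "(%m. Re (x (r (s1 m)) i)) \<longlonglongrightarrow> a" by (auto simp: convergent_def)
 obtain s2 where s2: "strict_mono s2" "monoseq (%m. Im (x (r (s1 (s2 m))) i))"
  using seq_monosub[of "%m. Im (x (r (s1 m)) i)"] by (auto simp: comp_def)
 have "Bseq (%m. Im (x (r (s1 (s2 m))) i))"
  by (rule BseqI'[of _ B]) (metis B abs_Im_le_cmod order_trans real_norm_def)
 hence "convergent (%m. Im (x (r (s1 (s2 m))) i))" using Bseq_monoseq_convergent s2 by blast
 then obtain b where b: "(%m. Im (x (r (s1 (s2 m))) i)) \<longlonglongrightarrow> b" by (auto simp: convergent_def)
 have a': "(%m. Re (x (r (s1 (s2 m))) i)) \<longlonglongrightarrow> a"
  using LIMSEQ_subseq_LIMSEQ[OF a s2(1)] by (simp add: comp_def)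
 define q where "q = r \<circ> s1 \<circ> s2"
 have "strict_mono q" unfolding q_def using r s1 s2 by (simp add: strict_mono_o)
 moreover have "(%m. x (q m) i) \<longlonglongrightarrow> Complex a b"
  unfolding q_def comp_def tendsto_complex_iff using a' b by simp
 moreover have "(%m. x (q m) j) \<longlonglongrightarrow> l j" if "j \<in> I" for j
  using LIMSEQ_subseq_LIMSEQ[of "%m. x (r m) j" "l j" "s1 \<circ> s2"] r that s1 s2
  by (simp add: q_def comp_def strict_mono_def)
 ultimately show ?case using insert.hyps
  by (intro exI[of _ q] exI[of _ "l(i := Complex a b)"]) auto
qed

section \<open>Polynomial functions and their gradients\<close>

lemma poly_funs_uminus: "f \<in> poly_funs I ==> (%p. - f p) \<in> poly_funs I"
 using poly_funs.mult[OF poly_funs.const[of "-1"]] by simp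

lemma poly_funs_diff: "f \<in> poly_funs I ==> g \<in> poly_funs I ==> (%p. f p - g p) \<in> poly_funs I"
 using poly_funs.add[OF _ poly_funs_uminus] by fastforce

lemma poly_funs_sum: "(!!a. a \<in> A ==> f a \<in> poly_funs I) ==> (%p. \<Sum>a\<in>A. f a p) \<in> poly_funs I"
 by (induction A rule: infinite_finite_induct) (auto intro: poly_funs.intros)

lemma poly_funs_prod: "(!!a. a \<in> A ==> f a \<in> poly_funs I) ==> (%p. \<Prod>a\<in>A. f a p) \<in> poly_funs I"
 by (induction A rule: infinite_finite_induct) (auto intro: poly_funs.intros)

lemma poly_funs_power: "f \<in> poly_funs I ==> (%p. f p ^ k) \<in> poly_funs I"
 by (induction k) (auto intro: poly_funs.intros)

lemma poly_funs_cong: "f \<in> poly_funs I ==> (!!i. i \<in> I ==> p i = q i) ==> f p = f q"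
 by (induction rule: poly_funs.induct) auto

lemma poly_funs_compose:
 assumes "f \<in> poly_funs I" "!!i. i \<in> I ==> (%x. c x i) \<in> poly_funs E"
 shows "(%x. f (c x)) \<in> poly_funs E"
 using assms by (induction rule: poly_funs.induct) (auto intro: poly_funs.intros)

text \<open>
Rational maps occur with powers of one common denominator; clearing it keeps the composition polynomial.
\<close>

lemma poly_funs_compose_rational:
 assumes "f \<in> poly_funs I" "D \<in> poly_funs E"
  "!!i. i \<in> I ==> \<exists>k. \<exists>F\<in>poly_funs E. \<forall>x\<in>X. D x ^ k * \<phi> x i = F x"
 shows "\<exists>k. \<exists>F\<in>poly_funs E. \<forall>x\<in>X. D x ^ k * f (\<phi> x) = F x"
 using assms(1)
proof (induction rule: poly_funs.induct)
 case (const c)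
 show ?case by (rule exI[of _ 0], rule bexI[of _ "%x. c"]) (auto intro: poly_funs.intros)
next
 case (coord i)
 then show ?case using assms(3) by blast
next
 case (add f g)
 then obtain k F l G where "F \<in> poly_funs E" "G \<in> poly_funs E" and e: "\<forall>x\<in>X. D x ^ k * f (\<phi> x) = F x"
  "\<forall>x\<in>X. D x ^ l * g (\<phi> x) = G x" by blast
 then show ?case
  by (intro exI[of _ "k + l"] bexI[of _ "%x. D x ^ l * F x + D x ^ k * G x"])
   (auto intro!: poly_funs.intros poly_funs_power assms
    simp: power_add e[rule_format, symmetric] algebra_simps)
next
 case (mult f g)
 then obtain k F l G where "F \<in> poly_funs E" "G \<in> poly_funs E" and e: "\<forall>x\<in>X. D x ^ k * f (\<phi> x) = F x"
  "\<forall>x\<in>X. D x ^ l * g (\<phi> x) = G x" by blast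
 then show ?case
  by (intro exI[of _ "k + l"] bexI[of _ "%x. F x * G x"])
   (auto intro!: poly_funs.intros simp: power_add e[rule_format, symmetric] mult_ac)
qed

lemma poly_funs_on_line:
 assumes "f \<in> poly_funs I"
 shows "\<exists>P. \<forall>s. f (%i. a i + s * b i) = poly P s"
 using assms
proof (induction rule: poly_funs.induct)
 case (const c)
 show ?case by (rule exI[of _ "[:c:]"]) simp
next
 case (coord i)
 show ?case by (rule exI[of _ "[:a i, b i:]"]) simp
next
 case (add f g)
 then show ?case by (metis poly_add)
next
 case (mult f g)
 then show ?case by (metis poly_mult)
qed

lemma tendsto_poly_funs:
 assumes "f \<in> poly_funs I" "!!i. i \<in> I ==> ((%m. x m i) \<longlongrightarrow> p i) F"
 shows "((%m. f (x m)) \<longlongrightarrow> f p) F"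
 using assms by (induction rule: poly_funs.induct) (auto intro!: tendsto_intros)

text \<open>
The gradient is characterised by the chain rule along arbitrary curves, the only way in which it is used.
\<close>

definition is_gradient :: "'i set => (('i => complex) => complex) => ('i => ('i => complex) => complex) => bool" where
 "is_gradient I f g \<longleftrightarrow> (\<forall>i. g i \<in> poly_funs I) &
   (\<forall>c v. (\<forall>i\<in>I. ((%t. c t i) has_field_derivative v i) (at 0)) -->
    ((%t. f (c t)) has_field_derivative (\<Sum>i\<in>I. g i (c 0) * v i)) (at (0::complex)))"

lemma gradient_exists:
 assumes "finite I" "f \<in> poly_funs I"
 shows "\<exists>g. is_gradient I f g"
 using assms(2)
proof (induction rule: poly_funs.induct)
 case (const c)
 show ?case by (rule exI[of _ "%i p. 0"]) (auto simp: is_gradient_def intro: poly_funs.intros)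
next
 case (coord j)
 have "(\<Sum>i\<in>I. (if i = j then 1 else 0) * v i) = v j" for v :: "'a => complex"
 proof -
  have "(\<Sum>i\<in>I. (if i = j then 1 else 0) * v i) = (\<Sum>i\<in>I. if i = j then v i else 0)"
   by (rule sum.cong) auto
  thus ?thesis using coord assms(1) by simp
 qed
 then show ?case using coord
  by (intro exI[of _ "%i p. if i = j then 1 else 0"]) (auto simp: is_gradient_def intro: poly_funs.intros)
next
 case (add f g)
 then obtain u w where "is_gradient I f u" "is_gradient I g w" by blast
 then show ?case
  by (intro exI[of _ "%i p. u i p + w i p"])
   (auto simp: is_gradient_def distrib_right sum.distrib intro!: poly_funs.intros derivative_eq_intros)
next
 case (mult f g)
 then obtain u w where uw: "is_gradient I f u" "is_gradient I g w" by blast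
 have e: "(\<Sum>i\<in>I. (u i p * g p + f p * w i p) * v i) =
   (\<Sum>i\<in>I. u i p * v i) * g p + (\<Sum>i\<in>I. w i p * v i) * f p" for v p
  unfolding sum_distrib_right sum.distrib[symmetric]
  by (intro sum.cong) (auto simp: algebra_simps)
 show ?case
  using uw mult.hyps
  by (intro exI[of _ "%i p. u i p * g p + f p * w i p"])
   (auto simp: is_gradient_def e intro!: poly_funs.intros DERIV_mult)
qed

definition grad :: "'i set => (('i => complex) => complex) => 'i => ('i => complex) => complex" where
 "grad I f = (SOME g. is_gradient I f g)"

lemma grad: "finite I ==> f \<in> poly_funs I ==> is_gradient I f (grad I f)"
 unfolding grad_def using someI_ex[OF gradient_exists] by blast

lemma grad_poly: "finite I ==> f \<in> poly_funs I ==> grad I f i \<in> poly_funs I"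
 using grad unfolding is_gradient_def by blast

lemma grad_chain:
 assumes "finite I" "f \<in> poly_funs I" "!!i. i \<in> I ==> ((%t. c t i) has_field_derivative v i) (at (0::complex))"
 shows "((%t. f (c t)) has_field_derivative (\<Sum>i\<in>I. grad I f i (c 0) * v i)) (at 0)"
 using grad[OF assms(1,2)] assms(3) unfolding is_gradient_def by blast

lemma grad_line:
 assumes "finite I" "f \<in> poly_funs I"
 shows "((%t. f (%i. p i + t * v i)) has_field_derivative (\<Sum>i\<in>I. grad I f i p * v i)) (at (0::complex))"
proof -
 have "((%t. p i + t * v i) has_field_derivative v i) (at 0)" for i
  by (auto intro!: derivative_eq_intros)
 from grad_chain[OF assms this] show ?thesis by simp
qed

section \<open>Tangent spaces\<close>

lemma tangent_space_iff:
 assumes "finite I"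
 shows "v \<in> tangent_space I Y p \<longleftrightarrow>
  v \<in> affine_space I & (\<forall>f\<in>vanishing_ideal I Y. (\<Sum>i\<in>I. grad I f i p * v i) = 0)"
proof -
 have "((%t. f (%i. p i + t * v i)) has_field_derivative 0) (at 0) \<longleftrightarrow> (\<Sum>i\<in>I. grad I f i p * v i) = 0"
  if "f \<in> vanishing_ideal I Y" for f
 proof -
  have "f \<in> poly_funs I" using that by (simp add: vanishing_ideal_def)
  note gl = grad_line[OF assms this, of p v]
  show ?thesis
  proof
   assume "((%t. f (%i. p i + t * v i)) has_field_derivative 0) (at 0)"
   from DERIV_unique[OF gl this] show "(\<Sum>i\<in>I. grad I f i p * v i) = 0" .
  next
   assume "(\<Sum>i\<in>I. grad I f i p * v i) = 0"
   with gl show "((%t. f (%i. p i + t * v i)) has_field_derivative 0) (at 0)" by simp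
  qed
 qed
 thus ?thesis unfolding tangent_space_def by auto
qed

lemma tangent_space_affine: "tangent_space I Y p \<subseteq> affine_space I"
 by (auto simp: tangent_space_def)

lemma subspace_tangent_space:
 assumes "finite I"
 shows "cfun.subspace (tangent_space I Y p)"
proof (rule cfun.subspaceI)
 show "0 \<in> tangent_space I Y p" by (simp add: tangent_space_iff[OF assms] affine_space_def)
next
 fix v w assume "v \<in> tangent_space I Y p" "w \<in> tangent_space I Y p"
 thus "v + w \<in> tangent_space I Y p"
  by (simp add: tangent_space_iff[OF assms] affine_space_def distrib_left sum.distrib)
next
 fix c v assume "v \<in> tangent_space I Y p"
 moreover have "(\<Sum>i\<in>I. g i * (c * v i)) = c * (\<Sum>i\<in>I. g i * v i)" for g :: "'a => complex"
  by (simp add: sum_distrib_left mult_ac)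
 ultimately show "(%i. c * v i) \<in> tangent_space I Y p"
  by (simp add: tangent_space_iff[OF assms] affine_space_def)
qed

text \<open>
Functoriality of the tangent space. If \<open>f\<close> vanishes on \<open>Y\<close>, then \<open>f \<circ> L\<close> times a power of \<open>D\<close> is a polynomial on \<open>E\<close>; one more factor \<open>D\<close> makes it vanish on all of \<open>Q\<close>.
\<close>

lemma tangent_space_rational_map:
 assumes E: "finite E" and I: "finite I"
  and B: "B \<in> tangent_space E Q a" and D: "D \<in> poly_funs E" "D a ~= 0"
  and L: "!!i. i \<in> I ==> \<exists>k. \<exists>F\<in>poly_funs E. \<forall>x\<in>{x. D x ~= 0}. D x ^ k * L x i = F x"
  and Y: "!!x. x \<in> Q ==> D x ~= 0 ==> L x \<in> Y"
  and a: "a \<in> Q"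
  and v: "v \<in> affine_space I" "!!i. i \<in> I ==> ((%t. L (%e. a e + t * B e) i) has_field_derivative v i) (at 0)"
 shows "v \<in> tangent_space I Y (L a)"
 unfolding tangent_space_iff[OF I]
proof (intro conjI ballI v(1))
 fix f assume f: "f \<in> vanishing_ideal I Y"
 hence fp: "f \<in> poly_funs I" by (simp add: vanishing_ideal_def)
 from poly_funs_compose_rational[OF fp D(1), where \<phi> = L and X = "{x. D x ~= 0}", OF L] obtain k F
  where F: "F \<in> poly_funs E" "!!x. D x ~= 0 ==> D x ^ k * f (L x) = F x" by blast
 have FD: "(%x. F x * D x) \<in> vanishing_ideal E Q"
 proof -
  have "F x * D x = 0" if "x \<in> Q" for x
   using F(2)[of x] Y[OF that] f by (cases "D x = 0") (auto simp: vanishing_ideal_def)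
  thus ?thesis using F D by (auto simp: vanishing_ideal_def intro: poly_funs.intros)
 qed
 let ?x = "%t e. a e + t * B e"
 have d0: "((%t. F (?x t) * D (?x t)) has_field_derivative 0) (at 0)"
  using B FD unfolding tangent_space_def mem_Collect_eq by (elim conjE) (drule (1) bspec, simp)
 have fL: "((%t. f (L (?x t))) has_field_derivative (\<Sum>i\<in>I. grad I f i (L (?x 0)) * v i)) (at 0)"
  by (rule grad_chain[OF I fp v(2)])
 have Dd: "((%t. D (?x t)) has_field_derivative (\<Sum>e\<in>E. grad E D e a * B e)) (at 0)"
  by (rule grad_line[OF E D(1)])
 have "((%t. D (?x t) ^ Suc k) has_field_derivative
   (of_nat (Suc k) * (D (?x 0) ^ k * (\<Sum>e\<in>E. grad E D e a * B e)))) (at 0)"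
  using DERIV_power[OF Dd, of "Suc k"] by (simp add: algebra_simps)
 from DERIV_mult[OF this fL]
 have d1: "((%t. D (?x t) ^ Suc k * f (L (?x t))) has_field_derivative
   D a ^ Suc k * (\<Sum>i\<in>I. grad I f i (L a) * v i)) (at 0)"
  using f Y[OF a D(2)] by (simp add: vanishing_ideal_def algebra_simps)
 have "((%t. D (?x t)) \<longlongrightarrow> D (?x 0)) (at 0)"
  using DERIV_isCont[OF Dd] by (simp add: isCont_def)
 hence "\<forall>\<^sub>F t in at 0. D (?x t) ~= 0"
  by (rule tendsto_imp_eventually_ne) (use D(2) in simp)
 hence "\<forall>\<^sub>F t in at 0. F (?x t) * D (?x t) = D (?x t) ^ Suc k * f (L (?x t))"
 proof eventually_elim
  case (elim t)
  show ?case unfolding F(2)[OF elim, symmetric] power_Suc by (simp only: mult_ac)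
 qed
 moreover have "F (?x 0) * D (?x 0) = D (?x 0) ^ Suc k * f (L (?x 0))"
 proof -
  have x0: "?x 0 = a" by simp
  show ?thesis unfolding x0 F(2)[OF D(2), symmetric] power_Suc by (simp only: mult_ac)
 qed
 ultimately have ev: "\<forall>\<^sub>F t in nhds 0. F (?x t) * D (?x t) = D (?x t) ^ Suc k * f (L (?x t))"
  unfolding eventually_nhds_conv_at by (rule conjI)
 have "((%t. D (?x t) ^ Suc k * f (L (?x t))) has_field_derivative 0) (at 0)"
  by (rule iffD1[OF DERIV_cong_ev[OF refl ev refl] d0])
 from DERIV_unique[OF this d1] D(2) show "(\<Sum>i\<in>I. grad I f i (L a) * v i) = 0" by simp
qed

text \<open>
The curve need only stay in \<open>Y\<close> off the zeros of \<open>W\<close>, typically a determinant: \<open>f W\<close> vanishes identically along it.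
\<close>

lemma tangent_space_curve:
 assumes I: "finite I" and p: "p \<in> Y" and W: "W \<in> poly_funs I" "W p ~= 0"
  and c: "c 0 = p" "!!t. W (c t) ~= 0 ==> c t \<in> Y"
  and v: "v \<in> affine_space I" "!!i. i \<in> I ==> ((%t. c t i) has_field_derivative v i) (at (0::complex))"
 shows "v \<in> tangent_space I Y p"
 unfolding tangent_space_iff[OF I]
proof (intro conjI ballI v(1))
 fix f assume f: "f \<in> vanishing_ideal I Y"
 hence fp: "f \<in> poly_funs I" by (simp add: vanishing_ideal_def)
 have 1: "((%t. f (c t)) has_field_derivative (\<Sum>i\<in>I. grad I f i (c 0) * v i)) (at 0)"
  by (rule grad_chain[OF I fp v(2)])
 have 2: "((%t. W (c t)) has_field_derivative (\<Sum>i\<in>I. grad I W i (c 0) * v i)) (at 0)"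
  by (rule grad_chain[OF I W(1) v(2)])
 have "(%t. f (c t) * W (c t)) = (%t. 0)"
  using c(2) f by (auto simp: vanishing_ideal_def fun_eq_iff)
 with DERIV_mult[OF 1 2] have "((%t. 0::complex) has_field_derivative
   (\<Sum>i\<in>I. grad I f i (c 0) * v i) * W (c 0) + (\<Sum>i\<in>I. grad I W i (c 0) * v i) * f (c 0)) (at 0)" by simp
 from DERIV_unique[OF this DERIV_const] W(2) c(1) f p
 show "(\<Sum>i\<in>I. grad I f i p * v i) = 0" by (auto simp: vanishing_ideal_def)
qed

text \<open>
The remainder is a quadratic form with polynomial coefficients, so that it can be divided by the square of a small parameter.
\<close>

lemma poly_funs_taylor:
 assumes I: "finite I" and "f \<in> poly_funs I"
 shows "\<exists>h. (\<forall>i j. h i j \<in> poly_funs I) &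
  (\<forall>x. f (%i. p i + x i) = f p + (\<Sum>i\<in>I. grad I f i p * x i) + (\<Sum>i\<in>I. \<Sum>j\<in>I. x i * x j * h i j x))"
proof -
 have "\<exists>g h. (\<forall>i j. h i j \<in> poly_funs I) &
  (\<forall>x. f (%i. p i + x i) = f p + (\<Sum>i\<in>I. g i * x i) + (\<Sum>i\<in>I. \<Sum>j\<in>I. x i * x j * h i j x))"
  using assms(2)
 proof (induction rule: poly_funs.induct)
  case (const c)
  show ?case by (rule exI[of _ "%i. 0"], rule exI[of _ "%i j x. 0"]) (auto intro: poly_funs.intros)
 next
  case (coord k)
  have "(\<Sum>i\<in>I. (if i = k then 1 else 0) * x i) = x k" for x :: "'a => complex"
  proof -
   have "(\<Sum>i\<in>I. (if i = k then 1 else 0) * x i) = (\<Sum>i\<in>I. if i = k then x i else 0)"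
    by (rule sum.cong) auto
   thus ?thesis using coord I by simp
  qed
  thus ?case by (intro exI[of _ "%i. if i = k then 1 else 0"] exI[of _ "%i j x. 0"])
    (auto intro: poly_funs.intros)
 next
  case (add f g)
  then obtain a h b l where H: "\<forall>i j. h i j \<in> poly_funs I" "\<forall>i j. l i j \<in> poly_funs I"
   "\<forall>x. f (%i. p i + x i) = f p + (\<Sum>i\<in>I. a i * x i) + (\<Sum>i\<in>I. \<Sum>j\<in>I. x i * x j * h i j x)"
   "\<forall>x. g (%i. p i + x i) = g p + (\<Sum>i\<in>I. b i * x i) + (\<Sum>i\<in>I. \<Sum>j\<in>I. x i * x j * l i j x)" by blast
  show ?case
   by (rule exI[of _ "%i. a i + b i"], rule exI[of _ "%i j x. h i j x + l i j x"])
    (use H in \<open>auto intro: poly_funs.intros simp: distrib_left distrib_right sum.distrib\<close>)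
 next
  case (mult f g)
  then obtain a h b l where H: "\<forall>i j. h i j \<in> poly_funs I" "\<forall>i j. l i j \<in> poly_funs I"
   "\<forall>x. f (%i. p i + x i) = f p + (\<Sum>i\<in>I. a i * x i) + (\<Sum>i\<in>I. \<Sum>j\<in>I. x i * x j * h i j x)"
   "\<forall>x. g (%i. p i + x i) = g p + (\<Sum>i\<in>I. b i * x i) + (\<Sum>i\<in>I. \<Sum>j\<in>I. x i * x j * l i j x)" by blast
  define A where "A x = (\<Sum>i\<in>I. a i * x i)" for x
  define B where "B x = (\<Sum>i\<in>I. b i * x i)" for x
  define h' where "h' i j x = h i j x * g (%i. p i + x i) + f p * l i j x + a i * b j + a i * (\<Sum>k\<in>I. x k * l j k x)" for i j x
  have px: "(%x. g (%i. p i + x i)) \<in> poly_funs I"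
   by (rule poly_funs_compose[OF mult.hyps(2)]) (auto intro: poly_funs.intros)
  have "h' i j \<in> poly_funs I" if "j \<in> I" for i j unfolding h'_def
   by (intro poly_funs.intros poly_funs_sum px) (use H in \<open>auto intro: poly_funs.intros\<close>)
  hence "(if j \<in> I then h' i j else (%x. 0)) \<in> poly_funs I" for i j
   by (auto intro: poly_funs.intros)
  moreover have "f (%i. p i + x i) * g (%i. p i + x i) = f p * g p + (\<Sum>i\<in>I. (a i * g p + f p * b i) * x i) +
    (\<Sum>i\<in>I. \<Sum>j\<in>I. x i * x j * (if j \<in> I then h' i j else (%x. 0)) x)" for x
  proof -
   define S where "S = (\<Sum>i\<in>I. \<Sum>j\<in>I. x i * x j * h i j x)"
   define T where "T = (\<Sum>i\<in>I. \<Sum>j\<in>I. x i * x j * l i j x)"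
   define G where "G = g (%i. p i + x i)"
   have G: "G = g p + B x + T" using H(4) by (simp add: G_def B_def T_def)
   have "(\<Sum>i\<in>I. \<Sum>j\<in>I. x i * x j * h' i j x) = S * G + f p * T + A x * B x + A x * T"
   proof -
    have s1: "(\<Sum>i\<in>I. \<Sum>j\<in>I. x i * x j * (h i j x * G)) = S * G"
     unfolding S_def sum_distrib_right by (simp add: mult_ac)
    have s2: "(\<Sum>i\<in>I. \<Sum>j\<in>I. x i * x j * (f p * l i j x)) = f p * T"
     unfolding T_def sum_distrib_left by (simp add: mult_ac)
    have s3: "(\<Sum>i\<in>I. \<Sum>j\<in>I. x i * x j * (a i * b j)) = A x * B x"
     unfolding A_def B_def sum_product by (simp add: mult_ac)
    have s4: "(\<Sum>i\<in>I. \<Sum>j\<in>I. x i * x j * (a i * (\<Sum>k\<in>I. x k * l j k x))) = A x * T"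
     unfolding A_def T_def sum_product by (simp add: sum_distrib_left mult_ac)
    show ?thesis unfolding h'_def G_def[symmetric] distrib_left sum.distrib s1 s2 s3 s4 by simp
   qed
   hence "(\<Sum>i\<in>I. \<Sum>j\<in>I. x i * x j * (if j \<in> I then h' i j else (%x. 0)) x) =
     S * G + f p * T + A x * B x + A x * T" by (simp cong: sum.cong)
   moreover have "(\<Sum>i\<in>I. (a i * g p + f p * b i) * x i) = A x * g p + f p * B x"
    unfolding A_def B_def sum_distrib_left sum_distrib_right sum.distrib[symmetric]
    by (intro sum.cong) (auto simp: algebra_simps)
   moreover have "f (%i. p i + x i) = f p + A x + S" using H(3) by (simp add: A_def S_def)
   ultimately show ?thesis by (simp add: G_def[symmetric] G algebra_simps)
  qed
  ultimately show ?case
   by (intro exI[of _ "%i. a i * g p + f p * b i"] exI[of _ "%i j. if j \<in> I then h' i j else (%x. 0)"]) auto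
 qed
 then obtain g h where H: "\<forall>i j. h i j \<in> poly_funs I" and
  eq: "!!x. f (%i. p i + x i) = f p + (\<Sum>i\<in>I. g i * x i) + (\<Sum>i\<in>I. \<Sum>j\<in>I. x i * x j * h i j x)" by blast
 have "(\<Sum>i\<in>I. g i * v i) = (\<Sum>i\<in>I. grad I f i p * v i)" for v
 proof -
  define q where "q t = (\<Sum>i\<in>I. \<Sum>j\<in>I. v i * v j * h i j (%i. t * v i))" for t :: complex
  have eq': "f (%i. p i + t * v i) = f p + t * (\<Sum>i\<in>I. g i * v i) + t * (t * q t)" for t
   using eq[of "%i. t * v i"] by (simp add: q_def sum_distrib_left mult_ac)
  have "(q \<longlongrightarrow> q 0) (at 0)" unfolding q_def
  proof (intro tendsto_sum tendsto_mult tendsto_const)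
   fix i j assume "i \<in> I" "j \<in> I"
   have tv: "((%t. t * v i) \<longlongrightarrow> 0 * v i) (at 0)" for i by (intro tendsto_intros)
   show "((%t. h i j (%i. t * v i)) \<longlongrightarrow> h i j (%i. 0 * v i)) (at 0)"
    by (rule tendsto_poly_funs[where I = I and f = "h i j" and x = "%t i. t * v i" and p = "%i. 0 * v i"])
     (use H tv in auto)
  qed
  hence "((%t. (\<Sum>i\<in>I. g i * v i) + t * q t) \<longlongrightarrow> (\<Sum>i\<in>I. g i * v i) + 0 * q 0) (at 0)"
   by (intro tendsto_intros)
  hence lim: "((%t. (\<Sum>i\<in>I. g i * v i) + t * q t) \<longlongrightarrow> (\<Sum>i\<in>I. g i * v i)) (at 0)" by simp
  have "((%t. (f (%i. p i + t * v i) - f (%i. p i + 0 * v i)) / t) \<longlongrightarrow> (\<Sum>i\<in>I. g i * v i)) (at 0)"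
   by (rule Lim_transform_eventually[OF lim]) (auto simp: eventually_at_filter eq' field_simps)
  hence "((%t. f (%i. p i + t * v i)) has_field_derivative (\<Sum>i\<in>I. g i * v i)) (at 0)"
   unfolding DERIV_def by simp
  from DERIV_unique[OF this grad_line[OF assms]] show ?thesis .
 qed
 with H eq show ?thesis by (intro exI[of _ h]) auto
qed

text \<open>semicontinuity\<close>

text \<open>
Otherwise a set \<open>J\<close> of coordinates that separates the tangent space at \<open>p\<close> has fewer than \<open>d\<close> elements, so that at each \<open>q m\<close> some tangent vector of maximum norm 1 vanishes on \<open>J\<close>. A limit of these is a nonzero tangent vector at \<open>p\<close> that vanishes on \<open>J\<close>.
\<close>

lemma dim_tangent_space_upper_semicontinuous:
 assumes I: "finite I" and q: "!!i. i \<in> I ==> (%m. q m i) \<longlonglongrightarrow> p i"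
  and d: "!!m. d <= cfun.dim (tangent_space I Y (q m))"
 shows "d <= cfun.dim (tangent_space I Y p)"
proof (rule ccontr)
 assume nle: "~ ?thesis"
 obtain J where J: "J \<subseteq> I" "card J <= cfun.dim (tangent_space I Y p)"
  "!!v. v \<in> tangent_space I Y p ==> (\<forall>j\<in>J. v j = 0) ==> v = 0"
  using pivot_set_exists[OF I subspace_tangent_space[OF I] tangent_space_affine] by metis
 have ex: "\<exists>v. v \<in> tangent_space I Y (q m) & (\<forall>j\<in>J. v j = 0) & (\<forall>i\<in>I. cmod (v i) <= 1) & (\<exists>i\<in>I. v i = 1)" for m
 proof -
  have "~ cfun.dim (tangent_space I Y (q m)) <= card J" using d[of m] J(2) nle by simp
  then obtain v where v: "v \<in> tangent_space I Y (q m)" "\<forall>j\<in>J. v j = 0" "v ~= 0"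
   using dim_le_card_coords[OF I J(1) subspace_tangent_space[OF I] tangent_space_affine] by metis
  then obtain k where k: "v k ~= 0" by (auto simp: fun_eq_iff)
  hence kI: "k \<in> I" using v(1) tangent_space_affine by (fastforce simp: affine_space_def)
  define M where "M = Max ((%i. cmod (v i)) ` I)"
  have "M \<in> (%i. cmod (v i)) ` I" unfolding M_def using I kI by (intro Max_in) auto
  then obtain l where l: "l \<in> I" "M = cmod (v l)" by auto
  have le: "cmod (v i) <= cmod (v l)" if "i \<in> I" for i
   using I that l(2) unfolding M_def by (metis Max_ge finite_imageI imageI)
  have "v l ~= 0" using le[OF kI] k by auto
  show ?thesis
  proof (intro exI[of _ "%i. inverse (v l) * v i"] conjI ballI bexI[OF _ l(1)])
   show "(%i. inverse (v l) * v i) \<in> tangent_space I Y (q m)"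
    using cfun.subspace_scale[OF subspace_tangent_space[OF I] v(1)] .
   fix i assume "i \<in> I"
   thus "cmod (inverse (v l) * v i) <= 1"
    using le[of i] `v l ~= 0` unfolding norm_mult norm_inverse by (simp add: field_simps)
  qed (use v \<open>v l ~= 0\<close> in auto)
 qed
 define v where "v m = (SOME v. v \<in> tangent_space I Y (q m) & (\<forall>j\<in>J. v j = 0) &
   (\<forall>i\<in>I. cmod (v i) <= 1) & (\<exists>i\<in>I. v i = 1))" for m
 have v: "v m \<in> tangent_space I Y (q m)" "j \<in> J ==> v m j = 0"
  "i \<in> I ==> cmod (v m i) <= 1" "\<exists>i\<in>I. v m i = 1" for m i j
  using someI_ex[OF ex[of m]] unfolding v_def[symmetric] by auto
 have bd: "\<forall>i\<in>I. \<exists>B. \<forall>m. cmod (v m i) <= B" using v(3) by blast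
 obtain r l where r0: "strict_mono (r :: nat => nat) & (\<forall>i\<in>I. (%m. v (r m) i) \<longlonglongrightarrow> l i)"
  using bounded_family_convergent_subsequence[OF I bd] by (elim exE) (rule that)
 hence r: "strict_mono r" "!!i. i \<in> I ==> (%m. v (r m) i) \<longlonglongrightarrow> l i" by auto
 define w where "w i = (if i \<in> I then l i else 0)" for i
 have wl: "(%m. v (r m) i) \<longlonglongrightarrow> w i" if "i \<in> I" for i using r(2) that by (simp add: w_def)
 have q': "(%m. q (r m) i) \<longlonglongrightarrow> p i" if "i \<in> I" for i
  using LIMSEQ_subseq_LIMSEQ[OF q[OF that] r(1)] by (simp add: comp_def)
 have "w \<in> tangent_space I Y p" unfolding tangent_space_iff[OF I]
 proof (intro conjI ballI)
  show "w \<in> affine_space I" by (simp add: affine_space_def w_def)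
  fix f assume f: "f \<in> vanishing_ideal I Y"
  hence fp: "f \<in> poly_funs I" by (simp add: vanishing_ideal_def)
  have "(%m. \<Sum>i\<in>I. grad I f i (q (r m)) * v (r m) i) \<longlonglongrightarrow> (\<Sum>i\<in>I. grad I f i p * w i)"
  proof (intro tendsto_sum tendsto_mult wl)
   show "(%m. grad I f i (q (r m))) \<longlonglongrightarrow> grad I f i p" for i
    by (rule tendsto_poly_funs[OF grad_poly[OF I fp] q'])
  qed
  moreover have "(\<Sum>i\<in>I. grad I f i (q (r m)) * v (r m) i) = 0" for m
   using v(1)[of "r m"] f by (simp add: tangent_space_iff[OF I])
  ultimately show "(\<Sum>i\<in>I. grad I f i p * w i) = 0"
   by (simp add: LIMSEQ_const_iff)
 qed
 moreover have "w j = 0" if "j \<in> J" for j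
  using wl[of j] J(1) that v(2)[OF that] by (auto simp: LIMSEQ_const_iff)
 ultimately have w0: "w = 0" using J(3) by blast
 have "\<forall>\<^sub>F m in sequentially. \<forall>i\<in>I. cmod (v (r m) i) < 1"
 proof (subst eventually_ball_finite_distrib[OF I], intro ballI)
  fix i assume "i \<in> I"
  from tendsto_norm[OF wl[OF this]] w0 have "(%m. cmod (v (r m) i)) \<longlonglongrightarrow> 0" by simp
  thus "\<forall>\<^sub>F m in sequentially. cmod (v (r m) i) < 1" by (rule order_tendstoD) simp
 qed
 from eventually_happens'[OF sequentially_bot this]
 obtain m where "\<forall>i\<in>I. cmod (v (r m) i) < 1" by blast
 with v(4)[of "r m"] show False by auto
qed

section \<open>Local dimension\<close>

lemma zariski_closed_affine: "zariski_closed I Z ==> Z \<subseteq> affine_space I"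
 by (auto simp: zariski_closed_def)

lemma zariski_closed_cut:
 assumes "zariski_closed I Z" "G \<subseteq> poly_funs I"
 shows "zariski_closed I {p \<in> Z. \<forall>g\<in>G. g p = 0}"
proof -
 obtain F where F: "F \<subseteq> poly_funs I" "Z = {p \<in> affine_space I. \<forall>f\<in>F. f p = 0}"
  using assms(1) by (auto simp: zariski_closed_def)
 have "{p \<in> Z. \<forall>g\<in>G. g p = 0} = {p \<in> affine_space I. \<forall>f\<in>F \<union> G. f p = 0}"
  unfolding F(2) by blast
 moreover have "F \<union> G \<subseteq> poly_funs I" using F(1) assms(2) by blast
 ultimately show ?thesis unfolding zariski_closed_def by blast
qed

lemma zariski_closed_separates:
 assumes "zariski_closed I Z" "p \<in> affine_space I" "p \<notin> Z"
 shows "\<exists>f\<in>poly_funs I. (\<forall>q\<in>Z. f q = 0) & f p ~= 0"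
proof -
 obtain F where F: "F \<subseteq> poly_funs I" "Z = {p \<in> affine_space I. \<forall>f\<in>F. f p = 0}"
  using assms(1) by (auto simp: zariski_closed_def)
 with assms(2,3) obtain f where "f \<in> F" "f p ~= 0" by blast
 with F show ?thesis by blast
qed

text \<open>
\<open>Z\<close> is the union of its intersections with the zero sets of \<open>f\<close> and \<open>g\<close>.
\<close>

lemma zariski_irreducible_prime:
 assumes Z: "zariski_closed I Z" "zariski_irreducible I Z"
  and fg: "f \<in> poly_funs I" "g \<in> poly_funs I" "!!p. p \<in> Z ==> f p * g p = 0"
 shows "(\<forall>p\<in>Z. f p = 0) \<or> (\<forall>p\<in>Z. g p = 0)"
proof -
 have "Z = {p \<in> Z. \<forall>h\<in>{f}. h p = 0} \<union> {p \<in> Z. \<forall>h\<in>{g}. h p = 0}" using fg(3) by auto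
 moreover have "zariski_closed I {p \<in> Z. \<forall>h\<in>{f}. h p = 0}" "zariski_closed I {p \<in> Z. \<forall>h\<in>{g}. h p = 0}"
  using zariski_closed_cut[OF Z(1), of "{f}"] zariski_closed_cut[OF Z(1), of "{g}"] fg(1,2) by auto
 ultimately have "Z = {p \<in> Z. \<forall>h\<in>{f}. h p = 0} \<or> Z = {p \<in> Z. \<forall>h\<in>{g}. h p = 0}"
  using Z(2) unfolding zariski_irreducible_def by blast
 thus ?thesis by auto
qed

text \<open>
A function that vanishes on one set of the chain but not on the next is independent of the functions found before: in a relation, the part without it vanishes on the smaller set, hence is trivial, and the rest can be divided by it because the larger set is irreducible.
\<close>

lemma chain_algebraically_independent:
 assumes "!!j. j <= k ==> zariski_closed I (Z j)" "!!j. j <= k ==> zariski_irreducible I (Z j)"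
  "!!j. j < k ==> Z j \<subset> Z (Suc j)"
 shows "\<exists>f. (\<forall>j<k. f j \<in> poly_funs I) &
  (\<forall>d c. (\<forall>p\<in>Z k. (\<Sum>a\<in>PiE {..<k} (%_. {..d}). c a * (\<Prod>j<k. f j p ^ a j)) = 0) -->
    (\<forall>a\<in>PiE {..<k} (%_. {..d::nat}). c a = 0))"
 using assms
proof (induction k)
 case 0
 have "Z 0 ~= {}" using 0(2)[of 0] unfolding zariski_irreducible_def by blast
 then show ?case by auto
next
 case (Suc k)
 have "\<exists>f. (\<forall>j<k. f j \<in> poly_funs I) &
  (\<forall>d c. (\<forall>p\<in>Z k. (\<Sum>a\<in>PiE {..<k} (%_. {..d}). c a * (\<Prod>j<k. f j p ^ a j)) = 0) -->
    (\<forall>a\<in>PiE {..<k} (%_. {..d::nat}). c a = 0))"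
  by (rule Suc.IH; rule Suc.prems; simp)
 then obtain f where f0: "(\<forall>j<k. f j \<in> poly_funs I) &
  (\<forall>d c. (\<forall>p\<in>Z k. (\<Sum>a\<in>PiE {..<k} (%_. {..d}). c a * (\<Prod>j<k. f j p ^ a j)) = 0) -->
    (\<forall>a\<in>PiE {..<k} (%_. {..d::nat}). c a = 0))" by (elim exE) (rule that)
 have f: "f j \<in> poly_funs I" if "j < k" for j using mp[OF spec[OF conjunct1[OF f0]] that] .
 have ind: "c a = 0" if z: "!!p. p \<in> Z k ==> (\<Sum>a\<in>PiE {..<k} (%_. {..d}). c a * (\<Prod>j<k. f j p ^ a j)) = 0"
  and a: "a \<in> PiE {..<k} (%_. {..d::nat})" for d c a
  using bspec[OF mp[OF spec[OF spec[OF conjunct2[OF f0]]] ballI[OF z]] a] .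
 have sub: "Z k \<subset> Z (Suc k)" by (rule Suc.prems(3)) simp
 obtain x where x: "x \<in> Z (Suc k)" "x \<notin> Z k" using psubset_imp_ex_mem[OF sub] by blast
 have cl: "zariski_closed I (Z (Suc k))" "zariski_closed I (Z k)"
  and irr: "zariski_irreducible I (Z (Suc k))" by (rule Suc.prems(1) Suc.prems(2), simp)+
 have "x \<in> affine_space I" using zariski_closed_affine[OF cl(1)] x(1) by blast
 from zariski_closed_separates[OF cl(2) this x(2)] obtain h
  where h: "h \<in> poly_funs I" "!!q. q \<in> Z k ==> h q = 0" "h x ~= 0" by blast
 have key: "\<forall>l\<le>e. \<forall>a\<in>PiE {..<k} (%_. {..d}). C l a = 0"
  if "!!p. p \<in> Z (Suc k) ==>
   (\<Sum>l\<le>e. h p ^ l * (\<Sum>a\<in>PiE {..<k} (%_. {..d}). C l a * (\<Prod>j<k. f j p ^ a j))) = 0"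
  for e d and C :: "nat => (nat => nat) => complex"
  using that
 proof (induction e arbitrary: C)
  case 0
  have "C 0 a = 0" if "a \<in> PiE {..<k} (%_. {..d})" for a
  proof (rule ind[OF _ that])
   fix p assume "p \<in> Z k"
   hence "p \<in> Z (Suc k)" using sub by blast
   from 0[OF this] show "(\<Sum>a\<in>PiE {..<k} (%_. {..d}). C 0 a * (\<Prod>j<k. f j p ^ a j)) = 0" by simp
  qed
  thus ?case by simp
 next
  case (Suc e)
  let ?P = "PiE {..<k} (%_. {..d})"
  let ?G = "%l p. \<Sum>a\<in>?P. C l a * (\<Prod>j<k. f j p ^ a j)"
  have split: "(\<Sum>l\<le>Suc e. h p ^ l * ?G l p) = ?G 0 p + h p * (\<Sum>l\<le>e. h p ^ l * ?G (Suc l) p)" for p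
   by (subst sum.atMost_Suc_shift) (simp add: sum_distrib_left mult_ac)
  have c0: "C 0 a = 0" if "a \<in> ?P" for a
  proof (rule ind[OF _ that])
   fix p assume p: "p \<in> Z k"
   hence "p \<in> Z (Suc k)" using sub by blast
   from Suc.prems[OF this] h(2)[OF p] show "?G 0 p = 0" unfolding split by simp
  qed
  have Gp: "?G l \<in> poly_funs I" for l
   by (intro poly_funs_sum poly_funs.intros poly_funs_prod poly_funs_power f) auto
  (* Division of the relation by h. *)
  have "(\<forall>p\<in>Z (Suc k). h p = 0) \<or> (\<forall>p\<in>Z (Suc k). (\<Sum>l\<le>e. h p ^ l * ?G (Suc l) p) = 0)"
  proof (rule zariski_irreducible_prime)
   show "zariski_closed I (Z (Suc k))" "zariski_irreducible I (Z (Suc k))" by fact+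
   show "(%p. \<Sum>l\<le>e. h p ^ l * ?G (Suc l) p) \<in> poly_funs I"
    by (intro poly_funs_sum poly_funs.mult[OF poly_funs_power[OF h(1)]] Gp)
   fix p assume "p \<in> Z (Suc k)"
   from Suc.prems[OF this] have "?G 0 p + h p * (\<Sum>l\<le>e. h p ^ l * ?G (Suc l) p) = 0" unfolding split .
   moreover have "?G 0 p = 0" using c0 by (intro sum.neutral) simp
   ultimately show "h p * (\<Sum>l\<le>e. h p ^ l * ?G (Suc l) p) = 0" by simp
  qed (rule h(1))
  with x h(3) have "!!p. p \<in> Z (Suc k) ==> (\<Sum>l\<le>e. h p ^ l * ?G (Suc l) p) = 0" by blast
  from Suc.IH[of "%l. C (Suc l)", OF this]
  have *: "C (Suc l) a = 0" if "l <= e" "a \<in> ?P" for l a using that by blast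
  show ?case
  proof (intro allI impI ballI)
   fix l a assume "l <= Suc e" "a \<in> ?P"
   thus "C l a = 0" using c0 * by (cases l) auto
  qed
 qed
 define f' where "f' = f(k := h)"
 show ?case
 proof (intro exI[of _ f'] conjI allI impI ballI)
  fix j assume "j < Suc k" thus "f' j \<in> poly_funs I" using f h(1) by (auto simp: f'_def less_Suc_eq)
 next
  fix d c a'
  assume z: "\<forall>p\<in>Z (Suc k). (\<Sum>a\<in>PiE {..<Suc k} (%_. {..d}). c a * (\<Prod>j<Suc k. f' j p ^ a j)) = 0"
   and a': "a' \<in> PiE {..<Suc k} (%_. {..d})"
  let ?P = "PiE {..<k} (%_. {..d})"
  have PE: "PiE {..<Suc k} (%_. {..d}) = (%(y, g). g(k := y)) ` ({..d} \<times> ?P)"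
   by (simp add: lessThan_Suc PiE_insert_eq)
  have inj: "inj_on (%(y, g). g(k := y)) ({..d} \<times> ?P)"
   by (rule inj_combinator) auto
  have re: "(\<Sum>a\<in>PiE {..<Suc k} (%_. {..d}). c a * (\<Prod>j<Suc k. f' j p ^ a j)) =
   (\<Sum>l\<le>d. h p ^ l * (\<Sum>a\<in>?P. c (a(k := l)) * (\<Prod>j<k. f j p ^ a j)))" for p
  proof -
   have "(\<Sum>a\<in>PiE {..<Suc k} (%_. {..d}). c a * (\<Prod>j<Suc k. f' j p ^ a j)) =
    (\<Sum>(l, a)\<in>{..d} \<times> ?P. c (a(k := l)) * (\<Prod>j<Suc k. f' j p ^ (a(k := l)) j))"
    unfolding PE by (subst sum.reindex[OF inj]) (simp add: comp_def case_prod_unfold)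
   also have "... = (\<Sum>l\<le>d. \<Sum>a\<in>?P. c (a(k := l)) * (\<Prod>j<Suc k. f' j p ^ (a(k := l)) j))"
    by (rule sum.cartesian_product[symmetric])
   also have "... = (\<Sum>l\<le>d. h p ^ l * (\<Sum>a\<in>?P. c (a(k := l)) * (\<Prod>j<k. f j p ^ a j)))"
    unfolding sum_distrib_left by (intro sum.cong refl) (simp add: f'_def mult_ac)
   finally show ?thesis .
  qed
  have "\<forall>l\<le>d. \<forall>a\<in>?P. c (a(k := l)) = 0"
  proof (rule key)
   fix p assume "p \<in> Z (Suc k)"
   thus "(\<Sum>l\<le>d. h p ^ l * (\<Sum>a\<in>?P. c (a(k := l)) * (\<Prod>j<k. f j p ^ a j))) = 0"
    using z unfolding re by blast
  qed
  hence "c (a(k := l)) = 0" if "l <= d" "a \<in> ?P" for l a using that by blast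
  moreover from a' PE obtain l a where "l <= d" "a \<in> ?P" "a' = a(k := l)" by auto
  ultimately show "c a' = 0" by simp
 qed
qed

text \<open>
The degree bound is on each variable separately, which makes products and cardinalities easy.
\<close>

definition monomials :: "'j set => nat => (('j => complex) => complex) set" where
 "monomials J D = (%b t. \<Prod>j\<in>J. t j ^ b j) ` PiE J (%_. {..D})"

lemma finite_monomials: "finite J ==> finite (monomials J D)"
 unfolding monomials_def by (intro finite_imageI finite_PiE) auto

lemma card_monomials: "finite J ==> card (monomials J D) <= (D + 1) ^ card J"
 unfolding monomials_def
 by (rule order_trans[OF card_image_le]) (auto simp: card_PiE intro: finite_PiE)

lemma monomials_mono: "D <= E ==> monomials J D \<subseteq> monomials J E"
 unfolding monomials_def by (intro image_mono PiE_mono) auto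

lemma span_monomials_mono: "D <= E ==> cfun.span (monomials J D) \<subseteq> cfun.span (monomials J E)"
 by (intro cfun.span_mono monomials_mono)

lemma monomials_mult:
 assumes "u \<in> monomials J D" "w \<in> monomials J E"
 shows "(%t. u t * w t) \<in> monomials J (D + E)"
proof -
 obtain a b where a: "a \<in> PiE J (%_. {..D})" "u = (%t. \<Prod>j\<in>J. t j ^ a j)"
  and b: "b \<in> PiE J (%_. {..E})" "w = (%t. \<Prod>j\<in>J. t j ^ b j)"
  using assms unfolding monomials_def by (elim imageE) (rule that)
 define c where "c = restrict (%j. a j + b j) J"
 have "(%t. u t * w t) = (%t. \<Prod>j\<in>J. t j ^ c j)"
  unfolding a(2) b(2) prod.distrib[symmetric] c_def
  by (intro ext prod.cong) (auto simp: power_add)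
 moreover have "a j + b j <= D + E" if "j \<in> J" for j
  using that a(1) b(1) by (intro add_mono) (auto simp: PiE_iff)
 hence "c \<in> PiE J (%_. {..D + E})" by (auto simp: c_def)
 ultimately show ?thesis unfolding monomials_def by blast
qed

lemma span_monomials_mult:
 assumes f: "f \<in> cfun.span (monomials J D)" and g: "g \<in> cfun.span (monomials J E)"
 shows "(%t. f t * g t) \<in> cfun.span (monomials J (D + E))"
proof -
 let ?V = "cfun.span (monomials J (D + E))"
 have sub: "cfun.subspace {f. (%t. f t * g t) \<in> ?V}" for g
 proof (rule cfun.subspaceI)
  show "0 \<in> {f. (%t. f t * g t) \<in> ?V}" using cfun.span_zero by (simp add: zero_fun_def)
 next
  fix x y assume "x \<in> {f. (%t. f t * g t) \<in> ?V}" "y \<in> {f. (%t. f t * g t) \<in> ?V}"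
  thus "x + y \<in> {f. (%t. f t * g t) \<in> ?V}"
   using cfun.span_add[of "%t. x t * g t" _ "%t. y t * g t"] by (simp add: plus_fun_def distrib_right)
 next
  fix c x assume "x \<in> {f. (%t. f t * g t) \<in> ?V}"
  thus "(%i. c * x i) \<in> {f. (%t. f t * g t) \<in> ?V}"
   using cfun.span_scale[of "%t. x t * g t" _ c] by (simp add: mult.assoc)
 qed
 have 1: "(%t. u t * g t) \<in> ?V" if u: "u \<in> monomials J D" for u
 proof -
  have "(%t. g t * u t) \<in> ?V"
  proof (rule cfun.span_induct[OF g, where P = "%g. (%t. g t * u t) \<in> ?V"])
   show "cfun.subspace {g. (%t. g t * u t) \<in> ?V}" by (rule sub)
   fix w assume "w \<in> monomials J E"
   with monomials_mult[OF u this] show "(%t. w t * u t) \<in> ?V"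
    by (simp add: mult.commute cfun.span_base)
  qed
  thus ?thesis by (simp add: mult.commute)
 qed
 show ?thesis
  by (rule cfun.span_induct[OF f, where P = "%f. (%t. f t * g t) \<in> ?V"]) (use sub 1 in auto)
qed

lemma span_monomials_const: "(%t. c) \<in> cfun.span (monomials J D)"
proof -
 have "(%t. \<Prod>j\<in>J. t j ^ restrict (%_. 0) J j) \<in> monomials J D" unfolding monomials_def by (rule imageI) auto
 moreover have "(%t. \<Prod>j\<in>J. t j ^ restrict (%_. 0) J j) = (%t. 1::complex)" for J :: "'a set" by (rule ext) simp
 ultimately have "(%t. 1) \<in> monomials J D" by metis
 from cfun.span_scale[OF cfun.span_base[OF this], of c] show ?thesis by simp
qed

lemma poly_funs_in_span_monomials:
 assumes J: "finite J" and "f \<in> poly_funs J"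
 shows "\<exists>D. f \<in> cfun.span (monomials J D)"
 using assms(2)
proof (induction rule: poly_funs.induct)
 case (const c)
 then show ?case using span_monomials_const by blast
next
 case (coord i)
 define b where "b = restrict (%j. if j = i then 1 else 0 :: nat) J"
 have "(\<Prod>j\<in>J. t j ^ b j) = t i" for t :: "'a => complex"
 proof -
  have "(\<Prod>j\<in>J. t j ^ b j) = (\<Prod>j\<in>J. if j = i then t j else 1)"
   by (rule prod.cong) (auto simp: b_def)
  thus ?thesis using coord J by (simp add: prod.delta)
 qed
 moreover have "(%t. \<Prod>j\<in>J. t j ^ b j) \<in> monomials J 1"
  unfolding monomials_def by (rule imageI) (auto simp: b_def)
 ultimately have "(%t. t i) \<in> monomials J 1" by simp
 then show ?case using cfun.span_base by blast
next
 case (add f g)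
 then obtain D E where DE: "f \<in> cfun.span (monomials J D)" "g \<in> cfun.span (monomials J E)" by blast
 hence "f \<in> cfun.span (monomials J (max D E))" "g \<in> cfun.span (monomials J (max D E))"
  using span_monomials_mono[of D "max D E" J] span_monomials_mono[of E "max D E" J] by auto
 from cfun.span_add[OF this] show ?case by (auto simp: plus_fun_def)
next
 case (mult f g)
 then show ?case using span_monomials_mult by blast
qed

lemma span_monomials_power:
 "f \<in> cfun.span (monomials J D) ==> (%t. f t ^ k) \<in> cfun.span (monomials J (D * k))"
 by (induction k) (auto simp: span_monomials_const dest: span_monomials_mult)

lemma span_monomials_prod:
 "finite A ==> (!!a. a \<in> A ==> f a \<in> cfun.span (monomials J D)) ==>
  (%t. \<Prod>a\<in>A. f a t) \<in> cfun.span (monomials J (D * card A))"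
 by (induction A rule: finite_induct) (auto simp: span_monomials_const dest: span_monomials_mult)

text \<open>
Pull \<open>k\<close> algebraically independent functions back along the finitely many charts. The \<open>(d+1)^k\<close> monomials of degree at most \<open>d\<close> in each become, with denominators cleared, polynomials in \<open>card J\<close> parameters of degree \<open>O(d)\<close>. If \<open>k > card J\<close>, then for large \<open>d\<close> a combination vanishes in every chart.
\<close>

lemma chain_length_le_parameters:
 fixes \<phi> :: "'c => ('j => complex) => 'i => complex"
 assumes J: "finite J" and C: "finite C"
  and D: "!!c. c \<in> C ==> D c \<in> poly_funs J"
  and \<phi>: "!!c i. c \<in> C ==> i \<in> I ==> \<exists>k. \<exists>F\<in>poly_funs J. \<forall>t\<in>{t. D c t ~= 0}. D c t ^ k * \<phi> c t i = F t"
  and Y: "Y \<subseteq> (\<Union>c\<in>C. \<phi> c ` {t. D c t ~= 0})"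
  and Z: "!!j. j <= k ==> zariski_closed I (Z j)" "!!j. j <= k ==> zariski_irreducible I (Z j)"
  "!!j. j < k ==> Z j \<subset> Z (Suc j)" "Z k \<subseteq> Y"
 shows "k <= card J"
proof (rule ccontr)
 assume "~ k <= card J"
 hence km: "Suc (card J) <= k" by simp
 have "\<exists>f. (\<forall>j<k. f j \<in> poly_funs I) &
  (\<forall>d c. (\<forall>p\<in>Z k. (\<Sum>a\<in>PiE {..<k} (%_. {..d}). c a * (\<Prod>j<k. f j p ^ a j)) = 0) -->
    (\<forall>a\<in>PiE {..<k} (%_. {..d::nat}). c a = 0))"
  by (rule chain_algebraically_independent; rule Z; assumption)
 then obtain f where f0: "(\<forall>j<k. f j \<in> poly_funs I) &
  (\<forall>d c. (\<forall>p\<in>Z k. (\<Sum>a\<in>PiE {..<k} (%_. {..d}). c a * (\<Prod>j<k. f j p ^ a j)) = 0) -->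
    (\<forall>a\<in>PiE {..<k} (%_. {..d::nat}). c a = 0))" by (elim exE) (rule that)
 have f: "f j \<in> poly_funs I" if "j < k" for j using mp[OF spec[OF conjunct1[OF f0]] that] .
 have ind: "\<forall>a\<in>PiE {..<k} (%_. {..d::nat}). c a = 0"
  if z: "!!p. p \<in> Z k ==> (\<Sum>a\<in>PiE {..<k} (%_. {..d}). c a * (\<Prod>j<k. f j p ^ a j)) = 0" for d c
  using mp[OF spec[OF spec[OF conjunct2[OF f0]]] ballI[OF z]] .
 define Q where "Q c j eF \<longleftrightarrow> snd eF \<in> poly_funs J &
  (\<forall>t. D c t ~= 0 --> D c t ^ fst eF * f j (\<phi> c t) = snd eF t)" for c j eF
 have exQ: "\<exists>eF. Q c j eF" if cj: "c \<in> C" "j < k" for c j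
 proof -
  have "\<exists>e. \<exists>F\<in>poly_funs J. \<forall>t\<in>{t. D c t ~= 0}. D c t ^ e * f j (\<phi> c t) = F t"
   by (rule poly_funs_compose_rational[OF f[OF cj(2)] D[OF cj(1)]]) (rule \<phi>[OF cj(1)])
  then obtain e F where "F \<in> poly_funs J" "\<forall>t\<in>{t. D c t ~= 0}. D c t ^ e * f j (\<phi> c t) = F t"
   by (elim exE bexE) (rule that)
  hence "Q c j (e, F)" unfolding Q_def by simp
  thus ?thesis by (rule exI)
 qed
 define e0 where "e0 x = fst (SOME eF. Q (fst x) (snd x) eF)" for x
 define F0 where "F0 x = snd (SOME eF. Q (fst x) (snd x) eF)" for x
 have Q: "Q c j (e0 (c, j), F0 (c, j))" if cj: "c \<in> C" "j < k" for c j
  using someI_ex[OF exQ[OF cj]] unfolding e0_def F0_def by simp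
 have F0: "F0 (c, j) \<in> poly_funs J" if cj: "c \<in> C" "j < k" for c j
  using Q[OF cj] unfolding Q_def by simp
 have F0e: "D c t ^ e0 (c, j) * f j (\<phi> c t) = F0 (c, j) t" if cj: "c \<in> C" "j < k" "D c t ~= 0" for c j t
  using Q[OF cj(1,2)] cj(3) unfolding Q_def by simp
 define e where "e = (\<Sum>x\<in>C \<times> {..<k}. e0 x)"
 have e: "e0 (c, j) <= e" if "c \<in> C" "j < k" for c j
  unfolding e_def using C that by (intro member_le_sum) auto
 define F where "F c j t = D c t ^ (e - e0 (c, j)) * F0 (c, j) t" for c j t
 have Fp: "F c j \<in> poly_funs J" if "c \<in> C" "j < k" for c j
  unfolding F_def using that F0 D by (intro poly_funs.mult poly_funs_power) auto
 have Fe: "F c j t = D c t ^ e * f j (\<phi> c t)" if "c \<in> C" "j < k" "D c t ~= 0" for c j t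
  unfolding F_def F0e[OF that, symmetric] using e[OF that(1,2)]
  by (simp add: mult.assoc[symmetric] power_add[symmetric])
 have exM: "\<exists>M. F c j \<in> cfun.span (monomials J M) & D c \<in> cfun.span (monomials J M)"
  if cj: "c \<in> C" "j < k" for c j
 proof -
  obtain A B where AB: "F c j \<in> cfun.span (monomials J A)" "D c \<in> cfun.span (monomials J B)"
   using poly_funs_in_span_monomials[OF J Fp[OF cj]] poly_funs_in_span_monomials[OF J D[OF cj(1)]] by blast
  show ?thesis
   using AB span_monomials_mono[of A "A + B" J] span_monomials_mono[of B "A + B" J]
   by (intro exI[of _ "A + B"]) auto
 qed
 define M0 where "M0 x = (SOME M. F (fst x) (snd x) \<in> cfun.span (monomials J M) & D (fst x) \<in> cfun.span (monomials J M))" for x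
 have M0: "F c j \<in> cfun.span (monomials J (M0 (c, j)))" "D c \<in> cfun.span (monomials J (M0 (c, j)))"
  if cj: "c \<in> C" "j < k" for c j
  using someI_ex[OF exM[OF cj]] unfolding M0_def by simp_all
 define M where "M = (\<Sum>x\<in>C \<times> {..<k}. M0 x)"
 have M: "M0 (c, j) <= M" if "c \<in> C" "j < k" for c j
  unfolding M_def using C that by (intro member_le_sum) auto
 have FM: "F c j \<in> cfun.span (monomials J M)" and DM: "D c \<in> cfun.span (monomials J M)"
  if "c \<in> C" "j < k" for c j
  using M0[OF that] span_monomials_mono[OF M[OF that], of J] by auto
 define N where "N = (M + M * e) * k + 1"
 define d where "d = card C * N ^ card J"
 let ?P = "PiE {..<k} (%_. {..d})"
 define H where "H c a t = (\<Prod>j<k. F c j t ^ a j * D c t ^ (e * (d - a j)))" for c a t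
 have Hspan: "H c a \<in> cfun.span (monomials J (N * d))" if c: "c \<in> C" and a: "a \<in> ?P" for c a
 proof -
  have fac: "(%t. F c j t ^ a j * D c t ^ (e * (d - a j))) \<in> cfun.span (monomials J ((M + M * e) * d))"
   if j: "j \<in> {..<k}" for j
  proof -
   have j': "j < k" using j by simp
   have "a j <= d" using a j by (auto simp: PiE_iff)
   hence "M * a j + M * (e * (d - a j)) <= M * d + M * (e * d)" by (intro add_mono mult_left_mono) auto
   also have "... = (M + M * e) * d" by (simp add: algebra_simps)
   finally have le: "M * a j + M * (e * (d - a j)) <= (M + M * e) * d" .
   show ?thesis
    using span_monomials_mult[OF span_monomials_power[OF FM[OF c j'], of "a j"]
      span_monomials_power[OF DM[OF c j'], of "e * (d - a j)"]] span_monomials_mono[OF le] by auto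
  qed
  have "H c a \<in> cfun.span (monomials J ((M + M * e) * d * card {..<k}))"
   unfolding H_def by (rule span_monomials_prod[OF finite_lessThan]) (rule fac)
  hence "H c a \<in> cfun.span (monomials J ((M + M * e) * d * k))" by simp
  moreover have "(M + M * e) * d * k <= N * d" unfolding N_def by (simp add: algebra_simps)
  ultimately show ?thesis using span_monomials_mono by blast
 qed
 have He: "H c a t = D c t ^ (e * d * k) * (\<Prod>j<k. f j (\<phi> c t) ^ a j)" if "c \<in> C" "a \<in> ?P" "D c t ~= 0" for c a t
 proof -
  have "F c j t ^ a j * D c t ^ (e * (d - a j)) = D c t ^ (e * d) * f j (\<phi> c t) ^ a j" if j: "j \<in> {..<k}" for j
  proof -
   have "a j <= d" using `a \<in> ?P` j by (auto simp: PiE_iff)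
   hence "e * a j + e * (d - a j) = e * d" by (simp add: distrib_left[symmetric])
   thus ?thesis using Fe[OF `c \<in> C` _ `D c t ~= 0`, of j] j
    by (simp add: power_mult_distrib power_mult[symmetric] power_add[symmetric] mult_ac)
  qed
  hence "H c a t = (\<Prod>j<k. D c t ^ (e * d) * f j (\<phi> c t) ^ a j)" unfolding H_def by (intro prod.cong) auto
  also have "... = D c t ^ (e * d * k) * (\<Prod>j<k. f j (\<phi> c t) ^ a j)"
   by (simp add: prod.distrib power_mult)
  finally show ?thesis .
 qed
 have fm: "finite (monomials J (N * d))" by (rule finite_monomials[OF J])
 have "\<exists>u. H c a = (\<Sum>\<mu>\<in>monomials J (N * d). (%t. u \<mu> * \<mu> t))" if "c \<in> C" "a \<in> ?P" for c a
  using Hspan[OF that] unfolding cfun.span_finite[OF fm] by auto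
 hence exU: "!!c a. c \<in> C ==> a \<in> ?P ==> \<exists>u. H c a = (\<Sum>\<mu>\<in>monomials J (N * d). (%t. u \<mu> * \<mu> t))" .
 define U where "U c a = (SOME u. H c a = (\<Sum>\<mu>\<in>monomials J (N * d). (%t. u \<mu> * \<mu> t)))" for c a
 have U: "H c a = (\<Sum>\<mu>\<in>monomials J (N * d). (%t. U c a \<mu> * \<mu> t))" if "c \<in> C" "a \<in> ?P" for c a
  using someI_ex[OF exU[OF that]] unfolding U_def .
 (* One unknown for each monomial in the f j, one equation for each chart and monomial in its parameters. *)
 have "card (C \<times> monomials J (N * d)) <= card C * (N * d + 1) ^ card J"
  unfolding card_cartesian_product using card_monomials[OF J] by simp
 also have "... <= card C * (N * (d + 1)) ^ card J"
  by (intro mult_left_mono power_mono) (auto simp: N_def)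
 also have "... = d * (d + 1) ^ card J" by (simp only: power_mult_distrib mult.assoc[symmetric] d_def[symmetric])
 also have "... < (d + 1) * (d + 1) ^ card J" by simp
 also have "... <= (d + 1) ^ k" using power_increasing[OF km, of "d + 1"] by simp
 also have "... = card ?P" by (simp add: card_PiE)
 finally have card: "card (C \<times> monomials J (N * d)) < card ?P" .
 have fP: "finite ?P" by (intro finite_PiE) auto
 obtain x where x0: "(\<forall>a. a \<notin> ?P --> x a = 0) & (\<exists>a\<in>?P. x a ~= 0) &
   (\<forall>e\<in>C \<times> monomials J (N * d). (\<Sum>a\<in>?P. U (fst e) a (snd e) * x a) = 0)"
  using more_unknowns_than_equations[OF finite_cartesian_product[OF C fm] fP card, of "%e a. U (fst e) a (snd e)"]
  by (elim exE) (rule that)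
 have x: "\<exists>a\<in>?P. x a ~= 0" using x0 by (elim conjE)
 have eq: "(\<Sum>a\<in>?P. U c a \<mu> * x a) = 0" if "c \<in> C" "\<mu> \<in> monomials J (N * d)" for c \<mu>
  using bspec[OF conjunct2[OF conjunct2[OF x0]], of "(c, \<mu>)"] that by simp
 have "(\<Sum>a\<in>?P. x a * (\<Prod>j<k. f j p ^ a j)) = 0" if p: "p \<in> Z k" for p
 proof -
  have "p \<in> (\<Union>c\<in>C. \<phi> c ` {t. D c t ~= 0})" using p Z(4) Y by blast
  then obtain c t where ct: "c \<in> C" "D c t ~= 0" "p = \<phi> c t" by (elim UN_E imageE) simp
  have "D c t ^ (e * d * k) * (\<Sum>a\<in>?P. x a * (\<Prod>j<k. f j p ^ a j)) = (\<Sum>a\<in>?P. x a * H c a t)"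
   unfolding sum_distrib_left by (intro sum.cong) (auto simp: He[OF ct(1) _ ct(2)] ct(3))
  also have "... = (\<Sum>a\<in>?P. \<Sum>\<mu>\<in>monomials J (N * d). x a * (U c a \<mu> * \<mu> t))"
   by (intro sum.cong refl) (simp add: U[OF ct(1)] cfun_sum sum_distrib_left)
  also have "... = (\<Sum>\<mu>\<in>monomials J (N * d). \<mu> t * (\<Sum>a\<in>?P. U c a \<mu> * x a))"
   by (subst sum.swap) (simp add: sum_distrib_left mult_ac)
  also have "... = 0" using eq[OF ct(1)] by simp
  finally show ?thesis using ct(2) by simp
 qed
 from ind[OF this] x show False by blast
qed

lemma local_dim_le:
 assumes "!!k Z. (!!j. j <= k ==> zariski_closed I (Z j)) ==> (!!j. j <= k ==> zariski_irreducible I (Z j)) ==>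
  (!!j. j < k ==> Z j \<subset> Z (Suc j)) ==> Z k \<subseteq> Y ==> k <= m"
 shows "local_dim I Y p <= enat m"
 unfolding local_dim_def
proof (rule Sup_least)
 fix x assume "x \<in> {enat k | k. \<exists>Z. p \<in> Z 0 & Z k \<subseteq> Y &
   (\<forall>j\<le>k. zariski_closed I (Z j) & zariski_irreducible I (Z j)) & (\<forall>j<k. Z j \<subset> Z (Suc j))}"
 then obtain k Z where xk: "x = enat k" and Z: "Z k \<subseteq> Y"
   "\<forall>j\<le>k. zariski_closed I (Z j) & zariski_irreducible I (Z j)" "\<forall>j<k. Z j \<subset> Z (Suc j)" by blast
 have "k <= m" by (rule assms[of k Z]) (use Z in blast)+
 thus "x <= enat m" using xk by simp
qed

text \<open>
\<open>\<phi>\<close> and \<open>\<psi>\<close> are inverse to each other between \<open>Y\<close> and the set \<open>D \<noteq> 0\<close>. Differentiating both compositions gives the dimension of the tangent space; the images of coordinate subspaces are an irreducible chain through the base point. Irreducibility is tested on the line that joins two parameter points.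
\<close>

lemma rational_chart:
 fixes \<psi> :: "'j => ('i => complex) => complex"
 assumes I: "finite I" and J: "finite J" and Y: "zariski_closed I Y"
  and \<psi>: "!!j. j \<in> J ==> \<psi> j \<in> poly_funs I"
  and D: "D \<in> poly_funs J" "D (%_. 0) ~= 0"
  and \<phi>: "!!i. i \<in> I ==> \<exists>k. \<exists>F\<in>poly_funs J. \<forall>t\<in>{t. D t ~= 0}. D t ^ k * \<phi> t i = F t"
  and \<phi>Y: "!!t. D t ~= 0 ==> \<phi> t \<in> Y" "!!t j. D t ~= 0 ==> j \<in> J ==> \<psi> j (\<phi> t) = t j"
  and Y\<phi>: "!!p. p \<in> Y ==> D (%j. \<psi> j p) ~= 0" "!!p. p \<in> Y ==> \<phi> (%j. \<psi> j p) = p"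
 shows "cfun.dim (tangent_space I Y (\<phi> (%_. 0))) = card J" (is ?dim)
  and "enat (card J) <= local_dim I Y (\<phi> (%_. 0))" (is ?loc)
proof -
 let ?p = "\<phi> (%_. 0)"
 define F where "F i = (SOME kF. snd kF \<in> poly_funs J & (\<forall>t. D t ~= 0 --> D t ^ fst kF * \<phi> t i = snd kF t))" for i
 have F: "snd (F i) \<in> poly_funs J & (\<forall>t. D t ~= 0 --> D t ^ fst (F i) * \<phi> t i = snd (F i) t)" if "i \<in> I" for i
  unfolding F_def
 proof (rule someI_ex)
  from \<phi>[OF that] obtain k G where "G \<in> poly_funs J" "\<forall>t\<in>{t. D t ~= 0}. D t ^ k * \<phi> t i = G t"
   by (elim exE bexE) (rule that)
  thus "\<exists>kF. snd kF \<in> poly_funs J & (\<forall>t. D t ~= 0 --> D t ^ fst kF * \<phi> t i = snd kF t)"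
   by (intro exI[of _ "(k, G)"]) simp
 qed
 have Fp: "snd (F i) \<in> poly_funs J" if "i \<in> I" for i using F[OF that] by (rule conjunct1)
 have Fe: "D t ^ fst (F i) * \<phi> t i = snd (F i) t" if "i \<in> I" "D t ~= 0" for i t
  using mp[OF spec[OF conjunct2[OF F[OF that(1)]]] that(2)] .
 have pY: "?p \<in> Y" by (rule \<phi>Y(1)[OF D(2)])
 have Dcong: "D t = D t'" if "!!j. j \<in> J ==> t j = t' j" for t t' by (rule poly_funs_cong[OF D(1) that])
 have \<psi>0: "\<psi> j ?p = 0" if "j \<in> J" for j using \<phi>Y(2)[OF D(2) that] .
 show ?dim
 proof (rule antisym)
  show "cfun.dim (tangent_space I Y ?p) <= card J"
  proof (rule dim_le_card_functionals[OF I J subspace_tangent_space[OF I] tangent_space_affine, where L = "%j i. grad I (\<psi> j) i ?p"])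
   fix v assume v: "v \<in> tangent_space I Y ?p" and z: "!!j. j \<in> J ==> (\<Sum>i\<in>I. grad I (\<psi> j) i ?p * v i) = 0"
   let ?c = "%s i. ?p i + s * v i"
   have vi: "v i = 0" if i: "i \<in> I" for i
   proof -
    let ?G = "%p. D (%j. \<psi> j p) ^ fst (F i) * p i - snd (F i) (%j. \<psi> j p)"
    have "?G \<in> poly_funs I"
     by (intro poly_funs_diff poly_funs.mult poly_funs_power poly_funs_compose[OF D(1)]
       poly_funs_compose[OF Fp[OF i]] \<psi> poly_funs.coord i)
    moreover have "?G p = 0" if "p \<in> Y" for p
     using Fe[OF i Y\<phi>(1)[OF that]] Y\<phi>(2)[OF that] by simp
    ultimately have "?G \<in> vanishing_ideal I Y" unfolding vanishing_ideal_def by simp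
    with v have d0: "((%s. ?G (?c s)) has_field_derivative 0) (at 0)"
     unfolding tangent_space_def mem_Collect_eq by (elim conjE) (drule (1) bspec, simp)
    have d\<psi>: "((%s. \<psi> j (?c s)) has_field_derivative 0) (at 0)" if "j \<in> J" for j
     using grad_line[OF I \<psi>[OF that], of ?p v] z[OF that] by simp
    have c0: "?c 0 = ?p" by simp
    have dD: "((%s. D (%j. \<psi> j (?c s))) has_field_derivative 0) (at 0)"
     using grad_chain[OF J D(1) d\<psi>] by simp
    have dF: "((%s. snd (F i) (%j. \<psi> j (?c s))) has_field_derivative 0) (at 0)"
     using grad_chain[OF J Fp[OF i] d\<psi>] by simp
    have "((%s. D (%j. \<psi> j (?c s)) ^ fst (F i)) has_field_derivative 0) (at 0)"
     using DERIV_power[OF dD, of "fst (F i)"] by simp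
    moreover have "((%s. ?c s i) has_field_derivative v i) (at 0)"
     by (auto intro!: derivative_eq_intros)
    ultimately have "((%s. ?G (?c s)) has_field_derivative
      (0 * ?c 0 i + v i * D (%j. \<psi> j (?c 0)) ^ fst (F i) - 0)) (at 0)"
     by (intro DERIV_diff DERIV_mult dF)
    from DERIV_unique[OF this d0] have "v i * D (%j. \<psi> j ?p) ^ fst (F i) = 0" by simp
    thus ?thesis using Y\<phi>(1)[OF pY] by simp
   qed
   show "v = 0"
   proof
    fix i show "v i = 0 i"
     using vi v tangent_space_affine[of I Y ?p] by (cases "i \<in> I") (auto simp: affine_space_def)
   qed
  qed
  define e where "e j l = (if l = j then 1 else 0 :: complex)" for j l :: 'j
  have D0: "((%s. D (%l. s * e j l)) \<longlongrightarrow> D (%l. 0)) (at 0)" for j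
  proof (rule tendsto_poly_funs[OF D(1)])
   fix l show "((%s. s * e j l) \<longlongrightarrow> 0) (at 0)" by (auto intro!: tendsto_eq_intros)
  qed
  have Dne: "\<forall>\<^sub>F s in at 0. D (%l. s * e j l) ~= 0" for j
   using tendsto_imp_eventually_ne[OF D0 D(2)] .
  have "\<exists>d. ((%s. \<phi> (%l. s * e j l) i) has_field_derivative d) (at 0)" if i: "i \<in> I" for i j
  proof -
   have 1: "((%s. snd (F i) (%l. 0 + s * e j l)) has_field_derivative (\<Sum>l\<in>J. grad J (snd (F i)) l (%_. 0) * e j l)) (at 0)"
    by (rule grad_line[OF J Fp[OF i]])
   have "((%s. D (%l. 0 + s * e j l)) has_field_derivative (\<Sum>l\<in>J. grad J D l (%_. 0) * e j l)) (at 0)"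
    by (rule grad_line[OF J D(1)])
   from DERIV_divide[OF 1 DERIV_power[OF this, of "fst (F i)"]] D(2) obtain d where
    d: "((%s. snd (F i) (%l. s * e j l) / D (%l. s * e j l) ^ fst (F i)) has_field_derivative d) (at 0)"
    by auto
   have ev: "\<forall>\<^sub>F s in nhds 0. snd (F i) (%l. s * e j l) / D (%l. s * e j l) ^ fst (F i) = \<phi> (%l. s * e j l) i"
    unfolding eventually_nhds_conv_at
   proof
    show "\<forall>\<^sub>F s in at 0. snd (F i) (%l. s * e j l) / D (%l. s * e j l) ^ fst (F i) = \<phi> (%l. s * e j l) i"
     using Dne[of j] by eventually_elim (simp add: Fe[OF i, symmetric])
    show "snd (F i) (%l. 0 * e j l) / D (%l. 0 * e j l) ^ fst (F i) = \<phi> (%l. 0 * e j l) i"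
     using D(2) by (simp add: Fe[OF i, symmetric])
   qed
   show ?thesis by (rule exI[of _ d], rule iffD1[OF DERIV_cong_ev[OF refl ev refl] d])
  qed
  hence exd: "!!i j. i \<in> I ==> \<exists>d. ((%s. \<phi> (%l. s * e j l) i) has_field_derivative d) (at 0)" .
  define u where "u j i = (if i \<in> I then SOME d. ((%s. \<phi> (%l. s * e j l) i) has_field_derivative d) (at 0) else 0)" for j i
  have u: "((%s. \<phi> (%l. s * e j l) i) has_field_derivative u j i) (at 0)" if "i \<in> I" for i j
   using someI_ex[OF exd[OF that]] that unfolding u_def by simp
  show "card J <= cfun.dim (tangent_space I Y ?p)"
  proof (rule card_le_dim[OF I tangent_space_affine J, where u = u])
   fix j assume j: "j \<in> J"
   show "u j \<in> tangent_space I Y ?p"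
   proof (rule tangent_space_rational_map[OF J I _ D \<phi>, where B = "e j" and Q = UNIV])
    show "e j \<in> tangent_space J UNIV (%_. 0)"
     unfolding tangent_space_def vanishing_ideal_def using j by (auto simp: e_def affine_space_def)
    show "u j \<in> affine_space I" by (auto simp: u_def affine_space_def)
    fix i assume "i \<in> I"
    from u[OF this] show "((%t. \<phi> (%l. 0 + t * e j l) i) has_field_derivative u j i) (at 0)" by simp
   qed (use \<phi>Y in auto)
  next
   fix x assume x: "!!i. (\<Sum>k\<in>J. x k * u k i) = 0"
   show "\<forall>k\<in>J. x k = 0"
   proof
    fix k assume k: "k \<in> J"
    have dj: "(\<Sum>i\<in>I. grad I (\<psi> k) i ?p * u j i) = e j k" if j: "j \<in> J" for j
    proof -
     have 1: "((%s. \<psi> k (\<phi> (%l. s * e j l))) has_field_derivative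
       (\<Sum>i\<in>I. grad I (\<psi> k) i (\<phi> (%l. 0 * e j l)) * u j i)) (at 0)"
      by (rule grad_chain[where c = "%s. \<phi> (%l. s * e j l)" and v = "u j", OF I \<psi>[OF k] u])
     have ev: "\<forall>\<^sub>F s in nhds 0. \<psi> k (\<phi> (%l. s * e j l)) = s * e j k"
      unfolding eventually_nhds_conv_at
     proof
      show "\<forall>\<^sub>F s in at 0. \<psi> k (\<phi> (%l. s * e j l)) = s * e j k"
       using Dne[of j] by eventually_elim (rule \<phi>Y(2)[OF _ k])
      show "\<psi> k (\<phi> (%l. 0 * e j l)) = 0 * e j k" using \<psi>0[OF k] by simp
     qed
     have "((%s. s * e j k) has_field_derivative e j k) (at 0)" by (auto intro!: derivative_eq_intros)
     from iffD2[OF DERIV_cong_ev[OF refl ev refl] this] 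
     have "((%s. \<psi> k (\<phi> (%l. s * e j l))) has_field_derivative e j k) (at 0)" .
     from DERIV_unique[OF this 1] show ?thesis by simp
    qed
    have "0 = (\<Sum>i\<in>I. grad I (\<psi> k) i ?p * (\<Sum>j\<in>J. x j * u j i))" unfolding x by simp
    also have "... = (\<Sum>j\<in>J. x j * (\<Sum>i\<in>I. grad I (\<psi> k) i ?p * u j i))"
     unfolding sum_distrib_left by (subst sum.swap) (simp add: mult_ac)
    also have "... = (\<Sum>j\<in>J. if j = k then x j else 0)"
     by (intro sum.cong refl) (auto simp: dj e_def)
    also have "... = x k" using k J by simp
    finally show "x k = 0" by simp
   qed
  qed
 qed
 obtain h where h: "bij_betw h {..<card J} J" using ex_bij_betw_nat_finite[OF J] by (auto simp: atLeast0LessThan)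
 (* The closed sets that correspond to coordinate subspaces of the parameter space. *)
 define Z where "Z r = {p \<in> Y. \<forall>g\<in>\<psi> ` (J - h ` {..<r}). g p = 0}" for r
 have Zi: "p \<in> Z r \<longleftrightarrow> p \<in> Y & (\<forall>j\<in>J - h ` {..<r}. \<psi> j p = 0)" for p r by (auto simp: Z_def)
 have closed: "zariski_closed I (Z r)" for r unfolding Z_def by (rule zariski_closed_cut[OF Y]) (use \<psi> in auto)
 have p0: "?p \<in> Z r" for r using \<psi>0 pY unfolding Zi by blast
 have irr: "zariski_irreducible I (Z r)" for r unfolding zariski_irreducible_def
 proof (intro conjI allI impI)
  show "Z r ~= {}" using p0 by blast
  fix Z1 Z2 assume Z1: "zariski_closed I Z1" and Z2: "zariski_closed I Z2" and un: "Z r = Z1 \<union> Z2"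
  show "Z r = Z1 \<or> Z r = Z2"
  proof (rule ccontr)
   assume "~ (Z r = Z1 \<or> Z r = Z2)"
   then obtain a b where ab: "a \<in> Z r" "a \<notin> Z1" "b \<in> Z r" "b \<notin> Z2" using un by blast
   have aff: "Z r \<subseteq> affine_space I" by (rule zariski_closed_affine[OF closed])
   obtain f where f: "f \<in> poly_funs I" "\<forall>q\<in>Z1. f q = 0" "f a ~= 0"
    using zariski_closed_separates[OF Z1 subsetD[OF aff ab(1)] ab(2)] by blast
   obtain g where g: "g \<in> poly_funs I" "\<forall>q\<in>Z2. g q = 0" "g b ~= 0"
    using zariski_closed_separates[OF Z2 subsetD[OF aff ab(3)] ab(4)] by blast
   have exf: "\<exists>k. \<exists>F\<in>poly_funs J. \<forall>t\<in>{t. D t ~= 0}. D t ^ k * f (\<phi> t) = F t" if "f \<in> poly_funs I" for f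
    by (rule poly_funs_compose_rational[OF that D(1)]) (rule \<phi>)
   obtain k1 F1 where F1: "F1 \<in> poly_funs J" "\<forall>t\<in>{t. D t ~= 0}. D t ^ k1 * f (\<phi> t) = F1 t"
    using exf[OF f(1)] by (elim exE bexE) (rule that)
   obtain k2 F2 where F2: "F2 \<in> poly_funs J" "\<forall>t\<in>{t. D t ~= 0}. D t ^ k2 * g (\<phi> t) = F2 t"
    using exf[OF g(1)] by (elim exE bexE) (rule that)
   have aY: "a \<in> Y" and bY: "b \<in> Y" using ab by (auto simp: Zi)
   define \<alpha> where "\<alpha> j = \<psi> j a" for j
   define \<beta> where "\<beta> j = \<psi> j b - \<psi> j a" for j
   let ?t = "%s j. \<alpha> j + s * \<beta> j"
   have t0: "?t 0 = (%j. \<psi> j a)" and t1: "?t 1 = (%j. \<psi> j b)" by (auto simp: \<alpha>_def \<beta>_def)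
   obtain PD where PD: "!!s. D (?t s) = poly PD s" using poly_funs_on_line[OF D(1)] by blast
   obtain P1 where P1: "!!s. F1 (?t s) = poly P1 s" using poly_funs_on_line[OF F1(1)] by blast
   obtain P2 where P2: "!!s. F2 (?t s) = poly P2 s" using poly_funs_on_line[OF F2(1)] by blast
   have Da: "D (%j. \<psi> j a) ~= 0" and Db: "D (%j. \<psi> j b) ~= 0" using Y\<phi>(1) aY bY by auto
   have "F1 (?t 0) ~= 0" unfolding t0 using F1(2)[rule_format, of "%j. \<psi> j a"] Da Y\<phi>(2)[OF aY] f(3) by auto
   hence "P1 ~= 0" using P1[of 0] by auto
   moreover have "F2 (?t 1) ~= 0" unfolding t1 using F2(2)[rule_format, of "%j. \<psi> j b"] Db Y\<phi>(2)[OF bY] g(3) by auto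
   hence "P2 ~= 0" using P2[of 1] by auto
   moreover have "PD ~= 0" using PD[of 0] Da unfolding t0 by auto
   ultimately have "PD * P1 * P2 ~= 0" by simp
   then obtain s where s: "poly (PD * P1 * P2) s ~= 0" using poly_all_0_iff_0 by blast
   hence nz: "D (?t s) ~= 0" "F1 (?t s) ~= 0" "F2 (?t s) ~= 0" by (auto simp: PD P1 P2)
   have "\<phi> (?t s) \<in> Z r" unfolding Zi
   proof (intro conjI ballI)
    show "\<phi> (?t s) \<in> Y" by (rule \<phi>Y(1)[OF nz(1)])
    fix j assume j: "j \<in> J - h ` {..<r}"
    have "\<psi> j a = 0" "\<psi> j b = 0" using ab j by (auto simp: Zi)
    thus "\<psi> j (\<phi> (?t s)) = 0" using \<phi>Y(2)[OF nz(1), of j] j by (simp add: \<alpha>_def \<beta>_def)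
   qed
   hence "f (\<phi> (?t s)) = 0 \<or> g (\<phi> (?t s)) = 0" using un f(2) g(2) by blast
   thus False using F1(2) F2(2) nz by auto
  qed
 qed
 have strict: "Z r \<subset> Z (Suc r)" if r: "r < card J" for r
 proof
  show "Z r \<subseteq> Z (Suc r)" by (auto simp: Zi lessThan_Suc)
  define j where "j = h r"
  have j: "j \<in> J" using h r by (auto simp: j_def bij_betw_def)
  have jr: "j \<notin> h ` {..<r}"
  proof
   assume "j \<in> h ` {..<r}"
   then obtain x where "x < r" "h r = h x" by (auto simp: j_def)
   with r bij_betw_imp_inj_on[OF h] show False by (auto dest: inj_onD[where x = r and y = x])
  qed
  let ?t = "%s l. 0 + s * (if l = j then 1 else 0)"
  obtain PD where PD0: "\<forall>s. D (?t s) = poly PD s"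
   using poly_funs_on_line[OF D(1), of "%_. 0" "%l. if l = j then 1 else 0"] by (elim exE) (rule that)
  have PD: "D (?t s) = poly PD s" for s using spec[OF PD0] .
  have "PD ~= 0" using PD[of 0] D(2) by auto
  hence "PD * [:0, 1:] ~= 0" by simp
  then obtain s where s: "poly (PD * [:0, 1:]) s ~= 0" using poly_all_0_iff_0 by blast
  hence "poly PD s ~= 0" and s0: "s ~= 0" by auto
  hence nz: "D (?t s) ~= 0" unfolding PD by simp
  have "\<phi> (?t s) \<in> Z (Suc r)" unfolding Zi
  proof (intro conjI ballI)
   show "\<phi> (?t s) \<in> Y" by (rule \<phi>Y(1)[OF nz(1)])
   fix l assume l: "l \<in> J - h ` {..<Suc r}"
   hence "l ~= j" by (auto simp: j_def)
   thus "\<psi> l (\<phi> (?t s)) = 0" using \<phi>Y(2)[OF nz(1), of l] l by simp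
  qed
  moreover have "\<psi> j (\<phi> (?t s)) ~= 0" using \<phi>Y(2)[OF nz(1) j] s0 by simp
  hence "\<phi> (?t s) \<notin> Z r" using j jr by (auto simp: Zi)
  ultimately show "Z r ~= Z (Suc r)" by blast
 qed
 show ?loc unfolding local_dim_def
  by (rule Sup_upper, rule CollectI, rule exI[of _ "card J"], rule conjI[OF refl], rule exI[of _ Z])
   (use p0 closed irr strict in \<open>auto simp: Zi\<close>)
qed

section \<open>Invertible and upper triangular matrices\<close>

lemma mat_mult_index:
 assumes "A \<in> carrier_mat n m" "B \<in> carrier_mat m k" "i < n" "j < k"
 shows "(A * B) $$ (i, j) = (\<Sum>l<m. A $$ (i, l) * B $$ (l, j))"
 using assms by (simp add: scalar_prod_def atLeast0LessThan cong: sum.cong_simp)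

lemma mult_carrier_square[simp]:
 "A \<in> carrier_mat n n ==> B \<in> carrier_mat n n ==> A * B \<in> carrier_mat n n"
 by (rule mult_carrier_mat)

lemma square_assoc:
 fixes A :: "complex mat"
 shows "A \<in> carrier_mat n n ==> B \<in> carrier_mat n n ==> C \<in> carrier_mat n n ==> A * B * C = A * (B * C)"
 by (rule assoc_mult_mat)

text \<open>
Cramer's formula makes the inverse a rational function of the entries.
\<close>

definition minv :: "complex mat => complex mat" where
 "minv g = (1 / det g) \<cdot>\<^sub>m adj_mat g"

lemma minv_carrier[simp]: "g \<in> carrier_mat n n ==> minv g \<in> carrier_mat n n"
 using adj_mat(1)[of g n] by (simp add: minv_def)

lemma mult_minv: "g \<in> carrier_mat n n ==> det g ~= 0 ==> g * minv g = 1\<^sub>m n"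
 unfolding minv_def using adj_mat(1,2)[of g n]
 by (simp add: mult_smult_distrib[of g n n "adj_mat g" n]) (rule eq_matI, auto)

lemma minv_mult: "g \<in> carrier_mat n n ==> det g ~= 0 ==> minv g * g = 1\<^sub>m n"
 unfolding minv_def using adj_mat(1,3)[of g n]
 by (simp add: mult_smult_assoc_mat[of "adj_mat g" n n g n]) (rule eq_matI, auto)

lemma GL_iff: "g \<in> GL n \<longleftrightarrow> g \<in> carrier_mat n n & det g ~= 0"
proof
 assume "g \<in> GL n"
 hence g: "g \<in> carrier_mat n n" and inv: "invertible_mat g" by (auto simp: GL_def)
 from inv obtain h where h: "g * h = 1\<^sub>m (dim_row g)" "h * g = 1\<^sub>m (dim_row h)"
  by (auto simp: invertible_mat_def inverts_mat_def)
 have "dim_col (g * h) = n" using h(1) g by simp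
 moreover have "dim_col (h * g) = n" using g by simp
 hence "dim_row h = n" using h(2) by simp
 ultimately have "h \<in> carrier_mat n n" by auto
 hence "det g * det h = 1" using det_mult[OF g, of h] h(1) g by simp
 thus "g \<in> carrier_mat n n & det g ~= 0" using g by auto
next
 assume g: "g \<in> carrier_mat n n & det g ~= 0"
 hence "g * minv g = 1\<^sub>m n" "minv g * g = 1\<^sub>m n" "minv g \<in> carrier_mat n n"
  using mult_minv minv_mult by auto
 moreover from this have "dim_row (minv g) = n" by auto
 ultimately have "invertible_mat g" unfolding invertible_mat_def inverts_mat_def
  using g by (intro conjI exI[of _ "minv g"]) auto
 thus "g \<in> GL n" using g unfolding GL_def by auto
qed

lemma GL_carrier: "g \<in> GL n ==> g \<in> carrier_mat n n" by (simp add: GL_iff)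
lemma GL_det: "g \<in> GL n ==> det g ~= 0" by (simp add: GL_iff)

lemma GL_mult: "g \<in> GL n ==> h \<in> GL n ==> g * h \<in> GL n"
 by (auto simp: GL_iff det_mult)

lemma GL_minv: "g \<in> GL n ==> minv g \<in> GL n"
proof -
 assume g: "g \<in> GL n"
 hence "det g * det (minv g) = 1"
  using det_mult[of g n "minv g"] mult_minv[of g n] by (simp add: GL_iff)
 thus ?thesis using g by (auto simp: GL_iff)
qed

lemma GL_cancel_left: "g \<in> GL n ==> A \<in> carrier_mat n k ==> minv g * (g * A) = A"
 using assoc_mult_mat[of "minv g" n n g n A k] minv_mult[of g n] by (simp add: GL_iff)

lemma GL_cancel_left': "g \<in> GL n ==> A \<in> carrier_mat n k ==> g * (minv g * A) = A"
 using assoc_mult_mat[of g n n "minv g" n A k] mult_minv[of g n] by (simp add: GL_iff)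

lemma GL_cancel_right: "g \<in> GL n ==> A \<in> carrier_mat k n ==> A * g * minv g = A"
 using assoc_mult_mat[of A k n g n "minv g" n] mult_minv[of g n] by (simp add: GL_iff)

lemma minv_unique:
 assumes "g \<in> carrier_mat n n" "h \<in> carrier_mat n n" "g * h = 1\<^sub>m n"
 shows "g \<in> GL n" "minv g = h"
proof -
 have "det g * det h = 1" using det_mult[OF assms(1,2)] assms(3) by simp
 hence "det g ~= 0" by force
 thus g: "g \<in> GL n" using assms(1) by (simp add: GL_iff)
 have "minv g * (g * h) = h" by (rule GL_cancel_left[OF g assms(2)])
 thus "minv g = h" using assms(3) minv_carrier[OF assms(1)] by simp
qed

lemma minv_mult_distrib:
 assumes "g \<in> GL n" "h \<in> GL n"
 shows "minv (g * h) = minv h * minv g"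
proof (rule minv_unique(2))
 note c = GL_carrier[OF assms(1)] GL_carrier[OF assms(2)]
 show "g * h \<in> carrier_mat n n" "minv h * minv g \<in> carrier_mat n n" using c by auto
 have "g * h * (minv h * minv g) = g * (h * (minv h * minv g))"
  using c by (simp add: square_assoc[of _ n])
 also have "h * (minv h * minv g) = minv g" using c by (intro GL_cancel_left'[OF assms(2), of _ n]) auto
 finally show "g * h * (minv h * minv g) = 1\<^sub>m n" using mult_minv assms(1) by (simp add: GL_iff)
qed

text \<open>
The first \<open>s\<close> columns lie in the span of the first \<open>s\<close> basis vectors; for invertible \<open>g\<close> they span it.
\<close>

definition brk :: "nat => complex mat => nat => bool" where
 "brk n g s \<longleftrightarrow> (\<forall>a b. s <= a --> a < n --> b < s --> g $$ (a, b) = 0)"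

abbreviation breaks :: "nat => complex mat => nat set" where
 "breaks n g \<equiv> {s \<in> {1..<n}. brk n g s}"

lemma brkD: "brk n g s ==> s <= a ==> a < n ==> b < s ==> g $$ (a, b) = 0"
 by (simp add: brk_def)

lemma brk_mult:
 assumes "g \<in> carrier_mat n n" "h \<in> carrier_mat n n" "brk n g s" "brk n h s" "s <= n"
 shows "brk n (g * h) s"
 unfolding brk_def
proof (intro allI impI)
 fix a b assume ab: "s <= a" "a < n" "b < s"
 have "(g * h) $$ (a, b) = (\<Sum>l<n. g $$ (a, l) * h $$ (l, b))"
  using ab assms(5) by (intro mat_mult_index[OF assms(1,2)]) auto
 also have "... = 0"
 proof (rule sum.neutral, rule ballI)
  fix l assume "l \<in> {..<n}"
  thus "g $$ (a, l) * h $$ (l, b) = 0"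
   using brkD[OF assms(3) ab(1,2), of l] brkD[OF assms(4) _ _ ab(3), of l] by (cases "l < s") auto
 qed
 finally show "(g * h) $$ (a, b) = 0" .
qed

text \<open>
An injective map of the span of the first \<open>s\<close> basis vectors to itself is onto, hence its inverse preserves that span.
\<close>

lemma brk_minv:
 assumes g: "g \<in> GL n" and b: "brk n g s" and sn: "s <= n"
 shows "brk n (minv g) s"
 unfolding brk_def
proof (intro allI impI)
 fix a c assume ac: "s <= a" "a < n" "c < s"
 note gc = GL_carrier[OF g]
 (* A system with one more unknown than equations: it asks for a combination of the first s columns that is a multiple of the c-th unit vector. *)
 define M where "M e k = (if k = s then (if e = c then -1 else 0) else g $$ (e, k))" for e k
 obtain x where x: "\<exists>k\<in>{..s}. x k ~= 0" "!!e. e < s ==> (\<Sum>k\<in>{..s}. M e k * x k) = 0"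
  using more_unknowns_than_equations[of "{..<s}" "{..s}" M] by auto
 define y where "y k = (if k < s then x k else 0)" for k
 have gy: "(\<Sum>k<n. g $$ (e, k) * y k) = (if e = c then x s else 0)" if e: "e < n" for e
 proof -
  have "(\<Sum>k<n. g $$ (e, k) * y k) = (\<Sum>k<s. g $$ (e, k) * x k)"
   using sn by (intro sum.mono_neutral_cong_right) (auto simp: y_def)
  also have "... = (if e = c then x s else 0)"
  proof (cases "e < s")
   case True
   have "(\<Sum>k\<in>{..s}. M e k * x k) = (\<Sum>k<s. g $$ (e, k) * x k) + M e s * x s"
    by (simp add: lessThan_Suc_atMost[symmetric] M_def)
   thus ?thesis using x(2)[OF True] by (auto simp: M_def split: if_splits)
  next
   case False
   thus ?thesis using ac e by (auto simp: brkD[OF b])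
  qed
  finally show ?thesis .
 qed
 have my: "y a = x s * minv g $$ (a, c)" if a: "a < n" for a
 proof -
  have one: "(\<Sum>e<n. minv g $$ (a, e) * g $$ (e, k)) = (if a = k then 1 else 0)" if k: "k < n" for k
   using mat_mult_index[OF minv_carrier[OF gc] gc a k] minv_mult[OF gc GL_det[OF g]] a k by simp
  have "(\<Sum>e<n. minv g $$ (a, e) * (\<Sum>k<n. g $$ (e, k) * y k)) =
    (\<Sum>k<n. (\<Sum>e<n. minv g $$ (a, e) * g $$ (e, k)) * y k)"
   unfolding sum_distrib_left sum_distrib_right by (subst sum.swap) (simp add: mult.assoc)
  also have "... = (\<Sum>k<n. if k = a then y k else 0)"
   by (intro sum.cong refl) (auto simp: one)
  also have "... = y a" using a by simp
  finally have "y a = (\<Sum>e<n. minv g $$ (a, e) * (\<Sum>k<n. g $$ (e, k) * y k))" by simp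
  also have "... = (\<Sum>e<n. if e = c then minv g $$ (a, e) * x s else 0)"
   by (intro sum.cong refl) (auto simp: gy)
  also have "... = x s * minv g $$ (a, c)" using ac sn by simp
  finally show ?thesis .
 qed
 have "x s ~= 0"
 proof
  assume xs: "x s = 0"
  obtain k where k: "k <= s" "x k ~= 0" using x(1) by auto
  hence "k < s" using xs by (cases "k = s") auto
  thus False using my[of k] k xs sn by (simp add: y_def)
 qed
 moreover have "y a = 0" using ac by (simp add: y_def)
 ultimately show "minv g $$ (a, c) = 0" using my[OF ac(2)] by simp
qed

lemma upper_triangular_iff_brk:
 "g \<in> carrier_mat n n ==> upper_triangular g \<longleftrightarrow> (\<forall>s\<le>n. brk n g s)"
proof
 assume g: "g \<in> carrier_mat n n" "upper_triangular g"
 thus "\<forall>s\<le>n. brk n g s" by (auto simp: brk_def)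
next
 assume g: "g \<in> carrier_mat n n" "\<forall>s\<le>n. brk n g s"
 show "upper_triangular g"
 proof
  fix i j assume "j < i" "i < dim_row g"
  thus "g $$ (i, j) = 0" using g brkD[of n g i i j] by auto
 qed
qed

lemma borel_iff: "b \<in> borel_subgroup n \<longleftrightarrow> b \<in> GL n & (\<forall>s\<le>n. brk n b s)"
 using upper_triangular_iff_brk GL_carrier by (auto simp: borel_subgroup_def)

lemma borel_GL: "b \<in> borel_subgroup n ==> b \<in> GL n" by (simp add: borel_iff)

lemma borel_carrier: "b \<in> borel_subgroup n ==> b \<in> carrier_mat n n"
 by (rule GL_carrier[OF borel_GL])

lemma borel_zero: "b \<in> borel_subgroup n ==> j < i ==> i < n ==> b $$ (i, j) = 0"
 using brkD[of n b i i j] by (auto simp: borel_iff)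

lemma borel_mult: "a \<in> borel_subgroup n ==> b \<in> borel_subgroup n ==> a * b \<in> borel_subgroup n"
 using brk_mult GL_carrier by (auto simp: borel_iff GL_mult)

lemma borel_minv: "b \<in> borel_subgroup n ==> minv b \<in> borel_subgroup n"
 by (auto simp: borel_iff GL_minv brk_minv)

lemma borel_one: "1\<^sub>m n \<in> borel_subgroup n"
 by (auto simp: borel_iff GL_iff brk_def)

lemma borel_diag:
 assumes "b \<in> borel_subgroup n" "i < n"
 shows "b $$ (i, i) ~= 0"
proof -
 have c: "b \<in> carrier_mat n n" using assms borel_GL GL_carrier by blast
 have "upper_triangular b" using assms by (simp add: borel_subgroup_def)
 from det_upper_triangular[OF this c] GL_det[OF borel_GL[OF assms(1)]] have "prod_list (diag_mat b) ~= 0" by simp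
 hence "0 \<notin> set (diag_mat b)" by (simp add: prod_list_zero_iff)
 thus ?thesis using assms c by (auto simp: diag_mat_def)
qed

lemma coset_mem: "g \<in> carrier_mat n n ==> g \<in> coset n g"
 unfolding coset_def using borel_one[of n] by (intro image_eqI[of _ _ "1\<^sub>m n"]) auto

lemma coset_mult:
 assumes g: "g \<in> carrier_mat n n" and b: "b \<in> borel_subgroup n"
 shows "coset n (g * b) = coset n g"
proof -
 note bc = borel_carrier[OF b]
 have 1: "coset n (g * b) \<subseteq> coset n g" if "g \<in> carrier_mat n n" "b \<in> borel_subgroup n" for g b
 proof
  fix x assume "x \<in> coset n (g * b)"
  then obtain c where c: "c \<in> borel_subgroup n" "x = g * b * c" by (auto simp: coset_def)
  have "x = g * (b * c)" unfolding c(2)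
   using that c(1) borel_GL GL_carrier by (simp add: square_assoc[of _ n])
  thus "x \<in> coset n g" using borel_mult[OF that(2) c(1)] by (auto simp: coset_def)
 qed
 have "coset n (g * b * minv b) \<subseteq> coset n (g * b)"
  using 1[of "g * b" "minv b"] g bc borel_minv[OF b] by auto
 moreover have "g * b * minv b = g" by (rule GL_cancel_right[OF borel_GL[OF b] g])
 ultimately show ?thesis using 1[OF g b] by simp
qed

lemma coset_eqD:
 assumes "h \<in> carrier_mat n n" "coset n g = coset n h"
 shows "\<exists>b\<in>borel_subgroup n. h = g * b"
 using coset_mem[OF assms(1)] assms(2) unfolding coset_def by auto

section \<open>Peterson matrices\<close>

definition hess :: "nat => complex mat => bool" where
 "hess n A \<longleftrightarrow> (\<forall>i j. i < n --> Suc j < i --> A $$ (i, j) = 0)"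

lemma hess_mult_borel:
 assumes "A \<in> carrier_mat n n" "hess n A" "b \<in> borel_subgroup n"
 shows "hess n (A * b)" "hess n (b * A)"
proof -
 note bc = borel_carrier[OF assms(3)]
 show "hess n (A * b)" unfolding hess_def
 proof (intro allI impI)
  fix i j assume ij: "i < n" "Suc j < i"
  have "(A * b) $$ (i, j) = (\<Sum>l<n. A $$ (i, l) * b $$ (l, j))"
   using ij by (intro mat_mult_index[OF assms(1) bc]) auto
  also have "... = 0"
  proof (rule sum.neutral, rule ballI)
   fix l assume "l \<in> {..<n}"
   thus "A $$ (i, l) * b $$ (l, j) = 0"
    using assms(2) ij borel_zero[OF assms(3), of j l] by (cases "l <= j") (auto simp: hess_def)
  qed
  finally show "(A * b) $$ (i, j) = 0" .
 qed
 show "hess n (b * A)" unfolding hess_def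
 proof (intro allI impI)
  fix i j assume ij: "i < n" "Suc j < i"
  have "(b * A) $$ (i, j) = (\<Sum>l<n. b $$ (i, l) * A $$ (l, j))"
   using ij by (intro mat_mult_index[OF bc assms(1)]) auto
  also have "... = 0"
  proof (rule sum.neutral, rule ballI)
   fix l assume "l \<in> {..<n}"
   thus "b $$ (i, l) * A $$ (l, j) = 0"
    using assms(2) ij borel_zero[OF assms(3), of l i] by (cases "l < i") (auto simp: hess_def)
  qed
  finally show "(b * A) $$ (i, j) = 0" .
 qed
qed

abbreviation "NN \<equiv> regular_nilpotent"

lemma NN_carrier[simp]: "NN n \<in> carrier_mat n n" by (simp add: regular_nilpotent_def)

lemma NN_mult_index:
 assumes "g \<in> carrier_mat n m" "a < n" "b < m"
 shows "(NN n * g) $$ (a, b) = (if Suc a < n then g $$ (Suc a, b) else 0)"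
proof -
 have "(NN n * g) $$ (a, b) = (\<Sum>l<n. NN n $$ (a, l) * g $$ (l, b))"
  by (rule mat_mult_index[OF NN_carrier assms])
 also have "... = (\<Sum>l<n. if l = Suc a then g $$ (l, b) else 0)"
  using assms by (intro sum.cong refl) (auto simp: regular_nilpotent_def)
 finally show ?thesis by simp
qed

text \<open>
Quantifying over \<open>A\<close> avoids the inverse of \<open>g\<close> and shows that only the coset of \<open>g\<close> matters.
\<close>

definition PM :: "nat => complex mat => bool" where
 "PM n g \<longleftrightarrow> g \<in> GL n & (\<exists>A\<in>carrier_mat n n. hess n A & NN n * g = g * A)"

lemma PM_GL: "PM n g ==> g \<in> GL n" by (simp add: PM_def)

lemma PM_iff_conj: "g \<in> GL n ==> PM n g \<longleftrightarrow> hess n (minv g * (NN n * g))"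
proof
 assume g: "g \<in> GL n" "PM n g"
 then obtain A where A: "A \<in> carrier_mat n n" "hess n A" "NN n * g = g * A" by (auto simp: PM_def)
 have "minv g * (NN n * g) = A" unfolding A(3) by (rule GL_cancel_left[OF g(1) A(1)])
 thus "hess n (minv g * (NN n * g))" using A by simp
next
 assume g: "g \<in> GL n" "hess n (minv g * (NN n * g))"
 note gc = GL_carrier[OF g(1)]
 show "PM n g" unfolding PM_def
 proof (intro conjI bexI[of _ "minv g * (NN n * g)"] g)
  show "NN n * g = g * (minv g * (NN n * g))"
   using GL_cancel_left'[OF g(1), of "NN n * g" n] gc by simp
  show "minv g * (NN n * g) \<in> carrier_mat n n" using gc by auto
 qed
qed

lemma PM_mult_borel:
 assumes "PM n g" "b \<in> borel_subgroup n"
 shows "PM n (g * b)"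
proof -
 obtain A where A: "A \<in> carrier_mat n n" "hess n A" "NN n * g = g * A" and g: "g \<in> GL n"
  using assms(1) by (auto simp: PM_def)
 note c = GL_carrier[OF g] borel_carrier[OF assms(2)]
 note mc = minv_carrier[OF c(2)]
 let ?A = "minv b * (A * b)"
 have "NN n * (g * b) = NN n * g * b" using c by (simp add: square_assoc[of _ n])
 also have "... = g * A * b" using A(3) by simp
 also have "... = g * (A * b)" using c A by (simp add: square_assoc[of _ n])
 also have "A * b = b * ?A" using GL_cancel_left'[OF borel_GL[OF assms(2)], of "A * b" n] A c by simp
 also have "g * (b * ?A) = g * b * ?A" using c A mc by (simp add: square_assoc[of _ n])
 finally have "NN n * (g * b) = g * b * ?A" .
 moreover have "?A \<in> carrier_mat n n" using mc A c by auto
 moreover have "A * b \<in> carrier_mat n n" using A c by auto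
 hence "hess n ?A"
  using hess_mult_borel(2)[OF _ hess_mult_borel(1)[OF A(1,2) assms(2)] borel_minv[OF assms(2)]] by simp
 ultimately show ?thesis unfolding PM_def using GL_mult[OF g borel_GL[OF assms(2)]] by blast
qed

text \<open>
The centraliser of \<open>N\<close> acts on the Peterson variety.
\<close>

lemma PM_mult_left:
 assumes "PM n g" "T \<in> GL n" "NN n * T = T * NN n"
 shows "PM n (T * g)"
proof -
 obtain A where A: "A \<in> carrier_mat n n" "hess n A" "NN n * g = g * A" and g: "g \<in> GL n"
  using assms(1) by (auto simp: PM_def)
 note c = GL_carrier[OF g] GL_carrier[OF assms(2)]
 have "NN n * (T * g) = NN n * T * g" using c by (simp add: square_assoc[of _ n])
 also have "... = T * NN n * g" using assms(3) by simp
 also have "... = T * (NN n * g)" using c by (simp add: square_assoc[of _ n])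
 also have "... = T * (g * A)" using A(3) by simp
 also have "... = T * g * A" using c A by (simp add: square_assoc[of _ n])
 finally show ?thesis unfolding PM_def using GL_mult[OF assms(2) g] A by blast
qed

lemma commute_minv:
 assumes "T \<in> GL n" "NN n * T = T * NN n"
 shows "NN n * minv T = minv T * NN n"
proof -
 note c = GL_carrier[OF assms(1)]
 note m = minv_carrier[OF c]
 have "minv T * NN n = minv T * (NN n * T * minv T)"
  using GL_cancel_right[OF assms(1) NN_carrier] by simp
 also have "... = minv T * (T * (NN n * minv T))"
  unfolding assms(2) using c m by (subst assoc_mult_mat[of T n n "NN n" n "minv T" n]) auto
 also have "... = NN n * minv T" using c m by (intro GL_cancel_left[OF assms(1), of _ n]) auto
 finally show ?thesis by simp
qed

lemma flag_space_iff:
 assumes g: "g \<in> carrier_mat n n" and i: "i <= n"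
 shows "x \<in> flag_space n g i \<longleftrightarrow> (\<exists>c. x = vec n (%a. \<Sum>k<i. g $$ (a, k) * c k))"
proof -
 interpret vs: vec_space "TYPE(complex)" n .
 let ?vs = "take i (cols g)"
 have len: "length ?vs = i" using g i by simp
 have sub: "set ?vs \<subseteq> carrier_vec n" using g cols_dim[of g] set_take_subset[of i "cols g"] by auto
 have nth: "?vs ! k = col g k" if "k < i" for k using that g i by simp
 have "flag_space n g i = vs.span_list ?vs"
  unfolding flag_space_def using vs.span_list_as_span[OF sub] by simp
 moreover have "vs.lincomb_list c ?vs = vec n (%a. \<Sum>k<i. g $$ (a, k) * c k)" for c
 proof -
  have "\<forall>w\<in>set ?vs. dim_vec w = n" using sub by auto
  hence "vs.lincomb_list c ?vs = mat_of_cols n ?vs *\<^sub>v vec (length ?vs) c"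
   by (rule vs.lincomb_list_as_mat_mult)
  also have "... = vec n (%a. \<Sum>k<i. g $$ (a, k) * c k)"
   using len i g by (intro eq_vecI)
    (auto simp: scalar_prod_def mat_of_cols_def atLeast0LessThan intro!: sum.cong)
  finally show ?thesis .
 qed
 ultimately show ?thesis by (auto simp: vs.span_list_def)
qed

lemma PM_iff_flags:
 assumes g: "g \<in> GL n"
 shows "PM n g \<longleftrightarrow> (\<forall>i<n. (%v. NN n *\<^sub>v v) ` flag_space n g i \<subseteq> flag_space n g (Suc i))"
proof
 note gc = GL_carrier[OF g]
 assume "PM n g"
 then obtain A where A: "A \<in> carrier_mat n n" "hess n A" "NN n * g = g * A" by (auto simp: PM_def)
 show "\<forall>i<n. (%v. NN n *\<^sub>v v) ` flag_space n g i \<subseteq> flag_space n g (Suc i)"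
 proof (intro allI impI image_subsetI)
  fix i v assume i: "i < n" and "v \<in> flag_space n g i"
  then obtain c where v: "v = vec n (%a. \<Sum>k<i. g $$ (a, k) * c k)"
   using flag_space_iff[OF gc, of i] by auto
  have "NN n *\<^sub>v v = vec n (%a. \<Sum>l<Suc i. g $$ (a, l) * (\<Sum>k<i. A $$ (l, k) * c k))"
  proof (rule eq_vecI)
   fix a assume "a < dim_vec (vec n (%a. \<Sum>l<Suc i. g $$ (a, l) * (\<Sum>k<i. A $$ (l, k) * c k)))"
   hence a: "a < n" by simp
   have "(NN n *\<^sub>v v) $ a = (\<Sum>l<n. NN n $$ (a, l) * v $ l)"
    using a v by (simp add: scalar_prod_def regular_nilpotent_def atLeast0LessThan cong: sum.cong_simp)
   also have "... = (\<Sum>l<n. \<Sum>k<i. NN n $$ (a, l) * g $$ (l, k) * c k)"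
    by (intro sum.cong refl) (simp add: v sum_distrib_left mult.assoc)
   also have "... = (\<Sum>k<i. (\<Sum>l<n. NN n $$ (a, l) * g $$ (l, k)) * c k)"
    by (subst sum.swap) (simp add: sum_distrib_right)
   also have "... = (\<Sum>k<i. (\<Sum>l<n. g $$ (a, l) * A $$ (l, k)) * c k)"
   proof (intro sum.cong refl)
    fix k assume "k \<in> {..<i}"
    hence k: "k < n" using i by simp
    show "(\<Sum>l<n. NN n $$ (a, l) * g $$ (l, k)) * c k = (\<Sum>l<n. g $$ (a, l) * A $$ (l, k)) * c k"
     using mat_mult_index[OF NN_carrier gc a k] mat_mult_index[OF gc A(1) a k] A(3) by simp
   qed
   also have "... = (\<Sum>k<i. (\<Sum>l<Suc i. g $$ (a, l) * A $$ (l, k)) * c k)"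
   proof (intro sum.cong refl)
    fix k assume "k \<in> {..<i}"
    hence "(\<Sum>l<n. g $$ (a, l) * A $$ (l, k)) = (\<Sum>l<Suc i. g $$ (a, l) * A $$ (l, k))"
     using A(2) i by (intro sum.mono_neutral_right) (auto simp: hess_def)
    thus "(\<Sum>l<n. g $$ (a, l) * A $$ (l, k)) * c k = (\<Sum>l<Suc i. g $$ (a, l) * A $$ (l, k)) * c k" by simp
   qed
   also have "... = (\<Sum>l<Suc i. g $$ (a, l) * (\<Sum>k<i. A $$ (l, k) * c k))"
    unfolding sum_distrib_left sum_distrib_right by (subst sum.swap) (simp add: mult.assoc)
   finally show "(NN n *\<^sub>v v) $ a = vec n (%a. \<Sum>l<Suc i. g $$ (a, l) * (\<Sum>k<i. A $$ (l, k) * c k)) $ a"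
    using a by simp
  qed (simp add: regular_nilpotent_def)
  thus "NN n *\<^sub>v v \<in> flag_space n g (Suc i)"
   using i flag_space_iff[OF gc, of "Suc i"] by auto
 qed
next
 note gc = GL_carrier[OF g]
 assume F: "\<forall>i<n. (%v. NN n *\<^sub>v v) ` flag_space n g i \<subseteq> flag_space n g (Suc i)"
 show "PM n g" unfolding PM_iff_conj[OF g] hess_def
 proof (intro allI impI)
  fix i j assume ij: "i < n" "Suc j < i"
  have "col g j = vec n (%a. \<Sum>k<Suc j. g $$ (a, k) * (if k = j then 1 else 0))"
   using gc ij by (intro eq_vecI) (auto simp: if_distrib[of "%z. _ * z"] cong: if_cong)
  moreover have sj: "Suc j <= n" "Suc j < n" "Suc (Suc j) <= n" using ij by auto
  ultimately have "col g j \<in> flag_space n g (Suc j)"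
   unfolding flag_space_iff[OF gc sj(1)] by (rule_tac exI)
  hence "NN n *\<^sub>v col g j \<in> flag_space n g (Suc (Suc j))"
   using mp[OF spec[OF F, of "Suc j"] sj(2)] by (rule subsetD[OF _ imageI, rotated])
  then obtain c where c: "NN n *\<^sub>v col g j = vec n (%a. \<Sum>k<Suc (Suc j). g $$ (a, k) * c k)"
   unfolding flag_space_iff[OF gc sj(3)] by (elim exE) (rule that)
  have e: "(NN n * g) $$ (a, j) = (\<Sum>k<Suc (Suc j). g $$ (a, k) * c k)" if a: "a < n" for a
  proof -
   have "(NN n * g) $$ (a, j) = (NN n *\<^sub>v col g j) $ a" using gc a ij by (simp add: regular_nilpotent_def)
   thus ?thesis unfolding c using a by simp
  qed
  have one: "(\<Sum>a<n. minv g $$ (i, a) * g $$ (a, k)) = (if i = k then 1 else 0)" if k: "k < n" for k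
   using mat_mult_index[OF minv_carrier[OF gc] gc ij(1) k] minv_mult[OF gc GL_det[OF g]] ij k by simp
  have "(minv g * (NN n * g)) $$ (i, j) = (\<Sum>a<n. minv g $$ (i, a) * (NN n * g) $$ (a, j))"
   using ij by (intro mat_mult_index[OF minv_carrier[OF gc] mult_carrier_mat[OF NN_carrier gc]]) auto
  also have "... = (\<Sum>a<n. \<Sum>k<Suc (Suc j). minv g $$ (i, a) * g $$ (a, k) * c k)"
   by (intro sum.cong refl) (simp only: e lessThan_iff sum_distrib_left mult.assoc)
  also have "... = (\<Sum>k<Suc (Suc j). (\<Sum>a<n. minv g $$ (i, a) * g $$ (a, k)) * c k)"
   by (subst sum.swap) (simp only: sum_distrib_right)
  also have "... = 0" using ij by (intro sum.neutral) (auto simp: one)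
  finally show "(minv g * (NN n * g)) $$ (i, j) = 0" .
 qed
qed

lemma coset_Peterson_iff:
 assumes "g \<in> GL n"
 shows "coset n g \<in> Peterson n \<longleftrightarrow> PM n g"
proof
 assume "coset n g \<in> Peterson n"
 then obtain h where h: "coset n g = coset n h" "PM n h"
  unfolding Peterson_def using PM_iff_flags by auto
 from coset_eqD[OF GL_carrier[OF assms] h(1)[symmetric]] obtain b where
  "b \<in> borel_subgroup n" "g = h * b" by blast
 thus "PM n g" using PM_mult_borel[OF h(2)] by simp
next
 assume "PM n g"
 thus "coset n g \<in> Peterson n" unfolding Peterson_def using PM_iff_flags[OF assms] assms by blast
qed

lemma Peterson_eq: "Peterson n = {coset n g | g. PM n g}"
 unfolding Peterson_def using PM_iff_flags PM_GL by blast

section \<open>Minors and coordinates of patches\<close>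

text \<open>
Matrices whose entries are polynomial functions of the point; all maps between patches are built from these.
\<close>

definition polymat :: "'e set => nat => nat => (('e => complex) => complex mat) => bool" where
 "polymat E n m M \<longleftrightarrow> (\<forall>x. M x \<in> carrier_mat n m) & (\<forall>i<n. \<forall>j<m. (%x. M x $$ (i, j)) \<in> poly_funs E)"

lemma polymat_carrier: "polymat E n m M ==> M x \<in> carrier_mat n m"
 by (simp add: polymat_def)

lemma polymat_entry: "polymat E n m M ==> i < n ==> j < m ==> (%x. M x $$ (i, j)) \<in> poly_funs E"
 by (simp add: polymat_def)

lemma polymat_const: "A \<in> carrier_mat n m ==> polymat E n m (%x. A)"
 by (simp add: polymat_def poly_funs.const)

lemma polymat_mat:
 "(!!i j. i < n ==> j < m ==> (%x. f x i j) \<in> poly_funs E) ==> polymat E n m (%x. mat n m (%(i, j). f x i j))"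
 by (simp add: polymat_def)

lemma polymat_mult:
 assumes A: "polymat E n m A" and B: "polymat E m k B"
 shows "polymat E n k (%x. A x * B x)"
 unfolding polymat_def
proof (intro conjI allI impI)
 fix x show "A x * B x \<in> carrier_mat n k"
  by (rule mult_carrier_mat[OF polymat_carrier[OF A] polymat_carrier[OF B]])
next
 fix i j assume ij: "i < n" "j < k"
 have "(%x. (A x * B x) $$ (i, j)) = (%x. \<Sum>l<m. A x $$ (i, l) * B x $$ (l, j))"
  by (rule ext) (rule mat_mult_index[OF polymat_carrier[OF A] polymat_carrier[OF B] ij])
 also have "... \<in> poly_funs E"
  by (intro poly_funs_sum poly_funs.mult polymat_entry[OF A] polymat_entry[OF B] ij) simp_all
 finally show "(%x. (A x * B x) $$ (i, j)) \<in> poly_funs E" .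
qed

lemma polymat_det:
 assumes A: "polymat E n n A"
 shows "(%x. det (A x)) \<in> poly_funs E"
proof -
 have "(%x. det (A x)) = (%x. \<Sum>p\<in>{p. p permutes {0..<n}}. signof p * (\<Prod>i = 0..<n. A x $$ (i, p i)))"
  by (rule ext) (rule det_def'[OF polymat_carrier[OF A]])
 also have "... \<in> poly_funs E"
 proof (intro poly_funs_sum poly_funs.mult poly_funs.const poly_funs_prod)
  fix p i assume "p \<in> {p. p permutes {0..<n}}" "i \<in> {0..<n}"
  hence "i < n" "p i < n" using permutes_in_image[of p "{0..<n}" i] by auto
  thus "(%x. A x $$ (i, p i)) \<in> poly_funs E" by (rule polymat_entry[OF A])
 qed
 finally show ?thesis .
qed

lemma polymat_adj:
 assumes A: "polymat E n n A"
 shows "polymat E n n (%x. adj_mat (A x))"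
 unfolding polymat_def
proof (intro conjI allI impI)
 fix x show "adj_mat (A x) \<in> carrier_mat n n" by (rule adj_mat(1)[OF polymat_carrier[OF A]])
next
 fix i j assume ij: "i < n" "j < n"
 have c: "dim_row (A x) = n" "dim_col (A x) = n" for x using polymat_carrier[OF A, of x] by auto
 have "polymat E (n - 1) (n - 1) (%x. mat_delete (A x) j i)"
  unfolding mat_delete_def c
 proof (rule polymat_mat)
  fix r s assume "r < n - 1" "s < n - 1"
  hence "(if r < j then r else Suc r) < n" "(if s < i then s else Suc s) < n" by auto
  thus "(%x. A x $$ (if r < j then r else Suc r, if s < i then s else Suc s)) \<in> poly_funs E"
   by (rule polymat_entry[OF A])
 qed
 from polymat_det[OF this] have "(%x. (-1) ^ (j + i) * det (mat_delete (A x) j i)) \<in> poly_funs E"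
  by (rule poly_funs.mult[OF poly_funs.const])
 moreover have "(%x. adj_mat (A x) $$ (i, j)) = (%x. (-1) ^ (j + i) * det (mat_delete (A x) j i))"
  using ij c by (auto simp: adj_mat_def cofactor_def)
 ultimately show "(%x. adj_mat (A x) $$ (i, j)) \<in> poly_funs E" by simp
qed

text \<open>
Rows \<open>0, ..., j - 1, i\<close> and columns \<open>0, ..., j\<close>: the quotient of this minor by the leading one is the \<open>(i, j)\<close> entry of the lower factor of an LU decomposition.
\<close>

definition minor :: "nat => nat => complex mat => complex" where
 "minor i j M = det (mat (Suc j) (Suc j) (%(r, c). M $$ (if r = j then i else r, c)))"

lemma polymat_minor:
 assumes "polymat E n n A" "j <= i" "i < n"
 shows "(%x. minor i j (A x)) \<in> poly_funs E"
 unfolding minor_def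
 by (rule polymat_det[where n = "Suc j", OF polymat_mat], rule polymat_entry[OF assms(1)])
  (use assms(2,3) in auto)

abbreviation "LL \<equiv> lower_unitriangular"

lemma LL_carrier[simp]: "LL n p \<in> carrier_mat n n" by (simp add: lower_unitriangular_def)

lemma LL_index: "i < n ==> j < n ==> LL n p $$ (i, j) = (if i = j then 1 else if j < i then p (i, j) else 0)"
 by (simp add: lower_unitriangular_def)

lemma LL_det: "det (LL n p) = 1"
proof -
 have "det (LL n p) = prod_list (diag_mat (LL n p))"
  by (rule det_lower_triangular[of n]) (auto simp: LL_index)
 also have "diag_mat (LL n p) = replicate n 1"
  by (rule nth_equalityI) (auto simp: diag_mat_def LL_index lower_unitriangular_def)
 finally show ?thesis by simp
qed

lemma LL_GL: "LL n p \<in> GL n" by (simp add: GL_iff LL_det)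

lemma LL_eqD:
 assumes "LL n p = LL n q" "p \<in> affine_space (patch_index n)" "q \<in> affine_space (patch_index n)"
 shows "p = q"
proof
 fix x :: "nat \<times> nat" obtain i j where x: "x = (i, j)" by (cases x)
 show "p x = q x"
 proof (cases "j < i & i < n")
  case True
  thus ?thesis using arg_cong[OF assms(1), of "%M. M $$ (i, j)"] by (simp add: LL_index x)
 next
  case False
  thus ?thesis using assms(2,3) by (auto simp: affine_space_def patch_index_def x)
 qed
qed

lemma LL_surj:
 assumes "M \<in> carrier_mat n n" "!!i j. i < n ==> j < n ==> i <= j ==> M $$ (i, j) = (if i = j then 1 else 0)"
 shows "LL n (%(i, j). if j < i & i < n then M $$ (i, j) else 0) = M"
 using assms by (intro eq_matI) (auto simp: LL_index lower_unitriangular_def)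

text \<open>
Up to row \<open>j\<close> the minor factors into a lower triangular piece, whose last row starts with row \<open>i\<close> of the lower factor, and a leading block of \<open>U\<close>.
\<close>

lemma minor_LU:
 assumes U: "U \<in> borel_subgroup n" and ij: "j <= i" "i < n"
 shows "minor i j (LL n p * U) = LL n p $$ (i, j) * minor j j (LL n p * U)" "minor j j (LL n p * U) ~= 0"
proof -
 note Uc = borel_carrier[OF U]
 define Us where "Us = mat (Suc j) (Suc j) (%(r, c). U $$ (r, c))"
 have gen: "minor i j (LL n p * U) = LL n p $$ (i, j) * det Us" if ij: "j <= i" "i < n" for i
 proof -
  define Ls where "Ls = mat (Suc j) (Suc j) (%(r, c). LL n p $$ (if r = j then i else r, c))"
  have "mat (Suc j) (Suc j) (%(r, c). (LL n p * U) $$ (if r = j then i else r, c)) = Ls * Us"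
  proof (rule eq_matI)
   fix r c assume "r < dim_row (Ls * Us)" "c < dim_col (Ls * Us)"
   hence rc: "r < Suc j" "c < Suc j" by (auto simp: Ls_def Us_def)
   let ?r = "if r = j then i else r"
   have r: "?r < n" and c: "c < n" using rc ij by auto
   have "(LL n p * U) $$ (?r, c) = (\<Sum>l<n. LL n p $$ (?r, l) * U $$ (l, c))"
    by (rule mat_mult_index[OF LL_carrier Uc r c])
   also have "... = (\<Sum>l<Suc j. LL n p $$ (?r, l) * U $$ (l, c))"
    using ij rc borel_zero[OF U, of c] by (intro sum.mono_neutral_right) auto
   also have "... = (\<Sum>l<Suc j. Ls $$ (r, l) * Us $$ (l, c))"
    using rc by (intro sum.cong refl) (auto simp: Ls_def Us_def)
   also have "... = (Ls * Us) $$ (r, c)"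
    using rc by (intro mat_mult_index[symmetric, of _ "Suc j" _ _ "Suc j"]) (auto simp: Ls_def Us_def)
   finally show "mat (Suc j) (Suc j) (%(r, c). (LL n p * U) $$ (if r = j then i else r, c)) $$ (r, c) = (Ls * Us) $$ (r, c)"
    using rc by simp
  qed (auto simp: Ls_def Us_def)
  moreover have "Ls \<in> carrier_mat (Suc j) (Suc j)" "Us \<in> carrier_mat (Suc j) (Suc j)"
   by (simp_all add: Ls_def Us_def)
  ultimately have "minor i j (LL n p * U) = det Ls * det Us"
   unfolding minor_def by (simp only: det_mult)
  also have "det Ls = prod_list (diag_mat Ls)"
   by (rule det_lower_triangular[of "Suc j"]) (use ij in \<open>auto simp: Ls_def LL_index\<close>)
  also have "diag_mat Ls = replicate j 1 @ [LL n p $$ (i, j)]"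
   by (rule nth_equalityI) (use ij in \<open>auto simp: diag_mat_def Ls_def LL_index nth_append less_Suc_eq simp del: upt_Suc\<close>)
  finally show ?thesis by simp
 qed
 have jj: "minor j j (LL n p * U) = det Us" using gen[of j] ij by (simp add: LL_index)
 show "minor i j (LL n p * U) = LL n p $$ (i, j) * minor j j (LL n p * U)"
  using gen[OF ij] jj by simp
 have "det Us = prod_list (diag_mat Us)"
  by (rule det_upper_triangular[of _ "Suc j"]) (use ij borel_zero[OF U] in \<open>auto simp: Us_def\<close>)
 moreover have "0 \<notin> set (diag_mat Us)"
  using borel_diag[OF U] ij by (auto simp: diag_mat_def Us_def simp del: upt_Suc)
 ultimately show "minor j j (LL n p * U) ~= 0" unfolding jj by (simp add: prod_list_zero_iff)
qed

definition lu_coord :: "nat => complex mat => nat \<times> nat => complex" where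
 "lu_coord n M = (%(i, j). if j < i & i < n then minor i j M / minor j j M else 0)"

lemma lu_coord_affine: "lu_coord n M \<in> affine_space (patch_index n)"
 by (auto simp: lu_coord_def affine_space_def patch_index_def)

lemma lu_coord_LU:
 assumes "U \<in> borel_subgroup n" "p \<in> affine_space (patch_index n)"
 shows "lu_coord n (LL n p * U) = p"
proof
 fix x :: "nat \<times> nat" obtain i j where x: "x = (i, j)" by (cases x)
 show "lu_coord n (LL n p * U) x = p x"
 proof (cases "j < i & i < n")
  case True
  thus ?thesis using minor_LU[OF assms(1), of j i p] by (simp add: lu_coord_def x LL_index)
 next
  case False
  thus ?thesis using assms(2) by (auto simp: lu_coord_def affine_space_def patch_index_def x)
 qed
qed

lemma LU_exists:
 assumes M: "M \<in> carrier_mat n n" and nz: "!!j. j < n ==> minor j j M ~= 0"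
 shows "M \<in> GL n" "\<exists>V\<in>borel_subgroup n. M * V = LL n (lu_coord n M)"
proof -
 define S where "S j = mat (Suc j) (Suc j) (%(r, c). M $$ (r, c))" for j
 have Sc: "S j \<in> carrier_mat (Suc j) (Suc j)" for j by (simp add: S_def)
 have "minor j j M = det (S j)" for j unfolding minor_def S_def by (rule arg_cong[of _ _ det]) (rule eq_matI, auto)
 hence Sd: "det (S j) ~= 0" if "j < n" for j using nz[OF that] by simp
 define V where "V = mat n n (%(c, j). if c <= j then minv (S j) $$ (c, j) else 0)"
 have Vc: "V \<in> carrier_mat n n" by (simp add: V_def)
 have MV: "(M * V) $$ (r, j) = (if r = j then 1 else 0)" if rj: "r <= j" "j < n" for r j
 proof -
  have r: "r < n" using rj by simp
  have "(M * V) $$ (r, j) = (\<Sum>l<n. M $$ (r, l) * V $$ (l, j))"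
   by (rule mat_mult_index[OF M Vc r rj(2)])
  also have "... = (\<Sum>l<Suc j. S j $$ (r, l) * minv (S j) $$ (l, j))"
   using rj by (intro sum.mono_neutral_cong_right) (auto simp: V_def S_def)
  also have "... = (S j * minv (S j)) $$ (r, j)"
   using rj by (intro mat_mult_index[symmetric, OF Sc minv_carrier[OF Sc]]) auto
  also have "... = (if r = j then 1 else 0)" using mult_minv[OF Sc Sd[OF rj(2)]] rj by simp
  finally show ?thesis .
 qed
 have MVc: "M * V \<in> carrier_mat n n" using M Vc by simp
 define p where "p = (%(i, j). if j < i & i < n then (M * V) $$ (i, j) else 0)"
 have L: "LL n p = M * V" unfolding p_def by (rule LL_surj[OF MVc]) (use MV in auto)
 have pa: "p \<in> affine_space (patch_index n)" by (auto simp: p_def affine_space_def patch_index_def)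
 have "det M * det V = 1" using det_mult[OF M Vc] LL_det[of n p] L by simp
 hence d: "det M ~= 0" "det V ~= 0" by force+
 thus MGL: "M \<in> GL n" using M by (simp add: GL_iff)
 have V: "V \<in> borel_subgroup n" unfolding borel_iff using d Vc by (auto simp: GL_iff brk_def V_def)
 have "LL n p * minv V = M" unfolding L by (rule GL_cancel_right[OF borel_GL[OF V] M])
 hence "lu_coord n M = p" using lu_coord_LU[OF borel_minv[OF V] pa] by simp
 thus "\<exists>V\<in>borel_subgroup n. M * V = LL n (lu_coord n M)" using L V by auto
qed

lemma finite_patch_index[simp]: "finite (patch_index n)"
 by (rule finite_subset[of _ "{..<n} \<times> {..<n}"]) (auto simp: patch_index_def)

abbreviation "Pat n g \<equiv> patch n g (Peterson n)"

lemma patch_iff: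
 assumes "g \<in> GL n"
 shows "p \<in> Pat n g \<longleftrightarrow> p \<in> affine_space (patch_index n) & PM n (g * LL n p)"
 unfolding patch_def using coset_Peterson_iff[OF GL_mult[OF assms LL_GL]] by simp

lemma LL_zero: "LL n (%_. 0) = 1\<^sub>m n"
 by (rule eq_matI) (auto simp: lower_unitriangular_def)

lemma polymat_LL: "polymat (patch_index n) n n (LL n)"
 unfolding lower_unitriangular_def
proof (rule polymat_mat)
 fix i j assume "i < n" "j < n"
 thus "(%p. if i = j then 1 else if j < i then p (i, j) else 0) \<in> poly_funs (patch_index n)"
  by (cases "i = j"; cases "j < i") (auto simp: patch_index_def intro: poly_funs.intros)
qed

lemma patch_closed:
 assumes g: "g \<in> GL n"
 shows "zariski_closed (patch_index n) (Pat n g)"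
proof -
 note gc = GL_carrier[OF g]
 define H where "H p = adj_mat (g * LL n p) * (NN n * (g * LL n p))" for p
 have pg: "polymat (patch_index n) n n (%p. g * LL n p)"
  by (rule polymat_mult[OF polymat_const[OF gc] polymat_LL])
 have pH: "polymat (patch_index n) n n H" unfolding H_def
  by (rule polymat_mult[OF polymat_adj[OF pg] polymat_mult[OF polymat_const[OF NN_carrier] pg]])
 have HP: "PM n (g * LL n p) \<longleftrightarrow> hess n (H p)" for p
 proof -
  have G: "g * LL n p \<in> GL n" by (rule GL_mult[OF g LL_GL])
  note c = GL_carrier[OF G]
  have "minv (g * LL n p) * (NN n * (g * LL n p)) = (1 / det (g * LL n p)) \<cdot>\<^sub>m H p"
   unfolding minv_def H_def using adj_mat(1)[OF c] c by (intro mult_smult_assoc_mat[of _ n n _ n]) auto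
  thus ?thesis unfolding PM_iff_conj[OF G] using polymat_carrier[OF pH, of p] GL_det[OF G]
   by (auto simp: hess_def)
 qed
 define F where "F = {%p. H p $$ (i, j) | i j. i < n & Suc j < i}"
 have "(\<forall>f\<in>F. f p = 0) \<longleftrightarrow> hess n (H p)" for p
 proof
  assume z: "\<forall>f\<in>F. f p = 0"
  show "hess n (H p)" unfolding hess_def
  proof (intro allI impI)
   fix i j assume "i < n" "Suc j < i"
   hence "(%p. H p $$ (i, j)) \<in> F" unfolding F_def by blast
   from bspec[OF z this] show "H p $$ (i, j) = 0" by simp
  qed
 next
  assume "hess n (H p)" thus "\<forall>f\<in>F. f p = 0" by (auto simp: F_def hess_def)
 qed
 hence "Pat n g = {p \<in> affine_space (patch_index n). \<forall>f\<in>F. f p = 0}"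
  using patch_iff[OF g] HP by auto
 moreover have "F \<subseteq> poly_funs (patch_index n)"
 proof
  fix f assume "f \<in> F"
  then obtain i j where f: "f = (%p. H p $$ (i, j))" "i < n" "Suc j < i" by (auto simp: F_def)
  show "f \<in> poly_funs (patch_index n)" unfolding f(1) by (rule polymat_entry[OF pH]) (use f in auto)
 qed
 ultimately show ?thesis unfolding zariski_closed_def by (intro exI[of _ F] conjI)
qed

lemma minor_one: "j < n ==> minor j j (1\<^sub>m n) = 1"
proof -
 assume "j < n"
 hence "mat (Suc j) (Suc j) (%(r, c). 1\<^sub>m n $$ (if r = j then j else r, c)) = (1\<^sub>m (Suc j) :: complex mat)"
  by (intro eq_matI) auto
 thus ?thesis unfolding minor_def by (simp only: det_one)
qed

lemma cofactor_one: "c < Suc j ==> cofactor (1\<^sub>m (Suc j)) j c = (if c = j then 1 else 0 :: complex)"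
proof -
 assume c: "c < Suc j"
 have one: "1 \<cdot>\<^sub>m 1\<^sub>m (Suc j) = (1\<^sub>m (Suc j) :: complex mat)" by (rule eq_matI) auto
 have "adj_mat (1\<^sub>m (Suc j)) * 1\<^sub>m (Suc j) = (1\<^sub>m (Suc j) :: complex mat)"
  using adj_mat(3)[of "1\<^sub>m (Suc j) :: complex mat" "Suc j"] one by simp
 hence "adj_mat (1\<^sub>m (Suc j)) = (1\<^sub>m (Suc j) :: complex mat)"
  using adj_mat(1)[of "1\<^sub>m (Suc j) :: complex mat" "Suc j"] by simp
 hence "adj_mat (1\<^sub>m (Suc j)) $$ (c, j) = (1\<^sub>m (Suc j) $$ (c, j) :: complex)" by simp
 thus ?thesis using c by (auto simp: adj_mat_def)
qed

text \<open>
Expand along the last row: at the identity that row is zero and the cofactors are those of the identity, so only the derivative of its last entry survives.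
\<close>

lemma minor_derivative_at_one:
 assumes E: "finite E" and M: "polymat E n n M" and a: "M a = 1\<^sub>m n"
  and d: "!!i j. i < n ==> j < n ==> ((%t. M (%e. a e + t * B e) $$ (i, j)) has_field_derivative X i j) (at 0)"
  and ij: "j < i" "i < n"
 shows "((%t. minor i j (M (%e. a e + t * B e))) has_field_derivative X i j) (at 0)"
proof -
 define S where "S x = mat (Suc j) (Suc j) (%(r, c). M x $$ (if r = j then i else r, c))" for x
 have pS: "polymat E (Suc j) (Suc j) S" unfolding S_def
  by (intro polymat_mat polymat_entry[OF M]) (use ij in auto)
 define C where "C c x = adj_mat (S x) $$ (c, j)" for c x
 have Cp: "C c \<in> poly_funs E" if "c < Suc j" for c unfolding C_def
  by (rule polymat_entry[OF polymat_adj[OF pS] that]) simp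
 have Cc: "C c x = cofactor (S x) j c" if "c < Suc j" for c x
  using polymat_carrier[OF pS, of x] that by (auto simp: C_def adj_mat_def)
 have C0: "C c a = (if c = j then 1 else 0)" if c: "c < Suc j" for c
 proof -
  have "mat_delete (S a) j c = mat_delete (1\<^sub>m (Suc j)) j c"
   using ij by (intro eq_matI) (auto simp: mat_delete_def S_def a)
  hence "cofactor (S a) j c = cofactor (1\<^sub>m (Suc j)) j c" by (simp add: cofactor_def)
  thus ?thesis using cofactor_one[OF c] Cc[OF c, of a] by simp
 qed
 have ex: "minor i j (M x) = (\<Sum>c<Suc j. M x $$ (i, c) * C c x)" for x
 proof -
  have "minor i j (M x) = det (S x)" by (simp add: minor_def S_def)
  also have "... = (\<Sum>c<Suc j. S x $$ (j, c) * cofactor (S x) j c)"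
   by (rule laplace_expansion_row[OF polymat_carrier[OF pS]]) simp
  also have "... = (\<Sum>c<Suc j. M x $$ (i, c) * C c x)"
   by (intro sum.cong refl) (auto simp: Cc S_def)
  finally show ?thesis .
 qed
 let ?x = "%t e. a e + t * B e"
 have x0: "?x 0 = a" by simp
 have "((%t. M (?x t) $$ (i, c) * C c (?x t)) has_field_derivative X i c * (if c = j then 1 else 0)) (at 0)"
  if c: "c < Suc j" for c
 proof -
  have 1: "((%t. C c (?x t)) has_field_derivative (\<Sum>e\<in>E. grad E (C c) e a * B e)) (at 0)"
   by (rule grad_line[OF E Cp[OF c]])
  have cn: "c < n" using c ij by simp
  have "M (?x 0) $$ (i, c) = 0" unfolding x0 a using c ij by simp
  with DERIV_mult[OF d[OF ij(2) cn] 1] show ?thesis unfolding x0 C0[OF c] by simp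
 qed
 hence "((%t. \<Sum>c<Suc j. M (?x t) $$ (i, c) * C c (?x t)) has_field_derivative
   (\<Sum>c<Suc j. X i c * (if c = j then 1 else 0))) (at 0)"
  by (intro DERIV_sum) simp
 moreover have "(\<Sum>c<Suc j. X i c * (if c = j then 1 else 0)) = X i j" by simp
 ultimately show ?thesis unfolding ex by simp
qed

text \<open>
Push a tangent vector to the patch by the LU decomposition. At the identity the lower factor has as its derivative the strictly lower triangular part.
\<close>

lemma tangent_patch:
 assumes E: "finite E" and M: "polymat E n n M" and a: "M a = 1\<^sub>m n" "a \<in> Q"
  and g: "g \<in> GL n"
  and Q: "!!x. x \<in> Q ==> det (M x) ~= 0 ==> PM n (g * M x)"
  and B: "B \<in> tangent_space E Q a"
  and d: "!!i j. i < n ==> j < n ==> ((%t. M (%e. a e + t * B e) $$ (i, j)) has_field_derivative X i j) (at 0)"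
 shows "(%(i, j). if j < i & i < n then X i j else 0) \<in> tangent_space (patch_index n) (Pat n g) (%_. 0)"
proof -
 define D where "D x = (\<Prod>j<n. minor j j (M x))" for x
 have Dp: "D \<in> poly_funs E" unfolding D_def by (intro poly_funs_prod polymat_minor[OF M]) auto
 have Da: "D a ~= 0" unfolding D_def a by (simp add: minor_one)
 have La: "lu_coord n (M a) = (%_. 0)"
  using lu_coord_LU[OF borel_one, of "%_. 0" n] by (simp add: a LL_zero affine_space_def)
 have "(%(i, j). if j < i & i < n then X i j else 0) \<in> tangent_space (patch_index n) (Pat n g) (lu_coord n (M a))"
 proof (rule tangent_space_rational_map[OF E finite_patch_index B Dp Da, where L = "%x. lu_coord n (M x)"])
  fix q assume "q \<in> patch_index n"
  then obtain i j where q: "q = (i, j)" "j < i" "i < n" by (auto simp: patch_index_def)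
  show "\<exists>k. \<exists>F\<in>poly_funs E. \<forall>x\<in>{x. D x ~= 0}. D x ^ k * lu_coord n (M x) q = F x"
  proof (rule exI[of _ 1], rule bexI[of _ "%x. minor i j (M x) * (\<Prod>l\<in>{..<n} - {j}. minor l l (M x))"], rule ballI)
   fix x assume "x \<in> {x. D x ~= 0}"
   hence "minor j j (M x) ~= 0" using q by (auto simp: D_def)
   moreover have "D x = minor j j (M x) * (\<Prod>l\<in>{..<n} - {j}. minor l l (M x))"
    unfolding D_def using q by (intro prod.remove) auto
   ultimately show "D x ^ 1 * lu_coord n (M x) q = minor i j (M x) * (\<Prod>l\<in>{..<n} - {j}. minor l l (M x))"
    using q by (simp add: lu_coord_def)
  qed (intro poly_funs.mult poly_funs_prod polymat_minor[OF M], use q in auto)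
  have md: "((%t. minor i j (M (%e. a e + t * B e))) has_field_derivative X i j) (at 0)"
   by (rule minor_derivative_at_one[OF E M a(1) d q(2,3)])
  have "(%x. minor j j (M x)) \<in> poly_funs E" by (rule polymat_minor[OF M]) (use q in auto)
  note jd = grad_line[OF E this, of a B]
  have j0: "minor j j (M (%e. a e + 0 * B e)) = 1" using minor_one[of j n] q a by simp
  have i0: "minor i j (M (%e. a e + 0 * B e)) = 0"
  proof -
   have "minor i j (LL n (%_. 0) * 1\<^sub>m n) = LL n (%_. 0) $$ (i, j) * minor j j (LL n (%_. 0) * 1\<^sub>m n)"
    by (rule minor_LU(1)[OF borel_one]) (use q in auto)
   thus ?thesis using a q by (simp add: LL_zero)
  qed
  have "((%t. minor i j (M (%e. a e + t * B e)) / minor j j (M (%e. a e + t * B e))) has_field_derivative X i j) (at 0)"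
   using DERIV_divide[OF md jd] j0 i0 by simp
  thus "((%t. lu_coord n (M (%e. a e + t * B e)) q) has_field_derivative
    (case q of (i, j) => if j < i & i < n then X i j else 0)) (at 0)"
   using q by (simp add: lu_coord_def)
 next
  fix x assume x: "x \<in> Q" "D x ~= 0"
  note Mc = polymat_carrier[OF M, of x]
  have nz: "minor j j (M x) ~= 0" if "j < n" for j using x(2) that by (auto simp: D_def)
  from LU_exists[OF Mc nz] obtain V where MG: "M x \<in> GL n" and V: "V \<in> borel_subgroup n" "M x * V = LL n (lu_coord n (M x))"
   by blast
  have "PM n (g * M x * V)" by (rule PM_mult_borel[OF Q[OF x(1) GL_det[OF MG]] V(1)])
  moreover have "g * M x * V = g * LL n (lu_coord n (M x))"
   using GL_carrier[OF g] Mc borel_carrier[OF V(1)] V(2) by (simp add: square_assoc[of _ n])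
  ultimately show "lu_coord n (M x) \<in> Pat n g" using patch_iff[OF g] lu_coord_affine by simp
 qed (use a in \<open>auto simp: affine_space_def patch_index_def\<close>)
 thus ?thesis unfolding La .
qed

section \<open>Normal forms of the strata\<close>

text \<open>
The block of an index is the interval between the nearest breaks, with \<open>0\<close> and \<open>n\<close> as sentinels.
\<close>

definition bs :: "nat set => nat => nat" where
 "bs S b = Max (insert 0 {s \<in> S. s <= b})"

definition be :: "nat => nat set => nat => nat" where
 "be n S b = Min (insert n {s \<in> S. b < s})"

context
 fixes n :: nat and S :: "nat set"
 assumes S: "S \<subseteq> {1..<n}"
begin

lemma finite_S: "finite S" using S finite_subset by blast

lemma bs_in: "bs S b \<in> insert 0 {s \<in> S. s <= b}"
 unfolding bs_def by (rule Max_in) (use finite_S in auto)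

lemma be_in: "be n S b \<in> insert n {s \<in> S. b < s}"
 unfolding be_def by (rule Min_in) (use finite_S in auto)

lemma bs_le: "bs S b <= b" using bs_in[of b] by auto

lemma be_gt: "b < n ==> b < be n S b" using be_in[of b] by auto

lemma be_le: "be n S b <= n" using be_in[of b] S by auto

lemma bs_S: "bs S b = 0 \<or> bs S b \<in> S" using bs_in[of b] by auto

lemma be_S: "be n S b = n \<or> be n S b \<in> S" using be_in[of b] by auto

lemma no_break_inside: "s \<in> S ==> s <= bs S b \<or> be n S b <= s"
proof (cases "s <= b")
 case True
 assume "s \<in> S"
 thus ?thesis unfolding bs_def using True finite_S by (intro disjI1 Max_ge) auto
next
 case False
 assume "s \<in> S"
 thus ?thesis unfolding be_def using False finite_S by (intro disjI2 Min_le) auto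
qed

lemma same_block:
 assumes "bs S b <= a" "a < be n S b"
 shows "bs S a = bs S b" "be n S a = be n S b"
proof -
 have "bs S b <= bs S a"
  unfolding bs_def[of S a] using bs_in[of b] assms finite_S by (intro Max_ge) auto
 moreover have "bs S a <= bs S b"
 proof (cases "bs S a = 0")
  case False
  hence "bs S a \<in> S" using bs_S[of a] by simp
  from no_break_inside[OF this, of b] bs_le[of a] assms show ?thesis by linarith
 qed simp
 ultimately show "bs S a = bs S b" by simp
 have "be n S a <= be n S b"
  unfolding be_def[of n S a] using be_in[of b] assms finite_S by (intro Min_le) auto
 moreover have "be n S b <= be n S a"
 proof (cases "be n S a = n")
  case False
  hence "be n S a \<in> S" using be_S[of a] by simp
  moreover have "a < be n S a" using assms(2) be_le[of b] by (intro be_gt) simp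
  ultimately show ?thesis using no_break_inside[of "be n S a" b] assms by linarith
 qed (use be_le in simp)
 ultimately show "be n S a = be n S b" by simp
qed

lemma break_start: "s \<in> S ==> bs S s = s"
proof -
 assume s: "s \<in> S"
 hence "s < n" using S by auto
 from bs_le[of s] no_break_inside[OF s, of s] be_gt[OF this] show ?thesis by linarith
qed

end

text \<open>
Each diagonal block is a Hankel matrix: ones on its antidiagonal, zeros below, and one free parameter for each antidiagonal above. The parameters of all blocks share the index set \<open>{1..<n}\<close>; only those that are not breaks matter.
\<close>

definition Kmat :: "nat => nat set => (nat => complex) => complex mat" where
 "Kmat n S t = mat n n (%(a, b). if bs S b <= a & a + b < bs S b + be n S b
   then (if Suc (a + b) = bs S b + be n S b then 1 else t (bs S b + (bs S b + be n S b - Suc (a + b)))) else 0)"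

lemma Kmat_carrier[simp]: "Kmat n S t \<in> carrier_mat n n" by (simp add: Kmat_def)

lemma Kmat_index: "a < n ==> b < n ==> Kmat n S t $$ (a, b) = (if bs S b <= a & a + b < bs S b + be n S b
   then (if Suc (a + b) = bs S b + be n S b then 1 else t (bs S b + (bs S b + be n S b - Suc (a + b)))) else 0)"
 by (simp add: Kmat_def)

lemma trivial_kernel_GL:
 assumes A: "A \<in> carrier_mat n n"
  and ker: "!!y. (!!a. a < n ==> (\<Sum>b<n. A $$ (a, b) * y b) = 0) ==> (\<forall>b<n. y b = 0)"
 shows "A \<in> GL n"
proof -
 have "det A ~= 0"
 proof
  assume "det A = 0"
  then obtain v where v: "v \<in> carrier_vec n" "v ~= 0\<^sub>v n" "A *\<^sub>v v = 0\<^sub>v n"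
   using det_0_iff_vec_prod_zero_field[OF A] by blast
  have "(\<Sum>b<n. A $$ (a, b) * v $ b) = 0" if a: "a < n" for a
  proof -
   have "(A *\<^sub>v v) $ a = (\<Sum>b<n. A $$ (a, b) * v $ b)"
    using a A v(1) by (simp add: scalar_prod_def atLeast0LessThan cong: sum.cong_simp)
   thus ?thesis using v(3) a by simp
  qed
  from ker[of "%b. v $ b", OF this] have "\<forall>b<n. v $ b = 0" .
  hence "v = 0\<^sub>v n" using v(1) by (intro eq_vecI) auto
  thus False using v(2) by simp
 qed
 thus ?thesis using A by (simp add: GL_iff)
qed

context
 fixes n :: nat and S :: "nat set"
 assumes S: "S \<subseteq> {1..<n}"
begin

lemma Kmat_GL: "Kmat n S t \<in> GL n"
proof (rule trivial_kernel_GL[OF Kmat_carrier])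
 fix y assume z: "!!a. a < n ==> (\<Sum>b<n. Kmat n S t $$ (a, b) * y b) = 0"
 show "\<forall>b<n. y b = 0"
 proof (intro allI)
  fix b show "b < n --> y b = 0"
  proof (induction b rule: less_induct)
   case (less b)
   show ?case
   proof
    assume b: "b < n"
    define a where "a = bs S b + be n S b - Suc b"
    have a: "bs S b <= a" "a < be n S b" "a + Suc b = bs S b + be n S b"
     using bs_le[OF S, of b] be_gt[OF S b] unfolding a_def by linarith+
    have an: "a < n" using a be_le[OF S, of b] by simp
    have "(\<Sum>c<n. Kmat n S t $$ (a, c) * y c) = Kmat n S t $$ (a, b) * y b"
    proof -
     have "Kmat n S t $$ (a, c) * y c = 0" if c: "c < n" "c ~= b" for c
     proof (cases "bs S c <= a & a + c < bs S c + be n S c")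
      case True
      hence "bs S a = bs S c" "be n S a = be n S c"
       using same_block[OF S, of c a] bs_le[OF S, of c] by (auto intro: order_trans)
      moreover have "bs S a = bs S b" "be n S a = be n S b" using same_block[OF S a(1,2)] by auto
      ultimately have "c < b" using True a(3) c(2) by auto
      thus ?thesis using less.IH c by simp
     next
      case False
      thus ?thesis using an c by (simp only: Kmat_index if_False mult_zero_left)
     qed
     hence "(\<Sum>c<n. Kmat n S t $$ (a, c) * y c) = (\<Sum>c\<in>{b}. Kmat n S t $$ (a, c) * y c)"
      using b by (intro sum.mono_neutral_right) auto
     thus ?thesis by simp
    qed
    moreover have "Kmat n S t $$ (a, b) = 1" using a an b by (simp add: Kmat_index)
    ultimately show "y b = 0" using z[OF an] by simp
   qed
  qed
 qed
qed

lemma Kmat_brk_iff: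
 assumes s: "1 <= s" "s < n"
 shows "brk n (Kmat n S t) s \<longleftrightarrow> s \<in> S"
proof
 assume sS: "s \<in> S"
 show "brk n (Kmat n S t) s" unfolding brk_def
 proof (intro allI impI)
  fix a b assume ab: "s <= a" "a < n" "b < s"
  have "s <= bs S b \<or> be n S b <= s" by (rule no_break_inside[OF S sS])
  hence "be n S b <= a" using bs_le[OF S, of b] ab by auto
  thus "Kmat n S t $$ (a, b) = 0" using ab s bs_le[OF S, of b] by (simp add: Kmat_index)
 qed
next
 assume b: "brk n (Kmat n S t) s"
 show "s \<in> S"
 proof (rule ccontr)
  assume "s \<notin> S"
  define lo where "lo = bs S s"
  have "bs S s < s" using bs_le[OF S, of s] bs_S[OF S, of s] `s \<notin> S` s by (metis le_neq_implies_less not_one_le_zero)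
  hence lo: "lo < s" by (simp add: lo_def)
  have "be n S s > s" by (rule be_gt[OF S s(2)])
  define a where "a = be n S s - 1"
  have a: "s <= a" "a < n" using `be n S s > s` be_le[OF S, of s] by (auto simp: a_def)
  have "bs S lo = lo" "be n S lo = be n S s"
   using same_block[OF S, of s lo] lo `be n S s > s` by (auto simp: lo_def)
  hence "Kmat n S t $$ (a, lo) = 1" using a lo `be n S s > s` by (simp add: Kmat_index a_def)
  thus False using brkD[OF b a lo] by simp
 qed
qed

lemma Kmat_PM: "PM n (Kmat n S t)"
 unfolding PM_iff_conj[OF Kmat_GL] hess_def
proof (intro allI impI)
 fix k b assume kb: "k < n" "Suc b < k"
 let ?K = "Kmat n S t"
 note G = Kmat_GL[of t]
 have bn: "b < n" using kb by simp
 define lo where "lo = bs S b"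
 define hi where "hi = be n S b"
 have lo: "lo <= b" "b < hi" "hi <= n" using bs_le[OF S] be_gt[OF S bn] be_le[OF S] by (auto simp: lo_def hi_def)
 have bk: "brk n (minv ?K) lo"
 proof (cases "lo = 0")
  case True thus ?thesis by (simp add: brk_def)
 next
  case False
  hence "lo \<in> S" using bs_S[OF S, of b] by (simp add: lo_def)
  hence "brk n ?K lo" using Kmat_brk_iff[of lo t] S by auto
  thus ?thesis using lo by (intro brk_minv[OF G]) auto
 qed
 have row: "(NN n * ?K) $$ (a, b) = (if Suc b < hi then ?K $$ (a, Suc b) else 0)" if a: "a < n" "lo <= a" for a
 proof -
  have "(NN n * ?K) $$ (a, b) = (if Suc a < n then ?K $$ (Suc a, b) else 0)"
   by (rule NN_mult_index[OF Kmat_carrier a(1) bn])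
  moreover have "bs S (Suc b) = lo" "be n S (Suc b) = hi" if "Suc b < hi"
   using same_block[OF S, of b "Suc b"] that lo by (auto simp: lo_def hi_def)
  ultimately show ?thesis
   using a bn lo kb by (cases "Suc a < n"; cases "Suc b < hi") (auto simp: Kmat_index lo_def[symmetric] hi_def[symmetric])
 qed
 have "(minv ?K * (NN n * ?K)) $$ (k, b) = (\<Sum>a<n. minv ?K $$ (k, a) * (NN n * ?K) $$ (a, b))"
  by (rule mat_mult_index[OF minv_carrier[OF Kmat_carrier] mult_carrier_square[OF NN_carrier Kmat_carrier] kb(1) bn])
 also have "... = (\<Sum>a<n. minv ?K $$ (k, a) * (if Suc b < hi then ?K $$ (a, Suc b) else 0))"
 proof (intro sum.cong refl)
  fix a assume "a \<in> {..<n}"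
  hence a: "a < n" by simp
  show "minv ?K $$ (k, a) * (NN n * ?K) $$ (a, b) = minv ?K $$ (k, a) * (if Suc b < hi then ?K $$ (a, Suc b) else 0)"
  proof (cases "lo <= a")
   case True thus ?thesis using row[OF a] by simp
  next
   case False
   hence "minv ?K $$ (k, a) = 0" using lo kb by (intro brkD[OF bk]) auto
   thus ?thesis by simp
  qed
 qed
 also have "... = (if Suc b < hi then (minv ?K * ?K) $$ (k, Suc b) else 0)"
  using kb by (simp add: mat_mult_index[OF minv_carrier[OF Kmat_carrier] Kmat_carrier])
 also have "... = 0" using minv_mult[OF Kmat_carrier GL_det[OF G]] kb by simp
 finally show "(minv ?K * (NN n * ?K)) $$ (k, b) = 0" .
qed

end

lemma brk_mult_borel:
 assumes "g \<in> GL n" "b \<in> borel_subgroup n" "s <= n"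
 shows "brk n (g * b) s \<longleftrightarrow> brk n g s"
proof
 note c = GL_carrier[OF assms(1)] borel_carrier[OF assms(2)]
 have br: "brk n b s" "brk n (minv b) s"
  using assms borel_minv[OF assms(2)] by (auto simp: borel_iff)
 show "brk n g s ==> brk n (g * b) s" using brk_mult[OF c _ br(1) assms(3)] .
 assume "brk n (g * b) s"
 from brk_mult[OF _ minv_carrier[OF c(2)] this br(2) assms(3)] c
 have "brk n (g * b * minv b) s" by simp
 thus "brk n g s" using GL_cancel_right[OF borel_GL[OF assms(2)] c(1)] by simp
qed

lemma brk_coset:
 assumes "g \<in> GL n" "h \<in> GL n" "coset n g = coset n h" "s <= n"
 shows "brk n g s \<longleftrightarrow> brk n h s"
 using coset_eqD[OF GL_carrier[OF assms(2)] assms(3)] brk_mult_borel[OF assms(1) _ assms(4)] by auto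

text \<open>powers of N applied to h\<close>

text \<open>
This is \<open>N^i h\<close>.
\<close>

definition Nshift :: "nat => complex mat => nat => complex mat" where
 "Nshift n h i = mat n n (%(a, b). if a + i < n then h $$ (a + i, b) else 0)"

lemma Nshift_carrier[simp]: "Nshift n h i \<in> carrier_mat n n" by (simp add: Nshift_def)

lemma Nshift_index: "a < n ==> b < n ==> Nshift n h i $$ (a, b) = (if a + i < n then h $$ (a + i, b) else 0)"
 by (simp add: Nshift_def)

lemma Nshift_Suc: "NN n * Nshift n h i = Nshift n h (Suc i)"
proof (rule eq_matI)
 fix a b assume "a < dim_row (Nshift n h (Suc i))" "b < dim_col (Nshift n h (Suc i))"
 hence ab: "a < n" "b < n" by (auto simp: Nshift_def)
 show "(NN n * Nshift n h i) $$ (a, b) = Nshift n h (Suc i) $$ (a, b)"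
  unfolding NN_mult_index[OF Nshift_carrier ab] using ab by (simp add: Nshift_def)
qed (auto simp: Nshift_def regular_nilpotent_def)

lemma Nshift_0: "h \<in> carrier_mat n n ==> Nshift n h 0 = h"
 by (rule eq_matI) (auto simp: Nshift_def)

context
 fixes n :: nat and h A :: "complex mat"
 assumes h: "h \<in> GL n" and A: "A \<in> carrier_mat n n" "hess n A" "NN n * h = h * A"
begin

lemma W_Suc: "minv h * Nshift n h (Suc i) = A * (minv h * Nshift n h i)"
proof -
 note c = GL_carrier[OF h]
 note m = minv_carrier[OF c]
 let ?W = "minv h * Nshift n h i"
 have "Nshift n h (Suc i) = NN n * (h * ?W)"
  using Nshift_Suc GL_cancel_left'[OF h Nshift_carrier] by simp
 also have "... = NN n * h * ?W" using c m by (simp add: square_assoc[of _ n])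
 also have "... = h * (A * ?W)" unfolding A(3) using c m A by (simp add: square_assoc[of _ n])
 finally have "minv h * Nshift n h (Suc i) = minv h * (h * (A * ?W))" by simp
 thus ?thesis using GL_cancel_left[OF h, of "A * ?W" n] A m by simp
qed

lemma W_0: "minv h * Nshift n h 0 = 1\<^sub>m n"
 using Nshift_0 minv_mult GL_carrier[OF h] GL_det[OF h] by simp

lemma W_carrier: "minv h * Nshift n h i \<in> carrier_mat n n"
 using minv_carrier[OF GL_carrier[OF h]] by simp

text \<open>
\<open>h\<^sup>-\<^sup>1 N^i h = A^i\<close>, and a power of a Hessenberg matrix has as its lowest band the products of subdiagonal entries of \<open>A\<close>.
\<close>

lemma W_lead:
 assumes "lo < n"
 shows "(\<forall>k<n. lo + i < k --> (minv h * Nshift n h i) $$ (k, lo) = 0) &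
   (lo + i < n --> (minv h * Nshift n h i) $$ (lo + i, lo) = (\<Prod>l<i. A $$ (Suc (lo + l), lo + l)))"
proof (induction i)
 case 0
 show ?case unfolding W_0 using assms by simp
next
 case (Suc i)
 let ?W = "minv h * Nshift n h i"
 have e: "(minv h * Nshift n h (Suc i)) $$ (k, lo) = (\<Sum>l<n. A $$ (k, l) * ?W $$ (l, lo))" if "k < n" for k
  unfolding W_Suc by (rule mat_mult_index[OF A(1) W_carrier that assms])
 have "(\<Sum>l<n. A $$ (k, l) * ?W $$ (l, lo)) = 0" if k: "k < n" "lo + Suc i < k" for k
 proof (rule sum.neutral, rule ballI)
  fix l assume "l \<in> {..<n}"
  thus "A $$ (k, l) * ?W $$ (l, lo) = 0"
   using Suc.IH k A(2) by (cases "lo + i < l") (auto simp: hess_def)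
 qed
 moreover have "(\<Sum>l<n. A $$ (lo + Suc i, l) * ?W $$ (l, lo)) = (\<Prod>l<Suc i. A $$ (Suc (lo + l), lo + l))"
  if k: "lo + Suc i < n"
 proof -
  have "(\<Sum>l<n. A $$ (lo + Suc i, l) * ?W $$ (l, lo)) = (\<Sum>l\<in>{lo + i}. A $$ (lo + Suc i, l) * ?W $$ (l, lo))"
  proof (rule sum.mono_neutral_right)
   show "\<forall>l\<in>{..<n} - {lo + i}. A $$ (lo + Suc i, l) * ?W $$ (l, lo) = 0"
   proof
    fix l assume l: "l \<in> {..<n} - {lo + i}"
    thus "A $$ (lo + Suc i, l) * ?W $$ (l, lo) = 0"
     using Suc.IH k A(2) by (cases "lo + i < l") (auto simp: hess_def)
   qed
  qed (use k in auto)
  thus ?thesis using Suc.IH k by (simp add: mult.commute)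
 qed
 ultimately show ?case using e by auto
qed

text \<open>
Then \<open>A\<close> preserves the span of the first \<open>s\<close> basis vectors, so \<open>F\<^sub>s\<close> is an \<open>N\<close>-invariant subspace of dimension \<open>s\<close>; the only such subspace is the kernel of \<open>N^s\<close>.
\<close>

lemma break_of_subdiag_zero:
 assumes s: "1 <= s" "s < n" and z: "A $$ (s, s - 1) = 0"
 shows "brk n h s"
proof -
 have "brk n A s" unfolding brk_def
 proof (intro allI impI)
  fix a b assume ab: "s <= a" "a < n" "b < s"
  show "A $$ (a, b) = 0"
  proof (cases "a = s & b = s - 1")
   case True thus ?thesis using z by simp
  next
   case False
   hence "Suc b < a" using ab by auto
   thus ?thesis using A(2) ab by (auto simp: hess_def)
  qed
 qed
 have W: "brk n (minv h * Nshift n h i) s" for i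
 proof (induction i)
  case 0 show ?case unfolding W_0 by (auto simp: brk_def)
 next
  case (Suc i)
  show ?case unfolding W_Suc using s by (intro brk_mult[OF A(1) W_carrier `brk n A s` Suc]) simp
 qed
 show ?thesis
 proof (rule ccontr)
  assume "~ ?thesis"
  then obtain a0 b where ab: "s <= a0" "a0 < n" "b < s" "h $$ (a0, b) ~= 0" by (auto simp: brk_def)
  define top where "top = Max {a. a < n & h $$ (a, b) ~= 0}"
  have fin: "finite {a. a < n & h $$ (a, b) ~= 0}" by simp
  have "top \<in> {a. a < n & h $$ (a, b) ~= 0}" unfolding top_def using fin ab by (intro Max_in) auto
  hence top: "top < n" "h $$ (top, b) ~= 0" by auto
  have above: "h $$ (a, b) = 0" if a: "top < a" "a < n" for a
  proof (rule ccontr)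
   assume "h $$ (a, b) ~= 0"
   hence "a \<in> {a. a < n & h $$ (a, b) ~= 0}" using a by simp
   from Max_ge[OF fin this] a show False by (simp add: top_def)
  qed
  have st: "s <= top"
  proof -
   have "a0 \<in> {a. a < n & h $$ (a, b) ~= 0}" using ab by simp
   from Max_ge[OF fin this] ab(1) show ?thesis unfolding top_def by linarith
  qed
  have bn: "b < n" using ab s by simp
  obtain y where y: "\<exists>k\<in>{..top}. y k ~= 0"
   "!!e. e < s ==> (\<Sum>k\<in>{..top}. (minv h * Nshift n h k) $$ (e, b) * y k) = 0"
   using more_unknowns_than_equations[of "{..<s}" "{..top}" "%e k. (minv h * Nshift n h k) $$ (e, b)"] st by auto
  have y2: "(\<Sum>k\<in>{..top}. (minv h * Nshift n h k) $$ (e, b) * y k) = 0" if e: "e < n" for e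
  proof (cases "e < s")
   case False
   hence "s <= e" by simp
   hence "(minv h * Nshift n h k) $$ (e, b) = 0" for k using brkD[OF W[of k] _ e ab(3)] by blast
   thus ?thesis by simp
  qed (use y in auto)
  have sh: "(\<Sum>k\<in>{..top}. Nshift n h k $$ (a, b) * y k) = 0" if a: "a < n" for a
  proof -
   have "Nshift n h k $$ (a, b) = (\<Sum>e<n. h $$ (a, e) * (minv h * Nshift n h k) $$ (e, b))" for k
   proof -
    have "Nshift n h k $$ (a, b) = (h * (minv h * Nshift n h k)) $$ (a, b)"
     using GL_cancel_left'[OF h Nshift_carrier] by simp
    also have "... = (\<Sum>e<n. h $$ (a, e) * (minv h * Nshift n h k) $$ (e, b))"
     using mat_mult_index[OF GL_carrier[OF h] W_carrier[of k] a bn] .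
    finally show ?thesis .
   qed
   hence "(\<Sum>k\<in>{..top}. Nshift n h k $$ (a, b) * y k) =
     (\<Sum>k\<in>{..top}. \<Sum>e<n. h $$ (a, e) * ((minv h * Nshift n h k) $$ (e, b) * y k))"
    by (simp add: sum_distrib_right mult.assoc)
   also have "... = (\<Sum>e<n. h $$ (a, e) * (\<Sum>k\<in>{..top}. (minv h * Nshift n h k) $$ (e, b) * y k))"
    by (subst sum.swap) (simp add: sum_distrib_left)
   also have "... = 0" using y2 by simp
   finally show ?thesis .
  qed
  have "k <= top --> y k = 0" for k
  proof (induction k rule: less_induct)
   case (less k)
   show ?case
   proof
    assume k: "k <= top"
    have an: "top - k < n" using top by simp
    have "(\<Sum>l\<in>{..top}. Nshift n h l $$ (top - k, b) * y l) = (\<Sum>l\<in>{k}. Nshift n h l $$ (top - k, b) * y l)"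
    proof (rule sum.mono_neutral_right)
     show "\<forall>l\<in>{..top} - {k}. Nshift n h l $$ (top - k, b) * y l = 0"
     proof
      fix l assume l: "l \<in> {..top} - {k}"
      show "Nshift n h l $$ (top - k, b) * y l = 0"
      proof (cases "l < k")
       case True thus ?thesis using less.IH[of l] l by simp
      next
       case False
       hence "top < top - k + l" using k l by auto
       thus ?thesis unfolding Nshift_index[OF an bn] using above[of "top - k + l"] by simp
      qed
     qed
    qed (use k in auto)
    hence "h $$ (top, b) * y k = 0" using sh[OF an] k top by (simp add: Nshift_index[OF an bn])
    thus "y k = 0" using top by simp
   qed
  qed
  with y(1) show False by auto
 qed
qed

text \<open>
Within a block the subdiagonal of \<open>A\<close> has no zeros, so the flag is generated there by \<open>v, N v, N^2 v, ...\<close> with \<open>v\<close> the first column of the block. These columns form a Hankel block; scaling makes its antidiagonal 1.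
\<close>

theorem strata_normal_form:
 defines "S \<equiv> (breaks n h)"
 shows "\<exists>t\<in>affine_space {1..<n}. \<exists>b\<in>borel_subgroup n. Kmat n S t = h * b"
proof -
 have S: "S \<subseteq> {1..<n}" by (auto simp: S_def)
 note c = GL_carrier[OF h]
 note m = minv_carrier[OF c]
 have sub: "A $$ (Suc l, l) ~= 0" if "Suc l < n" "Suc l \<notin> S" for l
  using break_of_subdiag_zero[of "Suc l"] that unfolding S_def by auto
 have bk: "brk n h s" if "s = 0 \<or> s \<in> S \<or> s = n" for s
  using that by (auto simp: S_def brk_def)
 (* A zero corner entry would make an entry of A^i vanish that is a product of nonzero subdiagonal entries. *)
 have topne: "h $$ (be n S b - 1, bs S b) ~= 0" if b: "b < n" for b
 proof
  define lo where "lo = bs S b"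
  define hi where "hi = be n S b"
  have lo: "lo <= b" "b < hi" "hi <= n"
   using bs_le[OF S] be_gt[OF S b] be_le[OF S] by (auto simp: lo_def hi_def)
  have lon: "lo < n" using lo by simp
  assume "h $$ (be n S b - 1, bs S b) = 0"
  hence z: "h $$ (hi - 1, lo) = 0" by (simp add: lo_def hi_def)
  define i where "i = hi - 1 - lo"
  have i: "lo + i = hi - 1" using lo by (simp add: i_def)
  have "Nshift n h i $$ (a, lo) = 0" if a: "lo <= a" "a < n" for a
  proof (cases "a = lo")
   case True thus ?thesis using z i lo by (simp add: Nshift_def)
  next
   case False
   have "brk n h hi" using be_S[OF S, of b] by (intro bk) (auto simp: hi_def)
   from brkD[OF this, of "a + i" lo] show ?thesis using a False i lo by (auto simp: Nshift_def)
  qed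
  hence Nz: "!!a. lo <= a ==> a < n ==> Nshift n h i $$ (a, lo) = 0" .
  have kn: "lo + i < n" using i lo by linarith
  have "brk n h lo" using bs_S[OF S, of b] by (intro bk) (auto simp: lo_def)
  from brk_minv[OF h this] lo have bm: "brk n (minv h) lo" by simp
  have "(minv h * Nshift n h i) $$ (lo + i, lo) = (\<Sum>a<n. minv h $$ (lo + i, a) * Nshift n h i $$ (a, lo))"
   by (rule mat_mult_index[OF m Nshift_carrier kn lon])
  also have "... = 0"
  proof (rule sum.neutral, rule ballI)
   fix a assume "a \<in> {..<n}"
   thus "minv h $$ (lo + i, a) * Nshift n h i $$ (a, lo) = 0"
    using brkD[OF bm _ kn, of a] Nz[of a] by (cases "a < lo") auto
  qed
  finally have "(\<Prod>l<i. A $$ (Suc (lo + l), lo + l)) = 0" using W_lead[OF lon, of i] kn by simp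
  then obtain l where l: "l < i" "A $$ (Suc (lo + l), lo + l) = 0" by auto
  have "Suc (lo + l) \<notin> S" using no_break_inside[OF S, of "Suc (lo + l)" b] l i lo by (auto simp: lo_def hi_def)
  moreover have "Suc (lo + l) < n" using l(1) kn by linarith
  ultimately show False using sub[of "lo + l"] l(2) by blast
 qed
 define t where "t k = (if k \<in> {1..<n} then h $$ (bs S k + be n S k - Suc k, bs S k) / h $$ (be n S k - 1, bs S k) else 0)" for k
 let ?K = "Kmat n S t"
 have KG: "?K \<in> GL n" by (rule Kmat_GL[OF S])
 have K: "?K $$ (a, b) = (if bs S b <= a then Nshift n h (b - bs S b) $$ (a, bs S b) / h $$ (be n S b - 1, bs S b) else 0)"
  if ab: "a < n" "b < n" for a b
 proof -
  define lo where "lo = bs S b"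
  define hi where "hi = be n S b"
  have lo: "lo <= b" "b < hi" "hi <= n"
   using bs_le[OF S] be_gt[OF S ab(2)] be_le[OF S] by (auto simp: lo_def hi_def)
  have lon: "lo < n" using lo by simp
  have ne: "h $$ (hi - 1, lo) ~= 0" using topne[OF ab(2)] by (simp add: lo_def hi_def)
  show ?thesis
  proof (cases "lo <= a")
   case False thus ?thesis using ab by (simp add: Kmat_index lo_def)
  next
   case sa: True
   show ?thesis
   proof (cases "a + b < lo + hi")
    case False
    have "brk n h hi" using be_S[OF S, of b] by (intro bk) (auto simp: hi_def)
    from brkD[OF this, of "a + (b - lo)" lo] False lo ab lon
    have "Nshift n h (b - lo) $$ (a, lo) = 0" unfolding Nshift_index[OF ab(1) lon] by auto
    thus ?thesis using False ab by (simp add: Kmat_index lo_def hi_def)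
   next
    case True
    have N: "Nshift n h (b - lo) $$ (a, lo) = h $$ (a + (b - lo), lo)"
     using True lo unfolding Nshift_index[OF ab(1) lon] by auto
    show ?thesis
    proof (cases "Suc (a + b) = lo + hi")
     case True
     hence "a + (b - lo) = hi - 1" using lo by simp
     thus ?thesis using True ab ne N sa by (simp add: Kmat_index lo_def[symmetric] hi_def[symmetric])
    next
     case False
     define k where "k = lo + (lo + hi - Suc (a + b))"
     have k: "lo < k" "k < hi" "lo + hi - Suc k = a + (b - lo)" using False True lo sa by (auto simp: k_def)
     have bk: "bs S k = lo" "be n S k = hi"
      using same_block[OF S, of b k] k by (auto simp: lo_def hi_def)
     have "t k = h $$ (a + (b - lo), lo) / h $$ (hi - 1, lo)"
      unfolding t_def bk using k lo by auto
     thus ?thesis using False True ab N sa by (simp add: Kmat_index lo_def[symmetric] hi_def[symmetric] k_def[symmetric])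
    qed
   qed
  qed
 qed
 have up: "(minv h * ?K) $$ (k, b) = 0" if kb: "k < n" "b < k" for k b
 proof -
  have bn: "b < n" using kb by simp
  define lo where "lo = bs S b"
  have lo: "lo <= b" using bs_le[OF S] by (simp add: lo_def)
  have lon: "lo < n" using lo bn by simp
  have "brk n h lo" using bs_S[OF S, of b] by (intro bk) (auto simp: lo_def)
  from brk_minv[OF h this] lon have bm: "brk n (minv h) lo" by simp
  let ?x = "h $$ (be n S b - 1, bs S b)"
  have "(minv h * ?K) $$ (k, b) = (\<Sum>a<n. minv h $$ (k, a) * ?K $$ (a, b))"
   by (rule mat_mult_index[OF m Kmat_carrier kb(1) bn])
  also have "... = (\<Sum>a<n. minv h $$ (k, a) * Nshift n h (b - lo) $$ (a, lo) / ?x)"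
  proof (intro sum.cong refl)
   fix a assume "a \<in> {..<n}"
   thus "minv h $$ (k, a) * ?K $$ (a, b) = minv h $$ (k, a) * Nshift n h (b - lo) $$ (a, lo) / ?x"
    using K[of a b] bn brkD[OF bm, of k a] kb lo by (cases "lo <= a") (auto simp: lo_def)
  qed
  also have "... = (minv h * Nshift n h (b - lo)) $$ (k, lo) / ?x"
   unfolding mat_mult_index[OF m Nshift_carrier kb(1) lon] by (simp add: sum_divide_distrib)
  also have "... = 0" using W_lead[OF lon, of "b - lo"] kb lo by simp
  finally show ?thesis .
 qed
 have bB: "minv h * ?K \<in> borel_subgroup n"
  unfolding borel_iff using GL_mult[OF GL_minv[OF h] KG] up by (auto simp: brk_def)
 have "h * (minv h * ?K) = ?K" by (rule GL_cancel_left'[OF h Kmat_carrier])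
 moreover have "t \<in> affine_space {1..<n}" by (auto simp: t_def affine_space_def)
 ultimately show ?thesis using bB by (intro bexI[of _ t] bexI[of _ "minv h * ?K"]) auto
qed

end

lemma PM_normal_form:
 assumes "PM n h"
 shows "\<exists>t\<in>affine_space {1..<n}. \<exists>b\<in>borel_subgroup n. Kmat n (breaks n h) t = h * b"
 using assms strata_normal_form unfolding PM_def by blast

lemma polymat_Kmat:
 assumes S: "S \<subseteq> {1..<n}"
 shows "polymat {1..<n} n n (Kmat n S)"
 unfolding Kmat_def
proof (rule polymat_mat)
 fix a b assume ab: "a < n" "b < n"
 show "(%t. if bs S b <= a & a + b < bs S b + be n S b
   then (if Suc (a + b) = bs S b + be n S b then 1 else t (bs S b + (bs S b + be n S b - Suc (a + b)))) else 0)
   \<in> poly_funs {1..<n}"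
 proof (cases "bs S b <= a & a + b < bs S b + be n S b & Suc (a + b) ~= bs S b + be n S b")
  case True
  hence k: "bs S b + (bs S b + be n S b - Suc (a + b)) \<in> {1..<n}"
   using bs_le[OF S, of b] be_le[OF S, of b] by auto
  have c1: "bs S b <= a & a + b < bs S b + be n S b" and c2: "Suc (a + b) ~= bs S b + be n S b"
   using True by auto
  show ?thesis unfolding if_P[OF c1] if_not_P[OF c2] by (rule poly_funs.coord[OF k])
 next
  case False
  show ?thesis
  proof (cases "bs S b <= a & a + b < bs S b + be n S b")
   case c1: True
   with False have c2: "Suc (a + b) = bs S b + be n S b" by blast
   show ?thesis unfolding if_P[OF c1] if_P[OF c2] by (rule poly_funs.const)
  next
   case c1: False
   show ?thesis unfolding if_not_P[OF c1] by (rule poly_funs.const)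
  qed
 qed
qed

text \<open>
For each break set the LU coordinates of the normal form are a rational chart with \<open>n - 1\<close> parameters.
\<close>

lemma local_dim_patch_le:
 assumes g: "g \<in> GL n"
 shows "local_dim (patch_index n) (Pat n g) p <= enat (n - 1)"
proof (rule local_dim_le)
 fix k Z
 assume Z: "!!j. j <= k ==> zariski_closed (patch_index n) (Z j)" "!!j. j <= k ==> zariski_irreducible (patch_index n) (Z j)"
  "!!j. j < k ==> Z j \<subset> Z (Suc j)" "Z k \<subseteq> Pat n g"
 note gc = GL_carrier[OF g]
 define M where "M S t = minv g * Kmat n S t" for S t
 have pM: "polymat {1..<n} n n (M S)" if "S \<in> Pow {1..<n}" for S
  unfolding M_def by (rule polymat_mult[OF polymat_const[OF minv_carrier[OF gc]] polymat_Kmat]) (use that in auto)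
 define D where "D S t = (\<Prod>j<n. minor j j (M S t))" for S t
 have "k <= card {1..<n}"
 proof (rule chain_length_le_parameters[where C = "Pow {1..<n}" and D = D and \<phi> = "%S t. lu_coord n (M S t)" and
    Y = "Pat n g" and I = "patch_index n" and Z = Z])
  fix S :: "nat set" assume S: "S \<in> Pow {1..<n}"
  show "D S \<in> poly_funs {1..<n}" unfolding D_def by (intro poly_funs_prod polymat_minor[OF pM[OF S]]) auto
  fix q assume "q \<in> patch_index n"
  then obtain i j where q: "q = (i, j)" "j < i" "i < n" by (auto simp: patch_index_def)
  show "\<exists>k. \<exists>F\<in>poly_funs {1..<n}. \<forall>t\<in>{t. D S t ~= 0}. D S t ^ k * lu_coord n (M S t) q = F t"
  proof (rule exI[of _ 1], rule bexI[of _ "%x. minor i j (M S x) * (\<Prod>l\<in>{..<n} - {j}. minor l l (M S x))"], rule ballI)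
   fix x assume "x \<in> {t. D S t ~= 0}"
   hence "minor j j (M S x) ~= 0" using q by (auto simp: D_def)
   moreover have "D S x = minor j j (M S x) * (\<Prod>l\<in>{..<n} - {j}. minor l l (M S x))"
    unfolding D_def using q by (intro prod.remove) auto
   ultimately show "D S x ^ 1 * lu_coord n (M S x) q = minor i j (M S x) * (\<Prod>l\<in>{..<n} - {j}. minor l l (M S x))"
    using q by (simp add: lu_coord_def)
  qed (intro poly_funs.mult poly_funs_prod polymat_minor[OF pM[OF S]], use q in auto)
 next
  show "Pat n g \<subseteq> (\<Union>S\<in>Pow {1..<n}. (%t. lu_coord n (M S t)) ` {t. D S t ~= 0})"
  proof
   fix p assume "p \<in> Pat n g"
   hence p: "p \<in> affine_space (patch_index n)" "PM n (g * LL n p)" using patch_iff[OF g] by auto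
   define S where "S = {s \<in> {1..<n}. brk n (g * LL n p) s}"
   obtain t b where b: "b \<in> borel_subgroup n" and K: "Kmat n S t = g * LL n p * b"
    using PM_normal_form[OF p(2)] by (auto simp: S_def)
   have "M S t = LL n p * b"
    unfolding M_def K using GL_cancel_left[OF g, of "LL n p * b" n] gc borel_carrier[OF b]
    by (simp add: square_assoc[of _ n])
   hence "lu_coord n (M S t) = p" "D S t ~= 0"
    using lu_coord_LU[OF b p(1)] minor_LU(2)[OF b] by (auto simp: D_def)
   moreover have "S \<in> Pow {1..<n}" by (auto simp: S_def)
   ultimately show "p \<in> (\<Union>S\<in>Pow {1..<n}. (%t. lu_coord n (M S t)) ` {t. D S t ~= 0})" by blast
  qed
 qed (use Z in auto)
 thus "k <= n - 1" by simp
qed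

section \<open>Inversions and Coxeter length\<close>

definition invs :: "nat => (nat => nat) => (nat \<times> nat) set" where
 "invs n w = {(i, j). 1 <= i & i < j & j <= n & w j < w i}"

lemma finite_invs: "finite (invs n w)"
 by (rule finite_subset[of _ "{1..n} \<times> {1..n}"]) (auto simp: invs_def)

lemma transpose_adjacent_less:
 assumes "x ~= y" "~ (x = Suc i & y = i)" "~ (x = i & y = Suc i)"
 shows "transpose i (Suc i) x < transpose i (Suc i) y \<longleftrightarrow> x < y"
 using assms by (auto simp: transpose_def)

lemma invs_transpose_subset:
 assumes w: "w permutes {1..n}" and i: "i \<in> {1..<n}"
 shows "invs n (transpose i (Suc i) \<circ> w) \<subseteq> insert (inv_into UNIV w i, inv_into UNIV w (Suc i)) (invs n w)"
proof
 fix x assume x: "x \<in> invs n (transpose i (Suc i) \<circ> w)"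
 obtain a b where ab: "x = (a, b)" by (cases x)
 have inj: "inj w" using permutes_inj[OF w] .
 have "a ~= b" using x ab by (auto simp: invs_def)
 hence ne: "w b ~= w a" using inj by (auto dest: injD)
 show "x \<in> insert (inv_into UNIV w i, inv_into UNIV w (Suc i)) (invs n w)"
 proof (cases "w b = Suc i & w a = i")
  case True
  hence "inv_into UNIV w i = a" "inv_into UNIV w (Suc i) = b"
   using inv_f_f[OF inj, of a] inv_f_f[OF inj, of b] by simp_all
  thus ?thesis using ab by simp
 next
  case False
  show ?thesis
  proof (cases "w b = i & w a = Suc i")
   case True
   thus ?thesis using x ab by (auto simp: invs_def)
  next
   case False2: False
   show ?thesis using x transpose_adjacent_less[OF ne False False2] by (auto simp: invs_def ab)
  qed
 qed
qed

text \<open>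
Swapping the values \<open>i\<close> and \<open>i + 1\<close> that occur in the wrong order removes exactly this inversion.
\<close>

lemma invs_transpose_down:
 assumes w: "w permutes {1..n}" and i: "i \<in> {1..<n}" and d: "inv_into UNIV w (Suc i) < inv_into UNIV w i"
 shows "invs n w = insert (inv_into UNIV w (Suc i), inv_into UNIV w i) (invs n (transpose i (Suc i) \<circ> w))"
  "(inv_into UNIV w (Suc i), inv_into UNIV w i) \<notin> invs n (transpose i (Suc i) \<circ> w)"
proof -
 have wi: "w (inv_into UNIV w x) = x" for x using permutes_inverses(1)[OF w] by simp
 have m: "inv_into UNIV w i \<in> {1..n}" "inv_into UNIV w (Suc i) \<in> {1..n}"
  using permutes_in_image[OF permutes_inv[OF w]] i by auto
 show 2: "(inv_into UNIV w (Suc i), inv_into UNIV w i) \<notin> invs n (transpose i (Suc i) \<circ> w)"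
  by (auto simp: invs_def wi)
 have in1: "(inv_into UNIV w (Suc i), inv_into UNIV w i) \<in> invs n w" using m d by (auto simp: invs_def wi)
 let ?u = "transpose i (Suc i) \<circ> w"
 have u: "?u permutes {1..n}" using i by (intro permutes_compose[OF w] permutes_swap_id) auto
 have uw: "transpose i (Suc i) \<circ> ?u = w" by (auto simp: fun_eq_iff)
 have iu: "inv_into UNIV ?u i = inv_into UNIV w (Suc i)" "inv_into UNIV ?u (Suc i) = inv_into UNIV w i"
  using inv_f_eq[OF permutes_inj[OF u], of "inv_into UNIV w (Suc i)" i] inv_f_eq[OF permutes_inj[OF u], of "inv_into UNIV w i" "Suc i"]
  by (auto simp: wi)
 have "invs n w \<subseteq> insert (inv_into UNIV w (Suc i), inv_into UNIV w i) (invs n ?u)"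
  using invs_transpose_subset[OF u i] unfolding uw iu .
 moreover have "invs n ?u \<subseteq> invs n w"
  using invs_transpose_subset[OF w i] d by (auto simp: invs_def)
 ultimately show "invs n w = insert (inv_into UNIV w (Suc i), inv_into UNIV w i) (invs n ?u)" using in1 by blast
qed

lemma permutes_mono_id:
 assumes w: "w permutes {1..n}" and m: "!!i. i \<in> {1..<n} ==> inv_into UNIV w i < inv_into UNIV w (Suc i)"
 shows "w = id"
proof -
 have iw: "inv_into UNIV w permutes {1..n}" by (rule permutes_inv[OF w])
 have ge: "i <= inv_into UNIV w i" if "1 <= i" "i <= n" for i
  using that
 proof (induction i)
  case (Suc i)
  show ?case
  proof (cases "i = 0")
   case True
   thus ?thesis using permutes_in_image[OF iw, of "Suc i"] Suc.prems by auto
  next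
   case False
   thus ?thesis using Suc m[of i] by auto
  qed
 qed simp
 have mono: "inv_into UNIV w i + k <= inv_into UNIV w (i + k)" if "1 <= i" "i + k <= n" for i k
  using that
 proof (induction k)
  case (Suc k)
  hence "inv_into UNIV w (i + k) < inv_into UNIV w (Suc (i + k))" by (intro m) auto
  thus ?case using Suc by simp
 qed simp
 have "inv_into UNIV w i = i" for i
 proof (cases "i \<in> {1..n}")
  case True
  have "inv_into UNIV w i + (n - i) <= inv_into UNIV w n" using mono[of i "n - i"] True by auto
  moreover have "inv_into UNIV w n <= n" using permutes_in_image[OF iw, of n] True by auto
  ultimately show ?thesis using ge[of i] True by auto
 next
  case False
  thus ?thesis using permutes_not_in[OF iw] by auto
 qed
 hence "inv_into UNIV w = id" by auto
 thus ?thesis using permutes_inv_inv[OF w] by (metis inv_id)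
qed

primrec word :: "nat list => nat => nat" where
 "word [] = id"
| "word (i # is) = transpose i (Suc i) \<circ> word is"

lemma word_foldr: "foldr (%i u. transpose i (Suc i) \<circ> u) is id = word is"
 by (induction "is") simp_all

lemma word_permutes: "set is \<subseteq> {1..<n} ==> word is permutes {1..n}"
proof (induction "is")
 case Nil
 show ?case unfolding word.simps by (rule permutes_id)
next
 case (Cons i "is")
 hence w: "word is permutes {1..n}" and i: "i \<in> {1..n}" "Suc i \<in> {1..n}" by auto
 show ?case unfolding word.simps by (rule permutes_compose[OF w permutes_swap_id[OF i]])
qed

lemma card_invs_word: "set is \<subseteq> {1..<n} ==> card (invs n (word is)) <= length is"
proof (induction "is")
 case Nil
 have "invs n (word []) = {}" by (auto simp: invs_def)
 thus ?case by (simp only: card.empty le0)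
next
 case (Cons i "is")
 have le1: "card (invs n (word (i # is))) <= card (insert (inv_into UNIV (word is) i, inv_into UNIV (word is) (Suc i)) (invs n (word is)))"
 proof (rule card_mono)
  have i: "set is \<subseteq> {1..<n}" "i \<in> {1..<n}" using Cons.prems by auto
  show "invs n (word (i # is)) \<subseteq> insert (inv_into UNIV (word is) i, inv_into UNIV (word is) (Suc i)) (invs n (word is))"
   unfolding word.simps by (rule invs_transpose_subset[OF word_permutes[OF i(1)] i(2)])
 qed (simp add: finite_invs)
 have "card (invs n (word is)) <= length is" using Cons by simp
 with le1 show ?case unfolding card_insert_if[OF finite_invs] by (simp split: if_splits del: word.simps)
qed

lemma word_exists:
 assumes "w permutes {1..n}"
 shows "\<exists>is. length is = card (invs n w) & set is \<subseteq> {1..<n} & w = word is"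
 using assms
proof (induction "card (invs n w)" arbitrary: w)
 case 0
 hence e: "invs n w = {}" using finite_invs by simp
 have "w = id"
 proof (rule permutes_mono_id[OF 0(2)])
  fix i assume i: "i \<in> {1..<n}"
  have wi: "w (inv_into UNIV w x) = x" for x using permutes_inverses(1)[OF 0(2)] by simp
  have m: "inv_into UNIV w i \<in> {1..n}" "inv_into UNIV w (Suc i) \<in> {1..n}"
   using permutes_in_image[OF permutes_inv[OF 0(2)]] i by auto
  have "inv_into UNIV w i ~= inv_into UNIV w (Suc i)" using wi[of i] wi[of "Suc i"] by fastforce
  moreover have "~ inv_into UNIV w (Suc i) < inv_into UNIV w i"
  proof
   assume "inv_into UNIV w (Suc i) < inv_into UNIV w i"
   hence "(inv_into UNIV w (Suc i), inv_into UNIV w i) \<in> invs n w" using m by (auto simp: invs_def wi)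
   thus False using e by simp
  qed
  ultimately show "inv_into UNIV w i < inv_into UNIV w (Suc i)" by simp
 qed
 hence "w = word []" by (simp only: word.simps)
 moreover have "length ([] :: nat list) = card (invs n w)" unfolding e by simp
 ultimately show ?case by (intro exI[of _ "[]"] conjI) (assumption | simp del: id_def)+
next
 case (Suc k)
 have "\<exists>i\<in>{1..<n}. inv_into UNIV w (Suc i) < inv_into UNIV w i"
 proof (rule ccontr)
  assume n: "~ ?thesis"
  have "w = id"
  proof (rule permutes_mono_id[OF Suc(3)])
   fix i assume i: "i \<in> {1..<n}"
   have "inv_into UNIV w i ~= inv_into UNIV w (Suc i)" using permutes_inverses(1)[OF Suc(3), of i] permutes_inverses(1)[OF Suc(3), of "Suc i"] by fastforce
   thus "inv_into UNIV w i < inv_into UNIV w (Suc i)" using n i by (meson linorder_neqE_nat)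
  qed
  hence "invs n w = invs n id" by (rule arg_cong)
  also have "invs n id = {}" unfolding invs_def by auto
  finally have "card (invs n w) = 0" by (simp only: card.empty)
  thus False using Suc(2) by linarith
 qed
 then obtain i where i: "i \<in> {1..<n}" "inv_into UNIV w (Suc i) < inv_into UNIV w i" by blast
 let ?u = "transpose i (Suc i) \<circ> w"
 have u: "?u permutes {1..n}" using i by (intro permutes_compose[OF Suc(3)] permutes_swap_id) auto
 have "card (invs n w) = Suc (card (invs n ?u))"
  unfolding invs_transpose_down(1)[OF Suc(3) i]
  using invs_transpose_down(2)[OF Suc(3) i] by (simp add: finite_invs)
 hence k: "k = card (invs n ?u)" using Suc(2) by simp
 from Suc(1)[OF k u] obtain "is" where is': "length is = card (invs n ?u)" "set is \<subseteq> {1..<n}" "?u = word is" by blast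
 have "w = transpose i (Suc i) \<circ> ?u" by (auto simp: fun_eq_iff)
 hence "w = word (i # is)" unfolding word.simps is'(3)[symmetric] .
 thus ?case using is' i k Suc(2) by (intro exI[of _ "i # is"]) auto
qed

lemma coxeter_length_eq:
 assumes "w permutes {1..n}"
 shows "coxeter_length n w = card (invs n w)"
 unfolding coxeter_length_def word_foldr
proof (rule Least_equality)
 show "\<exists>is. length is = card (invs n w) & set is \<subseteq> {1..<n} & w = word is" by (rule word_exists[OF assms])
 fix l assume "\<exists>is. length is = l & set is \<subseteq> {1..<n} & w = word is"
 thus "card (invs n w) <= l" using card_invs_word by auto
qed

abbreviation st :: "nat list => nat => nat" where "st c j \<equiv> sum_list (take j c)"

section \<open>Compositions and their partial sums\<close>

definition psums :: "nat list => nat set" where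
 "psums c = st c ` {1..<length c}"

lemma st_Suc: "j < length c ==> st c (Suc j) = st c j + c ! j"
 by (simp add: take_Suc_conv_app_nth)

context
 fixes n :: nat and c :: "nat list"
 assumes c: "c \<in> compositions n"
begin

lemma sum_c: "sum_list c = n" using c by (simp add: compositions_def)

lemma pos_c: "j < length c ==> 0 < c ! j" using c by (simp add: compositions_def)

lemma st_less: "i < j ==> j <= length c ==> st c i < st c j"
proof (induction j)
 case (Suc j)
 have "st c j < st c (Suc j)" using st_Suc[of j c] pos_c[of j] Suc.prems by simp
 thus ?case using Suc by (cases "i = j") auto
qed simp

lemma st_length: "st c (length c) = n" using sum_c by simp

lemma psums_subset: "psums c \<subseteq> {1..<n}"
proof
 fix s assume "s \<in> psums c"
 then obtain j where j: "1 <= j" "j < length c" "s = st c j" by (auto simp: psums_def)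
 thus "s \<in> {1..<n}" using st_less[of 0 j] st_less[of j "length c"] st_length by auto
qed

lemma block_bs_be:
 assumes j: "j < length c" and b: "st c j <= b" "b < st c (Suc j)"
 shows "bs (psums c) b = st c j" "be n (psums c) b = st c (Suc j)"
proof -
 have le: "st c i <= st c k" if "i <= k" "k <= length c" for i k
  using st_less[of i k] that by (cases "i = k") auto
 have dich: "s <= st c j \<or> st c (Suc j) <= s" if s: "s \<in> psums c" for s
 proof -
  obtain i where i: "i < length c" "s = st c i" using s by (auto simp: psums_def)
  show ?thesis using le[of i j] le[of "Suc j" i] i j by (cases "i <= j") auto
 qed
 have fin: "finite (psums c)" by (simp add: psums_def)
 show "bs (psums c) b = st c j" unfolding bs_def
 proof (rule Max_eqI)
  show "st c j \<in> insert 0 {s \<in> psums c. s <= b}"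
   using j b by (cases "j = 0") (auto simp: psums_def)
  fix y assume "y \<in> insert 0 {s \<in> psums c. s <= b}"
  thus "y <= st c j" using dich[of y] b by auto
 qed (use fin in auto)
 show "be n (psums c) b = st c (Suc j)" unfolding be_def
 proof (rule Min_eqI)
  show "st c (Suc j) \<in> insert n {s \<in> psums c. b < s}"
  proof (cases "Suc j = length c")
   case True thus ?thesis using st_length by simp
  next
   case False
   hence "st c (Suc j) \<in> psums c" using j by (auto simp: psums_def)
   thus ?thesis using b by simp
  qed
  fix y assume "y \<in> insert n {s \<in> psums c. b < s}"
  thus "st c (Suc j) <= y" using dich[of y] b le[of "Suc j" "length c"] st_length j by auto
 qed (use fin in auto)
qed

lemma block_exists:
 assumes "b < n"
 shows "\<exists>j<length c. st c j <= b & b < st c (Suc j)"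
proof -
 define j where "j = (LEAST j. b < st c j)"
 have ex: "b < st c (length c)" using assms st_length by simp
 have j: "b < st c j" unfolding j_def by (rule LeastI[of "%j. b < st c j", OF ex])
 have jl: "j <= length c" unfolding j_def by (rule Least_le[of "%j. b < st c j", OF ex])
 have "j ~= 0" using j by (cases "j = 0") auto
 then obtain i where i: "j = Suc i" by (cases j) auto
 have "~ b < st c i" using not_less_Least[of i "%j. b < st c j"] i by (simp add: j_def[symmetric])
 thus ?thesis using i j jl by (intro exI[of _ i]) auto
qed

end

lemma composition_exists:
 assumes "S \<subseteq> {1..<n}" "n \<ge> 1"
 shows "\<exists>c\<in>compositions n. psums c = S"
 using assms
proof (induction n arbitrary: S rule: less_induct)
 case (less n)
 show ?case
 proof (cases "S = {}")
  case True
  thus ?thesis using less.prems by (intro bexI[of _ "[n]"]) (auto simp: compositions_def psums_def)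
 next
  case False
  have fin: "finite S" using less.prems finite_subset by blast
  define m where "m = Max S"
  have m: "m \<in> S" unfolding m_def using fin False by simp
  have le: "s <= m" if "s \<in> S" for s using fin that by (simp add: m_def)
  have mn: "1 <= m" "m < n" using m less.prems by auto
  have "S - {m} \<subseteq> {1..<m}"
  proof
   fix s assume "s \<in> S - {m}"
   thus "s \<in> {1..<m}" using le[of s] less.prems by auto
  qed
  from less.IH[OF mn(2) this mn(1)] obtain c where c: "c \<in> compositions m" "psums c = S - {m}" by blast
  let ?c = "c @ [n - m]"
  have cne: "c ~= []" using c mn by (auto simp: compositions_def)
  have "?c \<in> compositions n" using c mn by (auto simp: compositions_def)
  moreover have "psums ?c = S"
  proof -
   have "{1..<length ?c} = insert (length c) {1..<length c}" using cne by (auto simp: Suc_le_eq)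
   hence "psums ?c = insert (st ?c (length c)) (st ?c ` {1..<length c})" by (simp add: psums_def)
   also have "st ?c ` {1..<length c} = psums c" unfolding psums_def by (rule image_cong) auto
   also have "st ?c (length c) = m" using sum_c[OF c(1)] by simp
   finally show ?thesis using c(2) m by auto
  qed
  ultimately show ?thesis by blast
 qed
qed

lemma psums_inj:
 assumes c: "c \<in> compositions n" and d: "d \<in> compositions n" and eq: "psums c = psums d"
 shows "c = d"
proof (cases "n = 0")
 case True
 have "c = []" if "c \<in> compositions 0" for c using that by (cases c) (auto simp: compositions_def)
 thus ?thesis using c d True by blast
next
 case False
 define P where "P c = map (st c) [1..<Suc (length c)]" for c
 have ne: "c ~= []" if "c \<in> compositions n" for c using that False by (auto simp: compositions_def)
 have st: "set (P c) = insert n (psums c)" if "c \<in> compositions n" for c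
 proof -
  have e: "{1..<Suc (length c)} = insert (length c) {1..<length c}" using ne[OF that] by (auto simp: Suc_le_eq)
  show ?thesis unfolding P_def psums_def set_map set_upt e image_insert st_length[OF that] ..
 qed
 have sorted: "sorted_wrt (<) (P c)" if cc: "c \<in> compositions n" for c
 proof (rule sorted_wrt_iff_nth_less[THEN iffD2], intro allI impI)
  fix i j assume ij: "i < j" "j < length (P c)"
  have "length (P c) = length c" unfolding P_def length_map length_upt by simp
  hence jl: "j < length c" using ij by simp
  have nth: "P c ! k = st c (Suc k)" if "k < length c" for k
  proof -
   have "k < length [1..<Suc (length c)]" unfolding length_upt using that by simp
   moreover have "[1..<Suc (length c)] ! k = Suc k" using nth_upt[of 1 k "Suc (length c)"] that by simp
   ultimately show ?thesis unfolding P_def by (simp only: nth_map)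
  qed
  show "P c ! i < P c ! j"
   unfolding nth[OF jl] nth[OF less_trans[OF ij(1) jl]]
   by (rule st_less[OF cc]) (use ij jl in auto)
 qed
 have "P c = P d"
  using strict_sorted_equal[OF sorted[OF c] sorted[OF d]] st[OF c] st[OF d] eq by (simp only:)
 hence len: "length c = length d" by (metis P_def diff_Suc_1 length_map length_upt)
 have s: "st c j = st d j" if "1 <= j" "j <= length c" for j
  using arg_cong[OF `P c = P d`, of "%l. l ! (j - 1)"] that len by (simp add: P_def del: upt_Suc)
 have s': "st c j = st d j" if "j <= length c" for j
  using s[of j] that by (cases "j = 0") auto
 show ?thesis
 proof (rule nth_equalityI[OF len])
  fix j assume "j < length c"
  thus "c ! j = d ! j" using st_Suc[of j c] st_Suc[of j d] s'[of j] s'[of "Suc j"] len by simp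
 qed
qed

section \<open>Block reversal is the longest element\<close>

definition wr :: "nat => nat set => nat => nat" where
 "wr n S x = (if 1 <= x & x <= n then bs S (x - 1) + be n S (x - 1) - (x - 1) else x)"

context
 fixes n :: nat and c :: "nat list"
 assumes c: "c \<in> compositions n"
begin

lemma wr_block:
 assumes j: "j < length c" and x: "x \<in> block c j"
 shows "wr n (psums c) x = Suc (st c j + st c (Suc j)) - x" "wr n (psums c) x \<in> block c j" "x \<in> {1..n}"
proof -
 have "st c (Suc j) <= n" using st_less[OF c, of "Suc j" "length c"] st_length[OF c] j by (cases "Suc j = length c") auto
 with x show xn: "x \<in> {1..n}" by (auto simp: block_def)
 have "st c j <= x - 1" "x - 1 < st c (Suc j)" using x by (auto simp: block_def)
 from block_bs_be[OF c j this] show 1: "wr n (psums c) x = Suc (st c j + st c (Suc j)) - x"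
  using x xn by (auto simp: wr_def block_def)
 show "wr n (psums c) x \<in> block c j" unfolding 1 using x by (auto simp: block_def)
qed

lemma in_block:
 assumes "x \<in> {1..n}"
 shows "\<exists>j<length c. x \<in> block c j"
 using block_exists[OF c, of "x - 1"] assms by (force simp: block_def)

lemma wr_invol: "wr n (psums c) (wr n (psums c) x) = x"
proof (cases "x \<in> {1..n}")
 case True
 then obtain j where j: "j < length c" "x \<in> block c j" using in_block by blast
 show ?thesis using wr_block(1)[OF j] wr_block(1)[OF j(1) wr_block(2)[OF j]] j(2) by (auto simp: block_def)
next
 case False
 thus ?thesis by (auto simp: wr_def)
qed

lemma wr_permutes: "wr n (psums c) permutes {1..n}"
proof (rule bij_imp_permutes)
 show "bij_betw (wr n (psums c)) {1..n} {1..n}"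
 proof (rule bij_betw_byWitness[where f' = "wr n (psums c)"])
  have "wr n (psums c) x \<in> {1..n}" if "x \<in> {1..n}" for x
  proof -
   obtain j where j: "j < length c" "x \<in> block c j" using in_block `x \<in> {1..n}` by blast
   show ?thesis using wr_block(3)[OF j(1) wr_block(2)[OF j]] .
  qed
  thus "wr n (psums c) ` {1..n} \<subseteq> {1..n}" by auto
  thus "wr n (psums c) ` {1..n} \<subseteq> {1..n}" .
 qed (use wr_invol in auto)
qed (auto simp: wr_def)

lemma wr_young: "wr n (psums c) \<in> young_subgroup c"
proof -
 have "wr n (psums c) ` block c j = block c j" if j: "j < length c" for j
 proof
  show "wr n (psums c) ` block c j \<subseteq> block c j" using wr_block(2)[OF j] by auto
  show "block c j \<subseteq> wr n (psums c) ` block c j"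
  proof
   fix x assume x: "x \<in> block c j"
   show "x \<in> wr n (psums c) ` block c j"
    by (rule image_eqI[of _ _ "wr n (psums c) x"]) (use wr_invol wr_block(2)[OF j x] in auto)
  qed
 qed
 thus ?thesis using wr_permutes sum_c[OF c] by (simp add: young_subgroup_def)
qed

text \<open>
An element of the Young subgroup has inversions only within blocks, and block reversal inverts all those pairs. It therefore is the unique maximiser of the length.
\<close>

lemma young_invs:
 assumes y: "y \<in> young_subgroup c"
 shows "invs n y \<subseteq> invs n (wr n (psums c))"
  "invs n y = invs n (wr n (psums c)) ==> y = wr n (psums c)"
proof -
 have yp: "y permutes {1..n}" and yb: "!!j. j < length c ==> y ` block c j = block c j"
  using y sum_c[OF c] by (auto simp: young_subgroup_def)
 have inv_iff: "(a, b) \<in> invs n (wr n (psums c))" if "j < length c" "a \<in> block c j" "b \<in> block c j" "a < b" for a b j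
  using wr_block[OF that(1,2)] wr_block[OF that(1,3)] that by (auto simp: invs_def block_def)
 show "invs n y \<subseteq> invs n (wr n (psums c))"
 proof
  fix x assume x: "x \<in> invs n y"
  then obtain a b where ab: "x = (a, b)" "a \<in> {1..n}" "b \<in> {1..n}" "a < b" "y b < y a" by (auto simp: invs_def)
  obtain i where i: "i < length c" "a \<in> block c i" using in_block[OF ab(2)] by blast
  obtain j where j: "j < length c" "b \<in> block c j" using in_block[OF ab(3)] by blast
  have le: "st c k <= st c l" if "k <= l" "l <= length c" for k l
   using st_less[OF c, of k l] that by (cases "k = l") auto
  have ya: "y a \<in> block c i" "y b \<in> block c j" using yb i j by blast+
  have "i = j"
  proof (rule ccontr)
   assume "i ~= j"
   then consider "Suc i <= j" | "Suc j <= i" by linarith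
   thus False
   proof cases
    case 1 thus False using le[of "Suc i" j] ya j ab(5) by (auto simp: block_def)
   next
    case 2 thus False using le[of "Suc j" i] i j ab(4) by (auto simp: block_def)
   qed
  qed
  thus "x \<in> invs n (wr n (psums c))" using inv_iff[of i a b] i j ab by simp
 qed
 assume eq: "invs n y = invs n (wr n (psums c))"
 show "y = wr n (psums c)"
 proof
  fix x show "y x = wr n (psums c) x"
  proof (cases "x \<in> {1..n}")
   case False
   thus ?thesis using permutes_not_in[OF yp] permutes_not_in[OF wr_permutes] by simp
  next
   case True
   then obtain j where j: "j < length c" "x \<in> block c j" using in_block by blast
   have dec: "y b < y a" if "a \<in> block c j" "b \<in> block c j" "a < b" for a b
    using inv_iff[OF j(1) that] eq by (auto simp: invs_def)
   have inj: "inj_on y A" for A using permutes_inj[OF yp] by (rule inj_on_subset) simp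
   have yx: "y x \<in> block c j" using yb j by blast
   have s: "{z \<in> block c j. y z < y x} = {x<..st c (Suc j)}"
   proof
    show "{z \<in> block c j. y z < y x} \<subseteq> {x<..st c (Suc j)}"
    proof
     fix z assume z: "z \<in> {z \<in> block c j. y z < y x}"
     have zb: "z \<in> block c j" "y z < y x" using z by blast+
     have "~ z < x" using dec[OF zb(1) j(2)] zb(2) by linarith
     moreover have "z ~= x" using zb(2) by blast
     ultimately show "z \<in> {x<..st c (Suc j)}"
      using zb(1) unfolding block_def greaterThanAtMost_iff by linarith
    qed
    show "{x<..st c (Suc j)} \<subseteq> {z \<in> block c j. y z < y x}"
    proof
     fix z assume z: "z \<in> {x<..st c (Suc j)}"
     have zb: "z \<in> block c j" using z j(2) unfolding block_def greaterThanAtMost_iff by linarith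
     have "x < z" using z by simp
     from dec[OF j(2) zb this] zb show "z \<in> {z \<in> block c j. y z < y x}" by blast
    qed
   qed
   have "y ` {z \<in> block c j. y z < y x} = {v \<in> block c j. v < y x}"
   proof (intro Set.set_eqI iffI)
    fix v assume "v \<in> y ` {z \<in> block c j. y z < y x}"
    then obtain z where z: "v = y z" "z \<in> block c j" "y z < y x" by (elim imageE CollectE conjE) (rule that)
    have "y z \<in> y ` block c j" using z(2) by (rule imageI)
    thus "v \<in> {v \<in> block c j. v < y x}" using z(1,3) unfolding yb[OF j(1)] by simp
   next
    fix v assume "v \<in> {v \<in> block c j. v < y x}"
    hence v: "v \<in> y ` block c j" "v < y x" unfolding yb[OF j(1)] by simp_all
    then obtain z where "v = y z" "z \<in> block c j" by (elim imageE) (rule that)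
    thus "v \<in> y ` {z \<in> block c j. y z < y x}" using v(2) by (intro image_eqI[of v y z]) simp_all
   qed
   also have "... = {st c j<..<y x}"
   proof (intro Set.set_eqI iffI)
    fix v assume "v \<in> {v \<in> block c j. v < y x}"
    thus "v \<in> {st c j<..<y x}" by (simp add: block_def)
   next
    fix v assume "v \<in> {st c j<..<y x}"
    thus "v \<in> {v \<in> block c j. v < y x}" using yx unfolding block_def by simp
   qed
   finally have "card {st c j<..<y x} = card {x<..st c (Suc j)}"
    using card_image[OF inj, of "{z \<in> block c j. y z < y x}"] unfolding s by simp
   hence e: "y x - Suc (st c j) = st c (Suc j) - x" unfolding card_greaterThanLessThan card_greaterThanAtMost .
   show ?thesis unfolding wr_block(1)[OF j]
    using e yx j(2) unfolding block_def greaterThanAtMost_iff by linarith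
  qed
 qed
qed

lemma w_P_eq: "w_P c = wr n (psums c)"
 unfolding w_P_def sum_c[OF c]
proof (rule arg_maxI[where P = "%w. w \<in> young_subgroup c" and f = "coxeter_length n" and x = "wr n (psums c)"])
 show "wr n (psums c) \<in> young_subgroup c" by (rule wr_young)
 have len: "coxeter_length n y = card (invs n y)" if "y \<in> young_subgroup c" for y
  using that sum_c[OF c] by (intro coxeter_length_eq) (auto simp: young_subgroup_def)
 fix y assume y: "y \<in> young_subgroup c"
 show "~ coxeter_length n y > coxeter_length n (wr n (psums c))"
  unfolding len[OF y] len[OF wr_young] using card_mono[OF finite_invs young_invs(1)[OF y]] by (simp only: not_less)
next
 have len: "coxeter_length n y = card (invs n y)" if "y \<in> young_subgroup c" for y
  using that sum_c[OF c] by (intro coxeter_length_eq) (auto simp: young_subgroup_def)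
 fix x assume x: "x \<in> young_subgroup c" "\<forall>y. y \<in> young_subgroup c --> ~ coxeter_length n x < coxeter_length n y"
 have "~ card (invs n x) < card (invs n (wr n (psums c)))"
  using x(2)[rule_format, OF wr_young] unfolding len[OF x(1)] len[OF wr_young] .
 hence "card (invs n x) = card (invs n (wr n (psums c)))"
  using card_mono[OF finite_invs young_invs(1)[OF x(1)]] by linarith
 hence "invs n x = invs n (wr n (psums c))" by (rule card_subset_eq[OF finite_invs young_invs(1)[OF x(1)]])
 thus "x = wr n (psums c)" by (rule young_invs(2)[OF x(1)])
qed

end

section \<open>Strata as level sets of the break set\<close>

lemma diag_block_mat_index:
 assumes "length Bs = length c" "!!j. j < length c ==> Bs ! j \<in> carrier_mat (c ! j) (c ! j)"
 shows "diag_block_mat Bs \<in> carrier_mat (sum_list c) (sum_list c) &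
  (\<forall>j a b. j < length c --> a < sum_list c --> st c j <= b --> b < st c (Suc j) -->
   diag_block_mat Bs $$ (a, b) = (if st c j <= a & a < st c (Suc j) then (Bs ! j) $$ (a - st c j, b - st c j) else 0))"
 using assms
proof (induction c arbitrary: Bs)
 case Nil
 thus ?case by simp
next
 case (Cons x c)
 obtain B Bs' where Bs: "Bs = B # Bs'" using Cons.prems(1) by (cases Bs) auto
 have len: "length Bs' = length c" using Cons.prems(1) Bs by simp
 have B: "B \<in> carrier_mat x x" using Cons.prems(2)[of 0] Bs by simp
 have Bs': "Bs' ! j \<in> carrier_mat (c ! j) (c ! j)" if "j < length c" for j
  using Cons.prems(2)[of "Suc j"] Bs that by simp
 note IH = Cons.IH[OF len Bs']
 let ?D = "diag_block_mat Bs'"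
 have D: "?D \<in> carrier_mat (sum_list c) (sum_list c)" using IH by blast
 have e: "diag_block_mat Bs = four_block_mat B (0\<^sub>m x (sum_list c)) (0\<^sub>m (sum_list c) x) ?D"
  unfolding Bs using B D by (simp add: Let_def)
 have "diag_block_mat Bs $$ (a, b) = (if st (x # c) j <= a & a < st (x # c) (Suc j)
   then (Bs ! j) $$ (a - st (x # c) j, b - st (x # c) j) else 0)"
  if j: "j < length (x # c)" and a: "a < sum_list (x # c)" and b: "st (x # c) j <= b" "b < st (x # c) (Suc j)" for j a b
 proof (cases j)
  case 0
  hence "b < x" using b by simp
  hence "diag_block_mat Bs $$ (a, b) = (if a < x then B $$ (a, b) else 0)"
   unfolding e using a B D by (simp add: index_mat_four_block)
  thus ?thesis using 0 Bs by simp
 next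
  case (Suc i)
  have i: "i < length c" using j Suc by simp
  have bb: "x <= b" "st c i <= b - x" "b - x < st c (Suc i)" using b Suc by auto
  have "st c (Suc i) <= sum_list c" by (metis append_take_drop_id le_add1 sum_list_append)
  hence bs: "b - x < sum_list c" using bb by linarith
  show ?thesis
  proof (cases "a < x")
   case True
   hence "diag_block_mat Bs $$ (a, b) = 0" unfolding e using bb bs B D by (simp add: index_mat_four_block)
   thus ?thesis using True Suc by simp
  next
   case False
   hence "diag_block_mat Bs $$ (a, b) = ?D $$ (a - x, b - x)"
    unfolding e using bb bs B D a by (simp add: index_mat_four_block)
   also have "... = (if st c i <= a - x & a - x < st c (Suc i) then (Bs' ! i) $$ (a - x - st c i, b - x - st c i) else 0)"
    using IH i bb a False by simp
   finally show ?thesis using Suc False Bs by (auto simp: algebra_simps)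
  qed
 qed
 moreover have "diag_block_mat Bs \<in> carrier_mat (sum_list (x # c)) (sum_list (x # c))"
  unfolding e using B D by simp
 ultimately show ?case by blast
qed

lemma toeplitz_entry:
 assumes A: "A \<in> unipotent_toeplitz m" and rs: "r <= s" "s < m"
 shows "A $$ (r, s) = A $$ (0, s - r)"
 using rs
proof (induction r arbitrary: s)
 case (Suc r)
 then obtain s' where s': "s = Suc s'" by (cases s) auto
 have "A $$ (Suc r, Suc s') = A $$ (r, s')" using A Suc.prems s' by (auto simp: unipotent_toeplitz_def)
 thus ?case using Suc.IH[of s'] Suc.prems s' by simp
qed simp

lemma toeplitz_below:
 assumes A: "A \<in> unipotent_toeplitz m" and rs: "s < r" "r < m"
 shows "A $$ (r, s) = 0"
 using A rs by (auto simp: unipotent_toeplitz_def)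

context
 fixes n :: nat and c :: "nat list"
 assumes c: "c \<in> compositions n"
begin

lemma w_P_Suc: "b < n ==> w_P c (Suc b) = bs (psums c) b + be n (psums c) b - b"
 by (simp add: w_P_eq[OF c] wr_def)

lemma Kmat_w_P: "perm_mat n (w_P c) = Kmat n (psums c) (%_. 0)"
proof (rule eq_matI)
 fix a b assume "a < dim_row (Kmat n (psums c) (%_. 0))" "b < dim_col (Kmat n (psums c) (%_. 0))"
 hence ab: "a < n" "b < n" using Kmat_carrier[of n "psums c" "%_. 0"] by auto
 note p = psums_subset[OF c]
 have 1: "perm_mat n (w_P c) $$ (a, b) = (if bs (psums c) b + be n (psums c) b - b = Suc a then 1 else 0)"
  using ab by (simp add: perm_mat_def w_P_Suc)
 have "bs (psums c) b <= b" "b < be n (psums c) b" using bs_le[OF p, of b] be_gt[OF p, of b] ab by auto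
 thus "perm_mat n (w_P c) $$ (a, b) = Kmat n (psums c) (%_. 0) $$ (a, b)"
  unfolding 1 Kmat_index[OF ab] by auto
qed (auto simp: perm_mat_def Kmat_def)

text \<open>
Reversing the columns of an upper triangular Toeplitz block turns it into a Hankel block, with the first row as its parameters.
\<close>

lemma block_mult_w_P:
 assumes len: "length Bs = length c" and Bs: "!!j. j < length c ==> Bs ! j \<in> unipotent_toeplitz (c ! j)"
  and t: "!!j d. j < length c ==> 0 < d ==> d < c ! j ==> t (st c j + d) = (Bs ! j) $$ (0, d)"
 shows "diag_block_mat Bs * perm_mat n (w_P c) = Kmat n (psums c) t"
proof (rule eq_matI)
 have Bc: "Bs ! j \<in> carrier_mat (c ! j) (c ! j)" if "j < length c" for j
  using Bs[OF that] by (simp add: unipotent_toeplitz_def)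
 note D = diag_block_mat_index[OF len Bc, unfolded sum_c[OF c]]
 have Dc: "diag_block_mat Bs \<in> carrier_mat n n" using D by blast
 have Pc: "perm_mat n (w_P c) \<in> carrier_mat n n" by (simp add: perm_mat_def)
 note p = psums_subset[OF c]
 {
  fix a b assume "a < dim_row (Kmat n (psums c) t)" "b < dim_col (Kmat n (psums c) t)"
  hence ab: "a < n" "b < n" using Kmat_carrier[of n "psums c" t] by auto
  obtain j where j: "j < length c" "st c j <= b" "b < st c (Suc j)" using block_exists[OF c ab(2)] by blast
  note bb = block_bs_be[OF c j]
  have ben: "st c (Suc j) <= n" using be_le[OF p, of b] bb by simp
  define l where "l = st c j + st c (Suc j) - Suc b"
  have l: "st c j <= l" "l < st c (Suc j)" "l < n" using j ben unfolding l_def by linarith+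
  have perm: "perm_mat n (w_P c) $$ (k, b) = (if k = l then 1 else 0)" if "k < n" for k
  proof -
   have "w_P c (Suc b) = Suc k \<longleftrightarrow> k = l" unfolding w_P_Suc[OF ab(2)] bb l_def using j by auto
   thus ?thesis using that ab by (simp add: perm_mat_def)
  qed
  have "(diag_block_mat Bs * perm_mat n (w_P c)) $$ (a, b) =
    (\<Sum>k<n. diag_block_mat Bs $$ (a, k) * perm_mat n (w_P c) $$ (k, b))"
   by (rule mat_mult_index[OF Dc Pc ab])
  also have "... = (\<Sum>k<n. if k = l then diag_block_mat Bs $$ (a, k) else 0)"
   by (intro sum.cong refl) (simp add: perm)
  also have "... = diag_block_mat Bs $$ (a, l)" using l by simp
  also have "... = (if st c j <= a & a < st c (Suc j) then (Bs ! j) $$ (a - st c j, l - st c j) else 0)"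
   using D j(1) ab(1) l(1,2) by blast
  also have "... = Kmat n (psums c) t $$ (a, b)"
  proof (cases "st c j <= a & a + b < st c j + st c (Suc j)")
   case True
   hence al: "a < st c (Suc j)" "a - st c j <= l - st c j" "l - st c j < c ! j"
    using j l st_Suc[of j c] unfolding l_def by linarith+
   have e: "(Bs ! j) $$ (a - st c j, l - st c j) = (Bs ! j) $$ (0, l - a)"
    using toeplitz_entry[OF Bs[OF j(1)] al(2,3)] True by (simp add: algebra_simps)
   show ?thesis
   proof (cases "Suc (a + b) = st c j + st c (Suc j)")
    case eq: True
    hence "l - a = 0" unfolding l_def by linarith
    hence "(Bs ! j) $$ (0, l - a) = 1" using Bs[OF j(1)] al(3) by (simp add: unipotent_toeplitz_def)
    thus ?thesis unfolding Kmat_index[OF ab] bb e using True al eq by simp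
   next
    case ne: False
    have d: "0 < l - a" "l - a < c ! j" "l - a = st c j + st c (Suc j) - Suc (a + b)"
     using ne True al unfolding l_def by linarith+
    show ?thesis unfolding Kmat_index[OF ab] bb e using t[OF j(1) d(1,2)] True al(1) ne d(3) by simp
   qed
  next
   case False
   show ?thesis
   proof (cases "st c j <= a & a < st c (Suc j)")
    case True
    hence "l - st c j < a - st c j" "a - st c j < c ! j"
     using False j l st_Suc[of j c] unfolding l_def by linarith+
    from toeplitz_below[OF Bs[OF j(1)] this] show ?thesis unfolding Kmat_index[OF ab] bb using False by auto
   next
    case F2: False
    thus ?thesis unfolding Kmat_index[OF ab] bb using False by auto
   qed
  qed
  finally show "(diag_block_mat Bs * perm_mat n (w_P c)) $$ (a, b) = Kmat n (psums c) t $$ (a, b)" .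
 }
qed (use diag_block_mat_index[OF len, unfolded sum_c[OF c]] Bs in \<open>auto simp: perm_mat_def Kmat_def unipotent_toeplitz_def\<close>)

lemma stratum_eq: "stratum c = {coset n (Kmat n (psums c) t) | t. True}"
proof (intro Set.set_eqI iffI)
 fix x assume "x \<in> stratum c"
 then obtain Bs where Bs: "length Bs = length c" "!!j. j < length c ==> Bs ! j \<in> unipotent_toeplitz (c ! j)"
  and x: "x = coset n (diag_block_mat Bs * perm_mat n (w_P c))"
  by (auto simp: stratum_def U_P_def sum_c[OF c] Let_def)
 have Bc: "Bs ! j \<in> carrier_mat (c ! j) (c ! j)" if "j < length c" for j
  using Bs(2)[OF that] by (simp add: unipotent_toeplitz_def)
 note D = diag_block_mat_index[OF Bs(1) Bc, unfolded sum_c[OF c]]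
 note p = psums_subset[OF c]
 define t where "t i = diag_block_mat Bs $$ (bs (psums c) i, i)" for i
 have "diag_block_mat Bs * perm_mat n (w_P c) = Kmat n (psums c) t"
 proof (rule block_mult_w_P)
  fix j d assume jd: "j < length c" "0 < d" "d < c ! j"
  have b: "st c j <= st c j + d" "st c j + d < st c (Suc j)" using jd st_Suc[of j c] by auto
  note bb = block_bs_be[OF c jd(1) b]
  have "st c j < n" using be_le[OF p, of "st c j + d"] bb b by simp
  hence "diag_block_mat Bs $$ (st c j, st c j + d) = (Bs ! j) $$ (0, d)"
   using D jd(1) b by simp
  thus "t (st c j + d) = (Bs ! j) $$ (0, d)" by (simp add: t_def bb)
 qed (use Bs in auto)
 hence "x = coset n (Kmat n (psums c) t)" unfolding x by simp
 thus "x \<in> {coset n (Kmat n (psums c) t) | t. True}" by blast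
next
 fix x assume "x \<in> {coset n (Kmat n (psums c) t) | t. True}"
 then obtain t where x: "x = coset n (Kmat n (psums c) t)" by blast
 define Bs where "Bs = map (%j. mat (c ! j) (c ! j) (%(r, s). if r = s then 1 else if r < s then t (st c j + (s - r)) else 0))
  [0..<length c]"
 have len: "length Bs = length c" by (simp add: Bs_def)
 have nth: "Bs ! j = mat (c ! j) (c ! j) (%(r, s). if r = s then 1 else if r < s then t (st c j + (s - r)) else 0)"
  if j: "j < length c" for j
 proof -
  have 1: "j < length [0..<length c]" and 2: "[0..<length c] ! j = j" using j by simp_all
  show ?thesis unfolding Bs_def nth_map[OF 1] 2 ..
 qed
 have Bs: "Bs ! j \<in> unipotent_toeplitz (c ! j)" if "j < length c" for j
  unfolding nth[OF that] unipotent_toeplitz_def by auto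
 have "diag_block_mat Bs * perm_mat n (w_P c) = Kmat n (psums c) t"
 proof (rule block_mult_w_P)
  fix j d assume j: "j < length c" and d: "0 < d" "d < c ! j"
  show "t (st c j + d) = (Bs ! j) $$ (0, d)" unfolding nth[OF j] using d by simp
 qed (use len Bs in auto)
 moreover have "diag_block_mat Bs \<in> U_P c" unfolding U_P_def using len Bs by blast
 ultimately show "x \<in> stratum c" unfolding stratum_def Let_def sum_c[OF c] x
  by (intro CollectI exI[of _ "diag_block_mat Bs"] conjI) simp_all
qed

lemma stratum_iff:
 "x \<in> stratum c \<longleftrightarrow> (\<exists>g. x = coset n g & PM n g & breaks n g = psums c)"
proof
 note p = psums_subset[OF c]
 assume "x \<in> stratum c"
 then obtain t where x: "x = coset n (Kmat n (psums c) t)" unfolding stratum_eq by blast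
 have "{s \<in> {1..<n}. brk n (Kmat n (psums c) t) s} = psums c" using Kmat_brk_iff[OF p, of _ t] p by auto
 thus "\<exists>g. x = coset n g & PM n g & breaks n g = psums c" using x Kmat_PM[OF p, of t] by blast
next
 assume "\<exists>g. x = coset n g & PM n g & breaks n g = psums c"
 then obtain g where g: "x = coset n g" "PM n g" "breaks n g = psums c" by blast
 obtain t b where tb: "b \<in> borel_subgroup n" "Kmat n (psums c) t = g * b"
  using PM_normal_form[OF g(2)] unfolding g(3) by blast
 have "x = coset n (Kmat n (psums c) t)"
  unfolding tb(2) g(1) using coset_mult[OF GL_carrier[OF PM_GL[OF g(2)]] tb(1)] by simp
 thus "x \<in> stratum c" unfolding stratum_eq by blast
qed

end

lemma strata_disjoint:
 assumes "C \<subseteq> compositions n"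
 shows "disjoint_family_on stratum C"
 unfolding disjoint_family_on_def
proof (intro ballI impI)
 fix c d assume "c \<in> C" "d \<in> C" and ne: "c ~= d"
 hence cd: "c \<in> compositions n" "d \<in> compositions n" using assms by auto
 show "stratum c \<inter> stratum d = {}"
 proof (rule ccontr)
  assume "stratum c \<inter> stratum d ~= {}"
  then obtain x where x: "x \<in> stratum c" "x \<in> stratum d" by blast
  obtain g where g: "x = coset n g" "PM n g" "breaks n g = psums c"
   using x(1) stratum_iff[OF cd(1)] by blast
  obtain h where h: "x = coset n h" "PM n h" "breaks n h = psums d"
   using x(2) stratum_iff[OF cd(2)] by blast
  have "brk n g s \<longleftrightarrow> brk n h s" if "s \<in> {1..<n}" for s
   by (rule brk_coset[OF PM_GL[OF g(2)] PM_GL[OF h(2)]]) (use g(1) h(1) that in auto)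
  hence "psums c = psums d" unfolding g(3)[symmetric] h(3)[symmetric] by auto
  thus False using psums_inj[OF cd] ne by simp
 qed
qed

section \<open>Conditions on the one-line notation\<close>

text \<open>
Excluded are the empty set, \<open>{1}\<close> and \<open>{n - 1}\<close>: the cases in which the flag is generated by its line up to dimension \<open>n - 1\<close>, or dually by its hyperplane.
\<close>

definition two_sided :: "nat => nat set => bool" where
 "two_sided n S \<longleftrightarrow> (\<exists>s\<in>S. \<exists>s'\<in>S. s < s') \<or> (\<exists>s\<in>S. 2 <= s & s + 2 <= n)"

text \<open>
One-line notation of the block reversal; positions count from 0, values from 1.
\<close>

definition wlist :: "nat => nat set => nat list" where
 "wlist n S = map (%i. bs S i + be n S i - i) [0..<n]"

lemma one_line_w_P: "c \<in> compositions n ==> one_line n (w_P c) = wlist n (psums c)"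
 by (rule nth_equalityI) (simp_all add: one_line_def wlist_def w_P_Suc nth_append del: upt_Suc)

lemma wlist_nth: "i < n ==> wlist n S ! i = bs S i + be n S i - i"
 by (simp add: wlist_def)

lemma length_wlist[simp]: "length (wlist n S) = n" by (simp add: wlist_def)

lemma contains_123_iff:
 "contains_pattern w [1, 2, 3] \<longleftrightarrow>
  (\<exists>p q r. p < q & q < r & r < length w & w ! p < w ! q & w ! q < w ! r)"
proof
 assume "contains_pattern w [1, 2, 3]"
 then obtain \<phi> where f: "strict_mono_on {..<3} \<phi>" "\<phi> ` {..<3} \<subseteq> {..<length w}"
  "\<forall>a<3. \<forall>b<3. w ! \<phi> a < w ! \<phi> b \<longleftrightarrow> [1, 2, 3::nat] ! a < [1, 2, 3] ! b"
  by (auto simp: contains_pattern_def numeral_3_eq_3)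
 have "\<phi> 0 < \<phi> 1" "\<phi> 1 < \<phi> 2" using f(1) by (auto simp: strict_mono_on_def)
 moreover have "\<phi> 2 \<in> \<phi> ` {..<3}" by (rule imageI) simp
 hence "\<phi> 2 < length w" using f(2) by blast
 moreover have "w ! \<phi> 0 < w ! \<phi> 1" using f(3)[rule_format, of 0 1] by simp
 moreover have "w ! \<phi> 1 < w ! \<phi> 2" using f(3)[rule_format, of 1 2] by simp
 ultimately show "\<exists>p q r. p < q & q < r & r < length w & w ! p < w ! q & w ! q < w ! r" by blast
next
 assume "\<exists>p q r. p < q & q < r & r < length w & w ! p < w ! q & w ! q < w ! r"
 then obtain p q r where "p < q & q < r & r < length w & w ! p < w ! q & w ! q < w ! r" by blast
 thus "contains_pattern w [1, 2, 3]" unfolding contains_pattern_def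
  by (intro exI[of _ "%a. [p, q, r] ! a"]) (auto simp: strict_mono_on_def less_Suc_eq)
qed

lemma contains_2143_iff:
 "contains_pattern w [2, 1, 4, 3] \<longleftrightarrow>
  (\<exists>p q r s. p < q & q < r & r < s & s < length w & w ! q < w ! p & w ! p < w ! s & w ! s < w ! r)"
proof
 assume "contains_pattern w [2, 1, 4, 3]"
 then obtain \<phi> where f: "strict_mono_on {..<4} \<phi>" "\<phi> ` {..<4} \<subseteq> {..<length w}"
  "\<forall>a<4. \<forall>b<4. w ! \<phi> a < w ! \<phi> b \<longleftrightarrow> [2, 1, 4, 3::nat] ! a < [2, 1, 4, 3] ! b"
  by (auto simp: contains_pattern_def eval_nat_numeral)
 have "\<phi> 0 < \<phi> 1" "\<phi> 1 < \<phi> 2" "\<phi> 2 < \<phi> 3" using f(1) by (auto simp: strict_mono_on_def)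
 moreover have "\<phi> 3 \<in> \<phi> ` {..<4}" by (rule imageI) simp
 hence "\<phi> 3 < length w" using f(2) by blast
 moreover have "w ! \<phi> 1 < w ! \<phi> 0" using f(3)[rule_format, of 1 0] by simp
 moreover have "w ! \<phi> 0 < w ! \<phi> 3" using f(3)[rule_format, of 0 3] by simp
 moreover have "w ! \<phi> 3 < w ! \<phi> 2" using f(3)[rule_format, of 3 2] by simp
 ultimately show "\<exists>p q r s. p < q & q < r & r < s & s < length w & w ! q < w ! p & w ! p < w ! s & w ! s < w ! r" by blast
next
 assume "\<exists>p q r s. p < q & q < r & r < s & s < length w & w ! q < w ! p & w ! p < w ! s & w ! s < w ! r"
 then obtain p q r s where "p < q & q < r & r < s & s < length w & w ! q < w ! p & w ! p < w ! s & w ! s < w ! r" by blast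
 thus "contains_pattern w [2, 1, 4, 3]" unfolding contains_pattern_def
  by (intro exI[of _ "%a. [p, q, r, s] ! a"]) (auto simp: strict_mono_on_def less_Suc_eq)
qed

lemma single_break:
 assumes "1 <= s" "s < n"
 shows "b < s ==> bs {s} b = 0" "b < s ==> be n {s} b = s" "s <= b ==> bs {s} b = s" "s <= b ==> be n {s} b = n"
proof -
 assume b: "b < s"
 have "{x \<in> {s}. x <= b} = {}" "{x \<in> {s}. b < x} = {s}" using b by auto
 thus "bs {s} b = 0" "be n {s} b = s" using assms by (simp_all only: bs_def be_def) auto
next
 assume b: "s <= b"
 have "{x \<in> {s}. x <= b} = {s}" "{x \<in> {s}. b < x} = {}" using b by auto
 thus "bs {s} b = s" "be n {s} b = n" using assms by (simp_all only: bs_def be_def) auto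
qed

text \<open>
Two entries of a block reversal increase iff they are in different blocks. So 123 means three blocks, and 2143 two blocks with at least two elements each.
\<close>

lemma pattern_iff_two_sided:
 assumes S: "S \<subseteq> {1..<n}"
 shows "contains_pattern (wlist n S) [1, 2, 3] \<or> contains_pattern (wlist n S) [2, 1, 4, 3] \<longleftrightarrow> two_sided n S"
proof
 have sep: "be n S p <= q" if "p < q" "q < n" "wlist n S ! p < wlist n S ! q" for p q
 proof (rule ccontr)
  assume "~ be n S p <= q"
  hence q: "q < be n S p" by simp
  have "bs S p <= p" "bs S p <= q" using bs_le[OF S, of p] that by auto
  note sb = same_block[OF S `bs S p <= q` q]
  have pn: "p < n" using that by linarith
  show False using that(3) unfolding wlist_nth[OF that(2)] wlist_nth[OF pn] sb using that(1) by linarith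
 qed
 have beS: "be n S p \<in> S" if "be n S p <= q" "q < n" for p q using be_S[OF S, of p] that by auto
 assume "contains_pattern (wlist n S) [1, 2, 3] \<or> contains_pattern (wlist n S) [2, 1, 4, 3]"
 thus "two_sided n S"
 proof
  assume "contains_pattern (wlist n S) [1, 2, 3]"
  then obtain p q r where p: "p < q" "q < r" "r < n" "wlist n S ! p < wlist n S ! q" "wlist n S ! q < wlist n S ! r"
   unfolding contains_123_iff length_wlist by blast
  have qn: "q < n" using p by linarith
  note 1 = sep[OF p(1) qn p(4)] and 2 = sep[OF p(2,3,5)]
  have "be n S p < be n S q" using 1 be_gt[OF S qn] by linarith
  thus ?thesis unfolding two_sided_def using beS[OF 1 qn] beS[OF 2 p(3)] by blast
 next
  assume "contains_pattern (wlist n S) [2, 1, 4, 3]"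
  then obtain p q r s where p: "p < q" "q < r" "r < s" "s < n" "wlist n S ! q < wlist n S ! p" "wlist n S ! p < wlist n S ! s"
   "wlist n S ! s < wlist n S ! r" unfolding contains_2143_iff length_wlist by blast
  have rn: "r < n" "q < n" and lt: "wlist n S ! q < wlist n S ! r" using p by linarith+
  note 1 = sep[OF p(2) rn(1) lt]
  have "2 <= be n S q" "be n S q + 2 <= n" using be_gt[OF S rn(2)] 1 p by linarith+
  thus ?thesis unfolding two_sided_def using beS[OF 1 rn(1)] by blast
 qed
next
 assume bad: "two_sided n S"
 show "contains_pattern (wlist n S) [1, 2, 3] \<or> contains_pattern (wlist n S) [2, 1, 4, 3]"
 proof (cases "\<exists>s\<in>S. \<exists>s'\<in>S. s < s'")
  case True
  then obtain s s' where s: "s \<in> S" "s' \<in> S" "s < s'" by blast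
  have sn: "1 <= s" "s' < n" "s < n" "0 < n" using s S by auto
  have "be n S 0 <= s" using no_break_inside[OF S s(1), of 0] bs_le[OF S, of 0] sn by linarith
  moreover have "be n S s <= s'" using no_break_inside[OF S s(2), of s] bs_le[OF S, of s] s by linarith
  moreover have "s < be n S s" "s' < be n S s'" using be_gt[OF S] sn by auto
  moreover have "bs S 0 = 0" using bs_le[OF S, of 0] by simp
  ultimately have "wlist n S ! 0 < wlist n S ! s" "wlist n S ! s < wlist n S ! s'"
   using sn by (simp_all add: wlist_nth break_start[OF S s(1)] break_start[OF S s(2)])
  hence "contains_pattern (wlist n S) [1, 2, 3]" unfolding contains_123_iff length_wlist using s sn
   by (intro exI[of _ 0] exI[of _ s] exI[of _ s']) auto
  thus ?thesis ..
 next
  case False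
  then obtain s where s: "s \<in> S" "2 <= s" "s + 2 <= n" using bad by (auto simp: two_sided_def)
  have "x = s" if "x \<in> S" for x
   using False s(1) that by (cases x s rule: linorder_cases) blast+
  hence Ss: "S = {s}" using s(1) by blast
  have sn: "1 <= s" "s < n" using s by auto
  have "wlist n S ! (s - 2) = 2" "wlist n S ! (s - 1) = 1" "wlist n S ! s = n" "wlist n S ! Suc s = n - 1"
   using s sn by (simp_all add: Ss wlist_nth single_break[OF sn])
  hence "contains_pattern (wlist n S) [2, 1, 4, 3]" unfolding contains_2143_iff length_wlist using s
   by (intro exI[of _ "s - 2"] exI[of _ "s - 1"] exI[of _ s] exI[of _ "Suc s"]) auto
  thus ?thesis ..
 qed
qed

lemma not_two_sided:
 assumes S: "S \<subseteq> {1..<n}" and n: "~ two_sided n S"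
 shows "S = {} \<or> (2 <= n & S = {1}) \<or> (2 <= n & S = {n - 1})"
proof (cases "S = {}")
 case False
 then obtain s where s: "s \<in> S" by blast
 have "x = s" if "x \<in> S" for x
  using n s(1) that unfolding two_sided_def by (cases x s rule: linorder_cases) blast+
 hence "S = {s}" using s(1) by blast
 moreover have "1 <= s" "s < n" "~ (2 <= s & s + 2 <= n)" using s S n by (auto simp: two_sided_def)
 hence "2 <= n & (s = 1 \<or> s = n - 1)" by linarith
 ultimately show ?thesis by blast
qed simp

lemma wlist_good:
 "wlist n {} = rev [1..<Suc n]"
 "2 <= n ==> wlist n {1} = 1 # rev [2..<Suc n]"
 "2 <= n ==> wlist n {n - 1} = rev [1..<n] @ [n]"
proof -
 show "wlist n {} = rev [1..<Suc n]"
  by (rule nth_equalityI) (simp_all add: wlist_nth rev_nth bs_def be_def del: upt_Suc)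
 assume n: "2 <= n"
 show "wlist n {1} = 1 # rev [2..<Suc n]"
 proof (rule nth_equalityI)
  fix i assume "i < length (wlist n {1})"
  thus "wlist n {1} ! i = (1 # rev [2..<Suc n]) ! i"
   using n single_break[of 1 n i] by (cases i) (simp_all add: wlist_nth rev_nth del: upt_Suc)
 qed (use n in \<open>simp del: upt_Suc\<close>)
 show "wlist n {n - 1} = rev [1..<n] @ [n]"
 proof (rule nth_equalityI)
  fix i assume "i < length (wlist n {n - 1})"
  thus "wlist n {n - 1} ! i = (rev [1..<n] @ [n]) ! i"
   using n single_break[of "n - 1" n i] by (cases "i < n - 1") (simp_all add: wlist_nth rev_nth nth_append del: upt_Suc)
 qed (use n in \<open>simp del: upt_Suc\<close>)
qed

lemma good_list_iff:
 assumes S: "S \<subseteq> {1..<n}" and n: "n \<ge> 1"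
 shows "wlist n S \<in> {rev [1..<Suc n], 1 # rev [2..<Suc n], rev [1..<n] @ [n]} \<longleftrightarrow> ~ two_sided n S"
proof
 assume "~ two_sided n S"
 thus "wlist n S \<in> {rev [1..<Suc n], 1 # rev [2..<Suc n], rev [1..<n] @ [n]}"
  using not_two_sided[OF S] wlist_good[of n] by auto
next
 assume a: "wlist n S \<in> {rev [1..<Suc n], 1 # rev [2..<Suc n], rev [1..<n] @ [n]}"
 have "\<exists>R \<subseteq> {1..<n}. ~ two_sided n R & wlist n S = wlist n R"
 proof (cases "n = 1")
  case True
  thus ?thesis using S by (intro exI[of _ S]) (auto simp: two_sided_def)
 next
  case False
  hence n2: "2 <= n" using n by simp
  have "~ two_sided n {}" "~ two_sided n {1}" "~ two_sided n {n - 1}" by (auto simp: two_sided_def)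
  moreover have "{1} \<subseteq> {1..<n}" "{n - 1} \<subseteq> {1..<n}" using n2 by auto
  ultimately show ?thesis using a wlist_good(1)[of n] wlist_good(2,3)[OF n2] by (elim insertE) (metis empty_subsetI empty_iff)+
 qed
 then obtain R where R: "R \<subseteq> {1..<n}" "~ two_sided n R" "wlist n S = wlist n R" by blast
 thus "~ two_sided n S" using pattern_iff_two_sided[OF S] pattern_iff_two_sided[OF R(1)] by simp
qed

lemma cond_III_iff:
 assumes "c \<in> compositions n"
 shows "cond_III n (w_P c) \<longleftrightarrow> two_sided n (psums c)"
 unfolding cond_III_def one_line_w_P[OF assms] by (rule pattern_iff_two_sided[OF psums_subset[OF assms]])

lemma cond_II_iff:
 assumes "c \<in> compositions n" "n \<ge> 1"
 shows "cond_II n (w_P c) \<longleftrightarrow> two_sided n (psums c)"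
 unfolding cond_II_def one_line_w_P[OF assms(1)] using good_list_iff[OF psums_subset[OF assms(1)] assms(2)] by blast

section \<open>Charts around regular points\<close>

text \<open>
The data that \<open>rational_chart\<close> needs, with base point \<open>gB\<close>.
\<close>

definition is_chart :: "nat => complex mat => ((nat => complex) => complex) =>
  ((nat => complex) => nat \<times> nat => complex) => (nat => (nat \<times> nat => complex) => complex) => bool" where
 "is_chart n g D \<phi> \<psi> \<longleftrightarrow> D \<in> poly_funs {1..<n} & D (%_. 0) ~= 0 & \<phi> (%_. 0) = (%_. 0) &
   (\<forall>j\<in>{1..<n}. \<psi> j \<in> poly_funs (patch_index n)) &
   (\<forall>i\<in>patch_index n. \<exists>k. \<exists>F\<in>poly_funs {1..<n}. \<forall>t\<in>{t. D t ~= 0}. D t ^ k * \<phi> t i = F t) &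
   (\<forall>t. D t ~= 0 --> \<phi> t \<in> Pat n g) & (\<forall>t. \<forall>j\<in>{1..<n}. D t ~= 0 --> \<psi> j (\<phi> t) = t j) &
   (\<forall>p\<in>Pat n g. D (%j. \<psi> j p) ~= 0) & (\<forall>p\<in>Pat n g. \<phi> (%j. \<psi> j p) = p)"

lemma regular_of_chart:
 assumes g: "g \<in> GL n" and ch: "is_chart n g D \<phi> \<psi>"
 shows "regular_point (patch_index n) (Pat n g) (%_. 0)"
proof -
 have D: "D \<in> poly_funs {1..<n}" "D (%_. 0) ~= 0" and z: "\<phi> (%_. 0) = (%_. 0)"
  using ch unfolding is_chart_def by blast+
 have P: "\<forall>t. D t ~= 0 --> \<phi> t \<in> Pat n g" using ch unfolding is_chart_def by (elim conjE)
 have p0: "(%_. 0) \<in> Pat n g" using P[rule_format, OF D(2)] unfolding z .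
 have 1: "cfun.dim (tangent_space (patch_index n) (Pat n g) (\<phi> (%_. 0))) = card {1..<n}"
  using ch patch_closed[OF g] by (intro rational_chart(1)[where D = D and \<psi> = \<psi> and \<phi> = \<phi>]) (simp_all add: is_chart_def)
 have 2: "enat (card {1..<n}) <= local_dim (patch_index n) (Pat n g) (\<phi> (%_. 0))"
  using ch patch_closed[OF g] by (intro rational_chart(2)[where D = D and \<psi> = \<psi> and \<phi> = \<phi>]) (simp_all add: is_chart_def)
 show ?thesis unfolding regular_point_def
  using p0 1 2 local_dim_patch_le[OF g, of "%_. 0"] unfolding z by simp
qed

lemma borelI:
 assumes A: "A \<in> carrier_mat n n" and low: "!!i j. j < i ==> i < n ==> A $$ (i, j) = 0" and d: "!!i. i < n ==> A $$ (i, i) ~= 0"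
 shows "A \<in> borel_subgroup n"
proof -
 have u: "upper_triangular A" using low A by auto
 have "det A ~= 0" unfolding det_upper_triangular[OF u A] using d A by (auto simp: prod_list_zero_iff diag_mat_def)
 thus ?thesis using u A by (simp add: borel_subgroup_def GL_iff)
qed

lemma PM_of_shifted_columns:
 assumes K: "K \<in> GL n" and sh: "!!a k. a < n ==> Suc k < n - 1 ==> K $$ (a, Suc k) = (if Suc a < n then K $$ (Suc a, k) else 0)"
 shows "PM n K"
 unfolding PM_iff_conj[OF K] hess_def
proof (intro allI impI)
 note Kc = GL_carrier[OF K]
 have m: "minv K \<in> carrier_mat n n" by (rule minv_carrier[OF Kc])
 fix i j assume ij: "i < n" "Suc j < i"
 have jn: "j < n" "Suc j < n" "Suc j < n - 1" using ij by auto
 have "(minv K * (NN n * K)) $$ (i, j) = (\<Sum>l<n. minv K $$ (i, l) * (NN n * K) $$ (l, j))"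
  by (rule mat_mult_index[OF m mult_carrier_square[OF NN_carrier Kc] ij(1) jn(1)])
 also have "... = (\<Sum>l<n. minv K $$ (i, l) * K $$ (l, Suc j))"
  by (intro sum.cong refl) (simp add: NN_mult_index[OF Kc _ jn(1)] sh[OF _ jn(3)])
 also have "... = (minv K * K) $$ (i, Suc j)" by (rule mat_mult_index[OF m Kc ij(1) jn(2), symmetric])
 also have "... = 0" unfolding minv_mult[OF Kc GL_det[OF K]] using ij jn by simp
 finally show "(minv K * (NN n * K)) $$ (i, j) = 0" .
qed

lemma minor_first_column: "minor i 0 M = M $$ (i, 0)"
 unfolding minor_def by (subst det_single) auto

context
 fixes n r :: nat and g :: "complex mat"
 assumes g: "g \<in> GL n"
  and cols: "!!a k. a < n ==> k < n - 1 ==> g $$ (a, k) = (if a + k < n then g $$ (a + k, 0) else 0)"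
  and r: "r < n" "n <= r + 2" and row: "!!b. b < n ==> g $$ (r, b) = (if b = 0 then 1 else 0)"
begin

definition kry_col :: "(nat => complex) => nat => complex" where
 "kry_col t a = g $$ (a, 0) + (\<Sum>i\<in>{1..<n}. g $$ (a, i) * t i)"

text \<open>
The flag generated by the vector with coordinates \<open>(1, t)\<close> in the basis given by \<open>g\<close>; the last column only completes the basis.
\<close>

definition kry :: "(nat => complex) => complex mat" where
 "kry t = mat n n (%(a, b). if b < n - 1 then (if a + b < n then kry_col t (a + b) else 0) else g $$ (a, b))"

lemma kry_carrier: "kry t \<in> carrier_mat n n" by (simp add: kry_def)

lemma polymat_kry: "polymat {1..<n} n n kry"
 unfolding kry_def
proof (rule polymat_mat)
 fix a b assume "a < n" "b < n"
 have k: "(%t. kry_col t (a + b)) \<in> poly_funs {1..<n}"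
  unfolding kry_col_def by (intro poly_funs.add poly_funs.const poly_funs_sum poly_funs.mult poly_funs.coord) auto
 show "(%t. if b < n - 1 then (if a + b < n then kry_col t (a + b) else 0) else g $$ (a, b)) \<in> poly_funs {1..<n}"
 proof (cases "b < n - 1")
  case b: True
  show ?thesis
  proof (cases "a + b < n")
   case ab: True
   show ?thesis unfolding if_P[OF b] if_P[OF ab] by (rule k)
  next
   case ab: False
   show ?thesis unfolding if_P[OF b] if_not_P[OF ab] by (rule poly_funs.const)
  qed
 next
  case b: False
  show ?thesis unfolding if_not_P[OF b] by (rule poly_funs.const)
 qed
qed

lemma kry_zero: "kry (%_. 0) = g"
proof (rule eq_matI)
 have gc: "dim_row g = n" "dim_col g = n" using GL_carrier[OF g] by auto
 fix a b assume "a < dim_row g" "b < dim_col g"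
 hence ab: "a < n" "b < n" using gc by auto
 show "kry (%_. 0) $$ (a, b) = g $$ (a, b)"
 proof (cases "b < n - 1")
  case True
  thus ?thesis using ab cols[OF ab(1) True] by (simp add: kry_def kry_col_def)
 next
  case False
  thus ?thesis using ab by (simp add: kry_def)
 qed
qed (use GL_carrier[OF g] in \<open>auto simp: kry_def\<close>)

lemma kry_PM: "kry t \<in> GL n ==> PM n (kry t)"
 by (rule PM_of_shifted_columns) (auto simp: kry_def)

lemma kry_first_column:
 assumes i: "i < n" and n: "2 <= n"
 shows "(minv g * kry t) $$ (i, 0) = (if i = 0 then 1 else t i)"
proof -
 note gc = GL_carrier[OF g]
 note m = minv_carrier[OF gc]
 define U where "U = mat n 1 (%(i, j::nat). if i = 0 then 1 else t i)"
 have U: "U \<in> carrier_mat n 1" by (simp add: U_def)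
 have gU: "g * U \<in> carrier_mat n 1" using gc U by simp
 have c: "kry t $$ (l, 0) = (g * U) $$ (l, 0)" if l: "l < n" for l
 proof -
  have "(g * U) $$ (l, 0) = (\<Sum>k<n. g $$ (l, k) * U $$ (k, 0))" using mat_mult_index[OF gc U l] by simp
  also have "{..<n} = insert 0 {1..<n}" using n by auto
  finally show ?thesis using l n by (simp add: U_def kry_def kry_col_def)
 qed
 have n0: "0 < n" using n by simp
 have "(minv g * kry t) $$ (i, 0) = (\<Sum>l<n. minv g $$ (i, l) * kry t $$ (l, 0))"
  by (rule mat_mult_index[OF m kry_carrier i n0])
 also have "... = (\<Sum>l<n. minv g $$ (i, l) * (g * U) $$ (l, 0))" by (intro sum.cong refl) (simp add: c)
 also have "... = (minv g * (g * U)) $$ (i, 0)" using mat_mult_index[OF m gU i, of 0] by simp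
 also have "... = U $$ (i, 0)" unfolding GL_cancel_left[OF g U] ..
 finally show ?thesis using i by (simp add: U_def)
qed

text \<open>
All but the last subdiagonal entries of \<open>A\<close> are nonzero on the patch, since a break \<open>s < n - 1\<close> is impossible when the first column has a nonzero entry in a row \<open>r \<ge> n - 2\<close>. So the flag is the one generated by its first column.
\<close>

lemma kry_factor:
 assumes p: "p \<in> Pat n g"
 shows "\<exists>R\<in>borel_subgroup n. minv g * kry (%j. p (j, 0)) = LL n p * R"
proof -
 note gc = GL_carrier[OF g]
 let ?t = "%j. p (j, 0)"
 define h where "h = g * LL n p"
 have PMh: "PM n h" using p patch_iff[OF g] by (simp add: h_def)
 note hG = PM_GL[OF PMh]
 note hc = GL_carrier[OF hG]
 obtain A where A: "A \<in> carrier_mat n n" "hess n A" "NN n * h = h * A" using PMh unfolding PM_def by blast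
 have hidx: "h $$ (a, b) = (\<Sum>l<n. g $$ (a, l) * LL n p $$ (l, b))" if "a < n" "b < n" for a b
  unfolding h_def by (rule mat_mult_index[OF gc LL_carrier that])
 have n0: "0 < n" using r by linarith
 have h0: "h $$ (a, 0) = kry_col ?t a" if "a < n" for a
 proof -
  have e: "{..<n} = insert 0 {1..<n}" using n0 by auto
  show ?thesis unfolding hidx[OF that n0] e kry_col_def using n0 by (simp add: LL_index)
 qed
 have hl: "h $$ (a, n - 1) = g $$ (a, n - 1)" if "a < n" for a
 proof -
  have "h $$ (a, n - 1) = (\<Sum>l<n. g $$ (a, l) * LL n p $$ (l, n - 1))" using hidx[OF that] n0 by simp
  also have "... = (\<Sum>l<n. if l = n - 1 then g $$ (a, l) else 0)"
   using n0 by (intro sum.cong refl) (auto simp: LL_index)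
  finally show ?thesis using n0 by simp
 qed
 have hr: "h $$ (r, 0) = 1"
 proof -
  have "h $$ (r, 0) = (\<Sum>l<n. if l = 0 then 1 else 0)"
   unfolding hidx[OF r(1) n0] using n0 by (intro sum.cong refl) (auto simp: row LL_index)
  thus ?thesis using n0 by simp
 qed
 have sub: "A $$ (Suc l, l) ~= 0" if l: "Suc l < n - 1" for l
 proof
  assume "A $$ (Suc l, l) = 0"
  hence "brk n h (Suc l)" using l by (intro break_of_subdiag_zero[OF hG A]) auto
  from brkD[OF this, of r 0] have "h $$ (r, 0) = 0" using l r by linarith
  thus False using hr by simp
 qed
 define R where "R = minv h * kry ?t"
 have m: "minv h \<in> carrier_mat n n" by (rule minv_carrier[OF hc])
 have R1: "R $$ (k, b) = (minv h * Nshift n h b) $$ (k, 0)" if kb: "k < n" "b < n - 1" for k b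
 proof -
  have bn: "b < n" using kb by simp
  have e: "kry ?t $$ (l, b) = Nshift n h b $$ (l, 0)" if "l < n" for l
   using that kb h0[of "l + b"] n0 by (simp add: kry_def Nshift_index)
  have "R $$ (k, b) = (\<Sum>l<n. minv h $$ (k, l) * kry ?t $$ (l, b))"
   unfolding R_def by (rule mat_mult_index[OF m kry_carrier kb(1) bn])
  also have "... = (\<Sum>l<n. minv h $$ (k, l) * Nshift n h b $$ (l, 0))" by (intro sum.cong refl) (simp add: e)
  also have "... = (minv h * Nshift n h b) $$ (k, 0)" by (rule mat_mult_index[OF m Nshift_carrier kb(1) n0, symmetric])
  finally show ?thesis .
 qed
 have R2: "R $$ (k, n - 1) = (if k = n - 1 then 1 else 0)" if k: "k < n" for k
 proof -
  have nn: "n - 1 < n" using n0 by simp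
  have e: "kry ?t $$ (l, n - 1) = h $$ (l, n - 1)" if "l < n" for l
   using that n0 hl[OF that] by (simp add: kry_def)
  have "R $$ (k, n - 1) = (\<Sum>l<n. minv h $$ (k, l) * kry ?t $$ (l, n - 1))"
   unfolding R_def by (rule mat_mult_index[OF m kry_carrier k nn])
  also have "... = (\<Sum>l<n. minv h $$ (k, l) * h $$ (l, n - 1))"
   by (intro sum.cong refl) (simp only: e lessThan_iff)
  also have "... = (minv h * h) $$ (k, n - 1)" by (rule mat_mult_index[OF m hc k nn, symmetric])
  finally show ?thesis unfolding minv_mult[OF hc GL_det[OF hG]] using k nn by simp
 qed
 have "R \<in> borel_subgroup n"
 proof (rule borelI)
  show "R \<in> carrier_mat n n" unfolding R_def using m kry_carrier by simp
  fix i j :: nat assume ij: "j < i" "i < n"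
  hence "j < n - 1" by linarith
  thus "R $$ (i, j) = 0" unfolding R1[OF ij(2) `j < n - 1`] using W_lead[OF hG A n0, of j] ij by simp
 next
  fix i assume i: "i < n"
  show "R $$ (i, i) ~= 0"
  proof (cases "i < n - 1")
   case True
   have "(minv h * Nshift n h i) $$ (i, 0) = (\<Prod>l<i. A $$ (Suc l, l))"
    using conjunct2[OF W_lead[OF hG A n0, of i]] i unfolding add_0 by (rule mp)
   moreover have "(\<Prod>l<i. A $$ (Suc l, l)) ~= 0"
    unfolding prod_zero_iff[OF finite_lessThan] using sub True by (auto simp: less_diff_conv)
   ultimately show ?thesis unfolding R1[OF i True] by simp
  next
   case False
   hence "i = n - 1" using i by simp
   thus ?thesis using R2[of "n - 1"] n0 by simp
  qed
 qed
 moreover have "minv g * kry ?t = LL n p * R"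
 proof -
  have Rc: "R \<in> carrier_mat n n" unfolding R_def using m kry_carrier by simp
  have "kry ?t = h * R" unfolding R_def using GL_cancel_left'[OF hG kry_carrier, symmetric] .
  also have "... = g * (LL n p * R)" unfolding h_def by (rule square_assoc[OF gc LL_carrier Rc])
  finally show ?thesis using GL_cancel_left[OF g mult_carrier_square[OF LL_carrier Rc]] by simp
 qed
 ultimately show ?thesis by blast
qed

text \<open>
The parameters are the first column of the lower unitriangular matrix, and \<open>D\<close> collects the leading minors that make its reconstruction rational.
\<close>

lemma krylov_chart: "\<exists>D \<phi> \<psi>. is_chart n g D \<phi> \<psi>"
proof -
 note gc = GL_carrier[OF g]
 define M where "M t = minv g * kry t" for t
 have Mc: "M t \<in> carrier_mat n n" for t unfolding M_def using minv_carrier[OF gc] kry_carrier by simp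
 have pM: "polymat {1..<n} n n M"
  unfolding M_def by (rule polymat_mult[OF polymat_const[OF minv_carrier[OF gc]] polymat_kry])
 define D where "D t = (\<Prod>j<n. minor j j (M t))" for t
 define \<phi> where "\<phi> t = lu_coord n (M t)" for t
 define \<psi> where "\<psi> j p = p (j, 0)" for j :: nat and p :: "nat \<times> nat => complex"
 have M0: "M (%_. 0) = LL n (%_. 0) * 1\<^sub>m n"
  unfolding M_def kry_zero minv_mult[OF gc GL_det[OF g]] LL_zero by simp
 have Dnz: "minor j j (M t) ~= 0" if "D t ~= 0" "j < n" for t j
  using that unfolding D_def prod_zero_iff[OF finite_lessThan] by blast
 have "is_chart n g D \<phi> \<psi>"
  unfolding is_chart_def
 proof (intro conjI allI ballI impI)
  show "D \<in> poly_funs {1..<n}" unfolding D_def by (intro poly_funs_prod polymat_minor[OF pM]) auto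
  show "D (%_. 0) ~= 0" unfolding D_def M0 using minor_LU(2)[OF borel_one] by (auto simp: prod_zero_iff)
  show "\<phi> (%_. 0) = (%_. 0)" unfolding \<phi>_def M0 by (rule lu_coord_LU[OF borel_one]) (simp add: affine_space_def)
 next
  fix j assume "j \<in> {1..<n}"
  thus "\<psi> j \<in> poly_funs (patch_index n)" unfolding \<psi>_def by (intro poly_funs.coord) (auto simp: patch_index_def)
 next
  fix q assume "q \<in> patch_index n"
  then obtain i j where q: "q = (i, j)" "j < i" "i < n" by (auto simp: patch_index_def)
  show "\<exists>k. \<exists>F\<in>poly_funs {1..<n}. \<forall>t\<in>{t. D t ~= 0}. D t ^ k * \<phi> t q = F t"
  proof (rule exI[of _ 1], rule bexI[of _ "%x. minor i j (M x) * (\<Prod>l\<in>{..<n} - {j}. minor l l (M x))"], rule ballI)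
   fix x assume "x \<in> {t. D t ~= 0}"
   hence "minor j j (M x) ~= 0" using q Dnz[of x j] by simp
   moreover have "D x = minor j j (M x) * (\<Prod>l\<in>{..<n} - {j}. minor l l (M x))"
    unfolding D_def using q by (intro prod.remove) auto
   ultimately show "D x ^ 1 * \<phi> x q = minor i j (M x) * (\<Prod>l\<in>{..<n} - {j}. minor l l (M x))"
    using q by (simp add: lu_coord_def \<phi>_def)
  qed (intro poly_funs.mult poly_funs_prod polymat_minor[OF pM], use q in auto)
 next
  fix t assume t: "D t ~= 0"
  have nz: "minor j j (M t) ~= 0" if "j < n" for j by (rule Dnz[OF t that])
  have MG: "M t \<in> GL n" by (rule LU_exists(1)[OF Mc]) (rule nz)
  have "\<exists>V\<in>borel_subgroup n. M t * V = LL n (lu_coord n (M t))" by (rule LU_exists(2)[OF Mc]) (rule nz)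
  then obtain V where V: "V \<in> borel_subgroup n" "M t * V = LL n (lu_coord n (M t))" by (elim bexE) (rule that)
  have K: "g * M t = kry t" unfolding M_def by (rule GL_cancel_left'[OF g kry_carrier])
  have KG: "kry t \<in> GL n" unfolding K[symmetric] by (rule GL_mult[OF g MG])
  have "g * LL n (\<phi> t) = kry t * V"
   unfolding \<phi>_def V(2)[symmetric] K[symmetric]
   by (rule square_assoc[OF gc Mc borel_carrier[OF V(1)], symmetric])
  thus "\<phi> t \<in> Pat n g" unfolding patch_iff[OF g]
   using PM_mult_borel[OF kry_PM[OF KG] V(1)] lu_coord_affine by (simp add: \<phi>_def)
 next
  fix t j assume j: "j \<in> {1..<n}"
  have "2 <= n" "j < n" "0 < n" using j by auto
  thus "\<psi> j (\<phi> t) = t j"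
   unfolding \<psi>_def \<phi>_def lu_coord_def using j kry_first_column[of j t] kry_first_column[of 0 t]
   by (simp add: minor_first_column M_def)
 next
  fix p assume p: "p \<in> Pat n g"
  have pa: "p \<in> affine_space (patch_index n)" using p patch_iff[OF g] by blast
  obtain R where R: "R \<in> borel_subgroup n" "M (%j. \<psi> j p) = LL n p * R"
   using kry_factor[OF p] unfolding M_def \<psi>_def by blast
  show "D (%j. \<psi> j p) ~= 0" unfolding D_def R(2) using minor_LU(2)[OF R(1)] by (auto simp: prod_zero_iff)
  show "\<phi> (%j. \<psi> j p) = p" unfolding \<phi>_def R(2) by (rule lu_coord_LU[OF R(1) pa])
 qed
 thus ?thesis by blast
qed

end

section \<open>Dual flags\<close>

text \<open>
Transposition along the antidiagonal: an anti-automorphism that fixes \<open>N\<close> and preserves upper triangular matrices.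
\<close>

definition antitr :: "nat => complex mat => complex mat" where
 "antitr n A = mat n n (%(a, b). A $$ (n - 1 - b, n - 1 - a))"

lemma antitr_carrier[simp]: "antitr n A \<in> carrier_mat n n" by (simp add: antitr_def)

lemma antitr_index: "a < n ==> b < n ==> antitr n A $$ (a, b) = A $$ (n - 1 - b, n - 1 - a)"
 by (simp add: antitr_def)

lemma antitr_antitr: "A \<in> carrier_mat n n ==> antitr n (antitr n A) = A"
 by (rule eq_matI) (auto simp: antitr_def)

lemma antitr_one: "antitr n (1\<^sub>m n) = 1\<^sub>m n"
 by (rule eq_matI) (auto simp: antitr_def)

lemma antitr_NN: "antitr n (NN n) = NN n"
 by (rule eq_matI) (auto simp: antitr_def regular_nilpotent_def)

lemma antitr_mult:
 assumes A: "A \<in> carrier_mat n n" and B: "B \<in> carrier_mat n n"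
 shows "antitr n (A * B) = antitr n B * antitr n A"
proof (rule eq_matI)
 fix a b assume "a < dim_row (antitr n B * antitr n A)" "b < dim_col (antitr n B * antitr n A)"
 hence ab: "a < n" "b < n" by (simp_all add: antitr_def)
 hence ab': "n - 1 - b < n" "n - 1 - a < n" by auto
 have "(antitr n B * antitr n A) $$ (a, b) = (\<Sum>l<n. antitr n B $$ (a, l) * antitr n A $$ (l, b))"
  by (rule mat_mult_index[OF antitr_carrier antitr_carrier ab])
 also have "... = (\<Sum>l<n. A $$ (n - 1 - b, n - 1 - l) * B $$ (n - 1 - l, n - 1 - a))"
  by (intro sum.cong refl) (simp add: antitr_index ab mult.commute)
 also have "... = (\<Sum>l<n. A $$ (n - 1 - b, l) * B $$ (l, n - 1 - a))"
  by (rule sum.reindex_bij_witness[of _ "%l. n - 1 - l" "%l. n - 1 - l"]) auto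
 also have "... = (A * B) $$ (n - 1 - b, n - 1 - a)" by (rule mat_mult_index[OF A B ab', symmetric])
 finally show "antitr n (A * B) $$ (a, b) = (antitr n B * antitr n A) $$ (a, b)" by (simp add: antitr_index ab)
qed (auto simp: antitr_def)

lemma antitr_GL:
 assumes "A \<in> GL n"
 shows "antitr n A \<in> GL n" "minv (antitr n A) = antitr n (minv A)"
proof -
 note c = GL_carrier[OF assms]
 have "antitr n A * antitr n (minv A) = antitr n (minv A * A)" by (rule antitr_mult[symmetric]) (simp_all add: c)
 also have "... = 1\<^sub>m n" unfolding minv_mult[OF c GL_det[OF assms]] by (rule antitr_one)
 finally have e: "antitr n A * antitr n (minv A) = 1\<^sub>m n" .
 show "antitr n A \<in> GL n" "minv (antitr n A) = antitr n (minv A)"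
  using minv_unique[OF antitr_carrier antitr_carrier e] by auto
qed

lemma minv_minv:
 assumes "A \<in> GL n"
 shows "minv (minv A) = A"
 using minv_unique(2)[OF minv_carrier[OF GL_carrier[OF assms]] GL_carrier[OF assms]
  minv_mult[OF GL_carrier[OF assms] GL_det[OF assms]]] .

text \<open>
Composed with inversion it becomes an automorphism, which sends a flag to its annihilator flag.
\<close>

definition flip :: "nat => complex mat => complex mat" where
 "flip n g = antitr n (minv g)"

lemma flip_GL: "g \<in> GL n ==> flip n g \<in> GL n"
 unfolding flip_def by (intro antitr_GL GL_minv)

lemma flip_flip: "g \<in> GL n ==> flip n (flip n g) = g"
 unfolding flip_def using antitr_GL(2)[OF GL_minv] minv_minv antitr_antitr[OF GL_carrier] by simp

lemma flip_mult: "g \<in> GL n ==> h \<in> GL n ==> flip n (g * h) = flip n g * flip n h"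
 unfolding flip_def minv_mult_distrib
 by (rule antitr_mult) (intro minv_carrier GL_carrier, assumption)+

lemma flip_brk:
 assumes g: "g \<in> GL n" and s: "s <= n" and b: "brk n g (n - s)"
 shows "brk n (flip n g) s"
 unfolding brk_def
proof (intro allI impI)
 fix a b assume ab: "s <= a" "a < n" "b < s"
 have bm: "brk n (minv g) (n - s)" by (rule brk_minv[OF g `brk n g (n - s)`]) simp
 have "b < n" "n - s <= n - 1 - b" "n - 1 - b < n" "n - 1 - a < n - s" using ab s by auto
 thus "flip n g $$ (a, b) = 0" using brkD[OF bm, of "n - 1 - b" "n - 1 - a"] ab by (simp add: flip_def antitr_index)
qed

lemma flip_borel: "b \<in> borel_subgroup n ==> flip n b \<in> borel_subgroup n"
 unfolding borel_iff using flip_GL flip_brk by simp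

lemma flip_PM:
 assumes "PM n g"
 shows "PM n (flip n g)"
proof -
 note g = PM_GL[OF assms]
 note c = GL_carrier[OF g] minv_carrier[OF GL_carrier[OF g]]
 have m: "minv (flip n g) = antitr n g" unfolding flip_def antitr_GL(2)[OF GL_minv[OF g]] minv_minv[OF g] ..
 have "antitr n (minv g * (NN n * g)) = antitr n g * NN n * antitr n (minv g)"
  using antitr_mult[OF c(2) mult_carrier_square[OF NN_carrier c(1)]] antitr_mult[OF NN_carrier c(1)] by (simp add: antitr_NN)
 also have "... = minv (flip n g) * (NN n * flip n g)"
  unfolding m unfolding flip_def by (rule square_assoc[of _ n]) auto
 finally have e: "minv (flip n g) * (NN n * flip n g) = antitr n (minv g * (NN n * g))" ..
 have h: "hess n (minv g * (NN n * g))" using assms PM_iff_conj[OF g] by simp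
 show ?thesis unfolding PM_iff_conj[OF flip_GL[OF g]] e hess_def
 proof (intro allI impI)
  fix i j assume ij: "i < n" "Suc j < i"
  hence "n - 1 - j < n" "Suc (n - 1 - i) < n - 1 - j" "j < n" by auto
  thus "antitr n (minv g * (NN n * g)) $$ (i, j) = 0" using h ij by (simp add: antitr_index hess_def)
 qed
qed

lemma minv_LL_index:
 assumes ij: "i < n" "j < n" "i <= j"
 shows "minv (LL n p) $$ (i, j) = (if i = j then 1 else 0)"
 using ij
proof (induction i arbitrary: j rule: less_induct)
 case (less i)
 have m: "minv (LL n p) \<in> carrier_mat n n" by (rule minv_carrier[OF LL_carrier])
 have z: "minv (LL n p) $$ (l, j) = 0" if "l < i" for l using less.IH[OF that, of j] less.prems that by simp
 have "(LL n p * minv (LL n p)) $$ (i, j) = (\<Sum>l<n. LL n p $$ (i, l) * minv (LL n p) $$ (l, j))"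
  by (rule mat_mult_index[OF LL_carrier m less.prems(1,2)])
 also have "... = (\<Sum>l<n. if l = i then minv (LL n p) $$ (l, j) else 0)"
 proof (intro sum.cong refl)
  fix l assume "l \<in> {..<n}"
  thus "LL n p $$ (i, l) * minv (LL n p) $$ (l, j) = (if l = i then minv (LL n p) $$ (l, j) else 0)"
   using z[of l] less.prems by (cases "l < i") (auto simp: LL_index)
 qed
 also have "... = minv (LL n p) $$ (i, j)" using less.prems by simp
 also have "LL n p * minv (LL n p) = 1\<^sub>m n" by (rule mult_minv[OF LL_carrier]) (simp add: LL_det)
 finally show ?case using less.prems by simp
qed

definition flipc :: "nat => (nat \<times> nat => complex) => nat \<times> nat => complex" where
 "flipc n p = (%(i, j). if j < i & i < n then flip n (LL n p) $$ (i, j) else 0)"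

lemma flipc_affine: "flipc n p \<in> affine_space (patch_index n)"
 by (auto simp: flipc_def affine_space_def patch_index_def)

lemma LL_flipc: "LL n (flipc n p) = flip n (LL n p)"
 unfolding flipc_def
proof (rule LL_surj)
 show "flip n (LL n p) \<in> carrier_mat n n" by (simp add: flip_def)
 fix i j assume ij: "i < n" "j < n" "i <= j"
 hence e: "n - 1 - j < n" "n - 1 - i < n" "n - 1 - j <= n - 1 - i" "n - 1 - j = n - 1 - i \<longleftrightarrow> i = j" by auto
 show "flip n (LL n p) $$ (i, j) = (if i = j then 1 else 0)"
  unfolding flip_def antitr_index[OF ij(1,2)] minv_LL_index[OF e(1-3)] e(4) ..
qed

lemma flipc_flipc:
 assumes "p \<in> affine_space (patch_index n)"
 shows "flipc n (flipc n p) = p"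
 by (rule LL_eqD[OF _ flipc_affine assms]) (simp add: LL_flipc flip_flip LL_GL)

lemma flipc_poly: "(%p. flipc n p q) \<in> poly_funs (patch_index n)"
proof (cases q)
 case (Pair i j)
 show ?thesis
 proof (cases "j < i & i < n")
  case True
  hence "flipc n p q = adj_mat (LL n p) $$ (n - 1 - j, n - 1 - i)" for p
   using adj_mat(1)[OF LL_carrier[of n p]] Pair
   by (simp add: flipc_def flip_def antitr_index minv_def LL_det)
  thus ?thesis using polymat_entry[OF polymat_adj[OF polymat_LL], of "n - 1 - j" n "n - 1 - i"] True by simp
 next
  case False
  show ?thesis unfolding Pair flipc_def prod.case if_not_P[OF False] by (rule poly_funs.const)
 qed
qed

lemma flipc_Pat:
 assumes g: "g \<in> GL n" and p: "p \<in> Pat n g"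
 shows "flipc n p \<in> Pat n (flip n g)"
proof -
 have "PM n (g * LL n p)" using p patch_iff[OF g] by blast
 from flip_PM[OF this] have "PM n (flip n g * LL n (flipc n p))"
  unfolding flip_mult[OF g LL_GL] LL_flipc .
 thus ?thesis using patch_iff[OF flip_GL[OF g]] flipc_affine by blast
qed

text \<open>
The automorphism preserves lower unitriangular matrices, so it transports charts of patches.
\<close>

lemma flip_chart:
 assumes g: "g \<in> GL n" and ch: "is_chart n g D \<phi> \<psi>"
 shows "is_chart n (flip n g) D (%t. flipc n (\<phi> t)) (%j p. \<psi> j (flipc n p))"
proof -
 have Pa: "p \<in> affine_space (patch_index n)" if "p \<in> Pat n g'" "g' \<in> GL n" for p g'
  using that patch_iff by blast
 have ch': "D \<in> poly_funs {1..<n}" "D (%_. 0) ~= 0" "\<phi> (%_. 0) = (%_. 0)"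
   "\<forall>j\<in>{1..<n}. \<psi> j \<in> poly_funs (patch_index n)"
   "\<forall>i\<in>patch_index n. \<exists>k. \<exists>F\<in>poly_funs {1..<n}. \<forall>t\<in>{t. D t ~= 0}. D t ^ k * \<phi> t i = F t"
   "\<forall>t. D t ~= 0 --> \<phi> t \<in> Pat n g" "\<forall>t. \<forall>j\<in>{1..<n}. D t ~= 0 --> \<psi> j (\<phi> t) = t j"
   "\<forall>p\<in>Pat n g. D (%j. \<psi> j p) ~= 0" "\<forall>p\<in>Pat n g. \<phi> (%j. \<psi> j p) = p"
  by (insert ch[unfolded is_chart_def], (elim conjE, assumption)+)
 have ff: "flipc n p \<in> Pat n g" if "p \<in> Pat n (flip n g)" for p
  using flipc_Pat[OF flip_GL[OF g] that] unfolding flip_flip[OF g] .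
 show ?thesis unfolding is_chart_def
 proof (intro conjI)
  show "flipc n (\<phi> (%_. 0)) = (%_. 0)"
   unfolding ch'(3) by (rule LL_eqD[OF _ flipc_affine, of n])
    (use GL_carrier[of "1\<^sub>m n" n] minv_unique(2)[of "1\<^sub>m n" n "1\<^sub>m n"] in
     \<open>simp_all add: LL_flipc LL_zero flip_def antitr_one affine_space_def\<close>)
  show "\<forall>j\<in>{1..<n}. (%p. \<psi> j (flipc n p)) \<in> poly_funs (patch_index n)"
  proof
   fix j assume "j \<in> {1..<n}"
   hence "\<psi> j \<in> poly_funs (patch_index n)" using ch'(4) by blast
   thus "(%p. \<psi> j (flipc n p)) \<in> poly_funs (patch_index n)" by (rule poly_funs_compose) (rule flipc_poly)
  qed
  show "\<forall>i\<in>patch_index n. \<exists>k. \<exists>F\<in>poly_funs {1..<n}. \<forall>t\<in>{t. D t ~= 0}. D t ^ k * flipc n (\<phi> t) i = F t"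
  proof
   fix i assume "i \<in> patch_index n"
   show "\<exists>k. \<exists>F\<in>poly_funs {1..<n}. \<forall>t\<in>{t. D t ~= 0}. D t ^ k * flipc n (\<phi> t) i = F t"
    by (rule poly_funs_compose_rational[OF flipc_poly ch'(1)]) (use ch'(5) in blast)
  qed
  show "\<forall>t. D t ~= 0 --> flipc n (\<phi> t) \<in> Pat n (flip n g)" using ch'(6) flipc_Pat[OF g] by simp
  show "\<forall>t. \<forall>j\<in>{1..<n}. D t ~= 0 --> \<psi> j (flipc n (flipc n (\<phi> t))) = t j"
  proof (intro allI ballI impI)
   fix t j assume "j \<in> {1..<n}" "D t ~= 0"
   thus "\<psi> j (flipc n (flipc n (\<phi> t))) = t j"
    using ch'(7)[rule_format, of j t] flipc_flipc[OF Pa[OF ch'(6)[rule_format, of t] g]] by simp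
  qed
  show "\<forall>p\<in>Pat n (flip n g). D (%j. \<psi> j (flipc n p)) ~= 0" using ch'(8) ff by simp
  show "\<forall>p\<in>Pat n (flip n g). flipc n (\<phi> (%j. \<psi> j (flipc n p))) = p"
   using ch'(9) ff flipc_flipc Pa flip_GL[OF g] by simp
 qed (rule ch')+
qed

lemma Kmat_chart:
 assumes n: "n \<ge> 1" and S: "S = {} \<or> 2 <= n & S = {n - 1}"
 shows "\<exists>D \<phi> \<psi>. is_chart n (Kmat n S t) D \<phi> \<psi>"
proof -
 have Sn: "S \<subseteq> {1..<n}" using S by auto
 have G: "Kmat n S t \<in> GL n" by (rule Kmat_GL[OF Sn])
 show ?thesis using S
 proof
  assume e: "S = {}"
  have I: "Kmat n S t $$ (a, b) = (if a + b < n then if Suc (a + b) = n then 1 else t (n - Suc (a + b)) else 0)"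
   if "a < n" "b < n" for a b unfolding Kmat_index[OF that] e bs_def be_def by simp
  show ?thesis by (rule krylov_chart[OF G, of "n - 1"]) (use n in \<open>auto simp: I\<close>)
 next
  assume e: "2 <= n & S = {n - 1}"
  hence n1: "1 <= n - 1" "n - 1 < n" by auto
  have I: "Kmat n S t $$ (a, b) = (if a + b < n - 1 then if Suc (a + b) = n - 1 then 1 else t (n - 1 - Suc (a + b)) else 0)"
   if "a < n" "b < n - 1" for a b
   using that single_break(1,2)[OF n1 that(2)] e by (simp add: Kmat_index)
  have I2: "Kmat n S t $$ (n - 2, n - 1) = 0"
   using single_break(3)[OF n1, of "n - 1"] e by (auto simp: Kmat_index)
  show ?thesis
  proof (rule krylov_chart[OF G, of "n - 2"])
   fix b assume "b < n"
   thus "Kmat n S t $$ (n - 2, b) = (if b = 0 then 1 else 0)"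
    using I[of "n - 2" b] I2 e by (cases "b < n - 1"; cases "b = n - 1") auto
  next
   fix a k assume ak: "a < n" "k < n - 1"
   thus "Kmat n S t $$ (a, k) = (if a + k < n then Kmat n S t $$ (a + k, 0) else 0)"
    using I[of a k] I[of "a + k" 0] n1 by auto
  qed (use e in auto)
 qed
qed

text \<open>
For \<open>S = {1}\<close> the dual flag has break set \<open>{n - 1}\<close>; its normal form is dualised back.
\<close>

theorem regular_of_not_two_sided:
 assumes n: "n \<ge> 1" and g: "PM n g" and ts: "~ two_sided n (breaks n g)"
 shows "regular_in_flags n (Peterson n) (coset n g)"
proof -
 note gG = PM_GL[OF g]
 let ?S = "breaks n g"
 have good: ?thesis if G: "g' \<in> GL n" "coset n g = coset n g'" and c: "\<exists>D \<phi> \<psi>. is_chart n g' D \<phi> \<psi>" for g'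
  using regular_of_chart[OF G(1)] c G unfolding regular_in_flags_def by blast
 have normal: "\<exists>t b. b \<in> borel_subgroup n & Kmat n (breaks n h) t = h * b" if "PM n h" for h
  using PM_normal_form[OF that] by blast
 have "?S = {} \<or> (2 <= n & ?S = {1}) \<or> (2 <= n & ?S = {n - 1})" by (rule not_two_sided[OF _ ts]) auto
 then consider "?S = {} \<or> 2 <= n & ?S = {n - 1}" | "2 <= n" "?S = {1}" by blast
 thus ?thesis
 proof cases
  case 1
  obtain t b where tb: "b \<in> borel_subgroup n" "Kmat n ?S t = g * b" using normal[OF g] by blast
  have "coset n g = coset n (Kmat n ?S t)" unfolding tb(2) using coset_mult[OF GL_carrier[OF gG] tb(1)] by simp
  moreover have "Kmat n ?S t \<in> GL n" by (rule Kmat_GL) blast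
  ultimately show ?thesis by (intro good[OF _ _ Kmat_chart[OF n 1, of t]])
 next
  case 2
  let ?h = "flip n g"
  have "{s \<in> {1..<n}. brk n ?h s} = {n - 1}"
  proof (intro Set.set_eqI iffI)
   fix s assume "s \<in> {s \<in> {1..<n}. brk n ?h s}"
   hence s: "1 <= s" "s < n" "brk n ?h s" by auto
   have "brk n (flip n ?h) (n - s)" by (rule flip_brk[OF flip_GL[OF gG]]) (use s in auto)
   hence "n - s \<in> ?S" using s unfolding flip_flip[OF gG] by auto
   hence "n - s = 1" unfolding 2(2) by simp
   thus "s \<in> {n - 1}" using s by simp
  next
   fix s assume s: "s \<in> {n - 1}"
   have "brk n g 1" using 2(2) by blast
   hence "brk n ?h (n - 1)" using 2(1) by (intro flip_brk[OF gG]) auto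
   thus "s \<in> {s \<in> {1..<n}. brk n ?h s}" using s 2(1) by auto
  qed
  then obtain t b where tb: "b \<in> borel_subgroup n" "Kmat n {n - 1} t = ?h * b" using normal[OF flip_PM[OF g]] by auto
  have KG: "Kmat n {n - 1} t \<in> GL n" by (rule Kmat_GL) (use 2(1) in simp)
  have "flip n (Kmat n {n - 1} t) = g * flip n b"
   unfolding tb(2) flip_mult[OF flip_GL[OF gG] borel_GL[OF tb(1)]] flip_flip[OF gG] ..
  hence co: "coset n g = coset n (flip n (Kmat n {n - 1} t))"
   using coset_mult[OF GL_carrier[OF gG] flip_borel[OF tb(1)]] by simp
  obtain D \<phi> \<psi> where "is_chart n (Kmat n {n - 1} t) D \<phi> \<psi>" using Kmat_chart[OF n, of "{n - 1}" t] 2(1) by blast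
  from flip_chart[OF KG this] show ?thesis by (intro good[OF flip_GL[OF KG] co]) blast
 qed
qed

section \<open>Tangent spaces in the matrix space\<close>

text \<open>
The condition \<open>PM n g\<close> is studied on the space of all \<open>n \<times> n\<close> matrices; \<open>hatT n g\<close> is its tangent space at \<open>g\<close>.
\<close>

definition hatE :: "nat => (nat \<times> nat) set" where "hatE n = {..<n} \<times> {..<n}"

definition hatP :: "nat => (nat \<times> nat => complex) set" where "hatP n = {x. PM n (mat n n x)}"

definition fn :: "nat => complex mat => nat \<times> nat => complex" where
 "fn n g = (%(a, b). if a < n & b < n then g $$ (a, b) else 0)"

definition hatT :: "nat => complex mat => (nat \<times> nat => complex) set" where
 "hatT n g = tangent_space (hatE n) (hatP n) (fn n g)"

definition upper_index :: "nat => (nat \<times> nat) set" where "upper_index n = {(i, j). i <= j & j < n}"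

lemma finite_hatE[simp]: "finite (hatE n)" by (simp add: hatE_def)

lemma finite_upper_index[simp]: "finite (upper_index n)"
 by (rule finite_subset[of _ "hatE n"]) (auto simp: upper_index_def hatE_def)

lemma mat_fn: "g \<in> carrier_mat n n ==> mat n n (fn n g) = g"
 by (rule eq_matI) (auto simp: fn_def)

lemma fn_in_hatP: "PM n g ==> fn n g \<in> hatP n"
 unfolding hatP_def by (simp add: mat_fn GL_carrier[OF PM_GL])

lemma polymat_id: "polymat (hatE n) n n (mat n n)"
proof -
 have "polymat (hatE n) n n (%x. mat n n (%(i, j). x (i, j)))"
  by (rule polymat_mat) (rule poly_funs.coord, simp add: hatE_def)
 thus ?thesis by simp
qed

lemma hatT_affine: "hatT n g \<subseteq> affine_space (hatE n)"
 unfolding hatT_def by (rule tangent_space_affine)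

lemma subspace_hatT: "cfun.subspace (hatT n g)"
 unfolding hatT_def by (rule subspace_tangent_space) simp

lemma hatT_curve:
 assumes g: "PM n g" and c0: "!!a b. a < n ==> b < n ==> c 0 (a, b) = g $$ (a, b)"
  and c: "!!t. det (mat n n (c t)) ~= 0 ==> PM n (mat n n (c t))"
  and B: "B \<in> affine_space (hatE n)"
  and d: "!!a b. a < n ==> b < n ==> ((%t. c t (a, b)) has_field_derivative B (a, b)) (at 0)"
 shows "B \<in> hatT n g"
 unfolding hatT_def
proof (rule tangent_space_curve[where W = "%x. det (mat n n x)" and c = "%t. fn n (mat n n (c t))"])
 show "finite (hatE n)" by simp
 show "fn n g \<in> hatP n" by (rule fn_in_hatP[OF g])
 show "(%x. det (mat n n x)) \<in> poly_funs (hatE n)" by (rule polymat_det[OF polymat_id])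
 show "det (mat n n (fn n g)) ~= 0" using GL_det[OF PM_GL[OF g]] by (simp add: mat_fn GL_carrier[OF PM_GL[OF g]])
 show "fn n (mat n n (c 0)) = fn n g" using c0 by (auto simp: fn_def)
 show "B \<in> affine_space (hatE n)" by (rule B)
 fix t
 {
  assume "det (mat n n (fn n (mat n n (c t)))) ~= 0"
  hence "det (mat n n (c t)) ~= 0" using mat_fn[OF mat_carrier[of n n "c t"]] by simp
  from fn_in_hatP[OF c[OF this]] show "fn n (mat n n (c t)) \<in> hatP n" .
 }
next
 fix i assume "i \<in> hatE n"
 then obtain a b where ab: "i = (a, b)" "a < n" "b < n" by (auto simp: hatE_def)
 have "(%t. fn n (mat n n (c t)) i) = (%t. c t (a, b))" using ab by (auto simp: fn_def)
 thus "((%t. fn n (mat n n (c t)) i) has_field_derivative B i) (at 0)" using d[OF ab(2,3)] ab(1) by simp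
qed

lemma hatT_line:
 assumes g: "PM n g" and B: "B \<in> affine_space (hatE n)"
  and c: "!!t. det (mat n n (%i. g $$ i + t * B i)) ~= 0 ==> PM n (mat n n (%i. g $$ i + t * B i))"
 shows "B \<in> hatT n g"
 by (rule hatT_curve[OF g, where c = "%t i. g $$ i + t * B i"]) (auto intro!: derivative_eq_intros c B)

text \<open>
Adding a multiple of an earlier column to a later one, or scaling a column, does not change the flag.
\<close>

lemma hatT_flag:
 assumes g: "PM n g" and kl: "k <= l" "l < n"
 shows "(%(a, b). if b = l & a < n then g $$ (a, k) else 0) \<in> hatT n g"
proof (rule hatT_line[OF g])
 note gc = GL_carrier[OF PM_GL[OF g]]
 let ?B = "%(a, b). if b = l & a < n then g $$ (a, k) else 0"
 show "?B \<in> affine_space (hatE n)" using kl by (auto simp: affine_space_def hatE_def)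
 fix t :: complex
 define b where "b = mat n n (%(i, j). (if i = j then 1 else 0) + (if i = k & j = l then t else 0))"
 have bc: "b \<in> carrier_mat n n" by (simp add: b_def)
 have kn: "k < n" using kl by simp
 have e: "mat n n (%i. g $$ i + t * ?B i) = g * b"
 proof (rule eq_matI)
  fix i j assume "i < dim_row (g * b)" "j < dim_col (g * b)"
  hence ij: "i < n" "j < n" using gc bc by auto
  have "(g * b) $$ (i, j) = (\<Sum>m<n. g $$ (i, m) * b $$ (m, j))" by (rule mat_mult_index[OF gc bc ij])
  also have "... = (\<Sum>m<n. (if m = j then g $$ (i, m) else 0) + (if m = k then (if j = l then t * g $$ (i, m) else 0) else 0))"
   using ij by (intro sum.cong refl) (auto simp: b_def algebra_simps)
  also have "... = g $$ (i, j) + (if j = l then t * g $$ (i, k) else 0)"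
   unfolding sum.distrib using ij kn by simp
  finally show "mat n n (%i. g $$ i + t * ?B i) $$ (i, j) = (g * b) $$ (i, j)" using ij by simp
 qed (use gc bc in auto)
 assume "det (mat n n (%i. g $$ i + t * ?B i)) ~= 0"
 hence "det b ~= 0" unfolding e det_mult[OF gc bc] by simp
 moreover have "upper_triangular b" using bc kl unfolding upper_triangular_def by (auto simp: b_def)
 ultimately have "b \<in> borel_subgroup n" using bc by (simp add: borel_subgroup_def GL_iff)
 thus "PM n (mat n n (%i. g $$ i + t * ?B i))" unfolding e by (rule PM_mult_borel[OF g])
qed

text \<open>
The directions \<open>g X\<close> with \<open>X\<close> upper triangular are tangent; \<open>ind\<close> says that the \<open>B k\<close> are independent modulo them.
\<close>

lemma hat_dim_ge:
 fixes B :: "'k => nat \<times> nat => complex"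
 assumes g: "PM n g" and K: "finite K" and B: "!!k. k \<in> K ==> B k \<in> hatT n g"
  and ind: "!!y X. X \<in> carrier_mat n n ==> (!!i j. j < i ==> i < n ==> X $$ (i, j) = 0) ==>
   (!!a b. a < n ==> b < n ==> (\<Sum>k\<in>K. y k * B k (a, b)) = (g * X) $$ (a, b)) ==> \<forall>k\<in>K. y k = 0"
 shows "card (upper_index n) + card K <= cfun.dim (hatT n g)"
proof -
 note gc = GL_carrier[OF PM_GL[OF g]]
 let ?U = "upper_index n"
 define u where "u z = (case z of Inl kl => (%(a, b). if b = snd kl & a < n then g $$ (a, fst kl) else 0) | Inr k => B k)"
  for z :: "(nat \<times> nat) + 'k"
 have "card (?U <+> K) <= cfun.dim (hatT n g)"
 proof (rule card_le_dim[where u = u and I = "hatE n"])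
  show "hatT n g \<subseteq> affine_space (hatE n)" by (rule hatT_affine)
  show "finite (?U <+> K)" using K by simp
  fix z assume "z \<in> ?U <+> K"
  thus "u z \<in> hatT n g"
  proof (rule PlusE)
   fix kl assume kl: "kl \<in> ?U" "z = Inl kl"
   thus ?thesis unfolding kl(2) u_def sum.case by (intro hatT_flag[OF g]) (auto simp: upper_index_def)
  next
   fix k assume "k \<in> K" "z = Inr k"
   thus ?thesis using B[of k] by (simp add: u_def)
  qed
 next
  fix x :: "(nat \<times> nat) + 'k => complex"
  assume x: "!!i. (\<Sum>z\<in>?U <+> K. x z * u z i) = 0"
  define X where "X = mat n n (%(k, l). if k <= l then - x (Inl (k, l)) else 0)"
  have Xc: "X \<in> carrier_mat n n" by (simp add: X_def)
  have Xu: "X $$ (i, j) = 0" if "j < i" "i < n" for i j using that by (simp add: X_def)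
  have eq: "(\<Sum>k\<in>K. x (Inr k) * B k (a, b)) = (g * X) $$ (a, b)" if ab: "a < n" "b < n" for a b
  proof -
   have "(\<Sum>z\<in>?U. x (Inl z) * u (Inl z) (a, b)) = (\<Sum>z\<in>(%k. (k, b)) ` {..b}. x (Inl z) * u (Inl z) (a, b))"
   proof (rule sum.mono_neutral_right[OF finite_upper_index])
    show "(%k. (k, b)) ` {..b} \<subseteq> ?U" using ab by (auto simp: upper_index_def)
    show "\<forall>z\<in>?U - (%k. (k, b)) ` {..b}. x (Inl z) * u (Inl z) (a, b) = 0"
    proof
     fix z assume z: "z \<in> ?U - (%k. (k, b)) ` {..b}"
     obtain k l where kl: "z = (k, l)" by (cases z)
     have "l ~= b" using z by (auto simp: kl upper_index_def)
     thus "x (Inl z) * u (Inl z) (a, b) = 0" by (simp add: u_def kl)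
    qed
   qed
   also have "... = (\<Sum>k\<le>b. x (Inl (k, b)) * g $$ (a, k))"
    using ab by (subst sum.reindex) (auto simp: u_def inj_on_def)
   also have "... = (\<Sum>k<n. - (g $$ (a, k) * X $$ (k, b)))"
    using ab by (intro sum.mono_neutral_cong_left) (auto simp: X_def)
   also have "... = - (g * X) $$ (a, b)" unfolding mat_mult_index[OF gc Xc ab] by (rule sum_negf)
   finally have 1: "(\<Sum>z\<in>?U. x (Inl z) * u (Inl z) (a, b)) = - (g * X) $$ (a, b)" .
   have "(\<Sum>z\<in>?U. x (Inl z) * u (Inl z) (a, b)) + (\<Sum>k\<in>K. x (Inr k) * u (Inr k) (a, b)) = 0"
    using x[of "(a, b)"] unfolding sum.Plus[OF finite_upper_index K] o_def .
   thus ?thesis unfolding 1 by (simp add: u_def algebra_simps)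
  qed
  have y0: "\<forall>k\<in>K. x (Inr k) = 0" by (rule ind[OF Xc]) (use Xu eq in auto)
  have "g * X = 0\<^sub>m n n"
  proof (rule eq_matI)
   fix a b assume "a < dim_row (0\<^sub>m n n :: complex mat)" "b < dim_col (0\<^sub>m n n :: complex mat)"
   hence ab: "a < n" "b < n" by auto
   show "(g * X) $$ (a, b) = 0\<^sub>m n n $$ (a, b)" unfolding eq[OF ab, symmetric] using y0 ab by simp
  qed (use gc Xc in auto)
  hence "minv g * (0\<^sub>m n n) = X" using GL_cancel_left[OF PM_GL[OF g] Xc] by simp
  hence X0: "X = 0\<^sub>m n n" using right_mult_zero_mat[OF minv_carrier[OF gc], of n] by simp
  have "x (Inl kl) = 0" if "kl \<in> ?U" for kl
  proof -
   obtain k l where e: "kl = (k, l)" by (cases kl)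
   have "k <= l" "l < n" using that unfolding e upper_index_def by simp_all
   hence kl: "kl = (k, l)" "k <= l" "l < n" "k < n" using e by simp_all
   have "X $$ (k, l) = 0" unfolding X0 using kl by simp
   thus ?thesis using kl by (simp add: X_def)
  qed
  thus "\<forall>z\<in>?U <+> K. x z = 0" using y0 by (auto elim!: PlusE)
 qed simp
 thus ?thesis by (simp add: card_Plus K)
qed

lemma dim_le_of_injection:
 fixes L :: "'j => 'i => complex"
 assumes I: "finite I" and V: "cfun.subspace V" "V \<subseteq> affine_space I"
  and J: "finite J" and W: "cfun.subspace W" "W \<subseteq> affine_space J"
  and L: "!!v. v \<in> V ==> (%j. if j \<in> J then \<Sum>i\<in>I. L j i * v i else 0) \<in> W"
  and inj: "!!v. v \<in> V ==> (!!j. j \<in> J ==> (\<Sum>i\<in>I. L j i * v i) = 0) ==> v = 0"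
 shows "cfun.dim V <= cfun.dim W"
proof -
 obtain P where P: "P \<subseteq> J" "card P <= cfun.dim W" "\<forall>w\<in>W. (\<forall>j\<in>P. w j = 0) --> w = 0"
  using pivot_set_exists[OF J W] by blast
 have fP: "finite P" using P(1) J finite_subset by blast
 have "cfun.dim V <= card P"
 proof (rule dim_le_card_functionals[OF I fP V, where L = L])
  fix v assume v: "v \<in> V" and z: "!!j. j \<in> P ==> (\<Sum>i\<in>I. L j i * v i) = 0"
  let ?w = "%j. if j \<in> J then \<Sum>i\<in>I. L j i * v i else 0"
  have "\<forall>j\<in>P. ?w j = 0" using z by simp
  hence w0: "?w = 0" by (rule mp[OF bspec[OF P(3) L[OF v]]])
  show "v = 0"
  proof (rule inj[OF v])
   fix j assume "j \<in> J"
   thus "(\<Sum>i\<in>I. L j i * v i) = 0" using fun_cong[OF w0, of j] by simp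
  qed
 qed
 thus ?thesis using P(2) by linarith
qed

lemma triple_index:
 fixes T b :: "complex mat"
 assumes T: "T \<in> carrier_mat n n" and b: "b \<in> carrier_mat n n" and ij: "i < n" "j < n"
 shows "(T * mat n n x * b) $$ (i, j) = (\<Sum>q\<in>hatE n. T $$ (i, fst q) * b $$ (snd q, j) * x q)"
proof -
 have M: "mat n n x \<in> carrier_mat n n" by simp
 have "(T * mat n n x * b) $$ (i, j) = (\<Sum>l<n. (T * mat n n x) $$ (i, l) * b $$ (l, j))"
  by (rule mat_mult_index[OF mult_carrier_square[OF T M] b ij])
 also have "... = (\<Sum>l<n. \<Sum>k<n. T $$ (i, k) * b $$ (l, j) * x (k, l))"
 proof (intro sum.cong refl)
  fix l assume "l \<in> {..<n}"
  hence l: "l < n" by simp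
  show "(T * mat n n x) $$ (i, l) * b $$ (l, j) = (\<Sum>k<n. T $$ (i, k) * b $$ (l, j) * x (k, l))"
   unfolding mat_mult_index[OF T M ij(1) l] sum_distrib_right using l by (intro sum.cong refl) simp
 qed
 also have "... = (\<Sum>k<n. \<Sum>l<n. T $$ (i, k) * b $$ (l, j) * x (k, l))" by (rule sum.swap)
 also have "... = (\<Sum>q\<in>hatE n. T $$ (i, fst q) * b $$ (snd q, j) * x q)"
  unfolding hatE_def by (simp add: sum.cartesian_product split_def)
 finally show ?thesis .
qed

lemma hatT_mult:
 assumes g: "PM n g" and T: "T \<in> GL n" "NN n * T = T * NN n" and b: "b \<in> borel_subgroup n"
 shows "cfun.dim (hatT n g) <= cfun.dim (hatT n (T * g * b))"
proof (rule dim_le_of_injection[where I = "hatE n" and J = "hatE n" and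
   L = "%j q. T $$ (fst j, fst q) * b $$ (snd q, snd j)"])
 note gc = GL_carrier[OF PM_GL[OF g]] and Tc = GL_carrier[OF T(1)] and bc = borel_carrier[OF b]
 have S: "(\<Sum>q\<in>hatE n. T $$ (i, fst q) * b $$ (snd q, j) * x q) = (T * mat n n x * b) $$ (i, j)"
  if "i < n" "j < n" for i j x using triple_index[OF Tc bc that, of x] ..
 {
  fix v assume v: "v \<in> hatT n g"
  let ?w = "%j. if j \<in> hatE n then \<Sum>q\<in>hatE n. T $$ (fst j, fst q) * b $$ (snd q, snd j) * v q else 0"
  have "?w \<in> tangent_space (hatE n) (hatP n) (fn n (T * mat n n (fn n g) * b))"
  proof (rule tangent_space_rational_map[where E = "hatE n" and D = "%_. 1" and L = "%x. fn n (T * mat n n x * b)"])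
   show "v \<in> tangent_space (hatE n) (hatP n) (fn n g)" using v unfolding hatT_def .
   show "fn n g \<in> hatP n" by (rule fn_in_hatP[OF g])
   show "?w \<in> affine_space (hatE n)" by (auto simp: affine_space_def)
   show "(%_. 1) \<in> poly_funs (hatE n)" by (rule poly_funs.const)
  next
   fix q assume q: "q \<in> hatE n"
   then obtain i j where ij: "q = (i, j)" "i < n" "j < n" by (auto simp: hatE_def)
   have pm: "polymat (hatE n) n n (%x. T * mat n n x * b)"
    by (rule polymat_mult[OF polymat_mult[OF polymat_const[OF Tc] polymat_id] polymat_const[OF bc]])
   have "(%x. fn n (T * mat n n x * b) q) = (%x. (T * mat n n x * b) $$ (i, j))" using ij by (auto simp: fn_def)
   hence "(%x. fn n (T * mat n n x * b) q) \<in> poly_funs (hatE n)" using polymat_entry[OF pm ij(2,3)] by simp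
   thus "\<exists>k. \<exists>F\<in>poly_funs (hatE n). \<forall>x\<in>{x. (1::complex) ~= 0}. 1 ^ k * fn n (T * mat n n x * b) q = F x"
    by (intro exI[of _ 0] bexI[of _ "%x. fn n (T * mat n n x * b) q"]) simp_all
   have "(%t. fn n (T * mat n n (%e. fn n g e + t * v e) * b) q) = (%t. (\<Sum>q\<in>hatE n. T $$ (i, fst q) * b $$ (snd q, j) * fn n g q) + t * ?w q)"
   proof
    fix t
    have "fn n (T * mat n n (%e. fn n g e + t * v e) * b) q = (\<Sum>q\<in>hatE n. T $$ (i, fst q) * b $$ (snd q, j) * (fn n g q + t * v q))"
     unfolding S[OF ij(2,3)] using ij by (simp add: fn_def)
    also have "... = (\<Sum>q\<in>hatE n. T $$ (i, fst q) * b $$ (snd q, j) * fn n g q) + t * (\<Sum>q\<in>hatE n. T $$ (i, fst q) * b $$ (snd q, j) * v q)"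
     unfolding sum_distrib_left sum.distrib[symmetric] by (intro sum.cong refl) (simp add: algebra_simps)
    finally show "fn n (T * mat n n (%e. fn n g e + t * v e) * b) q = (\<Sum>q\<in>hatE n. T $$ (i, fst q) * b $$ (snd q, j) * fn n g q) + t * ?w q"
     using q ij(1) by simp
   qed
   moreover have "((%t. A + t * C) has_field_derivative C) (at 0)" for A C :: complex
    by (auto intro!: derivative_eq_intros)
   ultimately show "((%t. fn n (T * mat n n (%e. fn n g e + t * v e) * b) q) has_field_derivative ?w q) (at 0)"
    by (simp only:)
  next
   fix x assume "x \<in> hatP n"
   hence "PM n (T * mat n n x * b)" unfolding hatP_def by (intro PM_mult_borel[OF PM_mult_left[OF _ T] b]) simp
   thus "fn n (T * mat n n x * b) \<in> hatP n" by (rule fn_in_hatP)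
  qed simp_all
  thus "?w \<in> hatT n (T * g * b)" unfolding hatT_def mat_fn[OF gc] .
  assume z: "!!j. j \<in> hatE n ==> (\<Sum>q\<in>hatE n. T $$ (fst j, fst q) * b $$ (snd q, snd j) * v q) = 0"
  have Mv: "mat n n v \<in> carrier_mat n n" by simp
  have "T * mat n n v * b = 0\<^sub>m n n"
  proof (rule eq_matI)
   fix i j assume "i < dim_row (0\<^sub>m n n :: complex mat)" "j < dim_col (0\<^sub>m n n :: complex mat)"
   hence ij: "i < n" "j < n" by auto
   show "(T * mat n n v * b) $$ (i, j) = 0\<^sub>m n n $$ (i, j)"
    using z[of "(i, j)"] ij unfolding S[OF ij, symmetric] by (simp add: hatE_def)
  qed (use Tc bc in auto)
  hence "T * mat n n v * b * minv b = 0\<^sub>m n n" using left_mult_zero_mat[OF minv_carrier[OF bc], of n] by simp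
  hence "T * mat n n v = 0\<^sub>m n n" using GL_cancel_right[OF borel_GL[OF b] mult_carrier_square[OF Tc Mv]] by simp
  hence "minv T * (T * mat n n v) = 0\<^sub>m n n" using right_mult_zero_mat[OF minv_carrier[OF Tc], of n] by simp
  hence v0: "mat n n v = 0\<^sub>m n n" using GL_cancel_left[OF T(1) Mv] by simp
  show "v = 0"
  proof
   fix q :: "nat \<times> nat"
   show "v q = 0 q"
   proof (cases "q \<in> hatE n")
    case True
    then obtain i j where ij: "q = (i, j)" "i < n" "j < n" by (auto simp: hatE_def)
    have "mat n n v $$ (i, j) = 0" unfolding v0 using ij by simp
    thus ?thesis using ij by simp
   next
    case False
    moreover have "v \<in> affine_space (hatE n)" using v hatT_affine[of n g] by blast
    ultimately show ?thesis by (simp add: affine_space_def del: split_paired_All)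
   qed
  qed
 }
qed (use hatT_affine subspace_hatT in auto)

text \<open>
The tangent space upstairs maps to that of the patch by the strictly lower part of \<open>g\<^sup>-\<^sup>1 B\<close>, with upper triangular \<open>g\<^sup>-\<^sup>1 B\<close> as kernel.
\<close>

lemma dim_patch_ge:
 assumes g: "PM n g" and d: "card (upper_index n) + n <= cfun.dim (hatT n g)"
 shows "n <= cfun.dim (tangent_space (patch_index n) (Pat n g) (%_. 0))"
proof -
 note gG = PM_GL[OF g]
 note gc = GL_carrier[OF gG]
 note mc = minv_carrier[OF gc]
 let ?W = "tangent_space (patch_index n) (Pat n g) (%_. 0)"
 define M where "M x = minv g * mat n n x" for x
 define X where "X B i j = (\<Sum>l<n. minv g $$ (i, l) * B (l, j))" for B :: "nat \<times> nat => complex" and i j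
 have Midx: "M x $$ (i, j) = X x i j" if "i < n" "j < n" for x i j
  unfolding M_def X_def using that by (simp add: mat_mult_index[OF mc mat_carrier])
 have low: "(%(i, j). if j < i & i < n then X B i j else 0) \<in> ?W" if B: "B \<in> hatT n g" for B
 proof (rule tangent_patch[where E = "hatE n" and M = M and a = "fn n g" and Q = "hatP n" and B = B])
  show "polymat (hatE n) n n M" unfolding M_def by (rule polymat_mult[OF polymat_const[OF mc] polymat_id])
  show "M (fn n g) = 1\<^sub>m n" unfolding M_def mat_fn[OF gc] by (rule minv_mult[OF gc GL_det[OF gG]])
  show "fn n g \<in> hatP n" by (rule fn_in_hatP[OF g])
  show "g \<in> GL n" by (rule gG)
  show "B \<in> tangent_space (hatE n) (hatP n) (fn n g)" using B unfolding hatT_def .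
  fix x assume "x \<in> hatP n"
  thus "PM n (g * M x)" unfolding M_def GL_cancel_left'[OF gG mat_carrier] hatP_def by simp
 next
  fix i j assume ij: "i < n" "j < n"
  have "X (%e. fn n g e + t * B e) i j = X (fn n g) i j + t * X B i j" for t
   unfolding X_def sum_distrib_left sum.distrib[symmetric] by (intro sum.cong refl) (simp add: algebra_simps)
  hence "(%t. M (%e. fn n g e + t * B e) $$ (i, j)) = (%t. X (fn n g) i j + t * X B i j)"
   unfolding Midx[OF ij] by (rule ext)
  moreover have "((%t. A + t * C) has_field_derivative C) (at 0)" for A C :: complex
   by (auto intro!: derivative_eq_intros)
  ultimately show "((%t. M (%e. fn n g e + t * B e) $$ (i, j)) has_field_derivative X B i j) (at 0)"
   by (simp only:)
 qed simp
 obtain P where P: "P \<subseteq> patch_index n" "card P <= cfun.dim ?W" "\<forall>w\<in>?W. (\<forall>j\<in>P. w j = 0) --> w = 0"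
  using pivot_set_exists[OF finite_patch_index subspace_tangent_space[OF finite_patch_index, of n "Pat n g" "%_. 0"] tangent_space_affine]
  by (elim exE conjE) (rule that)
 have fP: "finite P" using P(1) finite_subset[OF _ finite_patch_index] by blast
 have "cfun.dim (hatT n g) <= card (P \<union> upper_index n)"
 proof (rule dim_le_card_functionals[where I = "hatE n" and L = "%j q. if snd q = snd j then minv g $$ (fst j, fst q) else 0"])
  show "cfun.subspace (hatT n g)" by (rule subspace_hatT)
  show "hatT n g \<subseteq> affine_space (hatE n)" by (rule hatT_affine)
  fix B assume B: "B \<in> hatT n g"
   and z: "!!j. j \<in> P \<union> upper_index n ==> (\<Sum>q\<in>hatE n. (if snd q = snd j then minv g $$ (fst j, fst q) else 0) * B q) = 0"
  have L: "(\<Sum>q\<in>hatE n. (if snd q = j then minv g $$ (i, fst q) else 0) * B q) = X B i j" if "j < n" for i j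
  proof -
   have "(\<Sum>q\<in>hatE n. (if snd q = j then minv g $$ (i, fst q) else 0) * B q)
     = (\<Sum>q\<in>(%l. (l, j)) ` {..<n}. (if snd q = j then minv g $$ (i, fst q) else 0) * B q)"
    using that by (intro sum.mono_neutral_right) (auto simp: hatE_def)
   also have "... = X B i j" unfolding X_def by (subst sum.reindex) (auto simp: inj_on_def)
   finally show ?thesis .
  qed
  have zz: "X B i j = 0" if "(i, j) \<in> P \<union> upper_index n" "j < n" for i j
   using z[OF that(1)] L[OF that(2), of i] unfolding fst_conv snd_conv by simp
  let ?w = "%(i, j). if j < i & i < n then X B i j else 0"
  have "\<forall>q\<in>P. ?w q = 0"
  proof
   fix q assume q: "q \<in> P"
   obtain i j where ij: "q = (i, j)" by (cases q)
   have "j < n" using q P(1) by (auto simp: ij patch_index_def)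
   thus "?w q = 0" using zz[of i j] q by (simp add: ij)
  qed
  hence w0: "?w = 0" by (rule mp[OF bspec[OF P(3) low[OF B]]])
  have X0: "X B i j = 0" if "i < n" "j < n" for i j
  proof (cases "j < i")
   case True
   thus ?thesis using fun_cong[OF w0, of "(i, j)"] that by simp
  next
   case False
   thus ?thesis using that by (intro zz) (auto simp: upper_index_def)
  qed
  have "M B = 0\<^sub>m n n" by (rule eq_matI) (use Midx X0 mc in \<open>auto simp: M_def\<close>)
  hence "g * M B = 0\<^sub>m n n" using right_mult_zero_mat[OF gc, of n] by simp
  hence B0: "mat n n B = 0\<^sub>m n n" unfolding M_def GL_cancel_left'[OF gG mat_carrier] .
  show "B = 0"
  proof
   fix q :: "nat \<times> nat"
   show "B q = 0 q"
   proof (cases "q \<in> hatE n")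
    case True
    then obtain i j where ij: "q = (i, j)" "i < n" "j < n" by (auto simp: hatE_def)
    have "mat n n B $$ (i, j) = 0" unfolding B0 using ij by simp
    thus ?thesis using ij by simp
   next
    case False
    moreover have "B \<in> affine_space (hatE n)" using B hatT_affine[of n g] by blast
    ultimately show ?thesis by (simp add: affine_space_def del: split_paired_All)
   qed
  qed
 qed (use fP in auto)
 also have "... <= card P + card (upper_index n)" by (rule card_Un_le)
 finally show ?thesis using d P(2) by linarith
qed

lemma not_regular_of_dim:
 assumes n: "n \<ge> 1" and d: "!!g. PM n g ==> coset n g = x ==> card (upper_index n) + n <= cfun.dim (hatT n g)"
 shows "~ regular_in_flags n (Peterson n) x"
proof
 assume "regular_in_flags n (Peterson n) x"
 then obtain g where g: "g \<in> GL n" "x = coset n g" "regular_point (patch_index n) (Pat n g) (%_. 0)"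
  unfolding regular_in_flags_def by blast
 have p0: "(%_. 0) \<in> Pat n g" and e: "enat (cfun.dim (tangent_space (patch_index n) (Pat n g) (%_. 0))) = local_dim (patch_index n) (Pat n g) (%_. 0)"
  using g(3) unfolding regular_point_def by auto
 have "PM n (g * LL n (%_. 0))" using p0 patch_iff[OF g(1)] by blast
 hence "PM n g" unfolding LL_zero using GL_carrier[OF g(1)] by simp
 from dim_patch_ge[OF this d[OF this]] g(2) have "n <= cfun.dim (tangent_space (patch_index n) (Pat n g) (%_. 0))" by simp
 moreover have "enat (cfun.dim (tangent_space (patch_index n) (Pat n g) (%_. 0))) <= enat (n - 1)"
  unfolding e by (rule local_dim_patch_le[OF g(1)])
 ultimately show False using n by simp
qed

section \<open>Roots of a perturbed power\<close>

definition roots_poly :: "(nat => complex) => nat set => complex poly" where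
 "roots_poly y A = (\<Prod>i\<in>A. [:- y i, 1:])"

lemma poly_roots_poly: "finite A ==> poly (roots_poly y A) x = (\<Prod>i\<in>A. x - y i)"
 by (simp add: roots_poly_def poly_prod algebra_simps)

lemma roots_poly_insert: "finite A ==> a \<notin> A ==> roots_poly y (insert a A) = [:- y a, 1:] * roots_poly y A"
 by (simp add: roots_poly_def)

lemma coeff_linear_mult: "coeff ([:- a, 1:] * p) k = (if k = 0 then 0 else coeff p (k - 1)) - a * coeff (p :: complex poly) k"
 by (cases k) (simp_all add: algebra_simps)

lemma roots_poly_monic:
 assumes "finite A"
 shows "degree (roots_poly y A) = card A & coeff (roots_poly y A) (card A) = 1"
 using assms
proof (induction A rule: finite_induct)
 case empty
 thus ?case by (simp add: roots_poly_def)
next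
 case (insert a A)
 have ne: "roots_poly y A ~= 0" using insert.IH by auto
 have "degree (roots_poly y (insert a A)) = Suc (card A)"
  unfolding roots_poly_insert[OF insert(1,2)] using insert.IH ne by (subst degree_mult_eq) auto
 moreover have "coeff (roots_poly y A) (Suc (card A)) = 0" using insert.IH by (intro coeff_eq_0) simp
 hence "coeff (roots_poly y (insert a A)) (Suc (card A)) = 1"
  unfolding roots_poly_insert[OF insert(1,2)] coeff_linear_mult using insert.IH by simp
 ultimately show ?case using insert by simp
qed

lemma roots_poly_subleading:
 assumes "finite A"
 shows "(1 <= card A --> coeff (roots_poly y A) (card A - 1) = - (\<Sum>i\<in>A. y i)) &
  (2 <= card A --> 2 * coeff (roots_poly y A) (card A - 2) = (\<Sum>i\<in>A. y i)\<^sup>2 - (\<Sum>i\<in>A. (y i)\<^sup>2))"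
 using assms
proof (induction A rule: finite_induct)
 case empty
 thus ?case by simp
next
 case (insert a A)
 have lead: "coeff (roots_poly y A) (card A) = 1" using roots_poly_monic[OF insert(1)] by blast
 have c: "card (insert a A) = Suc (card A)" using insert by simp
 have 1: "coeff (roots_poly y (insert a A)) (card A) = - (\<Sum>i\<in>insert a A. y i)"
 proof (cases "card A = 0")
  case True
  hence "A = {}" using insert by simp
  thus ?thesis by (simp add: roots_poly_def)
 next
  case False
  hence "1 <= card A" by linarith
  hence "coeff (roots_poly y A) (card A - 1) = - (\<Sum>i\<in>A. y i)" by (rule mp[OF conjunct1[OF insert.IH]])
  thus ?thesis unfolding roots_poly_insert[OF insert(1,2)] coeff_linear_mult sum.insert[OF insert(1,2)]
   if_not_P[OF False] lead by (simp only:) simp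
 qed
 have 2: "2 * coeff (roots_poly y (insert a A)) (card A - 1) = (\<Sum>i\<in>insert a A. y i)\<^sup>2 - (\<Sum>i\<in>insert a A. (y i)\<^sup>2)"
  if "1 <= card A"
 proof -
  have A1: "coeff (roots_poly y A) (card A - 1) = - (\<Sum>i\<in>A. y i)" by (rule mp[OF conjunct1[OF insert.IH] that])
  show ?thesis
  proof (cases "card A = 1")
   case True
   then obtain b where b: "A = {b}" by (auto simp: card_1_singleton_iff)
   thus ?thesis using insert(2) by (simp add: roots_poly_def power2_eq_square algebra_simps)
  next
   case False
   hence "2 <= card A" using that by linarith
   hence A2: "2 * coeff (roots_poly y A) (card A - 2) = (\<Sum>i\<in>A. y i)\<^sup>2 - (\<Sum>i\<in>A. (y i)\<^sup>2)"
    by (rule mp[OF conjunct2[OF insert.IH]])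
   have e: "card A - 1 - 1 = card A - 2" "card A - 1 ~= 0" using False that by auto
   have "2 * coeff (roots_poly y (insert a A)) (card A - 1)
     = 2 * coeff (roots_poly y A) (card A - 2) - 2 * y a * coeff (roots_poly y A) (card A - 1)"
    unfolding roots_poly_insert[OF insert(1,2)] coeff_linear_mult e(1) using e(2) by (simp add: algebra_simps)
   thus ?thesis unfolding A1 A2 using insert by (simp add: power2_eq_square algebra_simps)
  qed
 qed
 have "card (insert a A) - 1 = card A" "card (insert a A) - 2 = card A - 1" "2 <= card (insert a A) ==> 1 <= card A"
  unfolding c by simp_all
 thus ?case using 1 2 by (simp only:) blast
qed

lemma tendsto_coeff_roots_poly:
 assumes "finite A" "!!i. i \<in> A ==> (%m. y m i) \<longlonglongrightarrow> \<eta> i"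
 shows "(%m. coeff (roots_poly (y m) A) k) \<longlonglongrightarrow> coeff (roots_poly \<eta> A) k"
 using assms
proof (induction A arbitrary: k rule: finite_induct)
 case empty
 thus ?case by (simp add: roots_poly_def)
next
 case (insert a A)
 have IH: "(%m. coeff (roots_poly (y m) A) k) \<longlonglongrightarrow> coeff (roots_poly \<eta> A) k" for k
  by (rule insert.IH) (use insert.prems in auto)
 have a: "(%m. y m a) \<longlonglongrightarrow> \<eta> a" by (rule insert.prems) simp
 show ?case unfolding roots_poly_insert[OF insert(1,2)] coeff_linear_mult
  by (intro tendsto_intros a IH) (cases "k = 0", simp_all add: IH)
qed

lemma monic_roots_exist:
 assumes "degree (p :: complex poly) = n" "coeff p n = 1"
 shows "\<exists>y. p = roots_poly y {..<n}"
proof -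
 have p0: "p ~= 0" using assms by auto
 obtain M where M: "size M = degree p" "p = smult (lead_coeff p) (\<Prod>x\<in>#M. [:- x, 1:])"
  using alg_closed_imp_factorization[OF p0] by blast
 obtain xs where xs: "M = mset xs" by (metis ex_mset)
 have len: "length xs = n" using M(1) assms(1) xs by simp
 have "p = (\<Prod>x\<in>#M. [:- x, 1:])" using M(2) assms by simp
 also have "... = prod_list (map (%x. [:- x, 1:]) xs)" unfolding xs by (simp add: prod_mset_prod_list[symmetric])
 also have "... = (\<Prod>i<n. [:- xs ! i, 1:])" by (simp add: prod.list_conv_set_nth len atLeast0LessThan)
 finally show ?thesis unfolding roots_poly_def by blast
qed

text \<open>
This is \<open>\<tau>^(-n) (w^n + \<tau>^n r(w))\<close> for \<open>w = \<tau> x\<close>: if \<open>r(0) \<noteq> 0\<close>, its roots stay bounded and separated as \<open>\<tau>\<close> tends to 0.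
\<close>

definition scaled :: "nat => complex poly => complex => complex poly" where
 "scaled n r \<tau> = monom 1 n + (\<Sum>k<n. monom (coeff r k * \<tau> ^ k) k)"

lemma coeff_scaled: "coeff (scaled n r \<tau>) k = (if k = n then 1 else if k < n then coeff r k * \<tau> ^ k else 0)"
 by (simp add: scaled_def coeff_sum)

lemma poly_scaled: "poly (scaled n r \<tau>) x = x ^ n + (\<Sum>k<n. coeff r k * \<tau> ^ k * x ^ k)"
 by (simp add: scaled_def poly_monom poly_sum)

lemma scaled_monic: "degree (scaled n r \<tau>) = n" "coeff (scaled n r \<tau>) n = 1"
proof -
 show "coeff (scaled n r \<tau>) n = 1" by (simp add: coeff_scaled)
 show "degree (scaled n r \<tau>) = n"
 proof (rule antisym)
  show "degree (scaled n r \<tau>) <= n" by (rule degree_le) (simp add: coeff_scaled)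
  show "n <= degree (scaled n r \<tau>)" by (rule le_degree) (simp add: coeff_scaled)
 qed
qed

lemma scaled_root_bound:
 assumes z: "poly (scaled n r \<tau>) x = 0" and t: "cmod \<tau> <= 1" and n: "n \<ge> 1"
 shows "cmod x <= 1 + (\<Sum>k<n. cmod (coeff r k))"
proof (cases "cmod x <= 1")
 case True
 moreover have "0 <= (\<Sum>k<n. cmod (coeff r k))" by (intro sum_nonneg) simp
 ultimately show ?thesis by linarith
next
 case False
 hence x: "1 < cmod x" by simp
 have "x ^ n = - (\<Sum>k<n. coeff r k * \<tau> ^ k * x ^ k)" using z unfolding poly_scaled by (simp add: eq_neg_iff_add_eq_0)
 hence "cmod x ^ n = cmod (\<Sum>k<n. coeff r k * \<tau> ^ k * x ^ k)" by (metis norm_minus_cancel norm_power)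
 also have "... <= (\<Sum>k<n. cmod (coeff r k) * cmod x ^ (n - 1))"
 proof (rule sum_norm_le)
  fix k assume k: "k \<in> {..<n}"
  have "cmod \<tau> ^ k <= 1" using t by (simp add: power_le_one)
  moreover have "cmod x ^ k <= cmod x ^ (n - 1)" using x k by (intro power_increasing) auto
  ultimately have "cmod \<tau> ^ k * cmod x ^ k <= 1 * cmod x ^ (n - 1)" by (intro mult_mono) auto
  thus "cmod (coeff r k * \<tau> ^ k * x ^ k) <= cmod (coeff r k) * cmod x ^ (n - 1)"
   by (simp add: norm_mult norm_power mult.assoc mult_left_mono)
 qed
 also have "... = (\<Sum>k<n. cmod (coeff r k)) * cmod x ^ (n - 1)" by (simp add: sum_distrib_right)
 finally have "cmod x * cmod x ^ (n - 1) <= (\<Sum>k<n. cmod (coeff r k)) * cmod x ^ (n - 1)"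
  using n by (simp add: power_eq_if)
 moreover have "0 < cmod x ^ (n - 1)" by (rule zero_less_power) (use x in linarith)
 ultimately have "cmod x <= (\<Sum>k<n. cmod (coeff r k))" by (rule mult_right_le_imp_le)
 thus ?thesis by simp
qed

text \<open>
The limit polynomial \<open>x^n + r(0)\<close> has distinct roots. A convergent subsequence of bounded root vectors suffices and avoids the continuity of roots.
\<close>

lemma perturbed_roots:
 fixes r :: "complex poly"
 assumes n: "n \<ge> 1" and r0: "coeff r 0 ~= 0"
 shows "\<exists>\<tau> y \<eta>. \<tau> \<longlonglongrightarrow> 0 & (\<forall>m. \<tau> m ~= (0::complex)) & (\<forall>m. scaled n r (\<tau> m) = roots_poly (y m) {..<n}) &
  (\<forall>i<n. (%m::nat. y m i) \<longlonglongrightarrow> \<eta> i) & inj_on \<eta> {..<n}"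
proof -
 define \<sigma> where "\<sigma> m = complex_of_real (inverse (real (Suc m)))" for m
 have s0: "\<sigma> \<longlonglongrightarrow> 0" unfolding \<sigma>_def using tendsto_of_real[OF LIMSEQ_inverse_real_of_nat] by (simp del: of_real_inverse)
 have sn: "\<sigma> m ~= 0" for m by (simp add: \<sigma>_def del: of_nat_Suc)
 have s1: "cmod (\<sigma> m) <= 1" for m unfolding \<sigma>_def norm_of_real by (simp add: field_simps)
 define Y where "Y m = (SOME y. scaled n r (\<sigma> m) = roots_poly y {..<n})" for m
 have Y: "scaled n r (\<sigma> m) = roots_poly (Y m) {..<n}" for m
  unfolding Y_def using someI_ex[OF monic_roots_exist[OF scaled_monic[of n r "\<sigma> m"]]] .
 have Yr: "poly (scaled n r (\<sigma> m)) (Y m i) = 0" if "i < n" for m i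
  unfolding Y poly_roots_poly[OF finite_lessThan] using that by (auto simp: prod_zero_iff)
 have "\<forall>i\<in>{..<n}. \<exists>B. \<forall>m. cmod (Y m i) <= B"
  using scaled_root_bound[OF Yr s1 n] by blast
 then obtain q \<eta> where q: "strict_mono (q :: nat => nat)" "\<forall>i\<in>{..<n}. (%m. Y (q m) i) \<longlonglongrightarrow> \<eta> i"
  using bounded_family_convergent_subsequence[OF finite_lessThan, of n Y] by blast
 have t0: "(%m. \<sigma> (q m)) \<longlonglongrightarrow> 0" using LIMSEQ_subseq_LIMSEQ[OF s0 q(1)] by (simp add: o_def)
 have lim: "x ^ n + coeff r 0 = (\<Prod>i<n. x - \<eta> i)" for x
 proof (rule LIMSEQ_unique)
  have "(%m. \<Prod>i<n. x - Y (q m) i) \<longlonglongrightarrow> (\<Prod>i<n. x - \<eta> i)" using q(2) by (intro tendsto_intros) auto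
  thus "(%m. poly (scaled n r (\<sigma> (q m))) x) \<longlonglongrightarrow> (\<Prod>i<n. x - \<eta> i)"
   unfolding Y poly_roots_poly[OF finite_lessThan] .
  have "(%m. x ^ n + (\<Sum>k<n. coeff r k * \<sigma> (q m) ^ k * x ^ k)) \<longlonglongrightarrow> x ^ n + (\<Sum>k<n. coeff r k * 0 ^ k * x ^ k)"
   by (intro tendsto_intros t0)
  also have "(\<Sum>k<n. coeff r k * 0 ^ k * x ^ k) = (\<Sum>k\<in>{0}. coeff r k * 0 ^ k * x ^ k)"
   using n by (intro sum.mono_neutral_right) auto
  finally show "(%m. poly (scaled n r (\<sigma> (q m))) x) \<longlonglongrightarrow> x ^ n + coeff r 0" unfolding poly_scaled by simp
 qed
 (* A double root would be a common zero of x^n + r(0) and its derivative, hence 0. *)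
 have inj: "inj_on \<eta> {..<n}"
 proof (rule inj_onI, rule ccontr)
  fix i j assume ij: "i \<in> {..<n}" "j \<in> {..<n}" "\<eta> i = \<eta> j" "i ~= j"
  define C where "C x = (\<Prod>k\<in>{..<n} - {i} - {j}. x - \<eta> k)" for x
  have e: "x ^ n + coeff r 0 = (x - \<eta> i) * (x - \<eta> i) * C x" for x
  proof -
   have "(\<Prod>k<n. x - \<eta> k) = (x - \<eta> i) * (\<Prod>k\<in>{..<n} - {i}. x - \<eta> k)" using ij by (intro prod.remove) auto
   also have "(\<Prod>k\<in>{..<n} - {i}. x - \<eta> k) = (x - \<eta> j) * C x" unfolding C_def using ij by (intro prod.remove) auto
   finally show ?thesis unfolding lim using ij by (simp add: mult.assoc)
  qed
  have d1: "((%x. x ^ n + coeff r 0) has_field_derivative of_nat n * \<eta> i ^ (n - 1)) (at (\<eta> i))"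
   by (auto intro!: derivative_eq_intros)
  have "\<exists>C'. (C has_field_derivative C') (at (\<eta> i))"
  proof -
   define p where "p = (\<Prod>k\<in>{..<n} - {i} - {j}. [:- \<eta> k, 1:])"
   have "C = poly p" by (rule ext) (simp add: C_def p_def poly_prod algebra_simps)
   thus ?thesis using poly_DERIV by blast
  qed
  then obtain C' where C': "(C has_field_derivative C') (at (\<eta> i))" by blast
  have "((%x. (x - \<eta> i) * (x - \<eta> i) * C x) has_field_derivative 0) (at (\<eta> i))"
   by (auto intro!: derivative_eq_intros C')
  with d1 have "of_nat n * \<eta> i ^ (n - 1) = (0::complex)" unfolding e by (rule DERIV_unique)
  hence z: "\<eta> i ^ (n - 1) = 0" using n by simp
  hence "\<eta> i ^ n = 0" using n by (cases n) auto
  moreover have "\<eta> i ^ n + coeff r 0 = 0" unfolding e by simp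
  ultimately have "coeff r 0 = 0" by (simp only: add_0)
  thus False using r0 by simp
 qed
 show ?thesis
  by (rule exI[of _ "%m. \<sigma> (q m)"], rule exI[of _ "%m. Y (q m)"], rule exI[of _ \<eta>])
   (use t0 sn Y q(2) inj in auto)
qed

section \<open>Deforming a flag with one break\<close>

text \<open>
The condition on the last two columns is void.
\<close>

lemma PM_of_columns:
 assumes K: "K \<in> GL n"
  and col: "!!j. Suc j < n - 1 ==> \<exists>c. \<forall>a<n. (if Suc a < n then K $$ (Suc a, j) else 0) = (\<Sum>l\<le>Suc j. K $$ (a, l) * c l)"
 shows "PM n K"
 unfolding PM_iff_conj[OF K] hess_def
proof (intro allI impI)
 note Kc = GL_carrier[OF K]
 have m: "minv K \<in> carrier_mat n n" by (rule minv_carrier[OF Kc])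
 fix i j assume ij: "i < n" "Suc j < i"
 have jn: "j < n" "Suc j < n" "Suc j < n - 1" using ij by auto
 obtain c where c: "\<forall>a<n. (if Suc a < n then K $$ (Suc a, j) else 0) = (\<Sum>l\<le>Suc j. K $$ (a, l) * c l)"
  using col[OF jn(3)] by blast
 have "(minv K * (NN n * K)) $$ (i, j) = (\<Sum>a<n. minv K $$ (i, a) * (NN n * K) $$ (a, j))"
  by (rule mat_mult_index[OF m mult_carrier_square[OF NN_carrier Kc] ij(1) jn(1)])
 also have "... = (\<Sum>a<n. \<Sum>l\<le>Suc j. c l * (minv K $$ (i, a) * K $$ (a, l)))"
 proof (intro sum.cong refl)
  fix a assume "a \<in> {..<n}"
  hence a: "a < n" by simp
  show "minv K $$ (i, a) * (NN n * K) $$ (a, j) = (\<Sum>l\<le>Suc j. c l * (minv K $$ (i, a) * K $$ (a, l)))"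
   unfolding NN_mult_index[OF Kc a jn(1)] c[rule_format, OF a] sum_distrib_left by (intro sum.cong refl) (simp add: mult_ac)
 qed
 also have "... = (\<Sum>l\<le>Suc j. \<Sum>a<n. c l * (minv K $$ (i, a) * K $$ (a, l)))" by (rule sum.swap)
 also have "... = (\<Sum>l\<le>Suc j. c l * (minv K * K) $$ (i, l))"
 proof (intro sum.cong refl)
  fix l assume "l \<in> {..Suc j}"
  hence l: "l < n" using jn by simp
  show "(\<Sum>a<n. c l * (minv K $$ (i, a) * K $$ (a, l))) = c l * (minv K * K) $$ (i, l)"
   unfolding mat_mult_index[OF m Kc ij(1) l] sum_distrib_left ..
 qed
 also have "... = 0" unfolding minv_mult[OF Kc GL_det[OF K]] using ij jn by (intro sum.neutral) auto
 finally show "(minv K * (NN n * K)) $$ (i, j) = 0" .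
qed

definition pin :: "nat => nat => nat \<times> nat => bool" where
 "pin n s i \<longleftrightarrow> fst i < n & snd i < s & fst i + snd i < n"

definition rin :: "nat => nat => nat \<times> nat => bool" where
 "rin n s i \<longleftrightarrow> fst i < n & s <= snd i & snd i < n & fst i + (snd i - s) < n"

definition dirP :: "nat => nat => complex poly => nat \<times> nat => complex" where
 "dirP n s \<delta> i = (if pin n s i then coeff \<delta> (n - 1 - fst i - snd i) else 0)"

definition dirR :: "nat => nat => complex poly => nat \<times> nat => complex" where
 "dirR n s \<delta> i = (if rin n s i then coeff \<delta> (n - 1 - fst i - (snd i - s)) else 0)"

text \<open>
Row \<open>a\<close> carries the coefficient of \<open>z^(n-1-a)\<close>, so that \<open>N\<close> is multiplication by \<open>z\<close> modulo \<open>z^n\<close>. The columns are \<open>z^b p\<close> for \<open>b < s\<close> and \<open>z^(b-s) r\<close> for \<open>b \<ge> s\<close>; \<open>dirP\<close> and \<open>dirR\<close> are the two parts, linear in \<open>p\<close> and \<open>r\<close>.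
\<close>

definition Gd :: "nat => nat => complex poly => complex poly => complex mat" where
 "Gd n s p r = mat n n (%i. dirP n s p i + dirR n s r i)"

lemma Gd_carrier[simp]: "Gd n s p r \<in> carrier_mat n n" by (simp add: Gd_def)

lemma Gd_index:
 assumes "a < n" "b < n"
 shows "Gd n s p r $$ (a, b) =
  (if b < s then (if a + b < n then coeff p (n - 1 - a - b) else 0)
   else (if a + (b - s) < n then coeff r (n - 1 - a - (b - s)) else 0))"
proof -
 have e: "Gd n s p r $$ (a, b) = dirP n s p (a, b) + dirR n s r (a, b)" unfolding Gd_def using assms by simp
 show ?thesis
 proof (cases "b < s")
  case True
  hence r: "~ rin n s (a, b)" unfolding rin_def by simp
  show ?thesis unfolding e dirP_def dirR_def if_not_P[OF r] if_P[OF True] pin_def fst_conv snd_conv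
   using True assms by simp
 next
  case False
  hence r: "~ pin n s (a, b)" unfolding pin_def by simp
  show ?thesis unfolding e dirP_def dirR_def if_not_P[OF r] if_not_P[OF False] rin_def fst_conv snd_conv
   using False assms by simp
 qed
qed

lemma dirP_outside:
 assumes "s <= n" "~ (a < n & b < n)"
 shows "dirP n s \<delta> (a, b) = 0"
proof -
 have "~ pin n s (a, b)" unfolding pin_def fst_conv snd_conv using assms by linarith
 thus ?thesis by (simp add: dirP_def)
qed

lemma dirR_outside:
 assumes "~ (a < n & b < n)"
 shows "dirR n s \<delta> (a, b) = 0"
proof -
 have "~ rin n s (a, b)" unfolding rin_def fst_conv snd_conv using assms by linarith
 thus ?thesis by (simp add: dirR_def)
qed

lemma fn_Gd:
 assumes "s <= n"
 shows "fn n (Gd n s p r) = (%i. dirP n s p i + dirR n s r i)"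
proof
 fix i :: "nat \<times> nat"
 obtain a b where i: "i = (a, b)" by (cases i)
 show "fn n (Gd n s p r) i = dirP n s p i + dirR n s r i"
 proof (cases "a < n & b < n")
  case True
  thus ?thesis unfolding i fn_def Gd_def by simp
 next
  case False
  show ?thesis unfolding i dirP_outside[OF assms False] dirR_outside[OF False] fn_def prod.case if_not_P[OF False] by simp
 qed
qed

lemma dir_affine:
 assumes "s <= n"
 shows "dirP n s \<delta> \<in> affine_space (hatE n)" "dirR n s \<delta> \<in> affine_space (hatE n)"
proof -
 have "dirP n s \<delta> i = 0 & dirR n s \<delta> i = 0" if i: "i \<notin> hatE n" for i
 proof -
  obtain a b where ab: "i = (a, b)" by (cases i)
  have "~ (a < n & b < n)" using i by (simp add: ab hatE_def)
  thus ?thesis unfolding ab using dirP_outside[OF assms] dirR_outside by blast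
 qed
 thus "dirP n s \<delta> \<in> affine_space (hatE n)" "dirR n s \<delta> \<in> affine_space (hatE n)"
  unfolding affine_space_def by blast+
qed

lemma dir_linear:
 "dirP n s (p + smult c q) i = dirP n s p i + c * dirP n s q i"
 "dirR n s (p + smult c q) i = dirR n s p i + c * dirR n s q i"
 by (simp_all add: dirP_def dirR_def)

lemma dir_sum:
 "dirP n s (\<Sum>k\<in>A. smult (y k) (q k)) i = (\<Sum>k\<in>A. y k * dirP n s (q k) i)"
 "dirR n s (\<Sum>k\<in>A. smult (y k) (q k)) i = (\<Sum>k\<in>A. y k * dirR n s (q k) i)"
 by (simp_all add: dirP_def dirR_def coeff_sum)

lemma coeff_mult_le:
 fixes p q :: "complex poly"
 assumes "degree p <= s"
 shows "coeff (p * q) i = (\<Sum>l\<le>s. coeff p l * (if l <= i then coeff q (i - l) else 0))"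
 unfolding coeff_mult
proof (rule sum.mono_neutral_cong)
 show "coeff p l * coeff q (i - l) = 0" if "l \<in> {..i} - {..s}" for l
  using that assms by (simp add: coeff_eq_0)
qed auto

text \<open>
The hypothesis reads \<open>p\<^sub>1 p = \<epsilon> r\<close> modulo \<open>z^n\<close>. As \<open>p\<^sub>1\<close> is monic of degree \<open>s\<close>, it expresses \<open>z^s p\<close>, the image of column \<open>s - 1\<close>, by columns \<open>0, ..., s\<close>.
\<close>

lemma Gd_PM:
 assumes s: "1 <= s" "s < n" and p1: "degree p1 <= s" "coeff p1 s = 1"
  and eq: "!!i. i < n ==> coeff (p1 * p) i = \<epsilon> * coeff r i" and d: "det (Gd n s p r) ~= 0"
 shows "PM n (Gd n s p r)"
proof (rule PM_of_columns)
 show "Gd n s p r \<in> GL n" using d by (simp add: GL_iff)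
 fix j assume "Suc j < n - 1"
 hence j: "Suc j < n" by simp
 show "\<exists>c. \<forall>a<n. (if Suc a < n then Gd n s p r $$ (Suc a, j) else 0) = (\<Sum>l\<le>Suc j. Gd n s p r $$ (a, l) * c l)"
 proof (cases "Suc j = s")
  case False
  show ?thesis
  proof (intro exI[of _ "%l. if l = Suc j then 1 else 0"] allI impI)
   fix a assume a: "a < n"
   have "(\<Sum>l\<le>Suc j. Gd n s p r $$ (a, l) * (if l = Suc j then 1 else 0)) = Gd n s p r $$ (a, Suc j)"
    by (simp add: if_distrib cong: if_cong)
   also have "... = (if Suc a < n then Gd n s p r $$ (Suc a, j) else 0)"
    using a j False by (auto simp: Gd_index Suc_diff_le)
   finally show "(if Suc a < n then Gd n s p r $$ (Suc a, j) else 0) = (\<Sum>l\<le>Suc j. Gd n s p r $$ (a, l) * (if l = Suc j then 1 else 0))" ..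
  qed
 next
  case js: True
  define c where "c l = (if l < s then - coeff p1 l else if l = s then \<epsilon> else 0)" for l
  show ?thesis
  proof (intro exI[of _ c] allI impI)
   fix a assume a: "a < n"
   define i where "i = n - 1 - a"
   have i: "i < n" using a by (simp add: i_def)
   have K: "Gd n s p r $$ (a, l) = (if l <= i then coeff p (i - l) else 0)" if "l < s" for l
    using that a s by (auto simp: Gd_index i_def)
   have Ks: "Gd n s p r $$ (a, s) = coeff r i" using a s by (simp add: Gd_index i_def)
   have left: "(if Suc a < n then Gd n s p r $$ (Suc a, j) else 0) = (if s <= i then coeff p (i - s) else 0)"
    using a s js by (auto simp: Gd_index i_def)
   have "\<epsilon> * coeff r i = (\<Sum>l<s. coeff p1 l * (if l <= i then coeff p (i - l) else 0)) + (if s <= i then coeff p (i - s) else 0)"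
    unfolding eq[OF i, symmetric] coeff_mult_le[OF p1(1)] using p1(2) by (simp add: lessThan_Suc_atMost[symmetric])
   hence "(if s <= i then coeff p (i - s) else 0) = \<epsilon> * coeff r i - (\<Sum>l<s. coeff p1 l * (if l <= i then coeff p (i - l) else 0))"
    by simp
   also have "... = (\<Sum>l<s. Gd n s p r $$ (a, l) * c l) + Gd n s p r $$ (a, s) * c s"
   proof -
    have "(\<Sum>l<s. Gd n s p r $$ (a, l) * c l) = (\<Sum>l<s. - (coeff p1 l * (if l <= i then coeff p (i - l) else 0)))"
     by (intro sum.cong refl) (simp add: K c_def)
    thus ?thesis by (simp add: Ks c_def sum_negf)
   qed
   also have "... = (\<Sum>l\<le>Suc j. Gd n s p r $$ (a, l) * c l)" unfolding js by (simp add: lessThan_Suc_atMost[symmetric])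
   finally show "(if Suc a < n then Gd n s p r $$ (Suc a, j) else 0) = (\<Sum>l\<le>Suc j. Gd n s p r $$ (a, l) * c l)"
    unfolding left .
  qed
 qed
qed

lemma Gd_base_index:
 assumes "s <= n" "a < n" "b < s"
 shows "Gd n s (monom 1 (n - s)) r $$ (a, b) = (if Suc (a + b) = s then 1 else 0)"
 using assms by (auto simp: Gd_index coeff_monom)

lemma Gd_base_GL:
 assumes s: "s <= n" and r: "coeff r 0 ~= 0"
 shows "Gd n s (monom 1 (n - s)) r \<in> GL n"
proof (rule trivial_kernel_GL[OF Gd_carrier])
 let ?h = "Gd n s (monom 1 (n - s)) r"
 fix y assume y: "!!a. a < n ==> (\<Sum>b<n. ?h $$ (a, b) * y b) = 0"
 have up: "y (s + d) = 0" if "d < n - s" for d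
  using that
 proof (induction d rule: less_induct)
  case (less d)
  define a where "a = n - 1 - d"
  have a: "a < n" "s <= a" using less.prems by (auto simp: a_def)
  have "(\<Sum>b<n. ?h $$ (a, b) * y b) = (\<Sum>b\<in>{s + d}. ?h $$ (a, b) * y b)"
  proof (rule sum.mono_neutral_right)
   show "\<forall>b\<in>{..<n} - {s + d}. ?h $$ (a, b) * y b = 0"
   proof
    fix b assume b: "b \<in> {..<n} - {s + d}"
    consider "b < s" | "s <= b" "b < s + d" | "s + d < b" using b by fastforce
    thus "?h $$ (a, b) * y b = 0"
    proof cases
     case 1
     thus ?thesis using Gd_base_index[OF s a(1) 1, of r] a by simp
    next
     case 2
     thus ?thesis using less.IH[of "b - s"] less.prems by simp
    next
     case 3
     hence "~ a + (b - s) < n" "~ b < s" "b < n" using b less.prems by (auto simp: a_def)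
     thus ?thesis using a by (simp add: Gd_index)
    qed
   qed
  qed (use less.prems in auto)
  also have "?h $$ (a, s + d) = coeff r 0" using a less.prems by (simp add: Gd_index a_def)
  hence "(\<Sum>b\<in>{s + d}. ?h $$ (a, b) * y b) = coeff r 0 * y (s + d)" by simp
  finally show ?case using y[OF a(1)] r by simp
 qed
 have low: "y b = 0" if b: "b < s" for b
 proof -
  define a where "a = s - 1 - b"
  have a: "a < n" "Suc (a + b) = s" using b s by (auto simp: a_def)
  have "(\<Sum>k<n. ?h $$ (a, k) * y k) = (\<Sum>k\<in>{b}. ?h $$ (a, k) * y k)"
  proof (rule sum.mono_neutral_right)
   show "\<forall>k\<in>{..<n} - {b}. ?h $$ (a, k) * y k = 0"
   proof
    fix k assume k: "k \<in> {..<n} - {b}"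
    show "?h $$ (a, k) * y k = 0"
    proof (cases "k < s")
     case True
     thus ?thesis using Gd_base_index[OF s a(1) True, of r] a k by auto
    next
     case False
     hence "s + (k - s) = k" "k - s < n - s" using k by auto
     thus ?thesis using up[of "k - s"] by simp
    qed
   qed
  qed (use b s in auto)
  thus ?thesis using y[OF a(1)] Gd_base_index[OF s a(1) b, of r] a by simp
 qed
 show "\<forall>b<n. y b = 0"
 proof (intro allI impI)
  fix b assume "b < n"
  thus "y b = 0" using low[of b] up[of "b - s"] by (cases "b < s") auto
 qed
qed

text \<open>
\<open>\<tau>^m E(z / \<tau>)\<close> for \<open>E\<close> of degree at most \<open>m\<close>: the roots are multiplied by \<open>\<tau>\<close>.
\<close>

definition rescale :: "nat => complex => complex poly => complex poly" where
 "rescale m \<tau> E = (\<Sum>k\<le>m. monom (\<tau> ^ (m - k) * coeff E k) k)"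

lemma coeff_rescale: "coeff (rescale m \<tau> E) k = (if k <= m then \<tau> ^ (m - k) * coeff E k else 0)"
 by (simp add: rescale_def coeff_sum)

lemma rescale_degree: "degree (rescale m \<tau> E) <= m"
 by (rule degree_le) (simp add: coeff_rescale)

lemma coeff_mult_rescale:
 assumes E1: "degree E1 <= s" and E: "degree E <= m" and i: "i <= s + m"
 shows "coeff (rescale s \<tau> E1 * rescale m \<tau> E) i = \<tau> ^ (s + m - i) * coeff (E1 * E) i"
 unfolding coeff_mult sum_distrib_left
proof (intro sum.cong refl)
 fix l assume l: "l \<in> {..i}"
 show "coeff (rescale s \<tau> E1) l * coeff (rescale m \<tau> E) (i - l) = \<tau> ^ (s + m - i) * (coeff E1 l * coeff E (i - l))"
 proof (cases "l <= s & i - l <= m")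
  case True
  hence e: "s + m - i = (s - l) + (m - (i - l))" using l by auto
  have "coeff (rescale s \<tau> E1) l = \<tau> ^ (s - l) * coeff E1 l"
   "coeff (rescale m \<tau> E) (i - l) = \<tau> ^ (m - (i - l)) * coeff E (i - l)"
   using True by (simp_all add: coeff_rescale)
  thus ?thesis unfolding e power_add by (simp only: mult_ac)
 next
  case False
  hence c: "degree E1 < l \<or> degree E < i - l" using E1 E by linarith
  show ?thesis
  proof (cases "degree E1 < l")
   case True
   hence "coeff E1 l = 0" by (rule coeff_eq_0)
   thus ?thesis unfolding coeff_rescale by simp
  next
   case F: False
   hence "degree E < i - l" using c by blast
   hence "coeff E (i - l) = 0" by (rule coeff_eq_0)
   thus ?thesis unfolding coeff_rescale by simp
  qed
 qed
qed

text \<open>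
Rescaling the factorisation of \<open>x^n + ...\<close> into the roots in \<open>A\<close> and the others gives \<open>p\<^sub>1 p = z^n + \<tau>^n r\<close>.
\<close>

lemma deformed_PM:
 assumes s: "1 <= s" "s < n" and A: "A \<subseteq> {..<n}" "card A = n - s"
  and y: "scaled n r \<tau> = roots_poly y {..<n}"
  and d: "det (Gd n s (rescale (n - s) \<tau> (roots_poly y A)) r) ~= 0"
 shows "PM n (Gd n s (rescale (n - s) \<tau> (roots_poly y A)) r)"
proof (rule Gd_PM[OF s])
 let ?E = "roots_poly y A" and ?E1 = "roots_poly y ({..<n} - A)"
 have fA: "finite A" using A(1) finite_subset by blast
 have cA: "card ({..<n} - A) = s" using A s by (simp add: card_Diff_subset fA)
 have E1: "degree ?E1 = s" "coeff ?E1 s = 1" using roots_poly_monic[of "{..<n} - A" y] cA by auto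
 have E: "degree ?E = n - s" using roots_poly_monic[OF fA, of y] A by auto
 show "degree (rescale s \<tau> ?E1) <= s" by (rule rescale_degree)
 show "coeff (rescale s \<tau> ?E1) s = 1" by (simp add: coeff_rescale E1)
 have prod: "?E1 * ?E = scaled n r \<tau>"
  unfolding y roots_poly_def using prod.subset_diff[OF A(1), of "%i. [:- y i, 1:]"] by simp
 fix i assume i: "i < n"
 have "coeff (rescale s \<tau> ?E1 * rescale (n - s) \<tau> ?E) i = \<tau> ^ (s + (n - s) - i) * coeff (?E1 * ?E) i"
  by (rule coeff_mult_rescale) (use E1 E s i in auto)
 also have "... = \<tau> ^ (n - i) * (coeff r i * \<tau> ^ i)" unfolding prod using i s by (simp add: coeff_scaled)
 also have "... = \<tau> ^ n * coeff r i"
 proof -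
  have "\<tau> ^ (n - i) * \<tau> ^ i = \<tau> ^ n" unfolding power_add[symmetric] using i by simp
  thus ?thesis by (simp add: mult_ac)
 qed
 finally show "coeff (rescale s \<tau> ?E1 * rescale (n - s) \<tau> ?E) i = \<tau> ^ n * coeff r i" .
qed (rule d)

lemma det_eventually_nonzero:
 fixes X :: "nat => nat \<times> nat => complex"
 assumes g: "det (mat n n x) ~= 0" and lim: "!!i. i \<in> hatE n ==> (%m::nat. X m i) \<longlonglongrightarrow> x i"
 shows "\<forall>\<^sub>F m in sequentially. det (mat n n (X m)) ~= 0"
proof -
 have "(%m. det (mat n n (X m))) \<longlonglongrightarrow> det (mat n n x)"
  by (rule tendsto_poly_funs[where f = "%x. det (mat n n x)" and I = "hatE n", OF polymat_det[OF polymat_id]]) (rule lim)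
 thus ?thesis using g by (rule tendsto_imp_eventually_ne)
qed

section \<open>First and second order terms\<close>

text \<open>
What \<open>f = 0\<close> along \<open>p + \<tau> u A + \<tau>\<^sup>2 Y\<close> yields in the first two orders. The number \<open>K\<close>, half the Hessian in direction \<open>A\<close>, is the same for all such families; this is why it can be eliminated.
\<close>

definition second_order_at :: "'i set => (('i => complex) => complex) => ('i => complex) => ('i => complex) => complex => bool" where
 "second_order_at I f p A K \<longleftrightarrow> (\<forall>\<tau> u Y u0 Y0. \<tau> \<longlonglongrightarrow> 0 --> (\<forall>m::nat. \<tau> m ~= 0) --> u \<longlonglongrightarrow> u0 --> (\<forall>i\<in>I. (%m. Y m i) \<longlonglongrightarrow> Y0 i) -->
   (\<forall>\<^sub>F m in sequentially. f (%i. p i + \<tau> m * (u m * A i + \<tau> m * Y m i)) = 0) -->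
   u0 * (\<Sum>i\<in>I. grad I f i p * A i) = 0 &
   ((\<Sum>i\<in>I. grad I f i p * A i) = 0 --> (\<Sum>i\<in>I. grad I f i p * Y0 i) + u0\<^sup>2 * K = 0))"

lemma second_order_atD:
 assumes "second_order_at I f p A K" "\<tau> \<longlonglongrightarrow> 0" "\<forall>m::nat. \<tau> m ~= 0" "u \<longlonglongrightarrow> u0" "\<forall>i\<in>I. (%m. Y m i) \<longlonglongrightarrow> Y0 i"
  "\<forall>\<^sub>F m in sequentially. f (%i. p i + \<tau> m * (u m * A i + \<tau> m * Y m i)) = 0"
 shows "u0 * (\<Sum>i\<in>I. grad I f i p * A i) = 0 &
   ((\<Sum>i\<in>I. grad I f i p * A i) = 0 --> (\<Sum>i\<in>I. grad I f i p * Y0 i) + u0\<^sup>2 * K = 0)"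
 using assms(1)[unfolded second_order_at_def, THEN spec[of _ \<tau>], THEN spec[of _ u], THEN spec[of _ Y], THEN spec[of _ u0],
   THEN spec[of _ Y0], THEN mp, THEN mp, THEN mp, THEN mp, THEN mp, OF assms(2-6)] .

lemma second_order:
 assumes I: "finite I" and f: "f \<in> poly_funs I" and fp: "f p = 0"
 shows "\<exists>K. second_order_at I f p A K"
proof -
 obtain h where h: "\<forall>i j. h i j \<in> poly_funs I"
  "\<forall>x. f (%i. p i + x i) = f p + (\<Sum>i\<in>I. grad I f i p * x i) + (\<Sum>i\<in>I. \<Sum>j\<in>I. x i * x j * h i j x)"
  using poly_funs_taylor[OF I f, of p] by (elim exE conjE) (rule that)
 define K where "K = (\<Sum>i\<in>I. \<Sum>j\<in>I. A i * A j * h i j (%_. 0))"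
 show ?thesis
  unfolding second_order_at_def
 proof (rule exI[of _ K], intro allI impI)
  fix \<tau> :: "nat => complex" and u Y u0 Y0
  assume t: "\<tau> \<longlonglongrightarrow> 0" "\<forall>m. \<tau> m ~= 0" and u: "u \<longlonglongrightarrow> u0" and Y: "\<forall>i\<in>I. (%m. Y m i) \<longlonglongrightarrow> Y0 i"
   and ev: "\<forall>\<^sub>F m in sequentially. f (%i. p i + \<tau> m * (u m * A i + \<tau> m * Y m i)) = 0"
  let ?GA = "\<Sum>i\<in>I. grad I f i p * A i"
  define X where "X m i = u m * A i + \<tau> m * Y m i" for m i
  define R where "R m = (\<Sum>i\<in>I. \<Sum>j\<in>I. X m i * X m j * h i j (%k. \<tau> m * X m k))" for m
  define GY where "GY m = (\<Sum>i\<in>I. grad I f i p * Y m i)" for m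
  have Xl: "(%m. X m i) \<longlonglongrightarrow> u0 * A i" if "i \<in> I" for i
  proof -
   have "(%m. u m * A i + \<tau> m * Y m i) \<longlonglongrightarrow> u0 * A i + 0 * Y0 i" using Y that by (intro tendsto_intros u t) auto
   thus ?thesis by (simp add: X_def)
  qed
  have tX: "(%m. \<tau> m * X m i) \<longlonglongrightarrow> 0" if "i \<in> I" for i
   using tendsto_mult[OF t(1) Xl[OF that]] by simp
  have hl: "(%m. h i j (%k. \<tau> m * X m k)) \<longlonglongrightarrow> h i j (%_. 0)" for i j
   by (rule tendsto_poly_funs[OF h(1)[rule_format]]) (rule tX)
  have Rl: "R \<longlonglongrightarrow> u0\<^sup>2 * K"
  proof -
   have 1: "R \<longlonglongrightarrow> (\<Sum>i\<in>I. \<Sum>j\<in>I. (u0 * A i) * (u0 * A j) * h i j (%_. 0))"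
    unfolding R_def by (intro tendsto_sum tendsto_mult Xl hl)
   have 2: "(\<Sum>i\<in>I. \<Sum>j\<in>I. (u0 * A i) * (u0 * A j) * h i j (%_. 0)) = u0\<^sup>2 * K" unfolding K_def sum_distrib_left by (intro sum.cong refl) (simp add: power2_eq_square mult_ac)
   show ?thesis using 1 unfolding 2 .
  qed
  have GYl: "GY \<longlonglongrightarrow> (\<Sum>i\<in>I. grad I f i p * Y0 i)"
   unfolding GY_def by (intro tendsto_sum tendsto_mult tendsto_const) (use Y in auto)
  have key: "u m * ?GA + \<tau> m * (GY m + R m) = 0" if z: "f (%i. p i + \<tau> m * X m i) = 0" for m
  proof -
   have a: "(\<Sum>i\<in>I. grad I f i p * (\<tau> m * X m i)) = \<tau> m * (u m * ?GA + \<tau> m * GY m)"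
    unfolding X_def GY_def sum_distrib_left sum.distrib[symmetric] by (intro sum.cong refl) (simp add: algebra_simps)
   have b: "(\<Sum>i\<in>I. \<Sum>j\<in>I. \<tau> m * X m i * (\<tau> m * X m j) * h i j (%k. \<tau> m * X m k)) = \<tau> m * (\<tau> m * R m)"
    unfolding R_def sum_distrib_left by (intro sum.cong refl) (simp only: mult_ac)
   have "0 = \<tau> m * (u m * ?GA + \<tau> m * GY m) + \<tau> m * (\<tau> m * R m)"
    using trans[OF z[symmetric] spec[OF h(2), of "%i. \<tau> m * X m i"]] unfolding fp a b add_0 .
   also have "... = \<tau> m * (u m * ?GA + \<tau> m * (GY m + R m))" by (simp add: algebra_simps)
   finally show ?thesis using t(2)[rule_format, of m] by simp
  qed
  have ev1: "\<forall>\<^sub>F m in sequentially. u m * ?GA + \<tau> m * (GY m + R m) = 0"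
   using ev unfolding X_def[symmetric] by (rule eventually_mono) (rule key)
  show "u0 * ?GA = 0 & (?GA = 0 --> (\<Sum>i\<in>I. grad I f i p * Y0 i) + u0\<^sup>2 * K = 0)"
  proof (intro conjI impI)
   have "(%m. u m * ?GA + \<tau> m * (GY m + R m)) \<longlonglongrightarrow> u0 * ?GA + 0 * ((\<Sum>i\<in>I. grad I f i p * Y0 i) + u0\<^sup>2 * K)"
    by (intro tendsto_intros u t Rl GYl)
   moreover have "(%m. u m * ?GA + \<tau> m * (GY m + R m)) \<longlonglongrightarrow> 0" by (rule tendsto_eventually[OF ev1])
   ultimately have "u0 * ?GA + 0 * ((\<Sum>i\<in>I. grad I f i p * Y0 i) + u0\<^sup>2 * K) = 0" by (rule LIMSEQ_unique)
   thus "u0 * ?GA = 0" unfolding mult_zero_left add_0_right .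
  next
   assume GA: "?GA = 0"
   have "\<forall>\<^sub>F m in sequentially. GY m + R m = 0"
    using ev1
   proof (rule eventually_mono)
    fix m assume "u m * ?GA + \<tau> m * (GY m + R m) = 0"
    thus "GY m + R m = 0" unfolding GA using t(2)[rule_format, of m] by simp
   qed
   hence "(%m. GY m + R m) \<longlonglongrightarrow> 0" by (rule tendsto_eventually)
   moreover have "(%m. GY m + R m) \<longlonglongrightarrow> (\<Sum>i\<in>I. grad I f i p * Y0 i) + u0\<^sup>2 * K" by (intro tendsto_intros Rl GYl)
   ultimately show "(\<Sum>i\<in>I. grad I f i p * Y0 i) + u0\<^sup>2 * K = 0" by (rule LIMSEQ_unique[rotated])
  qed
 qed
qed

text \<open>
Exchanging one root in \<open>A\<close> for another changes the sum, so \<open>G1 = 0\<close>. In the second relation the exchanges first force \<open>K = 0\<close> and, if \<open>G2 \<noteq> 0\<close>, then make all roots in \<open>A\<close> equal to their sum; \<open>m \<ge> 2\<close> gives two of them, \<open>n - m \<ge> 2\<close> two exchanges to compare.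
\<close>

lemma swap_argument:
 fixes y :: "nat => complex"
 assumes inj: "inj_on y {..<n}" and m: "2 <= m" "m + 2 <= n"
  and 1: "!!A. A \<subseteq> {..<n} ==> card A = m ==> (\<Sum>i\<in>A. y i) * G1 = 0"
  and 2: "!!A. G1 = 0 ==> A \<subseteq> {..<n} ==> card A = m ==> ((\<Sum>i\<in>A. y i)\<^sup>2 - (\<Sum>i\<in>A. (y i)\<^sup>2)) * G2 + 2 * (\<Sum>i\<in>A. y i)\<^sup>2 * K = 0"
 shows "G1 = 0 & G2 = 0"
proof -
 define c where "c = (\<Sum>i<m. y i)"
 define P where "P = (\<Sum>i<m. (y i)\<^sup>2)"
 have ne: "y i ~= y j" if "i < n" "j < n" "i ~= j" for i j using inj that by (auto dest: inj_onD)
 have sub: "{..<m} \<subseteq> {..<n}" "card {..<m} = m" using m by auto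
 have sw: "insert j ({..<m} - {i}) \<subseteq> {..<n}" "card (insert j ({..<m} - {i})) = m"
  "(\<Sum>k\<in>insert j ({..<m} - {i}). y k) = c + (y j - y i)"
  "(\<Sum>k\<in>insert j ({..<m} - {i}). (y k)\<^sup>2) = P + ((y j)\<^sup>2 - (y i)\<^sup>2)"
  if "i < m" "m <= j" "j < n" for i j
 proof -
  have j: "j \<notin> {..<m} - {i}" using that by auto
  show "insert j ({..<m} - {i}) \<subseteq> {..<n}" using that by auto
  show "card (insert j ({..<m} - {i})) = m" using that j by simp
  show "(\<Sum>k\<in>insert j ({..<m} - {i}). y k) = c + (y j - y i)"
   unfolding c_def using that j sum_diff1[of "{..<m}" y i] by simp
  show "(\<Sum>k\<in>insert j ({..<m} - {i}). (y k)\<^sup>2) = P + ((y j)\<^sup>2 - (y i)\<^sup>2)"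
   unfolding P_def using that j sum_diff1[of "{..<m}" "%k. (y k)\<^sup>2" i] by simp
 qed
 have G1: "G1 = 0"
 proof -
  have j: "0 < m" "m <= m" "m < n" using m by auto
  have a: "c * G1 = 0" using 1[OF sub] unfolding c_def .
  have b: "(c + (y m - y 0)) * G1 = 0" using 1[OF sw(1,2)[OF j]] unfolding sw(3)[OF j] .
  have "(y m - y 0) * G1 = (c + (y m - y 0)) * G1 - c * G1" by (simp add: algebra_simps)
  hence "(y m - y 0) * G1 = 0" unfolding a b by simp
  thus ?thesis using ne[of m 0] j by simp
 qed
 (* The second relation says L * (sum)^2 = G2 * (sum of squares) for each choice of roots. *)
 define L where "L = G2 + 2 * K"
 have lin: "L * x = G2 * p" if "(x - p) * G2 + 2 * x * K = 0" for x p
 proof -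
  have "L * x - G2 * p = (x - p) * G2 + 2 * x * K" by (simp add: L_def algebra_simps)
  thus ?thesis using that by simp
 qed
 have base: "L * c\<^sup>2 = G2 * P"
  using 2[OF G1 sub] unfolding c_def[symmetric] P_def[symmetric] by (rule lin)
 have step: "L * (2 * c + y j - y i) = G2 * (y i + y j)" if ij: "i < m" "m <= j" "j < n" for i j
 proof -
  have "L * (c + (y j - y i))\<^sup>2 = G2 * (P + ((y j)\<^sup>2 - (y i)\<^sup>2))"
   using 2[OF G1 sw(1,2)[OF ij]] unfolding sw(3,4)[OF ij] by (rule lin)
  moreover have "(y j - y i) * (L * (2 * c + y j - y i)) = L * (c + (y j - y i))\<^sup>2 - L * c\<^sup>2"
   by (simp add: algebra_simps power2_eq_square)
  moreover have "(y j - y i) * (G2 * (y i + y j)) = G2 * (P + ((y j)\<^sup>2 - (y i)\<^sup>2)) - G2 * P"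
   by (simp add: algebra_simps power2_eq_square)
  ultimately have "(y j - y i) * (L * (2 * c + y j - y i)) = (y j - y i) * (G2 * (y i + y j))"
   using base by simp
  thus ?thesis using ne[of j i] ij by simp
 qed
 have L: "L = G2"
 proof -
  have j: "0 < m" "m <= m" "m < n" "m <= Suc m" "Suc m < n" using m by auto
  have "(L - G2) * (y m - y (Suc m)) = (L * (2 * c + y m - y 0) - G2 * (y 0 + y m))
    - (L * (2 * c + y (Suc m) - y 0) - G2 * (y 0 + y (Suc m)))" by (simp add: algebra_simps)
  also have "... = 0" unfolding step[OF j(1-3)] step[OF j(1,4,5)] by simp
  finally have "(L - G2) * (y m - y (Suc m)) = 0" .
  thus ?thesis using ne[of m "Suc m"] m by simp
 qed
 have "G2 = 0"
 proof (rule ccontr)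
  assume G2: "G2 ~= 0"
  have "c = y i" if "i < m" for i
  proof -
   have "m <= m" "m < n" using m by auto
   from step[OF that this] have "2 * c + y m - y i = y i + y m" unfolding L using G2 by simp
   hence "2 * c = 2 * y i" by (simp add: algebra_simps)
   thus ?thesis by simp
  qed
  from this[of 0] this[of 1] show False using ne[of 0 1] m by simp
 qed
 thus ?thesis using G1 by blast
qed

lemma coeff_rescale_lim:
 assumes A: "finite A" "card A = m" and t: "\<tau> \<longlonglongrightarrow> 0" and y: "!!i. i \<in> A ==> (%k. y k i) \<longlonglongrightarrow> \<eta> i"
 shows "(%k::nat. coeff (rescale m (\<tau> k) (roots_poly (y k) A)) l) \<longlonglongrightarrow> coeff (monom 1 m) l"
proof -
 have E: "(%k. coeff (roots_poly (y k) A) l) \<longlonglongrightarrow> coeff (roots_poly \<eta> A) l"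
  by (rule tendsto_coeff_roots_poly[OF A(1)]) (rule y)
 consider "l < m" | "l = m" | "m < l" by linarith
 thus ?thesis
 proof cases
  case 1
  have "(%k. \<tau> k ^ (m - l) * coeff (roots_poly (y k) A) l) \<longlonglongrightarrow> 0 ^ (m - l) * coeff (roots_poly \<eta> A) l"
   by (intro tendsto_intros t E)
  moreover have "(0::complex) ^ (m - l) = 0" using 1 by simp
  ultimately show ?thesis using 1 by (simp only: mult_zero_left) (simp add: coeff_rescale)
 next
  case 2
  have "coeff (roots_poly (y k) A) m = 1" for k using roots_poly_monic[OF A(1)] A(2) by blast
  thus ?thesis using 2 by (simp add: coeff_rescale)
 next
  case 3
  thus ?thesis by (simp add: coeff_rescale)
 qed
qed

lemma dirP_tendsto:
 assumes "!!l. (%k. coeff (p k) l) \<longlonglongrightarrow> coeff q l"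
 shows "(%k::nat. dirP n s (p k) i) \<longlonglongrightarrow> dirP n s q i"
 unfolding dirP_def by (cases "pin n s i") (simp_all add: assms)

lemma rescale_decompose:
 assumes m: "2 <= m" and c: "coeff E m = 1"
 shows "rescale m \<tau> E = monom 1 m + smult \<tau> (smult (coeff E (m - 1)) (monom 1 (m - 1)) + smult \<tau> (rescale (m - 2) \<tau> E))"
proof (rule poly_eqI)
 fix k
 consider "k = m" | "k = m - 1" | "k <= m - 2" | "m < k" using m by linarith
 thus "coeff (rescale m \<tau> E) k = coeff (monom 1 m + smult \<tau> (smult (coeff E (m - 1)) (monom 1 (m - 1)) + smult \<tau> (rescale (m - 2) \<tau> E))) k"
 proof cases
  case 3
  hence e: "m - k = Suc (Suc (m - 2 - k))" and n: "k <= m" "m - 1 ~= k" "m ~= k" using m by linarith+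
  have l: "coeff (rescale m \<tau> E) k = \<tau> * (\<tau> * (\<tau> ^ (m - 2 - k) * coeff E k))"
   unfolding coeff_rescale if_P[OF n(1)] e power_Suc by (simp only: mult.assoc)
  have "coeff (rescale (m - 2) \<tau> E) k = \<tau> ^ (m - 2 - k) * coeff E k" using 3 by (simp add: coeff_rescale)
  thus ?thesis unfolding l using n by (simp only: coeff_add coeff_smult coeff_monom) simp
 qed (use m c in \<open>auto simp: coeff_rescale\<close>)
qed

lemma Gd_line:
 "mat n n (%i. Gd n s p r $$ i + t * dirP n s q i) = Gd n s (p + smult t q) r"
 "mat n n (%i. Gd n s p r $$ i + t * dirR n s q i) = Gd n s p (r + smult t q)"
 by (rule eq_matI, auto simp: Gd_def dir_linear)+

lemma Gd_split_PM:
 assumes s: "1 <= s" "s < n" and p: "!!i. i < n - s ==> coeff p i = 0" and d: "det (Gd n s p r) ~= 0"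
 shows "PM n (Gd n s p r)"
proof (rule Gd_PM[OF s, where ?p1.0 = "monom 1 s" and \<epsilon> = 0])
 show "degree (monom (1::complex) s) <= s" by (rule degree_monom_le)
 fix i assume "i < n"
 thus "coeff (monom 1 s * p) i = 0 * coeff r i" using p[of "i - s"] by (simp add: coeff_monom_mult)
qed (use d in simp_all)

context
 fixes n s :: nat and r :: "complex poly"
 assumes s: "1 <= s" "s < n" and r: "coeff r 0 ~= 0"
begin

abbreviation base where "base \<equiv> Gd n s (monom 1 (n - s)) r"

lemma base_GL: "base \<in> GL n" by (rule Gd_base_GL) (use s r in auto)

lemma base_PM: "PM n base"
 by (rule Gd_split_PM[OF s _ GL_det[OF base_GL]]) simp

lemma tangent_P: "1 <= k ==> k < s ==> dirP n s (monom 1 (n - s + k)) \<in> hatT n base"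
proof (rule hatT_line[OF base_PM])
 show "dirP n s (monom 1 (n - s + k)) \<in> affine_space (hatE n)" by (rule dir_affine) (use s in simp)
 fix t assume "det (mat n n (%i. base $$ i + t * dirP n s (monom 1 (n - s + k)) i)) ~= 0"
 thus "PM n (mat n n (%i. base $$ i + t * dirP n s (monom 1 (n - s + k)) i))"
  unfolding Gd_line by (rule Gd_split_PM[OF s, rotated]) simp
qed

lemma tangent_R: "dirR n s (monom 1 k) \<in> hatT n base"
proof (rule hatT_line[OF base_PM])
 show "dirR n s (monom 1 k) \<in> affine_space (hatE n)" by (rule dir_affine) (use s in simp)
 fix t assume "det (mat n n (%i. base $$ i + t * dirR n s (monom 1 k) i)) ~= 0"
 thus "PM n (mat n n (%i. base $$ i + t * dirR n s (monom 1 k) i))"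
  unfolding Gd_line by (rule Gd_split_PM[OF s, rotated]) simp
qed

lemma deformation_eventually_PM:
 assumes A: "A \<subseteq> {..<n}" "card A = n - s" and t: "\<tau> \<longlonglongrightarrow> 0"
  and y: "\<forall>m. scaled n r (\<tau> m) = roots_poly (y m) {..<n}" and \<eta>: "\<forall>i<n. (%m::nat. y m i) \<longlonglongrightarrow> \<eta> i"
 shows "\<forall>\<^sub>F m in sequentially. PM n (Gd n s (rescale (n - s) (\<tau> m) (roots_poly (y m) A)) r)"
  and "(%m. dirP n s (rescale (n - s) (\<tau> m) (roots_poly (y m) A)) i) \<longlonglongrightarrow> dirP n s (monom 1 (n - s)) i"
proof -
 have fA: "finite A" using A(1) finite_subset by blast
 have lim: "(%m. dirP n s (rescale (n - s) (\<tau> m) (roots_poly (y m) A)) i) \<longlonglongrightarrow> dirP n s (monom 1 (n - s)) i" for i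
 proof (rule dirP_tendsto, rule coeff_rescale_lim[OF fA A(2) t])
  fix j assume "j \<in> A"
  hence "j < n" using A(1) by auto
  thus "(%k. y k j) \<longlonglongrightarrow> \<eta> j" using \<eta> by blast
 qed
 show "(%m. dirP n s (rescale (n - s) (\<tau> m) (roots_poly (y m) A)) i) \<longlonglongrightarrow> dirP n s (monom 1 (n - s)) i" by (rule lim)
 have "\<forall>\<^sub>F m in sequentially. det (mat n n (%i. dirP n s (rescale (n - s) (\<tau> m) (roots_poly (y m) A)) i + dirR n s r i)) ~= 0"
 proof (rule det_eventually_nonzero)
  show "det (mat n n (%i. dirP n s (monom 1 (n - s)) i + dirR n s r i)) ~= 0"
   using GL_det[OF base_GL] unfolding Gd_def .
  fix i assume "i \<in> hatE n"
  show "(%m. dirP n s (rescale (n - s) (\<tau> m) (roots_poly (y m) A)) i + dirR n s r i)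
   \<longlonglongrightarrow> dirP n s (monom 1 (n - s)) i + dirR n s r i" by (intro tendsto_intros lim)
 qed
 thus "\<forall>\<^sub>F m in sequentially. PM n (Gd n s (rescale (n - s) (\<tau> m) (roots_poly (y m) A)) r)"
 proof (rule eventually_mono)
  fix m assume d: "det (mat n n (%i. dirP n s (rescale (n - s) (\<tau> m) (roots_poly (y m) A)) i + dirR n s r i)) ~= 0"
  show "PM n (Gd n s (rescale (n - s) (\<tau> m) (roots_poly (y m) A)) r)"
  proof (rule deformed_PM[OF s A y[rule_format]])
   show "det (Gd n s (rescale (n - s) (\<tau> m) (roots_poly (y m) A)) r) ~= 0" using d unfolding Gd_def .
  qed
 qed
qed

text \<open>
Let \<open>f\<close> vanish on \<open>hatP\<close>, with derivatives \<open>G1\<close>, \<open>G2\<close> in the two directions. A choice \<open>A\<close> of \<open>n - s\<close> roots gives \<open>p = z^(n-s) - \<tau> e\<^sub>1 z^(n-s-1) + \<tau>\<^sup>2 e\<^sub>2 z^(n-s-2) - ...\<close> with \<open>e\<^sub>i\<close> symmetric in the roots. The two orders of \<open>f = 0\<close> for all \<open>A\<close> are the relations of \<open>swap_argument\<close>.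
\<close>

lemma tangent_second_order:
 assumes s2: "2 <= s" "s + 2 <= n"
 shows "dirP n s (monom 1 (n - s - 1)) \<in> hatT n base & dirP n s (monom 1 (n - s - 2)) \<in> hatT n base"
proof -
 let ?M = "n - s"
 let ?B1 = "dirP n s (monom 1 (?M - 1))" and ?B2 = "dirP n s (monom 1 (?M - 2))"
 let ?p = "fn n base"
 have M: "2 <= ?M" "?M + 2 <= n" using s2 by auto
 have n1: "n \<ge> 1" and sn: "s <= n" using s by auto
 obtain \<tau> y \<eta> where t: "\<tau> \<longlonglongrightarrow> 0" "\<forall>m. \<tau> m ~= (0::complex)" and y: "\<forall>m. scaled n r (\<tau> m) = roots_poly (y m) {..<n}"
  and \<eta>: "\<forall>i<n. (%m::nat. y m i) \<longlonglongrightarrow> \<eta> i" and inj: "inj_on \<eta> {..<n}"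
  using perturbed_roots[OF n1 r] by (elim exE conjE) (rule that)
 have "(\<Sum>i\<in>hatE n. grad (hatE n) f i ?p * ?B1 i) = 0 & (\<Sum>i\<in>hatE n. grad (hatE n) f i ?p * ?B2 i) = 0"
  if f: "f \<in> vanishing_ideal (hatE n) (hatP n)" for f
 proof -
  have fp: "f \<in> poly_funs (hatE n)" and f0: "!!x. x \<in> hatP n ==> f x = 0" using f by (auto simp: vanishing_ideal_def)
  let ?G1 = "\<Sum>i\<in>hatE n. grad (hatE n) f i ?p * ?B1 i" and ?G2 = "\<Sum>i\<in>hatE n. grad (hatE n) f i ?p * ?B2 i"
  have "\<exists>K. second_order_at (hatE n) f ?p ?B1 K"
   by (rule second_order[OF finite_hatE fp f0[OF fn_in_hatP[OF base_PM]]])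
  then obtain K where K: "second_order_at (hatE n) f ?p ?B1 K" by blast
  have main: "(\<Sum>i\<in>A. \<eta> i) * ?G1 = 0 &
    (?G1 = 0 --> ((\<Sum>i\<in>A. \<eta> i)\<^sup>2 - (\<Sum>i\<in>A. (\<eta> i)\<^sup>2)) * ?G2 + 2 * (\<Sum>i\<in>A. \<eta> i)\<^sup>2 * K = 0)"
   if A: "A \<subseteq> {..<n}" "card A = ?M" for A
  proof -
   have fA: "finite A" using A(1) finite_subset by blast
   define E where "E m = roots_poly (y m) A" for m
   define c1 where "c1 = coeff (roots_poly \<eta> A) (?M - 1)"
   define c2 where "c2 = coeff (roots_poly \<eta> A) (?M - 2)"
   have yA: "(%k. y k i) \<longlonglongrightarrow> \<eta> i" if "i \<in> A" for i using that A(1) \<eta> by auto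
   have El: "(%m. coeff (E m) l) \<longlonglongrightarrow> coeff (roots_poly \<eta> A) l" for l
    unfolding E_def by (rule tendsto_coeff_roots_poly[OF fA]) (rule yA)
   have E1: "coeff (E m) ?M = 1" for m unfolding E_def using roots_poly_monic[OF fA] A(2) by metis
   define u where "u m = coeff (E m) (?M - 1)" for m
   define Y where "Y m i = dirP n s (rescale (?M - 2) (\<tau> m) (E m)) i" for m i
   have ul: "u \<longlonglongrightarrow> c1" unfolding u_def c1_def by (rule El)
   have Yl: "(%m. Y m i) \<longlonglongrightarrow> c2 * ?B2 i" for i
   proof -
    have "(%m. coeff (rescale (?M - 2) (\<tau> m) (E m)) l) \<longlonglongrightarrow> coeff (smult c2 (monom 1 (?M - 2))) l" for l
    proof -
     consider "l < ?M - 2" | "l = ?M - 2" | "?M - 2 < l" by linarith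
     thus ?thesis
     proof cases
      case 1
      have "(%m. \<tau> m ^ (?M - 2 - l) * coeff (E m) l) \<longlonglongrightarrow> 0 ^ (?M - 2 - l) * coeff (roots_poly \<eta> A) l"
       by (intro tendsto_intros t El)
      moreover have "(0::complex) ^ (?M - 2 - l) = 0" using 1 by simp
      ultimately show ?thesis using 1 by (simp only: mult_zero_left) (simp add: coeff_rescale)
     next
      case 2
      thus ?thesis using El[of "?M - 2"] by (simp add: coeff_rescale c2_def)
     next
      case 3
      thus ?thesis by (simp add: coeff_rescale)
     qed
    qed
    hence "(%m. Y m i) \<longlonglongrightarrow> dirP n s (smult c2 (monom 1 (?M - 2))) i" unfolding Y_def by (rule dirP_tendsto)
    moreover have "dirP n s (smult c2 q) i = c2 * dirP n s q i" for q by (simp add: dirP_def)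
    ultimately show ?thesis by (simp only:)
   qed
   have fe: "fn n (Gd n s (rescale ?M (\<tau> m) (E m)) r) = (%i. ?p i + \<tau> m * (u m * ?B1 i + \<tau> m * Y m i))" for m
    unfolding fn_Gd[OF sn] rescale_decompose[OF M(1) E1] u_def[symmetric]
    by (rule ext) (simp add: Y_def dirP_def algebra_simps)
   have "\<forall>\<^sub>F m in sequentially. f (%i. ?p i + \<tau> m * (u m * ?B1 i + \<tau> m * Y m i)) = 0"
    using deformation_eventually_PM(1)[OF A t(1) y \<eta>]
   proof (rule eventually_mono)
    fix m assume "PM n (Gd n s (rescale ?M (\<tau> m) (roots_poly (y m) A)) r)"
    from f0[OF fn_in_hatP[OF this]] show "f (%i. ?p i + \<tau> m * (u m * ?B1 i + \<tau> m * Y m i)) = 0"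
     unfolding E_def[symmetric] fe .
   qed
   note c = second_order_atD[OF K t ul ballI[OF Yl] this]
   have s1: "c1 = - (\<Sum>i\<in>A. \<eta> i)" "2 * c2 = (\<Sum>i\<in>A. \<eta> i)\<^sup>2 - (\<Sum>i\<in>A. (\<eta> i)\<^sup>2)"
    unfolding c1_def c2_def using roots_poly_subleading[OF fA, of \<eta>] A(2) M by auto
   show ?thesis
   proof (intro conjI impI)
    show "(\<Sum>i\<in>A. \<eta> i) * ?G1 = 0" using conjunct1[OF c] unfolding s1(1) by simp
    assume "?G1 = 0"
    hence "(\<Sum>i\<in>hatE n. grad (hatE n) f i ?p * (c2 * ?B2 i)) + c1\<^sup>2 * K = 0" by (rule mp[OF conjunct2[OF c]])
    moreover have "(\<Sum>i\<in>hatE n. grad (hatE n) f i ?p * (c2 * ?B2 i)) = c2 * ?G2"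
     unfolding sum_distrib_left by (intro sum.cong refl) (simp only: mult_ac)
    ultimately have "2 * (c2 * ?G2 + c1\<^sup>2 * K) = 0" by simp
    hence "(2 * c2) * ?G2 + 2 * (\<Sum>i\<in>A. \<eta> i)\<^sup>2 * K = 0" unfolding s1(1) by (simp only: power2_minus distrib_left mult.assoc)
    thus "((\<Sum>i\<in>A. \<eta> i)\<^sup>2 - (\<Sum>i\<in>A. (\<eta> i)\<^sup>2)) * ?G2 + 2 * (\<Sum>i\<in>A. \<eta> i)\<^sup>2 * K = 0" unfolding s1(2) .
   qed
  qed
  show ?thesis
   by (rule swap_argument[OF inj M, where K = K]) (use main in blast)+
 qed
 thus ?thesis unfolding hatT_def tangent_space_iff[OF finite_hatE] using dir_affine(1)[OF sn] by blast
qed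

lemma generic_dim:
 assumes s2: "2 <= s" "s + 2 <= n"
 shows "card (upper_index n) + n <= cfun.dim (hatT n base)"
proof -
 (* Exponents n - s in p and 0 in r are left out because p and r matter only up to scaling. *)
 define KP where "KP = {n - s - 2..<n} - {n - s}"
 define KR where "KR = {Suc 0..<n - s}"
 have fin: "finite KP" "finite KR" by (auto simp: KP_def KR_def)
 have "card KP = s + 1" "card KR = n - s - 1" using s2 by (simp_all add: KP_def KR_def)
 hence cK: "card (KP <+> KR) = n" using s2 fin by (simp add: card_Plus)
 define B where "B z = (case z of Inl e => dirP n s (monom 1 e) | Inr k => dirR n s (monom 1 k))" for z :: "nat + nat"
 have "card (upper_index n) + card (KP <+> KR) <= cfun.dim (hatT n base)"
 proof (rule hat_dim_ge[OF base_PM, where B = B])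
  show "finite (KP <+> KR)" using fin by simp
  fix z assume "z \<in> KP <+> KR"
  thus "B z \<in> hatT n base"
  proof (rule PlusE)
   fix e assume e: "e \<in> KP" "z = Inl e"
   consider "e = n - s - 1" | "e = n - s - 2" | "n - s < e" "e < n" using e s2 unfolding KP_def by fastforce
   thus ?thesis
   proof cases
    case 3
    hence "1 <= e - (n - s)" "e - (n - s) < s" "n - s + (e - (n - s)) = e" by auto
    thus ?thesis using tangent_P[of "e - (n - s)"] e(2) by (simp add: B_def)
   qed (use tangent_second_order[OF s2] e(2) in \<open>simp_all add: B_def\<close>)
  next
   fix k assume "k \<in> KR" "z = Inr k"
   thus ?thesis using tangent_R[of k] by (simp add: B_def)
  qed
 next
  fix w :: "nat + nat => complex" and X
  assume X: "X \<in> carrier_mat n n" "!!i j. j < i ==> i < n ==> X $$ (i, j) = 0"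
   and eq: "!!a b. a < n ==> b < n ==> (\<Sum>k\<in>KP <+> KR. w k * B k (a, b)) = (base * X) $$ (a, b)"
  define P where "P = (\<Sum>e\<in>KP. smult (w (Inl e)) (monom 1 e))"
  define R where "R = (\<Sum>k\<in>KR. smult (w (Inr k)) (monom 1 k))"
  have Pc: "coeff P e = (if e \<in> KP then w (Inl e) else 0)" for e
   unfolding P_def coeff_sum using fin by (simp add: if_distrib cong: if_cong)
  have Rc: "coeff R k = (if k \<in> KR then w (Inr k) else 0)" for k
   unfolding R_def coeff_sum using fin by (simp add: if_distrib cong: if_cong)
  have eq': "dirP n s P (a, b) + dirR n s R (a, b) = (base * X) $$ (a, b)" if "a < n" "b < n" for a b
   unfolding eq[OF that, symmetric] sum.Plus[OF fin] P_def R_def dir_sum o_def by (simp add: B_def)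
  have n0: "0 < n" using s by simp
  have P0: "w (Inl e) = 0" if e: "e \<in> KP" for e
  proof -
   define a where "a = n - 1 - e"
   have a: "a < n" "n - 1 - a = e" "Suc a ~= s" using e s unfolding a_def KP_def by auto
   have "dirP n s P (a, 0) = coeff P e" using a s by (simp add: dirP_def pin_def)
   moreover have "dirR n s R (a, 0) = 0" using s by (simp add: dirR_def rin_def)
   moreover have "(base * X) $$ (a, 0) = 0"
    unfolding mat_mult_index[OF Gd_carrier X(1) a(1) n0]
   proof (rule sum.neutral, rule ballI)
    fix l assume "l \<in> {..<n}"
    thus "base $$ (a, l) * X $$ (l, 0) = 0"
     using X(2)[of 0 l] Gd_base_index[of s n a 0 r] a s by (cases "l = 0") auto
   qed
   ultimately have "coeff P e = 0" using eq'[OF a(1) n0] by simp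
   thus ?thesis using Pc[of e] e by simp
  qed
  have Rk: "coeff R k = coeff r k * X $$ (s, s)" if k: "k < n - s" for k
  proof -
   define a where "a = n - 1 - k"
   have a: "a < n" "n - 1 - a = k" "s <= a" using k s unfolding a_def by auto
   have "dirR n s R (a, s) = coeff R k" using a s by (simp add: dirR_def rin_def)
   moreover have "dirP n s P (a, s) = 0" by (simp add: dirP_def pin_def)
   moreover have "(base * X) $$ (a, s) = (\<Sum>l\<in>{s}. base $$ (a, l) * X $$ (l, s))"
    unfolding mat_mult_index[OF Gd_carrier X(1) a(1) s(2)]
   proof (rule sum.mono_neutral_right)
    show "\<forall>l\<in>{..<n} - {s}. base $$ (a, l) * X $$ (l, s) = 0"
    proof
     fix l assume l: "l \<in> {..<n} - {s}"
     show "base $$ (a, l) * X $$ (l, s) = 0"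
     proof (cases "l < s")
      case True
      thus ?thesis using Gd_base_index[of s n a l r] a s by simp
     next
      case False
      thus ?thesis using X(2)[of s l] l by simp
     qed
    qed
   qed (use s in auto)
   moreover have "base $$ (a, s) = coeff r k" using a s by (simp add: Gd_index)
   ultimately show ?thesis using eq'[OF a(1) s(2)] by simp
  qed
  have "coeff R 0 = 0" by (simp add: Rc KR_def)
  hence "X $$ (s, s) = 0" using Rk[of 0] r s by simp
  hence R0: "w (Inr k) = 0" if "k \<in> KR" for k using Rk[of k] Rc[of k] that by (simp add: KR_def)
  show "\<forall>k\<in>KP <+> KR. w k = 0" using P0 R0 by (auto elim!: PlusE)
 qed
 thus ?thesis unfolding cK .
qed

end

section \<open>Approximation of matrices\<close>

text \<open>
Approximation in the analytic topology by matrices with property \<open>P\<close>.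
\<close>

definition apx :: "nat => (complex mat => bool) => complex mat => bool" where
 "apx n P g \<longleftrightarrow> (\<exists>X. (\<forall>m::nat. X m \<in> carrier_mat n n & P (X m)) & (\<forall>a<n. \<forall>b<n. (%m. X m $$ (a, b)) \<longlonglongrightarrow> g $$ (a, b)))"

lemma apxI:
 assumes "!!m. X m \<in> carrier_mat n n" "\<forall>\<^sub>F m in sequentially. P (X m)"
  "!!a b. a < n ==> b < n ==> (%m. X m $$ (a, b)) \<longlonglongrightarrow> g $$ (a, b)"
 shows "apx n P g"
proof -
 obtain N where N: "!!m. m \<ge> N ==> P (X m)" using assms(2) unfolding eventually_sequentially by blast
 show ?thesis unfolding apx_def
 proof (intro exI[of _ "%m. X (m + N)"] conjI allI impI)
  fix a b assume "a < n" "b < n"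
  from LIMSEQ_ignore_initial_segment[OF assms(3)[OF this], of N]
  show "(%m. X (m + N) $$ (a, b)) \<longlonglongrightarrow> g $$ (a, b)" .
 qed (use assms(1) N in auto)
qed

lemma apx_refl: "g \<in> carrier_mat n n ==> P g ==> apx n P g"
 by (rule apxI[where X = "%_. g"]) auto

lemma apx_near:
 assumes "apx n P g" "0 < e"
 shows "\<exists>x\<in>carrier_mat n n. P x & (\<forall>a<n. \<forall>b<n. cmod (x $$ (a, b) - g $$ (a, b)) < e)"
proof -
 obtain X where X0: "\<forall>m::nat. X m \<in> carrier_mat n n & P (X m)" "\<forall>a<n. \<forall>b<n. (%m. X m $$ (a, b)) \<longlonglongrightarrow> g $$ (a, b)"
  using assms(1) unfolding apx_def by (elim exE conjE) (rule that)
 have X: "X m \<in> carrier_mat n n" "P (X m)" for m using X0(1) by blast+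
 have Xl: "(%m. X m $$ (a, b)) \<longlonglongrightarrow> g $$ (a, b)" if "a < n" "b < n" for a b using X0(2) that by blast
 have 1: "\<forall>\<^sub>F m in sequentially. cmod (X m $$ q - g $$ q) < e" if "q \<in> hatE n" for q
 proof -
  obtain a b where q: "q = (a, b)" by (cases q)
  have ab: "a < n" "b < n" using that unfolding q hatE_def by simp_all
  from tendstoD[OF Xl[OF ab] assms(2)] show ?thesis unfolding q dist_norm .
 qed
 have "\<forall>\<^sub>F m in sequentially. \<forall>q\<in>hatE n. cmod (X m $$ q - g $$ q) < e"
  by (rule eventually_ball_finite[OF finite_hatE]) (rule ballI, rule 1)
 then obtain m where "\<forall>q\<in>hatE n. cmod (X m $$ q - g $$ q) < e" unfolding eventually_sequentially by blast
 thus ?thesis using X(1,2)[of m] by (intro bexI[of _ "X m"]) (auto simp: hatE_def)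
qed

lemma apx_of_near:
 assumes "!!e. 0 < e ==> \<exists>x\<in>carrier_mat n n. P x & (\<forall>a<n. \<forall>b<n. cmod (x $$ (a, b) - g $$ (a, b)) < e)"
 shows "apx n P g"
proof -
 define X where "X m = (SOME x. x \<in> carrier_mat n n & P x & (\<forall>a<n. \<forall>b<n. cmod (x $$ (a, b) - g $$ (a, b)) < inverse (real (Suc m))))" for m
 have X: "X m \<in> carrier_mat n n & P (X m) & (\<forall>a<n. \<forall>b<n. cmod (X m $$ (a, b) - g $$ (a, b)) < inverse (real (Suc m)))" for m
  unfolding X_def
 proof (rule someI_ex)
  have "0 < inverse (real (Suc m))" by simp
  from assms[OF this] show "\<exists>x. x \<in> carrier_mat n n & P x & (\<forall>a<n. \<forall>b<n. cmod (x $$ (a, b) - g $$ (a, b)) < inverse (real (Suc m)))"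
   by (elim bexE) (rule exI, rule conjI)
 qed
 show ?thesis
 proof (rule apxI[where X = X])
  fix a b assume ab: "a < n" "b < n"
  show "(%m. X m $$ (a, b)) \<longlonglongrightarrow> g $$ (a, b)"
  proof (rule LIMSEQ_I)
   fix e :: real assume "0 < e"
   then obtain N where N: "inverse (real (Suc N)) < e" using reals_Archimedean by blast
   have "cmod (X m $$ (a, b) - g $$ (a, b)) < e" if "N <= m" for m
   proof -
    have "cmod (X m $$ (a, b) - g $$ (a, b)) < inverse (real (Suc m))" using X[of m] ab by blast
    also have "inverse (real (Suc m)) <= inverse (real (Suc N))" by (rule le_imp_inverse_le) (use that in auto)
    finally show ?thesis using N by linarith
   qed
   thus "\<exists>N. \<forall>m\<ge>N. cmod (X m $$ (a, b) - g $$ (a, b)) < e" by blast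
  qed
 qed (use X in auto)
qed

lemma apx_trans:
 assumes g: "apx n P g" and PQ: "!!x. x \<in> carrier_mat n n ==> P x ==> apx n Q x"
 shows "apx n Q g"
proof (rule apx_of_near)
 fix e :: real assume "0 < e"
 hence e2: "0 < e / 2" by simp
 obtain x where x: "x \<in> carrier_mat n n" "P x" "\<forall>a<n. \<forall>b<n. cmod (x $$ (a, b) - g $$ (a, b)) < e / 2"
  using apx_near[OF g e2] by blast
 obtain z where z: "z \<in> carrier_mat n n" "Q z" "\<forall>a<n. \<forall>b<n. cmod (z $$ (a, b) - x $$ (a, b)) < e / 2"
  using apx_near[OF PQ[OF x(1,2)] e2] by blast
 have "cmod (z $$ (a, b) - g $$ (a, b)) < e" if "a < n" "b < n" for a b
  using norm_triangle_ineq[of "z $$ (a, b) - x $$ (a, b)" "x $$ (a, b) - g $$ (a, b)"] x(3) z(3) that by fastforce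
 thus "\<exists>x\<in>carrier_mat n n. Q x & (\<forall>a<n. \<forall>b<n. cmod (x $$ (a, b) - g $$ (a, b)) < e)" using z by blast
qed

lemma apx_mult:
 assumes g: "apx n P g" "g \<in> carrier_mat n n" and T: "T \<in> carrier_mat n n" and b: "b \<in> carrier_mat n n"
  and PQ: "!!x. x \<in> carrier_mat n n ==> P x ==> Q (T * x * b)"
 shows "apx n Q (T * g * b)"
proof -
 obtain X where X0: "\<forall>m::nat. X m \<in> carrier_mat n n & P (X m)" "\<forall>a<n. \<forall>b<n. (%m. X m $$ (a, b)) \<longlonglongrightarrow> g $$ (a, b)"
  using g(1) unfolding apx_def by (elim exE conjE) (rule that)
 have X: "X m \<in> carrier_mat n n" "P (X m)" for m using X0(1) by blast+
 have Xl: "(%m. X m $$ (a, b)) \<longlonglongrightarrow> g $$ (a, b)" if "a < n" "b < n" for a b using X0(2) that by blast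
 show ?thesis
 proof (rule apxI[where X = "%m. T * X m * b"])
  show "T * X m * b \<in> carrier_mat n n" for m using T b X(1)[of m] by simp
  show "\<forall>\<^sub>F m in sequentially. Q (T * X m * b)" using PQ[OF X(1,2)] by simp
  fix i j assume ij: "i < n" "j < n"
  have e: "(T * x * b) $$ (i, j) = (\<Sum>q\<in>hatE n. T $$ (i, fst q) * b $$ (snd q, j) * x $$ q)" if x: "x \<in> carrier_mat n n" for x
  proof -
   have 1: "(\<Sum>q\<in>hatE n. T $$ (i, fst q) * b $$ (snd q, j) * fn n x q) = (\<Sum>q\<in>hatE n. T $$ (i, fst q) * b $$ (snd q, j) * x $$ q)"
    by (intro sum.cong refl) (auto simp: fn_def hatE_def)
   show ?thesis using triple_index[OF T b ij, of "fn n x"] unfolding mat_fn[OF x] 1 .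
  qed
  show "(%m. (T * X m * b) $$ (i, j)) \<longlonglongrightarrow> (T * g * b) $$ (i, j)"
   unfolding e[OF X(1)] e[OF g(2)]
   by (intro tendsto_sum tendsto_mult tendsto_const) (use Xl in \<open>auto simp: hatE_def\<close>)
 qed
qed

lemma apx_dim:
 assumes "apx n (%x. d <= cfun.dim (hatT n x)) g"
 shows "d <= cfun.dim (hatT n g)"
proof -
 obtain X where X0: "\<forall>m::nat. X m \<in> carrier_mat n n & d <= cfun.dim (hatT n (X m))" "\<forall>a<n. \<forall>b<n. (%m. X m $$ (a, b)) \<longlonglongrightarrow> g $$ (a, b)"
  using assms unfolding apx_def by (elim exE conjE) (rule that)
 have X: "X m \<in> carrier_mat n n" "d <= cfun.dim (hatT n (X m))" for m using X0(1) by blast+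
 have Xl: "(%m. X m $$ (a, b)) \<longlonglongrightarrow> g $$ (a, b)" if "a < n" "b < n" for a b using X0(2) that by blast
 show ?thesis unfolding hatT_def
 proof (rule dim_tangent_space_upper_semicontinuous[where q = "%m. fn n (X m)"])
  show "d <= cfun.dim (tangent_space (hatE n) (hatP n) (fn n (X m)))" for m using X(2)[of m] unfolding hatT_def .
  fix i assume "i \<in> hatE n"
  thus "(%m. fn n (X m) i) \<longlonglongrightarrow> fn n g i" using Xl by (auto simp: fn_def hatE_def)
 qed simp
qed

text \<open>
No root of the deformed \<open>p\<close> is zero, so its constant coefficient, the lower left entry of the deformed matrix, is nonzero.
\<close>

lemma generic_corner:
 assumes s: "1 <= s" "s < n" and r: "coeff r 0 ~= 0"
 shows "apx n (%x. PM n x & x $$ (n - 1, 0) ~= 0) (Gd n s (monom 1 (n - s)) r)"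
proof -
 have n1: "n \<ge> 1" and sn: "s <= n" using s by auto
 obtain \<tau> y \<eta> where t: "\<tau> \<longlonglongrightarrow> 0" "\<forall>m. \<tau> m ~= (0::complex)" and y: "\<forall>m. scaled n r (\<tau> m) = roots_poly (y m) {..<n}"
  and \<eta>: "\<forall>i<n. (%m::nat. y m i) \<longlonglongrightarrow> \<eta> i"
  using perturbed_roots[OF n1 r] by (elim exE conjE) (rule that)
 have A: "{..<n - s} \<subseteq> {..<n}" "card {..<n - s} = n - s" by auto
 note def = deformation_eventually_PM[OF s r A t(1) y \<eta>]
 have y0: "y m i ~= 0" if "i < n" for m i
 proof
  assume z: "y m i = 0"
  have "poly (roots_poly (y m) {..<n}) 0 = 0" unfolding poly_roots_poly[OF finite_lessThan] using that z by (auto simp: prod_zero_iff)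
  hence "coeff (scaled n r (\<tau> m)) 0 = 0" unfolding y[rule_format, symmetric] by (simp add: poly_0_coeff_0)
  thus False using r n1 by (simp add: coeff_scaled)
 qed
 have corner: "Gd n s (rescale (n - s) (\<tau> m) (roots_poly (y m) {..<n - s})) r $$ (n - 1, 0) ~= 0" for m
 proof -
  have "coeff (roots_poly (y m) {..<n - s}) 0 = (\<Prod>i<n - s. 0 - y m i)"
   unfolding poly_roots_poly[OF finite_lessThan, symmetric] by (simp add: poly_0_coeff_0)
  moreover have "(\<Prod>i<n - s. 0 - y m i) ~= 0" unfolding prod_zero_iff[OF finite_lessThan] using y0 by simp
  ultimately show ?thesis using s t(2) by (simp add: Gd_index coeff_rescale)
 qed
 show ?thesis
 proof (rule apxI[where X = "%m. Gd n s (rescale (n - s) (\<tau> m) (roots_poly (y m) {..<n - s})) r"])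
  show "\<forall>\<^sub>F m in sequentially. PM n (Gd n s (rescale (n - s) (\<tau> m) (roots_poly (y m) {..<n - s})) r) &
    Gd n s (rescale (n - s) (\<tau> m) (roots_poly (y m) {..<n - s})) r $$ (n - 1, 0) ~= 0"
   using def(1) by (rule eventually_mono) (use corner in blast)
  fix a b assume ab: "a < n" "b < n"
  have "Gd n s p r $$ (a, b) = dirP n s p (a, b) + dirR n s r (a, b)" for p using ab by (simp add: Gd_def)
  thus "(%m. Gd n s (rescale (n - s) (\<tau> m) (roots_poly (y m) {..<n - s})) r $$ (a, b)) \<longlonglongrightarrow> Gd n s (monom 1 (n - s)) r $$ (a, b)"
   by (simp only:) (intro tendsto_intros def(2))
 qed simp
qed

section \<open>Block matrices\<close>

lemma sum_split_at:
 fixes f :: "nat => complex"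
 assumes "s <= n"
 shows "(\<Sum>l<n. f l) = (\<Sum>l<s. f l) + (\<Sum>l<n - s. f (l + s))"
proof -
 have "{..<n} = {..<s} \<union> {s..<n}" using assms by auto
 hence "(\<Sum>l<n. f l) = (\<Sum>l<s. f l) + (\<Sum>l\<in>{s..<n}. f l)" by (simp add: sum.union_disjoint ivl_disj_int)
 also have "(\<Sum>l\<in>{s..<n}. f l) = (\<Sum>l<n - s. f (l + s))"
  by (rule sum.reindex_bij_witness[of _ "%l. l + s" "%l. l - s"]) auto
 finally show ?thesis .
qed

definition ul :: "nat => complex mat => complex mat" where "ul s g = mat s s (%(a, b). g $$ (a, b))"

definition lr :: "nat => nat => complex mat => complex mat" where
 "lr s n g = mat (n - s) (n - s) (%(a, b). g $$ (a + s, b + s))"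

lemma ul_carrier[simp]: "ul s g \<in> carrier_mat s s" by (simp add: ul_def)
lemma lr_carrier[simp]: "lr s n g \<in> carrier_mat (n - s) (n - s)" by (simp add: lr_def)

lemma ul_mult:
 assumes g: "g \<in> carrier_mat n n" and h: "h \<in> carrier_mat n n" "brk n h s" and s: "s <= n"
 shows "ul s (g * h) = ul s g * ul s h"
proof (rule eq_matI)
 fix a b assume "a < dim_row (ul s g * ul s h)" "b < dim_col (ul s g * ul s h)"
 hence ab: "a < s" "b < s" by (simp_all add: ul_def)
 hence abn: "a < n" "b < n" using s by auto
 have z: "h $$ (l + s, b) = 0" if "l < n - s" for l using brkD[OF h(2), of "l + s" b] that ab by simp
 have "(g * h) $$ (a, b) = (\<Sum>l<s. g $$ (a, l) * h $$ (l, b))"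
  unfolding mat_mult_index[OF g h(1) abn] sum_split_at[OF s] using z by simp
 also have "... = (ul s g * ul s h) $$ (a, b)"
  unfolding mat_mult_index[OF ul_carrier ul_carrier ab] using ab by (intro sum.cong refl) (simp add: ul_def)
 finally show "ul s (g * h) $$ (a, b) = (ul s g * ul s h) $$ (a, b)" using ab by (simp add: ul_def)
qed (simp_all add: ul_def)

lemma lr_mult:
 assumes g: "g \<in> carrier_mat n n" "brk n g s" and h: "h \<in> carrier_mat n n" and s: "s <= n"
 shows "lr s n (g * h) = lr s n g * lr s n h"
proof (rule eq_matI)
 fix a b assume "a < dim_row (lr s n g * lr s n h)" "b < dim_col (lr s n g * lr s n h)"
 hence ab: "a < n - s" "b < n - s" by (simp_all add: lr_def)
 hence abn: "a + s < n" "b + s < n" by auto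
 have z: "g $$ (a + s, l) = 0" if "l < s" for l using brkD[OF g(2), of "a + s" l] that abn by simp
 have "(g * h) $$ (a + s, b + s) = (\<Sum>l<n - s. g $$ (a + s, l + s) * h $$ (l + s, b + s))"
  unfolding mat_mult_index[OF g(1) h abn] sum_split_at[OF s] using z by simp
 also have "... = (lr s n g * lr s n h) $$ (a, b)"
  unfolding mat_mult_index[OF lr_carrier lr_carrier ab] using ab by (intro sum.cong refl) (simp add: lr_def)
 finally show "lr s n (g * h) $$ (a, b) = (lr s n g * lr s n h) $$ (a, b)" using ab by (simp add: lr_def)
qed (simp_all add: lr_def)

lemma brk_NN: "brk n (NN n) s"
 by (auto simp: brk_def regular_nilpotent_def)

lemma PM_hess:
 assumes "PM n g"
 shows "minv g * (NN n * g) \<in> carrier_mat n n" "hess n (minv g * (NN n * g))" "NN n * g = g * (minv g * (NN n * g))"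
proof -
 note g = PM_GL[OF assms]
 note c = GL_carrier[OF g] minv_carrier[OF GL_carrier[OF g]]
 show "minv g * (NN n * g) \<in> carrier_mat n n" using c by simp
 show "hess n (minv g * (NN n * g))" using assms PM_iff_conj[OF g] by simp
 show "NN n * g = g * (minv g * (NN n * g))" using GL_cancel_left'[OF g mult_carrier_square[OF NN_carrier c(1)]] by simp
qed

lemma block_PM:
 assumes g: "PM n g" and b: "brk n g s" and s: "s <= n"
 shows "PM s (ul s g)" "PM (n - s) (lr s n g)"
proof -
 note gG = PM_GL[OF g]
 note gc = GL_carrier[OF gG] and mc = minv_carrier[OF GL_carrier[OF gG]]
 have bm: "brk n (minv g) s" by (rule brk_minv[OF gG b s])
 define H where "H = minv g * (NN n * g)"
 have H: "H \<in> carrier_mat n n" "hess n H" "NN n * g = g * H" unfolding H_def by (rule PM_hess[OF g])+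
 have bH: "brk n H s"
  unfolding H_def by (rule brk_mult[OF mc mult_carrier_square[OF NN_carrier gc] bm brk_mult[OF NN_carrier gc brk_NN b s] s])
 have one: "g * minv g = 1\<^sub>m n" by (rule mult_minv[OF gc GL_det[OF gG]])
 have "ul s g * ul s (minv g) = ul s (1\<^sub>m n)" unfolding one[symmetric] by (rule ul_mult[OF gc mc bm s, symmetric])
 also have "... = 1\<^sub>m s" by (rule eq_matI) (use s in \<open>auto simp: ul_def\<close>)
 finally have uG: "ul s g \<in> GL s" by (rule minv_unique(1)[OF ul_carrier ul_carrier])
 have "lr s n g * lr s n (minv g) = lr s n (1\<^sub>m n)" unfolding one[symmetric] by (rule lr_mult[OF gc b mc s, symmetric])
 also have "... = 1\<^sub>m (n - s)" by (rule eq_matI) (use s in \<open>auto simp: lr_def\<close>)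
 finally have lG: "lr s n g \<in> GL (n - s)" by (rule minv_unique(1)[OF lr_carrier lr_carrier])
 have uN: "ul s (NN n) = NN s" by (rule eq_matI) (use s in \<open>auto simp: ul_def regular_nilpotent_def\<close>)
 have lN: "lr s n (NN n) = NN (n - s)" by (rule eq_matI) (use s in \<open>auto simp: lr_def regular_nilpotent_def\<close>)
 have "NN s * ul s g = ul s (NN n * g)" unfolding uN[symmetric] by (rule ul_mult[OF NN_carrier gc b s, symmetric])
 also have "... = ul s g * ul s H" unfolding H(3) by (rule ul_mult[OF gc H(1) bH s])
 finally have 1: "NN s * ul s g = ul s g * ul s H" .
 have "hess s (ul s H)" using H(2) s by (auto simp: hess_def ul_def)
 with 1 uG show "PM s (ul s g)" unfolding PM_def using ul_carrier by blast
 have "NN (n - s) * lr s n g = lr s n (NN n * g)" unfolding lN[symmetric] by (rule lr_mult[OF NN_carrier brk_NN gc s, symmetric])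
 also have "... = lr s n g * lr s n H" unfolding H(3) by (rule lr_mult[OF gc b H(1) s])
 finally have 2: "NN (n - s) * lr s n g = lr s n g * lr s n H" .
 have "hess (n - s) (lr s n H)" using H(2) s by (auto simp: hess_def lr_def)
 with 2 lG show "PM (n - s) (lr s n g)" unfolding PM_def using lr_carrier by blast
qed

definition bd :: "nat => nat => complex mat => complex mat => complex mat" where
 "bd s n A D = mat n n (%(a, b). if a < s & b < s then A $$ (a, b) else if s <= a & s <= b then D $$ (a - s, b - s) else 0)"

lemma bd_carrier[simp]: "bd s n A D \<in> carrier_mat n n" by (simp add: bd_def)

lemma bd_index: "a < n ==> b < n ==> bd s n A D $$ (a, b) =
  (if a < s & b < s then A $$ (a, b) else if s <= a & s <= b then D $$ (a - s, b - s) else 0)"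
 by (simp add: bd_def)

lemma bd_mult:
 assumes A: "A \<in> carrier_mat s s" "A' \<in> carrier_mat s s" and D: "D \<in> carrier_mat (n - s) (n - s)" "D' \<in> carrier_mat (n - s) (n - s)"
  and s: "s <= n"
 shows "bd s n A D * bd s n A' D' = bd s n (A * A') (D * D')"
proof (rule eq_matI)
 fix a b assume "a < dim_row (bd s n (A * A') (D * D'))" "b < dim_col (bd s n (A * A') (D * D'))"
 hence ab: "a < n" "b < n" by (simp_all add: bd_def)
 have e: "(bd s n A D * bd s n A' D') $$ (a, b) = (\<Sum>l<s. bd s n A D $$ (a, l) * bd s n A' D' $$ (l, b))
   + (\<Sum>l<n - s. bd s n A D $$ (a, l + s) * bd s n A' D' $$ (l + s, b))"
  unfolding mat_mult_index[OF bd_carrier bd_carrier ab] by (rule sum_split_at[OF s])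
 show "(bd s n A D * bd s n A' D') $$ (a, b) = bd s n (A * A') (D * D') $$ (a, b)"
 proof (cases "a < s"; cases "b < s")
  assume "a < s" "b < s"
  thus ?thesis unfolding e using ab s by (simp add: bd_index mat_mult_index[OF A])
 next
  assume "a < s" "~ b < s"
  thus ?thesis unfolding e using ab s by (simp add: bd_index)
 next
  assume "~ a < s" "b < s"
  thus ?thesis unfolding e using ab s by (simp add: bd_index)
 next
  assume c: "~ a < s" "~ b < s"
  hence "a - s < n - s" "b - s < n - s" using ab by auto
  thus ?thesis unfolding e using ab s c by (simp add: bd_index mat_mult_index[OF D])
 qed
qed (simp_all add: bd_def)

lemma bd_borel:
 assumes A: "A \<in> borel_subgroup s" and D: "D \<in> borel_subgroup (n - s)" and s: "s <= n"
 shows "bd s n A D \<in> borel_subgroup n"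
proof (rule borelI[OF bd_carrier])
 fix i j assume ij: "j < i" "i < n"
 show "bd s n A D $$ (i, j) = 0"
  using ij borel_zero[OF A, of j i] borel_zero[OF D, of "j - s" "i - s"] by (auto simp: bd_index)
next
 fix i assume "i < n"
 thus "bd s n A D $$ (i, i) ~= 0"
  using borel_diag[OF A, of i] borel_diag[OF D, of "i - s"] by (auto simp: bd_index)
qed

section \<open>Normal form near a break\<close>

text \<open>
Polynomials in \<open>N\<close>, the centraliser of \<open>N\<close>.
\<close>

definition toep :: "nat => (nat => complex) => complex mat" where
 "toep n c = mat n n (%(a, b). if a <= b then c (b - a) else 0)"

lemma toep_carrier[simp]: "toep n c \<in> carrier_mat n n" by (simp add: toep_def)

lemma toep_borel: "c 0 ~= 0 ==> toep n c \<in> borel_subgroup n"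
 by (rule borelI) (auto simp: toep_def)

lemma toep_commute: "NN n * toep n c = toep n c * NN n"
proof (rule eq_matI)
 fix a b assume "a < dim_row (toep n c * NN n)" "b < dim_col (toep n c * NN n)"
 hence ab: "a < n" "b < n" by (simp_all add: toep_def regular_nilpotent_def)
 have "(toep n c * NN n) $$ (a, b) = (\<Sum>l<n. toep n c $$ (a, l) * NN n $$ (l, b))"
  by (rule mat_mult_index[OF toep_carrier NN_carrier ab])
 also have "... = (\<Sum>l<n. if Suc l = b then toep n c $$ (a, l) else 0)"
  using ab by (intro sum.cong refl) (auto simp: regular_nilpotent_def)
 also have "... = (if b = 0 then 0 else toep n c $$ (a, b - 1))"
  using ab by (cases b) auto
 finally show "(NN n * toep n c) $$ (a, b) = (toep n c * NN n) $$ (a, b)"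
  unfolding NN_mult_index[OF toep_carrier ab] using ab by (cases b) (auto simp: toep_def)
qed (simp_all add: toep_def regular_nilpotent_def)

lemma toep_mult_hankel:
 assumes a: "a < n" and M: "M <= n" and x: "!!l. a <= l ==> l < n ==> x l = (if l + e < M then \<tau> (M - 1 - l - e) else 0)"
 shows "(\<Sum>l<n. toep n c $$ (a, l) * x l) = (if a + e < M then \<Sum>i\<le>M - 1 - a - e. c i * \<tau> (M - 1 - a - e - i) else 0)"
proof (cases "a + e < M")
 case True
 have "(\<Sum>l<n. toep n c $$ (a, l) * x l) = (\<Sum>l\<in>{a..M - 1 - e}. toep n c $$ (a, l) * x l)"
 proof (rule sum.mono_neutral_right)
  show "{a..M - 1 - e} \<subseteq> {..<n}" using M True by auto
  show "\<forall>l\<in>{..<n} - {a..M - 1 - e}. toep n c $$ (a, l) * x l = 0"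
  proof
   fix l assume l: "l \<in> {..<n} - {a..M - 1 - e}"
   show "toep n c $$ (a, l) * x l = 0"
   proof (cases "a <= l")
    case True
    hence "~ l + e < M" using l by auto
    thus ?thesis using x[OF True] l by simp
   next
    case False
    thus ?thesis using a l by (simp add: toep_def)
   qed
  qed
 qed simp
 also have "... = (\<Sum>i\<le>M - 1 - a - e. c i * \<tau> (M - 1 - a - e - i))"
 proof (rule sum.reindex_bij_witness[of _ "%i. i + a" "%l. l - a"])
  fix l assume l: "l \<in> {a..M - 1 - e}"
  hence "l + e < M" "l < n" "a <= l" using True M by auto
  moreover have "M - 1 - a - e - (l - a) = M - 1 - l - e" using l by auto
  ultimately show "c (l - a) * \<tau> (M - 1 - a - e - (l - a)) = toep n c $$ (a, l) * x l" using x[of l] a by (simp add: toep_def)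
 qed (use True in auto)
 finally show ?thesis using True by simp
next
 case False
 have "(\<Sum>l<n. toep n c $$ (a, l) * x l) = 0"
 proof (rule sum.neutral, rule ballI)
  fix l assume l: "l \<in> {..<n}"
  show "toep n c $$ (a, l) * x l = 0"
  proof (cases "a <= l")
   case True
   thus ?thesis using x[OF True] l False by simp
  next
   case False
   thus ?thesis using a l by (simp add: toep_def)
  qed
 qed
 thus ?thesis using False by simp
qed

lemma Kmat_empty_index: "a < m ==> b < m ==>
  Kmat m {} t $$ (a, b) = (if a + b < m then if m - 1 - a - b = 0 then 1 else t (m - 1 - a - b) else 0)"
 by (auto simp: Kmat_index bs_def be_def)

lemma convolution_inverse_exists:
 fixes f :: "nat => complex"
 assumes "f 0 = 1"
 shows "\<exists>c. c 0 = 1 & (\<forall>d. (\<Sum>i\<le>d. c i * f (d - i)) = (if d = 0 then 1 else 0))"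
proof -
 define F where "F = Abs_fps f"
 have F0: "fps_nth F 0 ~= 0" using assms by (simp add: F_def)
 have e: "inverse F * F = 1" by (rule inverse_mult_eq_1[OF F0])
 have "(\<Sum>i\<le>d. fps_nth (inverse F) i * f (d - i)) = (if d = 0 then 1 else 0)" for d
  using arg_cong[OF e, of "%g. fps_nth g d"] by (simp add: fps_mult_nth F_def atLeast0AtMost)
 moreover have "fps_nth (inverse F) 0 = 1" using assms by (simp add: F_def)
 ultimately show ?thesis by (intro exI[of _ "fps_nth (inverse F)"] conjI allI)
qed

text \<open>
A polynomial in \<open>N\<close> that inverts the generator of the first block turns this block into powers of \<open>z\<close> and the second one into multiples of a unit \<open>r\<close>. The entries above the second block are removed by column operations.
\<close>

lemma block_normal_form:
 assumes s: "1 <= s" "s < n"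
 shows "\<exists>T b r. T \<in> borel_subgroup n & NN n * T = T * NN n & b \<in> borel_subgroup n & coeff r 0 ~= 0 &
  bd s n (Kmat s {} t1) (Kmat (n - s) {} t2) = T * Gd n s (monom 1 (n - s)) r * b"
proof -
 define f1 where "f1 d = (if d = 0 then 1 else t1 d)" for d
 define f2 where "f2 d = (if d = 0 then 1 else t2 d)" for d
 obtain c where c: "c 0 = 1" "\<forall>d. (\<Sum>i\<le>d. c i * f1 (d - i)) = (if d = 0 then 1 else 0)"
 proof -
  have "f1 0 = 1" by (simp add: f1_def)
  from convolution_inverse_exists[of f1, OF this] show thesis by (elim exE conjE) (rule that)
 qed
 (* The quotient of the generators of the two blocks. *)
 define r where "r = (\<Sum>k<n. monom (\<Sum>i\<le>k. c i * f2 (k - i)) k)"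
 have rc: "coeff r k = (\<Sum>i\<le>k. c i * f2 (k - i))" if "k < n" for k using that by (simp add: r_def coeff_sum)
 let ?g = "bd s n (Kmat s {} t1) (Kmat (n - s) {} t2)"
 let ?h = "Gd n s (monom 1 (n - s)) r"
 define T where "T = toep n c"
 have TB: "T \<in> borel_subgroup n" unfolding T_def by (rule toep_borel) (simp add: c)
 have sn: "s <= n" using s by simp
 have g1: "?g $$ (l, j) = (if l + j < s then f1 (s - 1 - l - j) else 0)" if "l < n" "j < s" for l j
  using that s by (auto simp: bd_index Kmat_empty_index f1_def)
 have g2: "?g $$ (l, j) = (if l + (j - s) < n then f2 (n - 1 - l - (j - s)) else 0)" if "s <= l" "l < n" "s <= j" "j < n" for l j
 proof -
  have ls: "l - s < n - s" "j - s < n - s" using that by auto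
  have "n - s - 1 - (l - s) - (j - s) = n - 1 - l - (j - s)" "(l - s) + (j - s) < n - s \<longleftrightarrow> l + (j - s) < n" using that by auto
  thus ?thesis using that ls by (simp add: bd_index Kmat_empty_index f2_def)
 qed
 have W: "(T * ?g) $$ (a, j) = (\<Sum>l<n. toep n c $$ (a, l) * ?g $$ (l, j))" if "a < n" "j < n" for a j
  unfolding T_def by (rule mat_mult_index[OF toep_carrier bd_carrier that])
 have W1: "(T * ?g) $$ (a, j) = ?h $$ (a, j)" if aj: "a < n" "j < s" for a j
 proof -
  have jn: "j < n" using aj s by simp
  have "(T * ?g) $$ (a, j) = (if a + j < s then \<Sum>i\<le>s - 1 - a - j. c i * f1 (s - 1 - a - j - i) else 0)"
   unfolding W[OF aj(1) jn] by (rule toep_mult_hankel[OF aj(1) sn]) (use g1 aj in auto)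
  also have "... = (if Suc (a + j) = s then 1 else 0)" unfolding c(2)[rule_format] using aj s by auto
  finally show ?thesis using Gd_base_index[OF sn aj, of r] by simp
 qed
 have W2: "(T * ?g) $$ (a, j) = ?h $$ (a, j)" if aj: "s <= a" "a < n" "s <= j" "j < n" for a j
 proof -
  have "(T * ?g) $$ (a, j) = (if a + (j - s) < n then \<Sum>i\<le>n - 1 - a - (j - s). c i * f2 (n - 1 - a - (j - s) - i) else 0)"
   unfolding W[OF aj(2,4)] by (rule toep_mult_hankel[OF aj(2) order_refl]) (use g2 aj in auto)
  also have "... = ?h $$ (a, j)" using aj s by (auto simp: Gd_index rc)
  finally show ?thesis .
 qed
 define b where "b = mat n n (%(i, j). if i = j then 1 else if i < s & s <= j then (T * ?g) $$ (s - 1 - i, j) - ?h $$ (s - 1 - i, j) else 0)"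
 have bc: "b \<in> carrier_mat n n" by (simp add: b_def)
 have bB: "b \<in> borel_subgroup n" by (rule borelI[OF bc]) (auto simp: b_def)
 have eq: "T * ?g = ?h * b"
 proof (rule eq_matI)
  fix a j assume "a < dim_row (?h * b)" "j < dim_col (?h * b)"
  hence aj: "a < n" "j < n" using bc by (auto simp: Gd_def)
  have hb: "(?h * b) $$ (a, j) = (\<Sum>l<n. ?h $$ (a, l) * b $$ (l, j))" by (rule mat_mult_index[OF Gd_carrier bc aj])
  show "(T * ?g) $$ (a, j) = (?h * b) $$ (a, j)"
  proof (cases "j < s")
   case True
   have "(?h * b) $$ (a, j) = (\<Sum>l<n. if l = j then ?h $$ (a, l) else 0)"
    unfolding hb using aj True by (intro sum.cong refl) (auto simp: b_def)
   thus ?thesis using W1[OF aj(1) True] aj by simp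
  next
   case False
   define w where "w i = (T * ?g) $$ (i, j) - ?h $$ (i, j)" for i
   have "(?h * b) $$ (a, j) = (\<Sum>l<n. (if l = j then ?h $$ (a, l) else 0) + (if l = s - 1 - a & a < s then w a else 0))"
    unfolding hb
   proof (intro sum.cong refl)
    fix l assume l: "l \<in> {..<n}"
    show "?h $$ (a, l) * b $$ (l, j) = (if l = j then ?h $$ (a, l) else 0) + (if l = s - 1 - a & a < s then w a else 0)"
    proof (cases "l < s")
     case True
     have "b $$ (l, j) = w (s - 1 - l)" using l aj True False by (auto simp: b_def w_def)
     moreover have "?h $$ (a, l) = (if Suc (a + l) = s then 1 else 0)" by (rule Gd_base_index[OF sn aj(1) True])
     ultimately show ?thesis using True False by auto
    next
     case F: False
     have "b $$ (l, j) = (if l = j then 1 else 0)" using l aj F by (auto simp: b_def)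
     thus ?thesis using F s by auto
    qed
   qed
   also have "... = ?h $$ (a, j) + (if a < s then w a else 0)"
    unfolding sum.distrib using aj s by (cases "a < s") auto
   also have "... = (T * ?g) $$ (a, j)" using W2[of a j] aj False by (auto simp: w_def)
   finally show ?thesis ..
  qed
 qed (use bc in \<open>auto simp: T_def toep_def bd_def Gd_def\<close>)
 have TG: "T \<in> GL n" by (rule borel_GL[OF TB])
 have "?g = minv T * (?h * b)" unfolding eq[symmetric] by (rule GL_cancel_left[OF TG bd_carrier, symmetric])
 also have "... = minv T * ?h * b" by (rule square_assoc[OF minv_carrier[OF GL_carrier[OF TG]] Gd_carrier bc, symmetric])
 finally have "?g = minv T * ?h * b" .
 moreover have "NN n * minv T = minv T * NN n" by (rule commute_minv[OF TG]) (simp add: T_def toep_commute)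
 moreover have "coeff r 0 ~= 0" using rc[of 0] s c by (simp add: f2_def)
 ultimately show ?thesis using borel_minv[OF TB] bB
  by (intro exI[of _ "minv T"] exI[of _ b] exI[of _ r] conjI)
qed

text \<open>
These points form the open stratum: the line of the flag generates all of \<open>\<complex>^n\<close> under \<open>N\<close>.
\<close>

definition corner :: "nat => complex mat => bool" where
 "corner n g \<longleftrightarrow> PM n g & g $$ (n - 1, 0) ~= 0"

lemma corner_mult_right:
 assumes g: "g \<in> carrier_mat n n" and b: "b \<in> borel_subgroup n" and n: "1 <= n"
 shows "(g * b) $$ (n - 1, 0) = g $$ (n - 1, 0) * b $$ (0, 0)"
proof -
 have n0: "n - 1 < n" "0 < n" using n by auto
 have "(\<Sum>l<n. g $$ (n - 1, l) * b $$ (l, 0)) = (\<Sum>l\<in>{0}. g $$ (n - 1, l) * b $$ (l, 0))"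
  using n0 borel_zero[OF b] by (intro sum.mono_neutral_right) auto
 thus ?thesis unfolding mat_mult_index[OF g borel_carrier[OF b] n0] by simp
qed

lemma corner_mult_left:
 assumes g: "g \<in> carrier_mat n n" and b: "b \<in> borel_subgroup n" and n: "1 <= n"
 shows "(b * g) $$ (n - 1, 0) = b $$ (n - 1, n - 1) * g $$ (n - 1, 0)"
proof -
 have n0: "n - 1 < n" "0 < n" using n by auto
 have "(\<Sum>l<n. b $$ (n - 1, l) * g $$ (l, 0)) = (\<Sum>l\<in>{n - 1}. b $$ (n - 1, l) * g $$ (l, 0))"
  using n0 borel_zero[OF b] by (intro sum.mono_neutral_right) auto
 thus ?thesis unfolding mat_mult_index[OF borel_carrier[OF b] g n0] by simp
qed

lemma corner_normal_form:
 assumes g: "corner n g" and n: "1 <= n"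
 shows "\<exists>t. \<exists>b\<in>borel_subgroup n. Kmat n {} t = g * b"
proof -
 have e: "breaks n g = {}"
 proof (rule ccontr)
  assume "breaks n g ~= {}"
  then obtain s where s: "1 <= s" "s < n" "brk n g s" by auto
  have "g $$ (n - 1, 0) = 0" by (rule brkD[OF s(3)]) (use s in auto)
  thus False using g by (simp add: corner_def)
 qed
 have "PM n g" using g by (simp add: corner_def)
 from PM_normal_form[OF this] show ?thesis unfolding e by blast
qed

lemma corner_blocks:
 assumes s: "1 <= s" "s < n" and A: "corner s A" and D: "corner (n - s) D"
 shows "\<exists>T b r. T \<in> borel_subgroup n & NN n * T = T * NN n & b \<in> borel_subgroup n & coeff r 0 ~= 0 &
  bd s n A D = T * Gd n s (monom 1 (n - s)) r * b"
proof -
 have sn: "s <= n" "1 <= n - s" using s by auto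
 obtain t1 b1 where b1: "b1 \<in> borel_subgroup s" "Kmat s {} t1 = A * b1" using corner_normal_form[OF A s(1)] by blast
 obtain t2 b2 where b2: "b2 \<in> borel_subgroup (n - s)" "Kmat (n - s) {} t2 = D * b2" using corner_normal_form[OF D sn(2)] by blast
 obtain T b r where T: "T \<in> borel_subgroup n" "NN n * T = T * NN n" "b \<in> borel_subgroup n" "coeff r 0 ~= 0"
  "bd s n (Kmat s {} t1) (Kmat (n - s) {} t2) = T * Gd n s (monom 1 (n - s)) r * b"
  using block_normal_form[OF s, of t1 t2] by (elim exE conjE) (rule that)
 let ?B = "bd s n b1 b2" and ?h = "Gd n s (monom 1 (n - s)) r"
 have BB: "?B \<in> borel_subgroup n" by (rule bd_borel[OF b1(1) b2(1) sn(1)])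
 have Ac: "A \<in> carrier_mat s s" "D \<in> carrier_mat (n - s) (n - s)"
  using A D GL_carrier[OF PM_GL] by (auto simp: corner_def)
 have "bd s n A D * ?B = T * ?h * b"
  unfolding bd_mult[OF Ac(1) borel_carrier[OF b1(1)] Ac(2) borel_carrier[OF b2(1)] sn(1)]
   b1(2)[symmetric] b2(2)[symmetric] by (rule T(5))
 hence "bd s n A D = T * ?h * b * minv ?B" using GL_cancel_right[OF borel_GL[OF BB] bd_carrier[of s n A D]] by simp
 also have "... = T * ?h * (b * minv ?B)"
  by (rule square_assoc[of _ n]) (use borel_carrier[OF T(1)] borel_carrier[OF T(3)] minv_carrier[OF bd_carrier] in auto)
 finally have "bd s n A D = T * ?h * (b * minv ?B)" .
 thus ?thesis using T(1,2,4) borel_mult[OF T(3) borel_minv[OF BB]]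
  by (intro exI[of _ T] exI[of _ "b * minv ?B"] exI[of _ r] conjI)
qed

lemma Kmat_blocks:
 assumes S: "S \<subseteq> {1..<n}" and s: "s \<in> S"
 shows "Kmat n S t = bd s n (ul s (Kmat n S t)) (lr s n (Kmat n S t))"
proof (rule eq_matI)
 have sn: "1 <= s" "s < n" using S s by auto
 fix a b assume "a < dim_row (bd s n (ul s (Kmat n S t)) (lr s n (Kmat n S t)))" "b < dim_col (bd s n (ul s (Kmat n S t)) (lr s n (Kmat n S t)))"
 hence ab: "a < n" "b < n" by (simp_all add: bd_def)
 have z1: "Kmat n S t $$ (a, b) = 0" if "s <= a" "b < s"
  by (rule brkD[OF _ that(1) ab(1) that(2)]) (simp add: Kmat_brk_iff[OF S sn] s)
 have z2: "Kmat n S t $$ (a, b) = 0" if "a < s" "s <= b"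
  using no_break_inside[OF S s, of b] be_gt[OF S ab(2)] that ab by (simp add: Kmat_index)
 show "Kmat n S t $$ (a, b) = bd s n (ul s (Kmat n S t)) (lr s n (Kmat n S t)) $$ (a, b)"
  unfolding bd_index[OF ab] using z1 z2 ab by (auto simp: ul_def lr_def)
qed (simp_all add: bd_def Kmat_def)

lemma apx_blocks:
 assumes A: "apx s P A" and D: "apx (n - s) Q D"
 shows "apx n (%x. \<exists>A D. P A & Q D & x = bd s n A D) (bd s n A D)"
proof -
 obtain X where X0: "\<forall>m::nat. X m \<in> carrier_mat s s & P (X m)" "\<forall>a<s. \<forall>b<s. (%m. X m $$ (a, b)) \<longlonglongrightarrow> A $$ (a, b)"
  using A unfolding apx_def by (elim exE conjE) (rule that)
 obtain Y where Y0: "\<forall>m::nat. Y m \<in> carrier_mat (n - s) (n - s) & Q (Y m)" "\<forall>a<(n - s). \<forall>b<(n - s). (%m. Y m $$ (a, b)) \<longlonglongrightarrow> D $$ (a, b)"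
  using D unfolding apx_def by (elim exE conjE) (rule that)
 have X: "P (X m)" "a < s ==> b < s ==> (%m. X m $$ (a, b)) \<longlonglongrightarrow> A $$ (a, b)" for m a b using X0 by blast+
 have Y: "Q (Y m)" "a < n - s ==> b < n - s ==> (%m. Y m $$ (a, b)) \<longlonglongrightarrow> D $$ (a, b)" for m a b using Y0 by blast+
 show ?thesis
 proof (rule apxI[where X = "%m. bd s n (X m) (Y m)"])
  show "\<forall>\<^sub>F m in sequentially. \<exists>A D. P A & Q D & bd s n (X m) (Y m) = bd s n A D"
   by (rule always_eventually) (use X(1) Y(1) in blast)
  fix a b assume ab: "a < n" "b < n"
  show "(%m. bd s n (X m) (Y m) $$ (a, b)) \<longlonglongrightarrow> bd s n A D $$ (a, b)"
  proof (cases "a < s & b < s")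
   case True
   thus ?thesis unfolding bd_index[OF ab] using X(2)[of a b] by simp
  next
   case F: False
   show ?thesis
   proof (cases "s <= a & s <= b")
    case True
    hence "a - s < n - s" "b - s < n - s" using ab by auto
    thus ?thesis unfolding bd_index[OF ab] using Y(2)[of "a - s" "b - s"] F True by simp
   next
    case False
    show ?thesis unfolding bd_index[OF ab] if_not_P[OF F] if_not_P[OF False] by (rule tendsto_const)
   qed
  qed
 qed simp
qed

text \<open>
Induction on \<open>n\<close>: at a break the normal form consists of two smaller Peterson matrices, each a limit of corner matrices; and a point with two corner blocks is a limit of corner matrices by \<open>generic_corner\<close>.
\<close>

lemma corner_dense:
 assumes "1 <= n" "PM n g"
 shows "apx n (corner n) g"
 using assms
proof (induction n arbitrary: g rule: less_induct)
 case (less n)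
 note gG = PM_GL[OF less.prems(2)]
 note gc = GL_carrier[OF gG]
 have n0: "n - 1 < n" "0 < n" using less.prems(1) by auto
 define S where "S = breaks n g"
 have S: "S \<subseteq> {1..<n}" by (auto simp: S_def)
 obtain t b where b: "b \<in> borel_subgroup n" and K: "Kmat n S t = g * b"
  using PM_normal_form[OF less.prems(2)] unfolding S_def by blast
 note bc = borel_carrier[OF b]
 show ?case
 proof (cases "S = {}")
  case True
  have "Kmat n {} t $$ (n - 1, 0) = 1" using n0 by (simp add: Kmat_empty_index)
  hence "(g * b) $$ (n - 1, 0) = 1" using K True by simp
  hence "g $$ (n - 1, 0) ~= 0" unfolding corner_mult_right[OF gc b less.prems(1)] by auto
  thus ?thesis using less.prems(2) by (intro apx_refl[OF gc]) (simp add: corner_def)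
 next
  case False
  then obtain s where sS: "s \<in> S" by blast
  have "s \<in> {1..<n}" using sS S by (rule subsetD[rotated])
  hence s: "1 <= s" "s < n" "s <= n" "1 <= n - s" "n - s < n" by (simp_all add: Suc_le_eq)
  let ?K = "Kmat n S t"
  have PK: "PM n ?K" by (rule Kmat_PM[OF S])
  have bK: "brk n ?K s" using Kmat_brk_iff[OF S s(1,2)] sS by simp
  have "apx n (%x. \<exists>A D. corner s A & corner (n - s) D & x = bd s n A D) (bd s n (ul s ?K) (lr s n ?K))"
   by (rule apx_blocks[OF less.IH[OF s(2,1) block_PM(1)[OF PK bK s(3)]] less.IH[OF s(5,4) block_PM(2)[OF PK bK s(3)]]])
  hence 1: "apx n (%x. \<exists>A D. corner s A & corner (n - s) D & x = bd s n A D) ?K"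
   unfolding Kmat_blocks[OF S sS, symmetric] .
  have 2: "apx n (corner n) ?K"
  proof (rule apx_trans[OF 1])
   fix x assume "\<exists>A D. corner s A & corner (n - s) D & x = bd s n A D"
   then obtain A D where AD: "corner s A" "corner (n - s) D" "x = bd s n A D" by (elim exE conjE) (rule that)
   obtain T d r where T: "T \<in> borel_subgroup n" "NN n * T = T * NN n" "d \<in> borel_subgroup n" "coeff r 0 ~= 0"
    "bd s n A D = T * Gd n s (monom 1 (n - s)) r * d" using corner_blocks[OF s(1,2) AD(1,2)] by (elim exE conjE) (rule that)
   show "apx n (corner n) x"
    unfolding AD(3) T(5)
   proof (rule apx_mult[OF generic_corner[OF s(1,2) T(4)] Gd_carrier borel_carrier[OF T(1)] borel_carrier[OF T(3)]])
    fix y assume y: "y \<in> carrier_mat n n" "PM n y & y $$ (n - 1, 0) ~= 0"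
    note Tc = borel_carrier[OF T(1)] and dc = borel_carrier[OF T(3)]
    have "PM n (T * y * d)" by (rule PM_mult_borel[OF PM_mult_left[OF conjunct1[OF y(2)] borel_GL[OF T(1)] T(2)] T(3)])
    moreover have "(T * y * d) $$ (n - 1, 0) = T $$ (n - 1, n - 1) * y $$ (n - 1, 0) * d $$ (0, 0)"
     unfolding corner_mult_right[OF mult_carrier_square[OF Tc y(1)] T(3) less.prems(1)]
      corner_mult_left[OF y(1) T(1) less.prems(1)] ..
    ultimately show "corner n (T * y * d)"
     using y(2) borel_diag[OF T(1) n0(1)] borel_diag[OF T(3) n0(2)] by (simp add: corner_def)
   qed
  qed
  have Kc: "?K \<in> carrier_mat n n" by simp
  have g_eq: "g = 1\<^sub>m n * ?K * minv b"
   unfolding K left_mult_one_mat[OF mult_carrier_square[OF gc bc]] by (rule GL_cancel_right[OF borel_GL[OF b] gc, symmetric])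
  have "apx n (corner n) (1\<^sub>m n * ?K * minv b)"
  proof (rule apx_mult[OF 2 Kc one_carrier_mat minv_carrier[OF bc]])
   fix y assume y: "y \<in> carrier_mat n n" "corner n y"
   note m = borel_minv[OF b]
   have "PM n (y * minv b)" using y(2) PM_mult_borel[OF _ m] by (simp add: corner_def)
   moreover have "(y * minv b) $$ (n - 1, 0) = y $$ (n - 1, 0) * minv b $$ (0, 0)"
    by (rule corner_mult_right[OF y(1) m less.prems(1)])
   ultimately show "corner n (1\<^sub>m n * y * minv b)" unfolding left_mult_one_mat[OF y(1)] using y borel_diag[OF m n0(2)] by (simp add: corner_def)
  qed
  thus ?thesis unfolding g_eq[symmetric] .
 qed
qed

lemma hatT_borel:
 assumes g: "PM n g" and b: "b \<in> borel_subgroup n"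
 shows "cfun.dim (hatT n g) <= cfun.dim (hatT n (g * b))"
proof -
 have "NN n * 1\<^sub>m n = 1\<^sub>m n * NN n"
  unfolding right_mult_one_mat[OF NN_carrier] left_mult_one_mat[OF NN_carrier] ..
 from hatT_mult[OF g borel_GL[OF borel_one] this b] show ?thesis
  unfolding left_mult_one_mat[OF GL_carrier[OF PM_GL[OF g]]] .
qed

text \<open>
Make both blocks at the break corner matrices by approximation. Up to the centraliser of \<open>N\<close> and \<open>B\<close> this is the base point of \<open>generic_dim\<close>.
\<close>

lemma break_dim:
 assumes g: "PM n g" and s: "2 <= s" "s + 2 <= n" and bs: "brk n g s"
 shows "card (upper_index n) + n <= cfun.dim (hatT n g)"
proof -
 note gG = PM_GL[OF g]
 note gc = GL_carrier[OF gG]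
 define S where "S = breaks n g"
 have S: "S \<subseteq> {1..<n}" by (auto simp: S_def)
 have sS: "s \<in> S" using s bs by (simp add: S_def)
 have s': "1 <= s" "s < n" "s <= n" "1 <= n - s" using s by auto
 obtain t b where b: "b \<in> borel_subgroup n" and K: "Kmat n S t = g * b"
  using PM_normal_form[OF g] unfolding S_def by blast
 note bc = borel_carrier[OF b]
 let ?K = "Kmat n S t"
 have PK: "PM n ?K" by (rule Kmat_PM[OF S])
 have bK: "brk n ?K s" using Kmat_brk_iff[OF S s'(1,2)] sS by simp
 have "apx n (%x. \<exists>A D. corner s A & corner (n - s) D & x = bd s n A D) (bd s n (ul s ?K) (lr s n ?K))"
  by (rule apx_blocks[OF corner_dense[OF s'(1) block_PM(1)[OF PK bK s'(3)]] corner_dense[OF s'(4) block_PM(2)[OF PK bK s'(3)]]])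
 hence 1: "apx n (%x. \<exists>A D. corner s A & corner (n - s) D & x = bd s n A D) ?K"
  unfolding Kmat_blocks[OF S sS, symmetric] .
 have "apx n (%x. card (upper_index n) + n <= cfun.dim (hatT n x)) ?K"
 proof (rule apx_trans[OF 1])
  fix x assume x: "x \<in> carrier_mat n n" "\<exists>A D. corner s A & corner (n - s) D & x = bd s n A D"
  from x(2) obtain A D where AD: "corner s A" "corner (n - s) D" "x = bd s n A D" by (elim exE conjE) (rule that)
  obtain T d r where T: "T \<in> borel_subgroup n" "NN n * T = T * NN n" "d \<in> borel_subgroup n" "coeff r 0 ~= 0"
   "bd s n A D = T * Gd n s (monom 1 (n - s)) r * d" using corner_blocks[OF s'(1,2) AD(1,2)] by (elim exE conjE) (rule that)
  have "card (upper_index n) + n <= cfun.dim (hatT n (Gd n s (monom 1 (n - s)) r))"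
   by (rule generic_dim[OF s'(1,2) T(4) s])
  also have "... <= cfun.dim (hatT n x)"
   unfolding AD(3) T(5) by (rule hatT_mult[OF base_PM[OF s'(1,2) T(4)] borel_GL[OF T(1)] T(2,3)])
  finally show "apx n (%x. card (upper_index n) + n <= cfun.dim (hatT n x)) x" by (rule apx_refl[OF x(1)])
 qed
 hence "card (upper_index n) + n <= cfun.dim (hatT n ?K)" by (rule apx_dim)
 also have "... <= cfun.dim (hatT n (?K * minv b))" by (rule hatT_borel[OF PK borel_minv[OF b]])
 also have "?K * minv b = g" unfolding K by (rule GL_cancel_right[OF borel_GL[OF b] gc])
 finally show ?thesis .
qed

section \<open>Breaks exactly at both ends\<close>

definition ein :: "nat => nat \<times> nat => bool" where
 "ein n i \<longleftrightarrow> fst i < n & snd i = 0"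

definition dirF :: "nat => complex poly => nat \<times> nat => complex" where
 "dirF n q i = (if ein n i then coeff q (n - 1 - fst i) else 0)"

definition din :: "nat => nat \<times> nat => bool" where
 "din n i \<longleftrightarrow> fst i < n & 1 <= snd i & snd i < n - 1 & fst i + (snd i - 1) < n"

definition dirM :: "nat => complex poly => nat \<times> nat => complex" where
 "dirM n q i = (if din n i then coeff q (n - 1 - fst i - (snd i - 1)) else 0)"

definition lastc :: "nat => nat \<times> nat => complex" where
 "lastc n i = (if fst i = n - 1 & snd i = n - 1 then 1 else 0)"

text \<open>
Columns \<open>p0\<close>, then \<open>z^(b-1) p\<close>, then \<open>1\<close>, in the notation of \<open>Gd\<close>. At the base point they are \<open>z^(n-1)\<close>, \<open>z, ..., z^(n-2)\<close>, \<open>1\<close>.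
\<close>

definition Hd :: "nat => complex poly => complex poly => complex mat" where
 "Hd n p0 p = mat n n (%i. dirF n p0 i + dirM n p i + lastc n i)"

lemma Hd_carrier[simp]: "Hd n p0 p \<in> carrier_mat n n" by (simp add: Hd_def)

lemma Hd_sum: "a < n ==> b < n ==> Hd n p0 p $$ (a, b) = dirF n p0 (a, b) + dirM n p (a, b) + lastc n (a, b)"
 by (simp add: Hd_def)

lemma dirF_affine: "1 <= n ==> dirF n q \<in> affine_space (hatE n)"
 unfolding affine_space_def hatE_def dirF_def ein_def by simp

lemma dirM_affine: "dirM n q \<in> affine_space (hatE n)"
proof -
 have "dirM n q i = 0" if "i \<notin> hatE n" for i
 proof -
  obtain a b where ab: "i = (a, b)" by (cases i)
  have "~ din n i" using that unfolding ab din_def hatE_def fst_conv snd_conv by auto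
  thus ?thesis by (simp add: dirM_def)
 qed
 thus ?thesis unfolding affine_space_def by blast
qed

lemma dirFM_linear:
 "dirF n (p + smult c q) i = dirF n p i + c * dirF n q i"
 "dirM n (p + smult c q) i = dirM n p i + c * dirM n q i"
 by (simp_all add: dirF_def dirM_def)

lemma dirFM_sum:
 "dirF n (\<Sum>k\<in>A. smult (y k) (q k)) i = (\<Sum>k\<in>A. y k * dirF n (q k) i)"
 "dirM n (\<Sum>k\<in>A. smult (y k) (q k)) i = (\<Sum>k\<in>A. y k * dirM n (q k) i)"
 by (simp_all add: dirF_def dirM_def coeff_sum)

context
 fixes n :: nat
 assumes n: "3 <= n"
begin

lemma Hd_col0: "a < n ==> Hd n p0 p $$ (a, 0) = coeff p0 (n - 1 - a)"
 using n by (simp add: Hd_sum dirF_def ein_def dirM_def din_def lastc_def)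

lemma Hd_mid: "a < n ==> 1 <= b ==> b < n - 1 ==> Hd n p0 p $$ (a, b) = (if a + (b - 1) < n then coeff p (n - 1 - a - (b - 1)) else 0)"
 using n by (simp add: Hd_sum dirF_def ein_def dirM_def din_def lastc_def)

lemma Hd_last: "a < n ==> Hd n p0 p $$ (a, n - 1) = (if a = n - 1 then 1 else 0)"
 using n by (simp add: Hd_sum dirF_def ein_def dirM_def din_def lastc_def)

text \<open>
The hypothesis reads \<open>z p0 = \<alpha> p0 + \<beta> p\<close> modulo \<open>z^n\<close>.
\<close>

lemma Hd_PM:
 assumes z: "!!i. i < n ==> (if i = 0 then 0 else coeff p0 (i - 1)) = \<alpha> * coeff p0 i + \<beta> * coeff p i"
  and d: "det (Hd n p0 p) ~= 0"
 shows "PM n (Hd n p0 p)"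
proof (rule PM_of_columns)
 show "Hd n p0 p \<in> GL n" using d by (simp add: GL_iff)
 fix j assume j: "Suc j < n - 1"
 show "\<exists>c. \<forall>a<n. (if Suc a < n then Hd n p0 p $$ (Suc a, j) else 0) = (\<Sum>l\<le>Suc j. Hd n p0 p $$ (a, l) * c l)"
 proof (cases "j = 0")
  case True
  show ?thesis
  proof (intro exI[of _ "%l. if l = 0 then \<alpha> else \<beta>"] allI impI)
   fix a assume a: "a < n"
   have 1: "Hd n p0 p $$ (a, 1) = coeff p (n - 1 - a)" using Hd_mid[OF a, of 1] a n by simp
   have "(if Suc a < n then Hd n p0 p $$ (Suc a, j) else 0) = (if n - 1 - a = 0 then 0 else coeff p0 (n - 1 - a - 1))"
    using a Hd_col0[of "Suc a" p0 p] True by auto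
   also have "... = \<alpha> * coeff p0 (n - 1 - a) + \<beta> * coeff p (n - 1 - a)" by (rule z) (use a in simp)
   also have "... = (\<Sum>l\<le>Suc 0. Hd n p0 p $$ (a, l) * (if l = 0 then \<alpha> else \<beta>))"
    using 1 Hd_col0[OF a, of p0 p] by simp
   finally show "(if Suc a < n then Hd n p0 p $$ (Suc a, j) else 0) = (\<Sum>l\<le>Suc j. Hd n p0 p $$ (a, l) * (if l = 0 then \<alpha> else \<beta>))"
    unfolding True .
  qed
 next
  case False
  show ?thesis
  proof (intro exI[of _ "%l. if l = Suc j then 1 else 0"] allI impI)
   fix a assume a: "a < n"
   have "(\<Sum>l\<le>Suc j. Hd n p0 p $$ (a, l) * (if l = Suc j then 1 else 0)) = Hd n p0 p $$ (a, Suc j)"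
    by (simp add: if_distrib cong: if_cong)
   also have "... = (if a + j < n then coeff p (n - 1 - a - j) else 0)"
    using Hd_mid[OF a, of "Suc j"] j by simp
   also have "... = (if Suc a < n then Hd n p0 p $$ (Suc a, j) else 0)"
   proof (cases "Suc a < n")
    case True
    have "Suc a + (j - 1) = a + j" "n - 1 - Suc a - (j - 1) = n - 1 - a - j" using False by auto
    thus ?thesis using Hd_mid[OF True, of j p0 p] False j True by simp
   next
    case F: False
    hence "~ a + j < n" using a False by linarith
    thus ?thesis using F by simp
   qed
   finally show "(if Suc a < n then Hd n p0 p $$ (Suc a, j) else 0) = (\<Sum>l\<le>Suc j. Hd n p0 p $$ (a, l) * (if l = Suc j then 1 else 0))" ..
  qed
 qed
qed

abbreviation ends :: "nat set" where "ends \<equiv> {1, n - 1}"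

lemma ends_subset: "ends \<subseteq> {1..<n}" using n by auto

lemma ends_blocks:
 "bs ends 0 = 0" "be n ends 0 = 1"
 "1 <= b ==> b < n - 1 ==> bs ends b = 1" "1 <= b ==> b < n - 1 ==> be n ends b = n - 1"
 "bs ends (n - 1) = n - 1" "be n ends (n - 1) = n"
proof -
 note S = ends_subset
 show "bs ends 0 = 0" using bs_le[OF S, of 0] by simp
 show "be n ends 0 = 1" using no_break_inside[OF S, of 1 0] be_gt[OF S, of 0] bs_le[OF S, of 0] n by simp
 show "bs ends (n - 1) = n - 1" using break_start[OF S, of "n - 1"] by simp
 show "be n ends (n - 1) = n" using be_gt[OF S, of "n - 1"] be_le[OF S, of "n - 1"] n by simp
 assume b: "1 <= b" "b < n - 1"
 have bn: "b < n" using b by simp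
 have m: "n - 1 \<in> ends" "1 \<in> ends" by auto
 have 1: "1 <= bs ends b" using no_break_inside[OF S m(2), of b] be_gt[OF S bn] b by linarith
 have 2: "be n ends b <= n - 1" using no_break_inside[OF S m(1), of b] bs_le[OF S, of b] b by linarith
 show "bs ends b = 1" using 1 bs_S[OF S, of b] bs_le[OF S, of b] b by auto
 show "be n ends b = n - 1" using 2 be_S[OF S, of b] be_gt[OF S bn] b by auto
qed

lemma ends_index:
 assumes a: "a < n"
 shows "Kmat n ends t $$ (a, 0) = (if a = 0 then 1 else 0)"
  "1 <= b ==> b < n - 1 ==> Kmat n ends t $$ (a, b) = (if 1 <= a & a + b < n then (if n - 1 - a - b = 0 then 1 else t (1 + (n - 1 - a - b))) else 0)"
  "Kmat n ends t $$ (a, n - 1) = (if a = n - 1 then 1 else 0)"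
proof -
 have n0: "0 < n" "n - 1 < n" using n by auto
 show "Kmat n ends t $$ (a, 0) = (if a = 0 then 1 else 0)"
  unfolding Kmat_index[OF a n0(1)] ends_blocks(1,2) by auto
 show "Kmat n ends t $$ (a, n - 1) = (if a = n - 1 then 1 else 0)"
  unfolding Kmat_index[OF a n0(2)] ends_blocks(5,6) using a by auto
 assume b: "1 <= b" "b < n - 1"
 have bn: "b < n" using b by simp
 have "1 + (n - 1) = n" using n by simp
 thus "Kmat n ends t $$ (a, b) = (if 1 <= a & a + b < n then (if n - 1 - a - b = 0 then 1 else t (1 + (n - 1 - a - b))) else 0)"
  unfolding Kmat_index[OF a bn] ends_blocks(3,4)[OF b] using a b by auto
qed

abbreviation ebase :: "complex mat" where "ebase \<equiv> Hd n (monom 1 (n - 1)) (monom 1 1)"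

lemma ebase_index:
 assumes a: "a < n"
 shows "ebase $$ (a, 0) = (if a = 0 then 1 else 0)"
  "1 <= b ==> b < n - 1 ==> ebase $$ (a, b) = (if a + b = n - 1 then 1 else 0)"
  "ebase $$ (a, n - 1) = (if a = n - 1 then 1 else 0)"
proof -
 show "ebase $$ (a, 0) = (if a = 0 then 1 else 0)" using a by (auto simp: Hd_col0)
 show "ebase $$ (a, n - 1) = (if a = n - 1 then 1 else 0)" by (rule Hd_last[OF a])
 assume b: "1 <= b" "b < n - 1"
 show "ebase $$ (a, b) = (if a + b = n - 1 then 1 else 0)" unfolding Hd_mid[OF a b] using a b by auto
qed

lemma ebase_eq: "ebase = Kmat n ends (%_. 0)"
proof (rule eq_matI)
 fix a b assume "a < dim_row (Kmat n ends (%_. 0))" "b < dim_col (Kmat n ends (%_. 0))"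
 hence ab: "a < n" "b < n" by (simp_all add: Kmat_def)
 consider "b = 0" | "1 <= b" "b < n - 1" | "b = n - 1" using ab by linarith
 thus "ebase $$ (a, b) = Kmat n ends (%_. 0) $$ (a, b)"
 proof cases
  case 1
  thus ?thesis using ebase_index(1)[OF ab(1)] ends_index(1)[OF ab(1)] by simp
 next
  case 2
  show ?thesis unfolding ebase_index(2)[OF ab(1) 2] ends_index(2)[OF ab(1) 2] using 2 ab by auto
 next
  case 3
  thus ?thesis using ebase_index(3)[OF ab(1)] ends_index(3)[OF ab(1)] by simp
 qed
qed (simp_all add: Hd_def Kmat_def)

lemma ebase_PM: "PM n ebase" unfolding ebase_eq by (rule Kmat_PM[OF ends_subset])

lemma ends_normal_form:
 "\<exists>T b. T \<in> GL n & NN n * T = T * NN n & b \<in> borel_subgroup n & Kmat n ends t = T * ebase * b"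
proof -
 let ?K = "Kmat n ends t"
 define f where "f d = (if d = 0 then 1 else t (1 + d))" for d
 have f0: "f 0 = 1" by (simp add: f_def)
 obtain c where c: "c 0 = 1" "\<forall>d. (\<Sum>i\<le>d. c i * f (d - i)) = (if d = 0 then 1 else 0)"
  using convolution_inverse_exists[of f, OF f0] by (elim exE conjE) (rule that)
 define T where "T = toep n c"
 have TB: "T \<in> borel_subgroup n" unfolding T_def by (rule toep_borel) (simp add: c)
 have TG: "T \<in> GL n" by (rule borel_GL[OF TB])
 have W: "(T * ?K) $$ (a, j) = (\<Sum>l<n. toep n c $$ (a, l) * ?K $$ (l, j))" if "a < n" "j < n" for a j
  unfolding T_def by (rule mat_mult_index[OF toep_carrier Kmat_carrier that])
 have n0: "0 < n" "n - 1 < n" using n by auto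
 have W0: "(T * ?K) $$ (a, 0) = (if a = 0 then 1 else 0)" if a: "a < n" for a
 proof -
  have "(T * ?K) $$ (a, 0) = (\<Sum>l<n. if l = 0 then toep n c $$ (a, l) else 0)"
   unfolding W[OF a n0(1)]
  proof (intro sum.cong refl)
   fix l assume "l \<in> {..<n}"
   thus "toep n c $$ (a, l) * ?K $$ (l, 0) = (if l = 0 then toep n c $$ (a, l) else 0)" using ends_index(1)[of l t] by simp
  qed
  thus ?thesis using a n0 c by (simp add: toep_def)
 qed
 have W1: "(T * ?K) $$ (a, j) = (if a + j = n - 1 then 1 else 0)" if aj: "1 <= a" "a < n" "1 <= j" "j < n - 1" for a j
 proof -
  have a: "1 <= a" "a < n" and j: "1 <= j" "j < n - 1" by (rule aj)+
  have jn: "j < n" using j by simp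
  have "(T * ?K) $$ (a, j) = (if a + j < n then \<Sum>i\<le>n - 1 - a - j. c i * f (n - 1 - a - j - i) else 0)"
   unfolding W[OF a(2) jn]
  proof (rule toep_mult_hankel[OF a(2) order_refl])
   fix l assume "a <= l" "l < n"
   thus "?K $$ (l, j) = (if l + j < n then f (n - 1 - l - j) else 0)"
    using ends_index(2)[of l j t] j a(1) by (simp add: f_def)
  qed
  also have "... = (if a + j = n - 1 then 1 else 0)" unfolding c(2)[rule_format] using a j by auto
  finally show ?thesis .
 qed
 have W2: "(T * ?K) $$ (n - 1, n - 1) = 1"
 proof -
  have "(T * ?K) $$ (n - 1, n - 1) = (\<Sum>l<n. if l = n - 1 then toep n c $$ (n - 1, l) else 0)"
   unfolding W[OF n0(2) n0(2)]
  proof (intro sum.cong refl)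
   fix l assume "l \<in> {..<n}"
   thus "toep n c $$ (n - 1, l) * ?K $$ (l, n - 1) = (if l = n - 1 then toep n c $$ (n - 1, l) else 0)"
    using ends_index(3)[of l t] by simp
  qed
  thus ?thesis using n0 c by (simp add: toep_def)
 qed
 (* The base point is the permutation matrix of this involution. *)
 define \<pi> where "\<pi> i = (if i = 0 \<or> i = n - 1 then i else n - 1 - i)" for i
 have \<pi>v: "\<pi> i = n - 1 & i = n - 1 \<or> \<pi> i = n - 1 - i & i < n - 1" if "0 < i" "i < n" for i
 proof (cases "i = n - 1")
  case True
  thus ?thesis by (simp add: \<pi>_def)
 next
  case False
  hence "\<pi> i = n - 1 - i" "i < n - 1" using that by (simp_all add: \<pi>_def)
  thus ?thesis by blast
 qed
 have \<pi>: "\<pi> i < n" "\<pi> (\<pi> i) = i" if "i < n" for i using that by (auto simp: \<pi>_def)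
 define b where "b = mat n n (%(i, j). (T * ?K) $$ (\<pi> i, j))"
 have bc: "b \<in> carrier_mat n n" by (simp add: b_def)
 have hb: "ebase $$ (a, l) = (if l = \<pi> a then 1 else 0)" if al: "a < n" "l < n" for a l
 proof -
  consider "l = 0" | "1 <= l" "l < n - 1" | "l = n - 1" using al by linarith
  thus ?thesis
  proof cases
   case 1
   show ?thesis unfolding 1 ebase_index(1)[OF al(1)] \<pi>_def using al n by auto
  next
   case 2
   show ?thesis unfolding ebase_index(2)[OF al(1) 2] \<pi>_def using al 2 by auto
  next
   case 3
   show ?thesis unfolding 3 ebase_index(3)[OF al(1)] \<pi>_def using al n by auto
  qed
 qed
 have eq: "T * ?K = ebase * b"
 proof (rule eq_matI)
  fix a j assume "a < dim_row (ebase * b)" "j < dim_col (ebase * b)"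
  hence aj: "a < n" "j < n" using bc by (auto simp: Hd_def)
  have "(ebase * b) $$ (a, j) = (\<Sum>l<n. ebase $$ (a, l) * b $$ (l, j))" by (rule mat_mult_index[OF Hd_carrier bc aj])
  also have "... = (\<Sum>l<n. if l = \<pi> a then b $$ (l, j) else 0)" 
  proof (intro sum.cong refl)
   fix l assume "l \<in> {..<n}"
   hence l: "l < n" by simp
   show "ebase $$ (a, l) * b $$ (l, j) = (if l = \<pi> a then b $$ (l, j) else 0)" unfolding hb[OF aj(1) l] by simp
  qed
  also have "... = b $$ (\<pi> a, j)" using \<pi>(1)[OF aj(1)] by simp
  also have "... = (T * ?K) $$ (a, j)" using \<pi>[OF aj(1)] aj by (simp add: b_def)
  finally show "(T * ?K) $$ (a, j) = (ebase * b) $$ (a, j)" ..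
 qed (use bc in \<open>auto simp: T_def toep_def Hd_def Kmat_def\<close>)
 have bB: "b \<in> borel_subgroup n"
 proof (rule borelI[OF bc])
  fix i j assume ij: "j < i" "i < n"
  have e: "b $$ (i, j) = (T * ?K) $$ (\<pi> i, j)" using ij by (simp add: b_def)
  have "0 < i" using ij by simp
  note p1 = \<pi>v[OF this ij(2)]
  show "b $$ (i, j) = 0"
  proof (cases "j = 0")
   case True
   have "\<pi> i ~= 0" using p1 n by (elim disjE) linarith+
   thus ?thesis using e W0[OF \<pi>(1)[OF ij(2)]] True by simp
  next
   case False
   have "1 <= \<pi> i" using p1 n by (elim disjE) linarith+
   moreover have "1 <= j" "j < n - 1" using ij False by linarith+
   moreover have "\<pi> i + j ~= n - 1" using p1 ij n False by (elim disjE) linarith+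
   ultimately show ?thesis unfolding e using W1[of "\<pi> i" j] \<pi>(1)[OF ij(2)] by simp
  qed
 next
  fix i assume i: "i < n"
  have e: "b $$ (i, i) = (T * ?K) $$ (\<pi> i, i)" using i by (simp add: b_def)
  consider "i = 0" | "i = n - 1" | "1 <= i" "i < n - 1" using i by linarith
  thus "b $$ (i, i) ~= 0"
  proof cases
   case 1
   have "\<pi> 0 = 0" by (simp add: \<pi>_def)
   thus ?thesis using e W0[OF n0(1)] 1 by simp
  next
   case 2
   have "\<pi> i = n - 1" using 2 by (simp add: \<pi>_def)
   thus ?thesis unfolding e using W2 2 by simp
  next
   case 3
   have "0 < i" using 3 by simp
   from \<pi>v[OF this i] 3 have "\<pi> i = n - 1 - i" by (elim disjE) linarith+
   hence "1 <= \<pi> i" "\<pi> i < n" "\<pi> i + i = n - 1" using 3 by linarith+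
   thus ?thesis unfolding e using W1[of "\<pi> i" i] 3 by simp
  qed
 qed
 have "?K = minv T * (ebase * b)" unfolding eq[symmetric] by (rule GL_cancel_left[OF TG Kmat_carrier, symmetric])
 also have "... = minv T * ebase * b" by (rule square_assoc[OF minv_carrier[OF GL_carrier[OF TG]] Hd_carrier bc, symmetric])
 finally have "?K = minv T * ebase * b" .
 moreover have "NN n * minv T = minv T * NN n" by (rule commute_minv[OF TG]) (simp add: T_def toep_commute)
 ultimately show ?thesis using GL_minv[OF TG] bB by (intro exI[of _ "minv T"] exI[of _ b] conjI)
qed

lemma Hd_line:
 "mat n n (%i. Hd n p0 p $$ i + t * dirF n q i) = Hd n (p0 + smult t q) p"
 "mat n n (%i. Hd n p0 p $$ i + t * dirM n q i) = Hd n p0 (p + smult t q)"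
 by (rule eq_matI, auto simp: Hd_def dirFM_linear)+

lemma tangent_middle: "dirM n q \<in> hatT n ebase"
proof (rule hatT_line[OF ebase_PM dirM_affine])
 fix t assume d: "det (mat n n (%i. ebase $$ i + t * dirM n q i)) ~= 0"
 have e: "mat n n (%i. ebase $$ i + t * dirM n q i) = Hd n (monom 1 (n - 1)) (monom 1 1 + smult t q)"
  by (rule Hd_line)
 show "PM n (mat n n (%i. ebase $$ i + t * dirM n q i))"
  unfolding e
 proof (rule Hd_PM[where \<alpha> = 0 and \<beta> = 0])
  fix i assume "i < n"
  thus "(if i = 0 then 0 else coeff (monom 1 (n - 1)) (i - 1)) = 0 * coeff (monom 1 (n - 1)) i + 0 * coeff (monom 1 1 + smult t q) i"
   by auto
 qed (use d e in simp)
qed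

text \<open>
For \<open>p0 = z^(n-1) + t\<close> and \<open>p = z\<close> one has \<open>z p0 = t p\<close> modulo \<open>z^n\<close>.
\<close>

lemma tangent_first_constant: "dirF n (monom 1 0) \<in> hatT n ebase"
proof (rule hatT_line[OF ebase_PM dirF_affine])
 show "1 <= n" using n by simp
 fix t assume d: "det (mat n n (%i. ebase $$ i + t * dirF n (monom 1 0) i)) ~= 0"
 have e: "mat n n (%i. ebase $$ i + t * dirF n (monom 1 0) i) = Hd n (monom 1 (n - 1) + smult t (monom 1 0)) (monom 1 1)"
  by (rule Hd_line)
 show "PM n (mat n n (%i. ebase $$ i + t * dirF n (monom 1 0) i))"
  unfolding e
 proof (rule Hd_PM[where \<alpha> = 0 and \<beta> = t])
  fix i assume i: "i < n"
  show "(if i = 0 then 0 else coeff (monom 1 (n - 1) + smult t (monom 1 0)) (i - 1)) =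
    0 * coeff (monom 1 (n - 1) + smult t (monom 1 0)) i + t * coeff (monom 1 1) i"
   unfolding coeff_add coeff_smult coeff_monom using i by auto
 qed (use d e in simp)
qed

text \<open>
\<open>z^(n-1) + t z^(n-2) + ... + t^(n-2) z\<close>, which satisfies \<open>z p0 = t p0 - t^(n-1) z\<close> modulo \<open>z^n\<close>.
\<close>

definition geom :: "complex => complex poly" where
 "geom t = (\<Sum>j\<in>{1..<n}. monom (t ^ (n - 1 - j)) j)"

lemma coeff_geom: "coeff (geom t) j = (if 1 <= j & j < n then t ^ (n - 1 - j) else 0)"
 by (simp add: geom_def coeff_sum)

lemma tangent_first_geometric: "dirF n (monom 1 (n - 2)) \<in> hatT n ebase"
proof (rule hatT_curve[OF ebase_PM, where c = "%t i. dirF n (geom t) i + dirM n (monom 1 1) i + lastc n i"])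
 show "dirF n (monom 1 (n - 2)) \<in> affine_space (hatE n)" by (rule dirF_affine) (use n in simp)
next
 fix a b assume ab: "a < n" "b < n"
 have g0: "coeff (geom 0) j = coeff (monom 1 (n - 1)) j" if "j < n" for j
  using that n by (auto simp: coeff_geom zero_power)
 show "dirF n (geom 0) (a, b) + dirM n (monom 1 1) (a, b) + lastc n (a, b) = ebase $$ (a, b)"
  unfolding Hd_sum[OF ab] using g0[of "n - 1 - a"] ab by (simp add: dirF_def ein_def)
next
 fix t assume d: "det (mat n n (%i. dirF n (geom t) i + dirM n (monom 1 1) i + lastc n i)) ~= 0"
 have e: "mat n n (%i. dirF n (geom t) i + dirM n (monom 1 1) i + lastc n i) = Hd n (geom t) (monom 1 1)"
  unfolding Hd_def ..
 show "PM n (mat n n (%i. dirF n (geom t) i + dirM n (monom 1 1) i + lastc n i))"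
  unfolding e
 proof (rule Hd_PM[where \<alpha> = t and \<beta> = "- (t ^ (n - 1))"])
  fix i assume i: "i < n"
  consider "i = 0" | "i = 1" | "2 <= i" by linarith
  thus "(if i = 0 then 0 else coeff (geom t) (i - 1)) = t * coeff (geom t) i + - (t ^ (n - 1)) * coeff (monom 1 1) i"
  proof cases
   case 1
   thus ?thesis by (simp add: coeff_geom)
  next
   case 2
   have "t * t ^ (n - 1 - 1) = t ^ (n - 1)" unfolding power_Suc[symmetric] using n by (simp add: Suc_diff_Suc)
   thus ?thesis using 2 i by (simp add: coeff_geom)
  next
   case 3
   have "t * t ^ (n - 1 - i) = t ^ (n - 1 - (i - 1))" unfolding power_Suc[symmetric] using 3 i by (simp add: Suc_diff_Suc)
   moreover have f: "1 <= i - 1 & i - 1 < n" "1 <= i & i < n" "i ~= 0" "(1::nat) ~= i" using 3 i by linarith+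
   ultimately show ?thesis unfolding coeff_geom if_P[OF f(1)] if_P[OF f(2)] if_not_P[OF f(3)] coeff_monom if_not_P[OF f(4)]
    by (simp only: mult_zero_right add_0_right)
  qed
 qed (use d e in simp)
next
 fix a b assume ab: "a < n" "b < n"
 show "((%t. dirF n (geom t) (a, b) + dirM n (monom 1 1) (a, b) + lastc n (a, b)) has_field_derivative
   dirF n (monom 1 (n - 2)) (a, b)) (at 0)"
 proof (cases "b = 0 & a < n - 1")
  case True
  have ga: "dirF n (geom t) (a, b) = t ^ a" for t
  proof -
   have "1 <= n - 1 - a" "n - 1 - a < n" "n - 1 - (n - 1 - a) = a" using True by auto
   thus ?thesis using True ab unfolding dirF_def ein_def coeff_geom fst_conv snd_conv by simp
  qed
  have "((%t. t ^ a + dirM n (monom 1 1) (a, b) + lastc n (a, b)) has_field_derivative of_nat a * 0 ^ (a - 1)) (at (0::complex))"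
   by (auto intro!: derivative_eq_intros)
  moreover have "of_nat a * 0 ^ (a - 1) = dirF n (monom 1 (n - 2)) (a, b)"
  proof -
   have "n - 2 = n - 1 - a \<longleftrightarrow> a = 1" using True n by auto
   moreover have "of_nat a * 0 ^ (a - 1) = (if a = 1 then 1 else (0::complex))"
    by (cases "a = 0"; cases "a = 1") auto
   ultimately show ?thesis using True ab unfolding dirF_def ein_def coeff_monom fst_conv snd_conv by simp
  qed
  ultimately show ?thesis unfolding ga by simp
 next
  case False
  have ga: "dirF n (geom t) (a, b) = 0" for t
   using False ab unfolding dirF_def ein_def coeff_geom fst_conv snd_conv by auto
  have "dirF n (monom 1 (n - 2)) (a, b) = 0"
   using False ab n unfolding dirF_def ein_def coeff_monom fst_conv snd_conv by auto
  thus ?thesis unfolding ga by simp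
 qed
qed

text \<open>
Tangent directions: two in the first column, and \<open>z^k\<close> with \<open>k \<noteq> 1\<close> for \<open>p\<close>.
\<close>

lemma ebase_dim: "card (upper_index n) + n <= cfun.dim (hatT n ebase)"
proof -
 (* Exponent 1 in p is left out because p matters only up to scaling. *)
 define KP where "KP = {0, n - 2}"
 define KR where "KR = {..n - 2} - {1}"
 have fin: "finite KP" "finite KR" by (auto simp: KP_def KR_def)
 have "card KP = 2" "card KR = n - 2" using n by (simp_all add: KP_def KR_def)
 hence cK: "card (KP <+> KR) = n" using n fin by (simp add: card_Plus)
 define B where "B z = (case z of Inl e => dirF n (monom 1 e) | Inr k => dirM n (monom 1 k))" for z :: "nat + nat"
 have "card (upper_index n) + card (KP <+> KR) <= cfun.dim (hatT n ebase)"
 proof (rule hat_dim_ge[OF ebase_PM, where B = B])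
  show "finite (KP <+> KR)" using fin by simp
  fix z assume "z \<in> KP <+> KR"
  thus "B z \<in> hatT n ebase"
  proof (rule PlusE)
   fix e assume e: "e \<in> KP" "z = Inl e"
   show ?thesis
   proof (cases "e = 0")
    case True
    show ?thesis unfolding e(2) B_def sum.case True by (rule tangent_first_constant)
   next
    case False
    hence "e = n - 2" using e(1) by (simp add: KP_def)
    thus ?thesis unfolding e(2) B_def sum.case using tangent_first_geometric by (simp only:)
   qed
  next
   fix k assume "k \<in> KR" "z = Inr k"
   thus ?thesis using tangent_middle by (simp add: B_def)
  qed
 next
  fix w :: "nat + nat => complex" and X
  assume X: "X \<in> carrier_mat n n" "!!i j. j < i ==> i < n ==> X $$ (i, j) = 0"
   and eq: "!!a b. a < n ==> b < n ==> (\<Sum>k\<in>KP <+> KR. w k * B k (a, b)) = (ebase * X) $$ (a, b)"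
  define P where "P = (\<Sum>e\<in>KP. smult (w (Inl e)) (monom 1 e))"
  define R where "R = (\<Sum>k\<in>KR. smult (w (Inr k)) (monom 1 k))"
  have Pc: "coeff P e = (if e \<in> KP then w (Inl e) else 0)" for e
   unfolding P_def coeff_sum using fin by (simp add: if_distrib cong: if_cong)
  have Rc: "coeff R k = (if k \<in> KR then w (Inr k) else 0)" for k
   unfolding R_def coeff_sum using fin by (simp add: if_distrib cong: if_cong)
  have eq': "dirF n P (a, b) + dirM n R (a, b) = (ebase * X) $$ (a, b)" if "a < n" "b < n" for a b
   unfolding eq[OF that, symmetric] sum.Plus[OF fin] P_def R_def dirFM_sum o_def by (simp add: B_def)
  have n0: "0 < n" "1 < n" "1 < n - 1" using n by auto
  have P0: "w (Inl e) = 0" if e: "e \<in> KP" for e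
  proof -
   define a where "a = n - 1 - e"
   have "e = 0 \<or> e = n - 2" using e by (simp add: KP_def)
   hence a: "a < n" "n - 1 - a = e" "a ~= 0" using n unfolding a_def by (elim disjE; linarith)+
   have "dirF n P (a, 0) = coeff P e" using a by (simp add: dirF_def ein_def)
   moreover have "dirM n R (a, 0) = 0" by (simp add: dirM_def din_def)
   moreover have "(ebase * X) $$ (a, 0) = 0"
    unfolding mat_mult_index[OF Hd_carrier X(1) a(1) n0(1)]
   proof (rule sum.neutral, rule ballI)
    fix l assume l: "l \<in> {..<n}"
    show "ebase $$ (a, l) * X $$ (l, 0) = 0"
    proof (cases "l = 0")
     case True
     thus ?thesis using ebase_index(1)[OF a(1)] a(3) by simp
    next
     case False
     thus ?thesis using X(2)[of 0 l] l by simp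
    qed
   qed
   ultimately have "coeff P e = 0" using eq'[OF a(1) n0(1)] by simp
   thus ?thesis using Pc[of e] e by simp
  qed
  have R0: "w (Inr k) = 0" if k: "k \<in> KR" for k
  proof -
   define a where "a = n - 1 - k"
   have "k <= n - 2" "k ~= 1" using k by (simp_all add: KR_def)
   hence a: "a < n" "n - 1 - a = k" "a ~= 0" "a + 1 ~= n - 1" using n unfolding a_def by linarith+
   have "dirM n R (a, 1) = coeff R k" using a n0 unfolding dirM_def din_def fst_conv snd_conv by simp
   moreover have "dirF n P (a, 1) = 0" by (simp add: dirF_def ein_def)
   moreover have "(ebase * X) $$ (a, 1) = 0"
    unfolding mat_mult_index[OF Hd_carrier X(1) a(1) n0(2)]
   proof (rule sum.neutral, rule ballI)
    fix l assume l: "l \<in> {..<n}"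
    consider "l = 0" | "l = 1" | "1 < l" by linarith
    thus "ebase $$ (a, l) * X $$ (l, 1) = 0"
    proof cases
     case 1
     thus ?thesis using ebase_index(1)[OF a(1)] a(3) by simp
    next
     case 2
     thus ?thesis using ebase_index(2)[OF a(1) order_refl n0(3)] a(4) by simp
    next
     case 3
     thus ?thesis using X(2)[of 1 l] l by simp
    qed
   qed
   ultimately have "coeff R k = 0" using eq'[OF a(1) n0(2)] by simp
   thus ?thesis using Rc[of k] k by simp
  qed
  show "\<forall>k\<in>KP <+> KR. w k = 0" using P0 R0 by (auto elim!: PlusE)
 qed
 thus ?thesis unfolding cK .
qed

lemma ends_dim:
 assumes g: "PM n g" and S: "breaks n g = ends"
 shows "card (upper_index n) + n <= cfun.dim (hatT n g)"
proof -
 note gG = PM_GL[OF g]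
 note gc = GL_carrier[OF gG]
 obtain t b where b: "b \<in> borel_subgroup n" and K: "Kmat n ends t = g * b"
  using PM_normal_form[OF g] unfolding S by blast
 note bc = borel_carrier[OF b]
 obtain T d where T: "T \<in> GL n" "NN n * T = T * NN n" "d \<in> borel_subgroup n" "Kmat n ends t = T * ebase * d"
  using ends_normal_form[of t] by (elim exE conjE) (rule that)
 have PK: "PM n (Kmat n ends t)" by (rule Kmat_PM[OF ends_subset])
 have "card (upper_index n) + n <= cfun.dim (hatT n ebase)" by (rule ebase_dim)
 also have "... <= cfun.dim (hatT n (Kmat n ends t))" unfolding T(4) by (rule hatT_mult[OF ebase_PM T(1-3)])
 also have "... <= cfun.dim (hatT n (Kmat n ends t * minv b))" by (rule hatT_borel[OF PK borel_minv[OF b]])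
 also have "Kmat n ends t * minv b = g" unfolding K by (rule GL_cancel_right[OF borel_GL[OF b] gc])
 finally show ?thesis .
qed

end

section \<open>The singular locus\<close>

text \<open>
Without a break in \<open>{2..n-2}\<close>, two breaks can only be \<open>1\<close> and \<open>n - 1\<close>.
\<close>

lemma singular_dim:
 assumes g: "PM n g" and ts: "two_sided n (breaks n g)"
 shows "card (upper_index n) + n <= cfun.dim (hatT n g)"
proof (cases "\<exists>s\<in>(breaks n g). 2 <= s & s + 2 <= n")
 case True
 then obtain s where "2 <= s" "s + 2 <= n" "brk n g s" by blast
 thus ?thesis by (rule break_dim[OF g])
next
 case False
 let ?S = "breaks n g"
 obtain s s' where s: "s \<in> ?S" "s' \<in> ?S" "s < s'" using ts False unfolding two_sided_def by blast
 have e: "x = 1 \<or> x = n - 1" if "x \<in> ?S" for x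
 proof -
  have "1 <= x" "x < n" using that by simp_all
  moreover have "~ (2 <= x & x + 2 <= n)" using False that by blast
  ultimately show ?thesis by linarith
 qed
 have sn: "1 <= s" "s' < n" using s(1,2) by simp_all
 have n: "s = 1" "s' = n - 1" "3 <= n" using e[OF s(1)] e[OF s(2)] s(3) sn by linarith+
 have "?S \<subseteq> {1, n - 1}"
 proof
  fix x assume "x \<in> ?S"
  from e[OF this] show "x \<in> {1, n - 1}" by blast
 qed
 moreover have "1 \<in> ?S" by (rule subst[OF n(1), of "%x. x \<in> ?S"]) (rule s(1))
 moreover have "n - 1 \<in> ?S" by (rule subst[OF n(2), of "%x. x \<in> ?S"]) (rule s(2))
 ultimately have "?S = {1, n - 1}" by (intro subset_antisym insert_subsetI empty_subsetI)
 thus ?thesis by (rule ends_dim[OF n(3) g])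
qed

lemma singular_iff:
 assumes n: "1 <= n" and g: "PM n g"
 shows "coset n g \<in> singular_locus n (Peterson n) \<longleftrightarrow> two_sided n (breaks n g)"
proof
 assume "coset n g \<in> singular_locus n (Peterson n)"
 thus "two_sided n (breaks n g)"
  using regular_of_not_two_sided[OF n g] unfolding singular_locus_def by blast
next
 assume ts: "two_sided n (breaks n g)"
 have "~ regular_in_flags n (Peterson n) (coset n g)"
 proof (rule not_regular_of_dim[OF n])
  fix h assume h: "PM n h" "coset n h = coset n g"
  have "brk n h s \<longleftrightarrow> brk n g s" if "s \<in> {1..<n}" for s
   by (rule brk_coset[OF PM_GL[OF h(1)] PM_GL[OF g] h(2)]) (use that in simp)
  hence "breaks n h = breaks n g" by blast
  hence "two_sided n (breaks n h)" using ts by (simp only:)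
  thus "card (upper_index n) + n <= cfun.dim (hatT n h)" by (rule singular_dim[OF h(1)])
 qed
 thus "coset n g \<in> singular_locus n (Peterson n)" unfolding singular_locus_def Peterson_eq using g by blast
qed

lemma cond_I_iff:
 assumes c: "c \<in> compositions n" and n: "1 <= n"
 shows "cond_I n (w_P c) \<longleftrightarrow> two_sided n (psums c)"
proof -
 note p = psums_subset[OF c]
 have "{s \<in> {1..<n}. brk n (Kmat n (psums c) (%_. 0)) s} = psums c"
  using Kmat_brk_iff[OF p, of _ "%_. 0"] p by auto
 thus ?thesis unfolding cond_I_def Kmat_w_P[OF c] singular_iff[OF n Kmat_PM[OF p]] by (simp only:)
qed

lemma singular_locus_strata:
 assumes n: "1 <= n"
 shows "singular_locus n (Peterson n) = (\<Union>c\<in>{c \<in> compositions n. two_sided n (psums c)}. stratum c)"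
proof (intro Set.set_eqI iffI)
 fix x assume x: "x \<in> singular_locus n (Peterson n)"
 hence "x \<in> Peterson n" unfolding singular_locus_def by blast
 then obtain g where g: "x = coset n g" "PM n g" unfolding Peterson_eq by blast
 let ?S = "breaks n g"
 have ts: "two_sided n ?S" using x singular_iff[OF n g(2)] unfolding g(1) by blast
 obtain c where c: "c \<in> compositions n" "psums c = ?S" using composition_exists[of ?S n] n by blast
 have "x \<in> stratum c" unfolding stratum_iff[OF c(1)] c(2) by (intro exI[of _ g] conjI g refl)
 thus "x \<in> (\<Union>c\<in>{c \<in> compositions n. two_sided n (psums c)}. stratum c)" using c ts by auto
next
 fix x assume "x \<in> (\<Union>c\<in>{c \<in> compositions n. two_sided n (psums c)}. stratum c)"
 then obtain c where c: "c \<in> compositions n" "two_sided n (psums c)" "x \<in> stratum c" by blast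
 then obtain g where g: "x = coset n g" "PM n g" "breaks n g = psums c" using stratum_iff[OF c(1)] by blast
 show "x \<in> singular_locus n (Peterson n)" unfolding g(1) singular_iff[OF n g(2)] g(3) by (rule c(2))
qed

theorem theorem1p4:
  fixes n :: nat
  assumes "n \<ge> 1"
  shows "(\<forall>c \<in> compositions n.
            (cond_I n (w_P c) \<longleftrightarrow> cond_II n (w_P c)) \<and>
            (cond_II n (w_P c) \<longleftrightarrow> cond_III n (w_P c))) \<and>
         (\<forall>cond \<in> {cond_I, cond_II, cond_III}.
            singular_locus n (Peterson n) =
              (\<Union>c \<in> {c \<in> compositions n. cond n (w_P c)}. stratum c) \<and>
            disjoint_family_on stratum {c \<in> compositions n. cond n (w_P c)})"
proof (intro conjI ballI)
 fix c assume c: "c \<in> compositions n"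
 show "cond_I n (w_P c) \<longleftrightarrow> cond_II n (w_P c)" unfolding cond_I_iff[OF c assms] cond_II_iff[OF c assms] ..
 show "cond_II n (w_P c) \<longleftrightarrow> cond_III n (w_P c)" unfolding cond_II_iff[OF c assms] cond_III_iff[OF c] ..
next
 fix cond assume cond: "cond \<in> {cond_I, cond_II, cond_III}"
 have iff: "cond n (w_P c) \<longleftrightarrow> two_sided n (psums c)" if "c \<in> compositions n" for c
  using cond cond_I_iff[OF that assms] cond_II_iff[OF that assms] cond_III_iff[OF that] by blast
 have "{c \<in> compositions n. cond n (w_P c)} = {c \<in> compositions n. two_sided n (psums c)}" using iff by blast
 thus "singular_locus n (Peterson n) = (\<Union>c \<in> {c \<in> compositions n. cond n (w_P c)}. stratum c)"
  using singular_locus_strata[OF assms] by simp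
 show "disjoint_family_on stratum {c \<in> compositions n. cond n (w_P c)}" by (rule strata_disjoint) blast
qed

end
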